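(* Let $N\in\mathbb N_+$. For all spin values $j\in\frac12\mathbb N_+$ the following exchange relations hold for the homogeneous spin-$j$ chain. (1) If $h_+\bar h_-=q^2h_-\bar h_+$, then $$\mathcal H^{\text{spin }j}_{XXZ}(h_\pm,h_z,\bar h_\pm q^{\pm2},1)\,\mathcal W_0^{(N)}=\mathcal W_0^{(N)}\,\mathcal H^{\text{spin }j}_{XXZ}(h_\pm,h_z,\bar h_\pm,1).$$ (2) If $h_+\bar h_-=q^{-2}h_-\bar h_+$, then $$\mathcal H^{\text{spin }j}_{XXZ}(h_\pm,h_z,\bar h_\pm q^{\mp2},-1)\,\mathcal W_1^{(N)}=\mathcal W_1^{(N)}\,\mathcal H^{\text{spin }j}_{XXZ}(h_\pm,h_z,\bar h_\pm,-1).$$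
   Context: **Conventions.** $q\in\mathbb C^*$ is not a root of unity, $[n]_q=\frac{q^n-q^{-n}}{q-q^{-1}}$, $c(u)=u-u^{-1}$, $X_1=X\otimes\mathbb I$, $X_2=\mathbb I\otimes X$. Boundary parameters: $k_\pm\in\mathbb C^*$, $\varepsilon_\pm,\bar\varepsilon_\pm,\bar k_\pm\in\mathbb C$. **Fusion.** $B_{j,j'}=\sqrt{[j+j']_q[j-j'+1]_q}$; spin-$j$ matrices $(S_+)_{mn}=B_{j,j+1-m}\delta_{m,n-1}$, $(S_-)_{mn}=B_{j,j+1-n}\delta_{m-1,n}$, $(S_3)_{mn}=2(j+1-n)\delta_{mn}$. $\mathcal E^{(j)}:\mathbb C^{2j+1}\to\mathbb C^2\otimes\mathbb C^{2j}$ has nonzero entries $\mathcal E_{1,1}=1$, $\mathcal E_{1+n,1+n}=\prod_{p=0}^{n-1}\frac{B_{j-1/2,j-p-1/2}}{B_{j,j-p}}$ ($1\le n\le2j-1$), $\mathcal E_{2j+m,1+m}=[m]_q\mathcal E_{m,m}/B_{j,j+1-m}$ ($1\le m\le2j$). $\mathcal F^{(j)}:\mathbb C^2\otimes\mathbb C^{2j}\to\mathbb C^{2j+1}$ has nonzero entries $\mathcal F_{1,1}=1$, $\mathcal F_{n,n+2j-1}=\frac{\mathcal E_{n+2j-1,n}}{\mathcal E_{n,n}^2+\mathcal E_{n+2j-1,n}^2}$, $\mathcal F_{n,n}=\frac{1-\mathcal F_{n,n+2j-1}\mathcal E_{n+2j-1,n}}{\mathcal E_{n,n}}$ ($2\le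 n\le2j$), $\mathcal F_{2j+1,4j}=\mathcal E_{4j,2j+1}^{-1}$. **R-matrices.** $R^{(\frac12,0)}=\mathbb I_2$, $R^{(0,j)}=\mathbb I$, $R^{(\frac12,j)}(u)=\prod_{k=0}^{2j-2}c(uq^{j-\frac12-k})\Big((q-q^{-1})(\sigma_+\otimes S_-+\sigma_-\otimes S_+)+uq^{\frac12(\mathbb I+\sigma_z\otimes S_3)}-u^{-1}q^{-\frac12(\mathbb I+\sigma_z\otimes S_3)}\Big)$, $R^{(j_1,j_2)}(u)=\mathcal F^{(j_1)}_{\langle12\rangle}R_{13}^{(\frac12,j_2)}(uq^{-j_1+\frac12})R_{23}^{(j_1-\frac12,j_2)}(uq^{\frac12})\mathcal E^{(j_1)}_{\langle12\rangle}$; $\tilde R^{(j_1,j_2)}(u)=\Big(\prod_{k=0}^{2j_1-1}\prod_{\ell=0}^{2j_2-1}c(uq^{j_1+j_2-k-\ell})\Big)^{-1}R^{(j_1,j_2)}(u)$ (no pole at $u=1$ for $j_1=j_2$). **K-matrices.** $K^{(0)}=1$, $K^{(\frac12)}(u)=\begin{pmatrix}u\varepsilon_++u^{-1}\varepsilon_-&k_+c(u^2)/(q-q^{-1})\\k_-c(u^2)/(q-q^{-1})&u\varepsilon_-+u^{-1}\varepsilon_+\end{pmatrix}$, $K^{(j)}(u)=\mathcal F^{(j)}K_1^{(\frac12)}(uq^{-j+\frac12})R^{(\frac12,j-\frac12)}(u^2q^{-j+1})K_2^{(j-\frac12)}(uq^{\frac12})\mathcal E^{(j)}$; $\tilde K^{(j)}(u)=\Big(\prod_{\ell=0}^{2j-2}c(u^2q^{1-\ell})\Big)^{-1}K^{(j)}(u)$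 (Laurent polynomial entries); $\tilde K^{+(j)}(u)=\big(\tilde K^{(j)}(u^{-1}q^{-1})\big)^t$ with $\varepsilon_\pm\to\bar\varepsilon_\mp$, $k_\pm\to-\bar k_\mp$. **Homogeneous normalized transfer matrix and Hamiltonian.** $\tilde{\boldsymbol t}(u)=\mathrm{tr}_{\mathbb C^{2j+1}}\big(\tilde K_a^{+(j)}(u)\tilde R_{Na}^{(j,j)}(u)\cdots\tilde R_{1a}^{(j,j)}(u)\tilde K_a^{(j)}(u)\tilde R_{1a}^{(j,j)}(u)\cdots\tilde R_{Na}^{(j,j)}(u)\big)$ on $(\mathbb C^{2j+1})^{\otimes N}$ (tensor factors ordered $N,\dots,1$), i.e. all quantum spins equal $j$ and all inhomogeneities $v_n=1$. $\mathcal H^{\text{spin }j}_{XXZ}=\tilde{\boldsymbol t}(1)^{-1}\frac d{du}\tilde{\boldsymbol t}(u)|_{u=1}$, for (generic) parameters such that $\tilde{\boldsymbol t}(1)$ is invertible. It depends on the boundary parameters only through $h_\pm=\frac{2k_\pm}{\varepsilon_++\varepsilon_-}$, $\bar h_\pm=\frac{2\bar k_\pm}{\bar\varepsilon_++\bar\varepsilon_-}$, $h_z=\frac{\varepsilon_+-\varepsilon_-}{\varepsilon_++\varepsilon_-}$, $\bar h_z=\frac{\bar\varepsilon_+-\bar\varepsilon_-}{\bar\varepsilon_++\bar\varepsilon_-}$ and is written $\mathcal H^{\text{spin }j}_{XXZ}(h_\pm,h_z,\bar h_\pm,\bar h_z)$. **Operators.** With the $k_\pm,\varepsilon_\pm$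 defining $h_\pm,h_z$: $\mathcal W_0^{(0)}=\varepsilon_+$, $\mathcal W_1^{(0)}=\varepsilon_-$, $\mathcal W_0^{(n)}=\big(k_+q^{\frac12}S_+q^{\frac12S_3}+k_-q^{-\frac12}S_-q^{\frac12S_3}\big)\otimes\mathbb I^{(n-1)}+q^{S_3}\otimes\mathcal W_0^{(n-1)}$, $\mathcal W_1^{(n)}=\big(k_+q^{-\frac12}S_+q^{-\frac12S_3}+k_-q^{\frac12}S_-q^{-\frac12S_3}\big)\otimes\mathbb I^{(n-1)}+q^{-S_3}\otimes\mathcal W_1^{(n-1)}$ (spin-$j$ matrices). *)

theory Defs
  imports
    "HOL-Complex_Analysis.Complex_Analysis"
    "Jordan_Normal_Form.Gauss_Jordan_Elimination"
begin

text \<open>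
  Encoding of half-integers: a spin \<open>j\<close> is represented by the natural number \<open>s = 2j\<close>, and in general
  a half-integer \<open>x\<close> by the integer \<open>2x\<close>.  All definitions are relative to a square root \<open>r\<close> of \<open>q\<close>, so
  that \<open>q\<^sup>x\<close> is \<open>r powi (2x)\<close> and \<open>q = r\<^sup>2\<close>.
\<close>

subsection \<open>Matrices and tensor products\<close>

text \<open>Matrix with entries given by a function of the 1-based row and column numbers.\<close>

definition mat1 :: "nat \<Rightarrow> nat \<Rightarrow> (nat \<Rightarrow> nat \<Rightarrow> 'a) \<Rightarrow> 'a mat" where
  "mat1 nr nc f = Matrix.mat nr nc (\<lambda>(i, k). f (i + 1) (k + 1))"

definition kron :: "'a::semiring_1 mat \<Rightarrow> 'a mat \<Rightarrow> 'a mat" (infixr \<open>\<otimes>\<^sub>k\<close> 75) where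
  "A \<otimes>\<^sub>k C = Matrix.mat (dim_row A * dim_row C) (dim_col A * dim_col C)
     (\<lambda>(i, k). A $$ (i div dim_row C, k div dim_col C) * C $$ (i mod dim_row C, k mod dim_col C))"

text \<open>
  A basis vector of a tensor product with list of dimensions \<open>ds\<close> (leftmost factor most significant,
  as in \<open>\<otimes>\<^sub>k\<close>) is a number in mixed radix; \<open>digit ds i p\<close> is its component in the factor number \<open>p\<close>
  (counted from 0).  \<open>embed2 ds x y A\<close> is the usual \<open>A\<^bsub>xy\<^esub>\<close>: the first tensor leg of \<open>A\<close> acts on the
  factor \<open>x\<close>, its second leg on the factor \<open>y\<close>, and the identity acts on all the other factors.
\<close>

definition digit :: "nat list \<Rightarrow> nat \<Rightarrow> nat \<Rightarrow> nat" where
  "digit ds i p = (i div prod_list (drop (Suc p) ds)) mod (ds ! p)"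

definition embed2 :: "nat list \<Rightarrow> nat \<Rightarrow> nat \<Rightarrow> complex mat \<Rightarrow> complex mat" where
  "embed2 ds x y A = Matrix.mat (prod_list ds) (prod_list ds)
     (\<lambda>(i, k). if \<forall>t<length ds. t \<noteq> x \<and> t \<noteq> y \<longrightarrow> digit ds i t = digit ds k t
       then A $$ (digit ds i x * ds ! y + digit ds i y, digit ds k x * ds ! y + digit ds k y)
       else 0)"

text \<open>Trace over the leftmost factor of dimension \<open>d\<close>, the remaining factors having total dimension \<open>m\<close>.\<close>

definition partial_trace :: "nat \<Rightarrow> nat \<Rightarrow> complex mat \<Rightarrow> complex mat" where
  "partial_trace d m T = Matrix.mat m m (\<lambda>(i, k). \<Sum>a<d. T $$ (a * m + i, a * m + k))"

definition mat_prod_list :: "nat \<Rightarrow> complex mat list \<Rightarrow> complex mat" where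
  "mat_prod_list n As = foldr (*) As (1\<^sub>m n)"

text \<open>Entrywise removal of removable singularities, and entrywise derivative.\<close>

definition remove_sings_mat :: "(complex \<Rightarrow> complex mat) \<Rightarrow> complex \<Rightarrow> complex mat" where
  "remove_sings_mat M u = Matrix.mat (dim_row (M u)) (dim_col (M u))
     (\<lambda>(i, k). remove_sings (\<lambda>w. M w $$ (i, k)) u)"

definition deriv_mat :: "(complex \<Rightarrow> complex mat) \<Rightarrow> complex \<Rightarrow> complex mat" where
  "deriv_mat M u = Matrix.mat (dim_row (M u)) (dim_col (M u))
     (\<lambda>(i, k). deriv (\<lambda>w. M w $$ (i, k)) u)"


subsection \<open>Spin matrices and fusion\<close>

definition cfun :: "complex \<Rightarrow> complex" where
  "cfun u = u - inverse u"

text \<open>\<open>qnum r t\<close> is \<open>[t/2]\<^sub>q\<close>.\<close>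

definition qnum :: "complex \<Rightarrow> int \<Rightarrow> complex" where
  "qnum r t = (r powi t - r powi (- t)) / (r\<^sup>2 - inverse (r\<^sup>2))"

text \<open>\<open>Bcoef r s t\<close> is \<open>B\<^bsub>s/2, t/2\<^esub>\<close>.\<close>

definition Bcoef :: "complex \<Rightarrow> int \<Rightarrow> int \<Rightarrow> complex" where
  "Bcoef r s t = csqrt (qnum r (s + t) * qnum r (s - t + 2))"

definition Splus :: "complex \<Rightarrow> nat \<Rightarrow> complex mat" where
  "Splus r s = mat1 (s + 1) (s + 1)
     (\<lambda>m n. if n = m + 1 then Bcoef r (int s) (int s + 2 - 2 * int m) else 0)"

definition Sminus :: "complex \<Rightarrow> nat \<Rightarrow> complex mat" where
  "Sminus r s = mat1 (s + 1) (s + 1)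
     (\<lambda>m n. if m = n + 1 then Bcoef r (int s) (int s + 2 - 2 * int n) else 0)"

definition S3 :: "nat \<Rightarrow> int mat" where
  "S3 s = mat1 (s + 1) (s + 1) (\<lambda>m n. if m = n then int s + 2 - 2 * int n else 0)"

definition sigma_z :: "int mat" where
  "sigma_z = mat_of_rows_list 2 [[1, 0], [0, -1]]"

definition sigma_plus :: "complex mat" where
  "sigma_plus = mat_of_rows_list 2 [[0, 1], [0, 0]]"

definition sigma_minus :: "complex mat" where
  "sigma_minus = mat_of_rows_list 2 [[0, 0], [1, 0]]"

text \<open>\<open>qexp_half r D\<close> is \<open>q\<^bsup>D/2\<^esup>\<close> for a diagonal integer matrix \<open>D\<close>.\<close>

definition qexp_half :: "complex \<Rightarrow> int mat \<Rightarrow> complex mat" where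
  "qexp_half r D = Matrix.mat (dim_row D) (dim_row D)
     (\<lambda>(i, k). if i = k then r powi (D $$ (i, i)) else 0)"

text \<open>
  \<open>fus_diag r s n\<close> is the entry \<open>\<E>\<^bsub>n,n\<^esub>\<close> (for \<open>1 \<le> n \<le> 2j\<close>) and \<open>fus_low r s m\<close> is the entry
  \<open>\<E>\<^bsub>2j+m,1+m\<^esub>\<close> (for \<open>1 \<le> m \<le> 2j\<close>) of the fusion map \<open>\<E>\<close> for spin \<open>j = s/2\<close>.
\<close>

definition fus_diag :: "complex \<Rightarrow> nat \<Rightarrow> nat \<Rightarrow> complex" where
  "fus_diag r s n = (\<Prod>p<n - 1. Bcoef r (int s - 1) (int s - 1 - 2 * int p)
                                 / Bcoef r (int s) (int s - 2 * int p))"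

definition fus_low :: "complex \<Rightarrow> nat \<Rightarrow> nat \<Rightarrow> complex" where
  "fus_low r s m = qnum r (2 * int m) * fus_diag r s m / Bcoef r (int s) (int s + 2 - 2 * int m)"

definition Emap :: "complex \<Rightarrow> nat \<Rightarrow> complex mat" where
  "Emap r s = mat1 (2 * s) (s + 1)
     (\<lambda>a b. if a = b \<and> b \<le> s then fus_diag r s b
            else if 2 \<le> b \<and> a = s + (b - 1) then fus_low r s (b - 1)
            else 0)"

text \<open>\<open>fus_inv r s n\<close> is \<open>\<F>\<^bsub>n,n+2j-1\<^esub>\<close> for \<open>2 \<le> n \<le> 2j\<close>; note that \<open>\<E>\<^bsub>n+2j-1,n\<^esub>\<close> is \<open>fus_low r s (n-1)\<close>.\<close>

definition fus_inv :: "complex \<Rightarrow> nat \<Rightarrow> nat \<Rightarrow> complex" where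
  "fus_inv r s n = fus_low r s (n - 1) / ((fus_diag r s n)\<^sup>2 + (fus_low r s (n - 1))\<^sup>2)"

definition Fmap :: "complex \<Rightarrow> nat \<Rightarrow> complex mat" where
  "Fmap r s = mat1 (s + 1) (2 * s)
     (\<lambda>a b. if a = 1 \<and> b = 1 then 1
            else if 2 \<le> a \<and> a \<le> s \<and> b = a + s - 1 then fus_inv r s a
            else if 2 \<le> a \<and> a \<le> s \<and> b = a
              then (1 - fus_inv r s a * fus_low r s (a - 1)) / fus_diag r s a
            else if a = s + 1 \<and> b = 2 * s then inverse (fus_low r s s)
            else 0)"


subsection \<open>R-matrices\<close>

text \<open>\<open>Rhalf r s u\<close> is the R-matrix for the spins \<open>(1/2, s/2)\<close>.\<close>

definition Rhalf :: "complex \<Rightarrow> nat \<Rightarrow> complex \<Rightarrow> complex mat" where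
  "Rhalf r s u =
     (if s = 0 then 1\<^sub>m 2
      else let D = 1\<^sub>m (2 * (s + 1)) + sigma_z \<otimes>\<^sub>k S3 s in
        (\<Prod>k<s - 1. cfun (u * r powi (int s - 1 - 2 * int k))) \<cdot>\<^sub>m
          ((r\<^sup>2 - inverse (r\<^sup>2)) \<cdot>\<^sub>m (sigma_plus \<otimes>\<^sub>k Sminus r s + sigma_minus \<otimes>\<^sub>k Splus r s)
           + u \<cdot>\<^sub>m qexp_half r D - inverse u \<cdot>\<^sub>m qexp_half r (- D)))"

text \<open>\<open>Rmat r s1 s2 u\<close> is the R-matrix for the spins \<open>(s1/2, s2/2)\<close>.\<close>

fun Rmat :: "complex \<Rightarrow> nat \<Rightarrow> nat \<Rightarrow> complex \<Rightarrow> complex mat" where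
  "Rmat r 0 s2 u = 1\<^sub>m (s2 + 1)"
| "Rmat r (Suc 0) s2 u = Rhalf r s2 u"
| "Rmat r (Suc (Suc n)) s2 u =
     (let s1 = Suc (Suc n) in
       (Fmap r s1 \<otimes>\<^sub>k 1\<^sub>m (s2 + 1))
       * embed2 [2, s1, s2 + 1] 0 2 (Rhalf r s2 (u * r powi (1 - int s1)))
       * (1\<^sub>m 2 \<otimes>\<^sub>k Rmat r (Suc n) s2 (u * r))
       * (Emap r s1 \<otimes>\<^sub>k 1\<^sub>m (s2 + 1)))"

text \<open>
  The scalar prefactor may have poles at points, such as \<open>u = 1\<close> for \<open>s1 = s2\<close>, where the product is
  regular; \<open>remove_sings_mat\<close> supplies the value of the product there.
\<close>

definition Rtilde :: "complex \<Rightarrow> nat \<Rightarrow> nat \<Rightarrow> complex \<Rightarrow> complex mat" where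
  "Rtilde r s1 s2 = remove_sings_mat (\<lambda>u.
     inverse (\<Prod>k<s1. \<Prod>l<s2. cfun (u * r powi (int s1 + int s2 - 2 * int k - 2 * int l)))
       \<cdot>\<^sub>m Rmat r s1 s2 u)"


subsection \<open>K-matrices\<close>

text \<open>Boundary parameters \<open>(k\<^sub>+, k\<^sub>-, \<epsilon>\<^sub>+, \<epsilon>\<^sub>-)\<close> of one end of the chain.\<close>

datatype bparams = BParams (kp: complex) (km: complex) (ep: complex) (em: complex)

definition Khalf :: "complex \<Rightarrow> bparams \<Rightarrow> complex \<Rightarrow> complex mat" where
  "Khalf r \<kappa> u = mat_of_rows_list 2
     [[u * ep \<kappa> + inverse u * em \<kappa>, kp \<kappa> * cfun (u\<^sup>2) / (r\<^sup>2 - inverse (r\<^sup>2))],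
      [km \<kappa> * cfun (u\<^sup>2) / (r\<^sup>2 - inverse (r\<^sup>2)), u * em \<kappa> + inverse u * ep \<kappa>]]"

fun Kmat :: "complex \<Rightarrow> bparams \<Rightarrow> nat \<Rightarrow> complex \<Rightarrow> complex mat" where
  "Kmat r \<kappa> 0 u = 1\<^sub>m 1"
| "Kmat r \<kappa> (Suc 0) u = Khalf r \<kappa> u"
| "Kmat r \<kappa> (Suc (Suc n)) u =
     (let s = Suc (Suc n) in
       Fmap r s
       * (Khalf r \<kappa> (u * r powi (1 - int s)) \<otimes>\<^sub>k 1\<^sub>m s)
       * Rhalf r (Suc n) (u\<^sup>2 * r powi (2 - int s))
       * (1\<^sub>m 2 \<otimes>\<^sub>k Kmat r \<kappa> (Suc n) (u * r))
       * Emap r s)"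

text \<open>
  Normalized K-matrix.  The entries of \<open>Kmat\<close> are divisible by all the factors \<open>c(u\<^sup>2 q\<^bsup>1+k-l\<^esup>)\<close> with
  \<open>0 \<le> k\<close>, \<open>0 \<le> l\<close>, \<open>k + l \<le> 2j - 2\<close>, those with \<open>k = 0\<close> being the ones produced by the last fusion step and those
  with \<open>k \<ge> 1\<close> being inherited from the K-matrices of lower spin.  The parameter \<open>d\<close> tells how many of the
  layers \<open>k = 0, 1, \<dots>\<close> are divided out.  For \<open>d = 1\<close> the denominator is the single product of the
  \<open>c(u\<^sup>2 q\<^bsup>1-l\<^esup>)\<close> over \<open>0 \<le> l \<le> 2j - 2\<close>; for \<open>d \<ge> 2j - 1\<close> all the factors are removed.  For \<open>j \<le> 1\<close> the
  normalization does not depend on \<open>d \<ge> 1\<close>.  For \<open>j \<ge> 3/2\<close> and \<open>d = 1\<close> the remaining factor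
  \<open>c(u\<^sup>2 q\<^sup>2)\<close> makes the dual K-matrix, hence the transfer matrix, vanish at \<open>u = 1\<close>, so that the
  logarithmic derivative at \<open>u = 1\<close> calls for a larger \<open>d\<close>.
\<close>

definition Ktilde :: "complex \<Rightarrow> nat \<Rightarrow> bparams \<Rightarrow> nat \<Rightarrow> complex \<Rightarrow> complex mat" where
  "Ktilde r d \<kappa> s = remove_sings_mat (\<lambda>u.
     inverse (\<Prod>k<d. \<Prod>l<s - 1 - k. cfun (u\<^sup>2 * r powi (2 * (1 + int k - int l))))
       \<cdot>\<^sub>m Kmat r \<kappa> s u)"

text \<open>The substitution \<open>\<epsilon>\<^sub>\<plusminus> \<rightarrow> \<epsilon>'\<^sub>\<mp>\<close>, \<open>k\<^sub>\<plusminus> \<rightarrow> -k'\<^sub>\<mp>\<close>, where the primed parameters are the components of \<open>\<kappa>b\<close>.\<close>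

definition Kplus_tilde :: "complex \<Rightarrow> nat \<Rightarrow> bparams \<Rightarrow> nat \<Rightarrow> complex \<Rightarrow> complex mat" where
  "Kplus_tilde r d \<kappa>b s u =
     (Ktilde r d (BParams (- km \<kappa>b) (- kp \<kappa>b) (em \<kappa>b) (ep \<kappa>b)) s
        (inverse u * inverse (r\<^sup>2)))\<^sup>T"


subsection \<open>Transfer matrix and Hamiltonian\<close>

text \<open>
  The auxiliary space \<open>a\<close> is the leftmost tensor factor (position 0), followed by the quantum spaces
  \<open>N, \<dots>, 1\<close>; thus the quantum space \<open>n\<close> has position \<open>N + 1 - n\<close>.
\<close>

definition Rsite :: "complex \<Rightarrow> nat \<Rightarrow> nat \<Rightarrow> complex \<Rightarrow> nat \<Rightarrow> complex mat" where
  "Rsite r s N u n = embed2 (replicate (N + 1) (s + 1)) (N + 1 - n) 0 (Rtilde r s s u)"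

text \<open>\<open>\<kappa>\<close> are the parameters \<open>k\<^sub>\<plusminus>, \<epsilon>\<^sub>\<plusminus>\<close>, and \<open>\<kappa>b\<close> are the barred ones.\<close>

definition transfer ::
  "complex \<Rightarrow> nat \<Rightarrow> nat \<Rightarrow> nat \<Rightarrow> bparams \<Rightarrow> bparams \<Rightarrow> complex \<Rightarrow> complex mat" where
  "transfer r d s N \<kappa> \<kappa>b u =
     partial_trace (s + 1) ((s + 1) ^ N)
       ((Kplus_tilde r d \<kappa>b s u \<otimes>\<^sub>k 1\<^sub>m ((s + 1) ^ N))
        * mat_prod_list ((s + 1) ^ (N + 1)) (map (Rsite r s N u) (rev [1..<N + 1]))
        * (Ktilde r d \<kappa> s u \<otimes>\<^sub>k 1\<^sub>m ((s + 1) ^ N))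
        * mat_prod_list ((s + 1) ^ (N + 1)) (map (Rsite r s N u) [1..<N + 1]))"

text \<open>Only meaningful if \<open>transfer r d s N \<kappa> \<kappa>b 1\<close> is invertible.\<close>

definition ham :: "complex \<Rightarrow> nat \<Rightarrow> nat \<Rightarrow> nat \<Rightarrow> bparams \<Rightarrow> bparams \<Rightarrow> complex mat" where
  "ham r d s N \<kappa> \<kappa>b =
     the (mat_inverse (transfer r d s N \<kappa> \<kappa>b 1)) * deriv_mat (transfer r d s N \<kappa> \<kappa>b) 1"

text \<open>The parameters \<open>\<kappa>\<close> of one end of the chain give rise to the field parameters \<open>h\<^sub>+, h\<^sub>-, h\<^sub>z\<close>.\<close>

definition has_fields :: "bparams \<Rightarrow> complex \<Rightarrow> complex \<Rightarrow> complex \<Rightarrow> bool" where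
  "has_fields \<kappa> hp hm hz \<longleftrightarrow>
     ep \<kappa> + em \<kappa> \<noteq> 0 \<and>
     hp = 2 * kp \<kappa> / (ep \<kappa> + em \<kappa>) \<and>
     hm = 2 * km \<kappa> / (ep \<kappa> + em \<kappa>) \<and>
     hz = (ep \<kappa> - em \<kappa>) / (ep \<kappa> + em \<kappa>)"


subsection \<open>The operators \<open>\<W>\<^sub>0\<close> and \<open>\<W>\<^sub>1\<close>\<close>

fun W0 :: "complex \<Rightarrow> bparams \<Rightarrow> nat \<Rightarrow> nat \<Rightarrow> complex mat" where
  "W0 r \<kappa> s 0 = ep \<kappa> \<cdot>\<^sub>m 1\<^sub>m 1"
| "W0 r \<kappa> s (Suc n) =
     ((kp \<kappa> * r) \<cdot>\<^sub>m (Splus r s * qexp_half r (S3 s))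
      + (km \<kappa> * inverse r) \<cdot>\<^sub>m (Sminus r s * qexp_half r (S3 s))) \<otimes>\<^sub>k 1\<^sub>m ((s + 1) ^ n)
     + qexp_half r (2 \<cdot>\<^sub>m S3 s) \<otimes>\<^sub>k W0 r \<kappa> s n"

fun W1 :: "complex \<Rightarrow> bparams \<Rightarrow> nat \<Rightarrow> nat \<Rightarrow> complex mat" where
  "W1 r \<kappa> s 0 = em \<kappa> \<cdot>\<^sub>m 1\<^sub>m 1"
| "W1 r \<kappa> s (Suc n) =
     ((kp \<kappa> * inverse r) \<cdot>\<^sub>m (Splus r s * qexp_half r (- S3 s))
      + (km \<kappa> * r) \<cdot>\<^sub>m (Sminus r s * qexp_half r (- S3 s))) \<otimes>\<^sub>k 1\<^sub>m ((s + 1) ^ n)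
     + qexp_half r (- (2 \<cdot>\<^sub>m S3 s)) \<otimes>\<^sub>k W1 r \<kappa> s n"

end

theory Submission
  imports Defs
begin

text \<open>
  The matrices \<open>K(u)\<close> and \<open>R(u)\<close> intertwine the actions of a generator \<open>W\<close> of the coideal subalgebra behind the chain:
  \<open>K(u) W(u) = W(1/u) K(u)\<close>, and \<open>R\<close> exchanges the two coproducts.  For spin one half these are direct computations,
  and they are carried to higher spin by fusion as soon as the image of the fusion map \<open>\<E>\<close> is invariant under the
  unfused product \<open>V\<close>, that is, as soon as the defect \<open>Z = (1 - \<E>\<F>) V\<close> vanishes.  The defect satisfies intertwining
  relations of its own.  For \<open>R\<close>, its first column vanishes by weight considerations and the lowering operators
  propagate this to the other columns.  For \<open>K\<close>, a combination of the two generators turns the first column into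
  an eigenvector of a matrix that is nearly diagonal when \<open>k\<^sub>\<plusminus>\<close> are small, and the eigenvalue is excluded except for
  finitely many \<open>u\<close>; analytic continuation in a common factor of \<open>k\<^sub>\<plusminus>\<close> and in \<open>u\<close> gives all cases.

  Sliding \<open>W\<close> through the dressed K-matrix of the chain leaves boundary terms at the other end.  They cancel under the
  cyclic partial trace because the dual K-matrix obeys the transposed intertwining relation, while conjugation by
  \<open>q\<^bsup>S\<^sub>3\<^esup>\<close> moves \<open>h\<^sub>\<plusminus>\<close> of the dual end to \<open>q\<^bsup>\<plusminus>2\<^esup>h\<^sub>\<plusminus>\<close>.  The resulting exchange relation of transfer matrices can be differentiated
  at \<open>u = 1\<close>, because the normalized matrices are regular there: the only critical pole, that of the dual K-matrix,
  cancels since \<open>K(1)\<close> is scalar and \<open>R\<close> annihilates \<open>\<E>\<close> at the fusion point.  The operator \<open>W\<^sub>1\<close> is reduced to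
  \<open>W\<^sub>0\<close> by the symmetry \<open>q \<mapsto> 1/q\<close>, \<open>u \<mapsto> 1/u\<close>, \<open>\<epsilon>\<^sub>+ \<leftrightarrow> \<epsilon>\<^sub>-\<close>.
\<close>


text \<open>The shape of the hypotheses is dictated by the trace. There the auxiliary terms cancel
  only if the dual K-matrix intertwines the very combination of S_+ and S_- that W_0 contributes at
  the other end. Its barred parameters must therefore be proportional to the unbarred ones up to a
  power of q, which is the condition on h_+ hbar_-. A relation for a K-matrix also contains a
  diagonal term \<epsilon> q^(S_3), which has no partner here; hbar_z = 1 or -1 removes it. The
  factor q^(S_3) in front of W_0 in the coproduct must still pass the dual K-matrix, and this costs
  the rescaling of hbar by powers of q.

  The relation for K is derived for a nonzero lowering coefficient, whereas the dual parameters may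
  vanish; continuity in the parameters closes this gap. The factor between the two transfer matrices
  has to be independent of u, since only then does it drop out of the logarithmic derivative. For
  this reason scalar prefactors are tracked explicitly through fusion and normalization, and the
  constants arising from q to 1/q are shown not to depend on u.\<close>

section \<open>Matrix algebra whose side conditions are equations between dimensions, fit for
  rewriting\<close>

lemma mat_assoc_dim:
  fixes A B C :: "'a::semiring_0 mat"
  assumes "dim_col A = dim_row B" "dim_col B = dim_row C"
  shows "A * B * C = A * (B * C)"
  using assms by (intro assoc_mult_mat[of _ "dim_row A" "dim_col A" _ "dim_col B" _ "dim_col C"]) auto

lemma mat_distrib_left_dim:
  fixes A B C :: "'a::semiring_0 mat"
  assumes "dim_row B = dim_row C" "dim_col B = dim_col C" "dim_col A = dim_row B"
  shows "A * (B + C) = A * B + A * C"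
  using assms by (intro mult_add_distrib_mat[of _ "dim_row A" "dim_col A" _ "dim_col B"]) auto

lemma mat_distrib_right_dim:
  fixes A B C :: "'a::semiring_0 mat"
  assumes "dim_row B = dim_row C" "dim_col B = dim_col C" "dim_row A = dim_col B"
  shows "(B + C) * A = B * A + C * A"
  using assms by (intro add_mult_distrib_mat[of _ "dim_row B" "dim_col B" _ _ "dim_col A"]) auto

lemma mat_add_assoc_dim:
  fixes A B C :: "'a::semiring_0 mat"
  assumes "dim_row A = dim_row B" "dim_col A = dim_col B" "dim_row B = dim_row C" "dim_col B = dim_col C"
  shows "A + B + C = A + (B + C)"
  using assms by (intro eq_matI) (auto simp: add.assoc)

lemma mat_smult_mult_left_dim:
  fixes A B :: "'a::comm_semiring_0 mat"
  assumes "dim_col A = dim_row B"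
  shows "(c \<cdot>\<^sub>m A) * B = c \<cdot>\<^sub>m (A * B)"
  using assms by (intro eq_matI) (auto simp: scalar_prod_def sum_distrib_left mult.assoc)

lemma mat_smult_mult_right_dim:
  fixes A B :: "'a::comm_semiring_0 mat"
  assumes "dim_col A = dim_row B"
  shows "A * (c \<cdot>\<^sub>m B) = c \<cdot>\<^sub>m (A * B)"
  using assms by (intro eq_matI) (auto simp: scalar_prod_def sum_distrib_left mult.left_commute)

lemma mat_smult_add_dim:
  fixes A B :: "'a::semiring_0 mat"
  assumes "dim_row A = dim_row B" "dim_col A = dim_col B"
  shows "c \<cdot>\<^sub>m (A + B) = c \<cdot>\<^sub>m A + c \<cdot>\<^sub>m B"
  using assms by (intro eq_matI) (auto simp: distrib_left)

lemma mat_smult_smult: "a \<cdot>\<^sub>m (b \<cdot>\<^sub>m (A :: 'a::semiring_0 mat)) = (a * b) \<cdot>\<^sub>m A"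
  by (intro eq_matI) (auto simp: mult.assoc)

lemmas mat_ring_dim = mat_assoc_dim mat_distrib_left_dim mat_distrib_right_dim

lemma mat_mult_index:
  fixes A B :: "'a::semiring_0 mat"
  assumes "i < dim_row A" "k < dim_col B" "dim_col A = dim_row B"
  shows "(A * B) $$ (i, k) = (\<Sum>l<dim_row B. A $$ (i, l) * B $$ (l, k))"
  using assms by (auto simp: scalar_prod_def lessThan_atLeast0 intro!: sum.cong)

lemma one_mult_dim [simp]: "dim_row A = n \<Longrightarrow> 1\<^sub>m n * (A :: 'a::semiring_1 mat) = A"
  by (intro left_mult_one_mat[of _ n "dim_col A"]) auto

lemma mult_one_dim [simp]: "dim_col A = n \<Longrightarrow> (A :: 'a::semiring_1 mat) * 1\<^sub>m n = A"
  by (intro right_mult_one_mat[of _ "dim_row A" n]) auto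

subsection \<open>Kronecker products\<close>

lemma dim_kron [simp]:
  "dim_row (A \<otimes>\<^sub>k B) = dim_row A * dim_row B" "dim_col (A \<otimes>\<^sub>k B) = dim_col A * dim_col B"
  by (auto simp: kron_def)

lemma div_mult_less: "i < a * b \<Longrightarrow> i div b < (a::nat)"
  by (simp add: less_mult_imp_div_less)

lemma mod_mult_less: "i < a * b \<Longrightarrow> i mod b < (b::nat)"
  by (metis mod_less_divisor mult_0_right not_less_zero neq0_conv)

lemma kron_index:
  "i < dim_row A * dim_row B \<Longrightarrow> k < dim_col A * dim_col B \<Longrightarrow>
   (A \<otimes>\<^sub>k B) $$ (i, k) = A $$ (i div dim_row B, k div dim_col B) * B $$ (i mod dim_row B, k mod dim_col B)"
  by (auto simp: kron_def)

lemma pair_index_less: "a < m \<Longrightarrow> b < n \<Longrightarrow> a * n + b < m * (n::nat)"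
proof -
  assume "a < m" "b < n"
  then have "a * n + b < Suc a * n" "Suc a * n \<le> m * n" by (simp, intro mult_right_mono) auto
  then show ?thesis by linarith
qed

lemma kron_index_pair:
  "a < dim_row A \<Longrightarrow> b < dim_row B \<Longrightarrow> c < dim_col A \<Longrightarrow> d < dim_col B \<Longrightarrow>
   (A \<otimes>\<^sub>k B) $$ (a * dim_row B + b, c * dim_col B + d) = A $$ (a, c) * B $$ (b, d)"
  by (subst kron_index) (auto simp: pair_index_less)

lemma sum_lessThan_times:
  fixes f :: "nat \<Rightarrow> 'a::comm_monoid_add"
  shows "(\<Sum>i<m * n. f i) = (\<Sum>a<m. \<Sum>b<n. f (a * n + b))"
proof -
  have "bij_betw (\<lambda>(a, b). a * n + b) ({..<m} \<times> {..<n}) {..<m * n}"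
    by (rule bij_betw_byWitness[where f' = "\<lambda>i. (i div n, i mod n)"])
       (auto simp: pair_index_less div_mult_less mod_mult_less)
  from sum.reindex_bij_betw[OF this, of f] show ?thesis
    by (simp add: sum.cartesian_product case_prod_unfold)
qed

text \<open>The mixed-product rule: Euclidean division turns the sum over the middle index into a
  double sum, which factors.\<close>

lemma kron_mult_kron:
  fixes A B C D :: "'a::comm_semiring_1 mat"
  assumes "dim_col A = dim_row C" "dim_col B = dim_row D"
  shows "(A \<otimes>\<^sub>k B) * (C \<otimes>\<^sub>k D) = (A * C) \<otimes>\<^sub>k (B * D)"
proof (rule eq_matI)
  fix i k assume "i < dim_row ((A * C) \<otimes>\<^sub>k (B * D))" "k < dim_col ((A * C) \<otimes>\<^sub>k (B * D))"
  then have ik: "i < dim_row A * dim_row B" "k < dim_col C * dim_col D" by auto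
  note b = div_mult_less[OF ik(1)] mod_mult_less[OF ik(1)] div_mult_less[OF ik(2)] mod_mult_less[OF ik(2)]
  have "((A \<otimes>\<^sub>k B) * (C \<otimes>\<^sub>k D)) $$ (i, k) =
     (\<Sum>a<dim_row C. \<Sum>b<dim_row D. (A $$ (i div dim_row B, a) * B $$ (i mod dim_row B, b)) *
        (C $$ (a, k div dim_col D) * D $$ (b, k mod dim_col D)))"
    using ik assms by (subst mat_mult_index) (auto simp: sum_lessThan_times kron_index pair_index_less intro!: sum.cong)
  also have "\<dots> = ((A * C) \<otimes>\<^sub>k (B * D)) $$ (i, k)"
    using ik b assms
    by (simp add: kron_index mat_mult_index sum_product mult_ac del: index_mult_mat(1))
  finally show "((A \<otimes>\<^sub>k B) * (C \<otimes>\<^sub>k D)) $$ (i, k) = ((A * C) \<otimes>\<^sub>k (B * D)) $$ (i, k)" .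
qed (use assms in auto)

lemma kron_add_left: "dim_row A = dim_row A' \<Longrightarrow> dim_col A = dim_col A' \<Longrightarrow>
    (A + A') \<otimes>\<^sub>k B = A \<otimes>\<^sub>k B + A' \<otimes>\<^sub>k (B :: 'a::comm_semiring_1 mat)"
  by (intro eq_matI) (auto simp: kron_index div_mult_less mod_mult_less distrib_right)

lemma kron_add_right: "dim_row B = dim_row B' \<Longrightarrow> dim_col B = dim_col B' \<Longrightarrow>
    A \<otimes>\<^sub>k (B + B') = A \<otimes>\<^sub>k B + A \<otimes>\<^sub>k (B' :: 'a::comm_semiring_1 mat)"
  by (intro eq_matI) (auto simp: kron_index div_mult_less mod_mult_less distrib_left)

lemma kron_smult_left: "(c \<cdot>\<^sub>m A) \<otimes>\<^sub>k B = c \<cdot>\<^sub>m (A \<otimes>\<^sub>k (B :: 'a::comm_semiring_1 mat))"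
  by (intro eq_matI) (auto simp: kron_index div_mult_less mod_mult_less mult.assoc)

lemma kron_smult_right: "A \<otimes>\<^sub>k (c \<cdot>\<^sub>m B) = c \<cdot>\<^sub>m (A \<otimes>\<^sub>k (B :: 'a::comm_semiring_1 mat))"
  by (intro eq_matI) (auto simp: kron_index div_mult_less mod_mult_less mult.left_commute)

lemma kron_one: "1\<^sub>m m \<otimes>\<^sub>k 1\<^sub>m n = (1\<^sub>m (m * n) :: 'a::comm_semiring_1 mat)"
proof (intro eq_matI)
  fix i k assume ik: "i < dim_row (1\<^sub>m (m * n) :: 'a mat)" "k < dim_col (1\<^sub>m (m * n) :: 'a mat)"
  have "i = k \<longleftrightarrow> i div n = k div n \<and> i mod n = k mod n"
    by (metis div_mult_mod_eq)
  with ik show "(1\<^sub>m m \<otimes>\<^sub>k 1\<^sub>m n) $$ (i, k) = (1\<^sub>m (m * n) :: 'a mat) $$ (i, k)"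
    by (auto simp: kron_index div_mult_less mod_mult_less)
qed auto

lemma kron_one_one [simp]: "(1\<^sub>m 1 :: 'a::comm_semiring_1 mat) \<otimes>\<^sub>k A = A" "A \<otimes>\<^sub>k 1\<^sub>m 1 = A"
  by (intro eq_matI; auto simp: kron_index)+

lemma kron_assoc:
  fixes A B C :: "'a::comm_semiring_1 mat"
  shows "(A \<otimes>\<^sub>k B) \<otimes>\<^sub>k C = A \<otimes>\<^sub>k (B \<otimes>\<^sub>k C)"
proof (intro eq_matI)
  fix i k assume "i < dim_row (A \<otimes>\<^sub>k (B \<otimes>\<^sub>k C))" "k < dim_col (A \<otimes>\<^sub>k (B \<otimes>\<^sub>k C))"
  then have ik: "i < dim_row A * (dim_row B * dim_row C)" "k < dim_col A * (dim_col B * dim_col C)" by auto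
  then have ik': "i < (dim_row A * dim_row B) * dim_row C" "k < (dim_col A * dim_col B) * dim_col C"
    by (auto simp: mult.assoc)
  \<comment> \<open>The middle digit is the same whether the last digit is split off before or after
    reducing; both bracketings then read off the same three digits.\<close>
  have [simp]: "x div c mod b = x mod (b * c) div c" for x b c :: nat
    by (cases "c = 0") (simp_all add: mod_mult2_eq mult.commute[of b c])
  show "((A \<otimes>\<^sub>k B) \<otimes>\<^sub>k C) $$ (i, k) = (A \<otimes>\<^sub>k (B \<otimes>\<^sub>k C)) $$ (i, k)"
    using ik ik' div_mult_less[OF ik'(1)] div_mult_less[OF ik'(2)] mod_mult_less[OF ik(1)] mod_mult_less[OF ik(2)]
    by (simp add: kron_index mult.assoc div_mult2_eq[symmetric] mult.commute[of "dim_row C"] mult.commute[of "dim_col C"]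
        mod_mod_cancel)
qed (auto simp: mult.assoc)

lemma kron_mat2:
  fixes B :: "'a::comm_semiring_1 mat"
  shows "mat_of_rows_list 2 [[a, b], [c, d]] \<otimes>\<^sub>k B =
     four_block_mat (a \<cdot>\<^sub>m B) (b \<cdot>\<^sub>m B) (c \<cdot>\<^sub>m B) (d \<cdot>\<^sub>m B)"
proof (intro eq_matI)
  fix i k
  assume "i < dim_row (four_block_mat (a \<cdot>\<^sub>m B) (b \<cdot>\<^sub>m B) (c \<cdot>\<^sub>m B) (d \<cdot>\<^sub>m B))"
    "k < dim_col (four_block_mat (a \<cdot>\<^sub>m B) (b \<cdot>\<^sub>m B) (c \<cdot>\<^sub>m B) (d \<cdot>\<^sub>m B))"
  then have ik: "i < 2 * dim_row B" "k < 2 * dim_col B" by auto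
  have *: "x div n = (if x < n then 0 else 1) \<and> x mod n = (if x < n then x else x - n)" if "x < 2 * n" for x n :: nat
    using that by (auto simp: div_if mod_if)
  show "(mat_of_rows_list 2 [[a, b], [c, d]] \<otimes>\<^sub>k B) $$ (i, k) =
      four_block_mat (a \<cdot>\<^sub>m B) (b \<cdot>\<^sub>m B) (c \<cdot>\<^sub>m B) (d \<cdot>\<^sub>m B) $$ (i, k)"
    using ik *[OF ik(1)] *[OF ik(2)] by (subst kron_index) (auto simp: mat_of_rows_list_def)
qed (auto simp: mat_of_rows_list_def)

subsection \<open>Operators on chosen tensor factors\<close>

lemma prod_list_split_nth:
  "p < length ds \<Longrightarrow> prod_list ds = prod_list (take p ds) * (ds ! p * prod_list (drop (Suc p) ds))"
  for ds :: "nat list"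
  by (subst id_take_nth_drop[of p ds]) auto

lemma digit_mod: "p < length ds \<Longrightarrow> digit ds (i mod prod_list ds) p = digit ds i p"
proof -
  assume p: "p < length ds"
  have *: "x div c mod b = x mod (b * c) div c" for x b c :: nat
    by (cases "c = 0") (simp_all add: mod_mult2_eq mult.commute[of b c])
  show ?thesis
    unfolding digit_def * by (subst prod_list_split_nth[OF p]) (simp add: mod_mod_cancel)
qed

lemma digit_Cons_0: "i < d * prod_list ds \<Longrightarrow> digit (d # ds) i 0 = i div prod_list ds"
  by (simp add: digit_def div_mult_less)

lemma digit_Cons_Suc: "digit (d # ds) i (Suc p) = digit ds i p"
  by (simp add: digit_def)

lemma digit_less: "i < prod_list ds \<Longrightarrow> p < length ds \<Longrightarrow> digit ds i p < ds ! p"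
proof -
  assume "i < prod_list ds" "p < length ds"
  then have "ds ! p > 0" using prod_list_split_nth[of p ds] by (cases "ds ! p") auto
  then show ?thesis by (simp add: digit_def)
qed

lemma digits_inject:
  "i < prod_list ds \<Longrightarrow> k < prod_list ds \<Longrightarrow> (\<And>t. t < length ds \<Longrightarrow> digit ds i t = digit ds k t) \<Longrightarrow> i = k"
proof (induction ds arbitrary: i k)
  case (Cons d ds)
  then have ik: "i < d * prod_list ds" "k < d * prod_list ds" by auto
  have 1: "i div prod_list ds = k div prod_list ds"
    using Cons.prems(3)[of 0] ik by (simp add: digit_Cons_0)
  have 2: "i mod prod_list ds = k mod prod_list ds"
  proof (rule Cons.IH)
    fix t assume "t < length ds"
    then show "digit ds (i mod prod_list ds) t = digit ds (k mod prod_list ds) t"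
      using Cons.prems(3)[of "Suc t"] by (simp add: digit_Cons_Suc digit_mod)
  qed (use ik mod_mult_less in blast)+
  from 1 2 show ?case by (metis div_mult_mod_eq)
qed auto

lemma digits_surject:
  assumes "\<And>t. t < length ds \<Longrightarrow> c t < ds ! t"
  shows "\<exists>i<prod_list ds. \<forall>t<length ds. digit ds i t = c t"
  using assms
proof (induction ds arbitrary: c)
  case (Cons d ds)
  obtain j where j: "j < prod_list ds" "\<And>t. t < length ds \<Longrightarrow> digit ds j t = c (Suc t)"
    using Cons.IH[of "\<lambda>t. c (Suc t)"] Cons.prems by force
  let ?i = "c 0 * prod_list ds + j"
  have i: "?i < d * prod_list ds"
    using j(1) Cons.prems[of 0] by (intro pair_index_less) auto
  have "digit (d # ds) ?i t = c t" if "t < length (d # ds)" for t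
  proof (cases t)
    case 0 then show ?thesis using i j(1) by (simp add: digit_Cons_0)
  next
    case (Suc t')
    then have "digit ds ?i t' = digit ds (?i mod prod_list ds) t'" using that by (intro digit_mod[symmetric]) auto
    also have "\<dots> = c t" using Suc that j by simp
    finally show ?thesis by (simp add: Suc digit_Cons_Suc)
  qed
  with i show ?case by auto
qed auto

text \<open>With the set of free positions as a parameter, the positions left free by a product of
  operators are the union of those left free by the factors.\<close>

definition agree_off :: "nat list \<Rightarrow> nat set \<Rightarrow> nat \<Rightarrow> nat \<Rightarrow> bool" where
  "agree_off ds X i k \<longleftrightarrow> (\<forall>t<length ds. t \<notin> X \<longrightarrow> digit ds i t = digit ds k t)"

text \<open>One-site counterpart of \<open>embed2\<close>; coproducts on several sites are
  decomposed into sums of products of such operators.\<close>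

definition embed1 :: "nat list \<Rightarrow> nat \<Rightarrow> complex mat \<Rightarrow> complex mat" where
  "embed1 ds x A = Matrix.mat (prod_list ds) (prod_list ds)
     (\<lambda>(i, k). if agree_off ds {x} i k then A $$ (digit ds i x, digit ds k x) else 0)"

lemma embed2_alt: "embed2 ds x y A = Matrix.mat (prod_list ds) (prod_list ds)
     (\<lambda>(i, k). if agree_off ds {x, y} i k
       then A $$ (digit ds i x * ds ! y + digit ds i y, digit ds k x * ds ! y + digit ds k y) else 0)"
  by (auto simp: embed2_def agree_off_def intro!: cong_mat)

lemma dim_embed [simp]:
  "dim_row (embed1 ds x A) = prod_list ds" "dim_col (embed1 ds x A) = prod_list ds"
  "dim_row (embed2 ds x y B) = prod_list ds" "dim_col (embed2 ds x y B) = prod_list ds"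
  by (auto simp: embed1_def embed2_def)

text \<open>The indices that differ from i at x and y only correspond to the pairs of digits there.
  A product of two embedded operators thereby becomes the product of the operators
  themselves.\<close>

lemma sum_agree_off2:
  assumes xy: "x < length ds" "y < length ds" "x \<noteq> y" and i: "i < prod_list ds"
  shows "(\<Sum>m<prod_list ds. if agree_off ds {x, y} i m then f (digit ds m x) (digit ds m y) else 0) =
    (\<Sum>a<ds ! x. \<Sum>b<ds ! y. f a b :: 'a::comm_monoid_add)"
proof -
  let ?S = "{m. m < prod_list ds \<and> agree_off ds {x, y} i m}"
  have "bij_betw (\<lambda>m. (digit ds m x, digit ds m y)) ?S ({..<ds ! x} \<times> {..<ds ! y})"
  proof (rule bij_betwI')
    fix m m' assume m: "m \<in> ?S" "m' \<in> ?S"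
    have "m = m'" if "digit ds m x = digit ds m' x" "digit ds m y = digit ds m' y"
    proof (rule digits_inject)
      fix t assume "t < length ds"
      then show "digit ds m t = digit ds m' t"
        using that m by (cases "t = x \<or> t = y") (auto simp: agree_off_def)
    qed (use m in auto)
    then show "((digit ds m x, digit ds m y) = (digit ds m' x, digit ds m' y)) = (m = m')" by auto
  next
    fix ab assume "ab \<in> {..<ds ! x} \<times> {..<ds ! y}"
    then obtain a b where ab: "ab = (a, b)" "a < ds ! x" "b < ds ! y" by auto
    have "\<exists>m<prod_list ds. \<forall>t<length ds. digit ds m t = ((digit ds i)(x := a, y := b)) t"
      using ab digit_less[OF i] by (intro digits_surject) auto
    then obtain m where "m < prod_list ds" "\<forall>t<length ds. digit ds m t = ((digit ds i)(x := a, y := b)) t" by blast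
    then show "\<exists>m\<in>?S. ab = (digit ds m x, digit ds m y)"
      using xy ab by (auto simp: agree_off_def intro!: exI[of _ m])
  qed (use xy digit_less in auto)
  from sum.reindex_bij_betw[OF this, of "\<lambda>(a, b). f a b"]
  have "(\<Sum>m\<in>?S. f (digit ds m x) (digit ds m y)) = (\<Sum>a<ds ! x. \<Sum>b<ds ! y. f a b)"
    by (simp add: sum.cartesian_product)
  moreover have "(\<Sum>m<prod_list ds. if agree_off ds {x, y} i m then f (digit ds m x) (digit ds m y) else 0) =
      (\<Sum>m\<in>?S. f (digit ds m x) (digit ds m y))"
    by (rule sum.mono_neutral_cong_right) auto
  ultimately show ?thesis by simp
qed

lemma embed2_mult:
  assumes xy: "x < length ds" "y < length ds" "x \<noteq> y"
    and A: "A \<in> carrier_mat (ds ! x * ds ! y) (ds ! x * ds ! y)" "B \<in> carrier_mat (ds ! x * ds ! y) (ds ! x * ds ! y)"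
  shows "embed2 ds x y (A * B) = embed2 ds x y A * embed2 ds x y B"
proof (rule eq_matI)
  fix i k assume "i < dim_row (embed2 ds x y A * embed2 ds x y B)" "k < dim_col (embed2 ds x y A * embed2 ds x y B)"
  then have ik: "i < prod_list ds" "k < prod_list ds" by auto
  let ?p = "\<lambda>m. digit ds m x * ds ! y + digit ds m y"
  have p: "?p m < ds ! x * ds ! y" if "m < prod_list ds" for m
    using digit_less[OF that] xy by (intro pair_index_less) auto
  have ag: "agree_off ds {x, y} i m \<Longrightarrow> agree_off ds {x, y} m k \<longleftrightarrow> agree_off ds {x, y} i k" for m
    by (auto simp: agree_off_def)
  have "(embed2 ds x y A * embed2 ds x y B) $$ (i, k) =
     (\<Sum>m<prod_list ds. if agree_off ds {x, y} i m then
        (if agree_off ds {x, y} i k then A $$ (?p i, ?p m) * B $$ (?p m, ?p k) else 0) else 0)"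
    using ik by (subst mat_mult_index) (auto simp: embed2_alt ag intro!: sum.cong)
  also have "\<dots> = (\<Sum>a<ds ! x. \<Sum>b<ds ! y. if agree_off ds {x, y} i k then
       A $$ (?p i, a * ds ! y + b) * B $$ (a * ds ! y + b, ?p k) else 0)"
    by (rule sum_agree_off2[OF xy ik(1)])
  also have "\<dots> = (if agree_off ds {x, y} i k then (A * B) $$ (?p i, ?p k) else 0)"
    using A p[OF ik(1)] p[OF ik(2)] by (auto simp: mat_mult_index sum_lessThan_times simp del: index_mult_mat(1))
  finally show "embed2 ds x y (A * B) $$ (i, k) = (embed2 ds x y A * embed2 ds x y B) $$ (i, k)"
    using ik by (simp add: embed2_alt)
qed auto

lemma embed2_add:
  assumes xy: "x < length ds" "y < length ds"
    and A: "B \<in> carrier_mat (ds ! x * ds ! y) (ds ! x * ds ! y)"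
  shows "embed2 ds x y (A + B) = embed2 ds x y A + embed2 ds x y B"
  using assms by (intro eq_matI) (auto simp: embed2_alt pair_index_less digit_less)

lemma embed2_smult:
  assumes xy: "x < length ds" "y < length ds"
    and A: "A \<in> carrier_mat (ds ! x * ds ! y) (ds ! x * ds ! y)"
  shows "embed2 ds x y (c \<cdot>\<^sub>m A) = c \<cdot>\<^sub>m embed2 ds x y A"
  using assms by (intro eq_matI) (auto simp: embed2_alt pair_index_less digit_less)

lemma embed2_kron_one_right:
  assumes xy: "x < length ds" "y < length ds" "x \<noteq> y" and A: "A \<in> carrier_mat (ds ! x) (ds ! x)"
  shows "embed2 ds x y (A \<otimes>\<^sub>k 1\<^sub>m (ds ! y)) = embed1 ds x A"
proof (rule eq_matI)
  fix i k assume "i < dim_row (embed1 ds x A)" "k < dim_col (embed1 ds x A)"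
  then have ik: "i < prod_list ds" "k < prod_list ds" by auto
  have [simp]: "dim_row A = ds ! x" "dim_col A = ds ! x" using A by auto
  have f1: "(A \<otimes>\<^sub>k 1\<^sub>m (ds ! y)) $$ (digit ds i x * ds ! y + digit ds i y, digit ds k x * ds ! y + digit ds k y) =
    A $$ (digit ds i x, digit ds k x) * 1\<^sub>m (ds ! y) $$ (digit ds i y, digit ds k y)"
    using kron_index_pair[of "digit ds i x" A "digit ds i y" "1\<^sub>m (ds ! y)" "digit ds k x" "digit ds k y"]
      digit_less[OF ik(1)] digit_less[OF ik(2)] xy by simp
  have f2: "agree_off ds {x} i k \<longleftrightarrow> agree_off ds {x, y} i k \<and> digit ds i y = digit ds k y"
    using xy by (auto simp: agree_off_def)
  have f3: "embed2 ds x y (A \<otimes>\<^sub>k 1\<^sub>m (ds ! y)) $$ (i, k) = (if agree_off ds {x, y} i k then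
      (A \<otimes>\<^sub>k 1\<^sub>m (ds ! y)) $$ (digit ds i x * ds ! y + digit ds i y, digit ds k x * ds ! y + digit ds k y) else 0)"
    using ik by (simp add: embed2_alt)
  show "embed2 ds x y (A \<otimes>\<^sub>k 1\<^sub>m (ds ! y)) $$ (i, k) = embed1 ds x A $$ (i, k)"
    unfolding f3 f1 using ik xy digit_less[OF ik(1)] digit_less[OF ik(2)] by (simp add: embed1_def f2)
qed auto

lemma embed2_kron_one_left:
  assumes xy: "x < length ds" "y < length ds" "x \<noteq> y" and A: "A \<in> carrier_mat (ds ! y) (ds ! y)"
  shows "embed2 ds x y (1\<^sub>m (ds ! x) \<otimes>\<^sub>k A) = embed1 ds y A"
proof (rule eq_matI)
  fix i k assume "i < dim_row (embed1 ds y A)" "k < dim_col (embed1 ds y A)"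
  then have ik: "i < prod_list ds" "k < prod_list ds" by auto
  have [simp]: "dim_row A = ds ! y" "dim_col A = ds ! y" using A by auto
  have f1: "(1\<^sub>m (ds ! x) \<otimes>\<^sub>k A) $$ (digit ds i x * ds ! y + digit ds i y, digit ds k x * ds ! y + digit ds k y) =
    1\<^sub>m (ds ! x) $$ (digit ds i x, digit ds k x) * A $$ (digit ds i y, digit ds k y)"
    using kron_index_pair[of "digit ds i x" "1\<^sub>m (ds ! x)" "digit ds i y" A "digit ds k x" "digit ds k y"]
      digit_less[OF ik(1)] digit_less[OF ik(2)] xy by simp
  have f2: "agree_off ds {y} i k \<longleftrightarrow> agree_off ds {x, y} i k \<and> digit ds i x = digit ds k x"
    using xy by (auto simp: agree_off_def)
  have f3: "embed2 ds x y (1\<^sub>m (ds ! x) \<otimes>\<^sub>k A) $$ (i, k) = (if agree_off ds {x, y} i k then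
      (1\<^sub>m (ds ! x) \<otimes>\<^sub>k A) $$ (digit ds i x * ds ! y + digit ds i y, digit ds k x * ds ! y + digit ds k y) else 0)"
    using ik by (simp add: embed2_alt)
  show "embed2 ds x y (1\<^sub>m (ds ! x) \<otimes>\<^sub>k A) $$ (i, k) = embed1 ds y A $$ (i, k)"
    unfolding f3 f1 using ik xy digit_less[OF ik(1)] digit_less[OF ik(2)] by (simp add: embed1_def f2)
qed auto

lemma embed2_kron:
  assumes xy: "x < length ds" "y < length ds" "x \<noteq> y"
    and A: "A \<in> carrier_mat (ds ! x) (ds ! x)" and B: "B \<in> carrier_mat (ds ! y) (ds ! y)"
  shows "embed2 ds x y (A \<otimes>\<^sub>k B) = embed1 ds x A * embed1 ds y B"
proof -
  have eq: "A \<otimes>\<^sub>k B = (A \<otimes>\<^sub>k 1\<^sub>m (ds ! y)) * (1\<^sub>m (ds ! x) \<otimes>\<^sub>k B)"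
    using A B by (subst kron_mult_kron) auto
  show ?thesis
    unfolding eq using assms by (subst embed2_mult) (auto simp: embed2_kron_one_right embed2_kron_one_left)
qed

text \<open>In either order at most one intermediate index contributes to a given entry, and the
  contribution is the same entry of C times the same entry of A.\<close>

lemma embed1_commute_embed2:
  assumes xyz: "x < length ds" "y < length ds" "z < length ds" "z \<noteq> x" "z \<noteq> y"
  shows "embed1 ds z C * embed2 ds x y A = embed2 ds x y A * embed1 ds z C"
proof (rule eq_matI)
  fix i k assume "i < dim_row (embed2 ds x y A * embed1 ds z C)" "k < dim_col (embed2 ds x y A * embed1 ds z C)"
  then have ik: "i < prod_list ds" "k < prod_list ds" by auto
  let ?p = "\<lambda>m. digit ds m x * ds ! y + digit ds m y"
  let ?v = "if agree_off ds {x, y, z} i k then C $$ (digit ds i z, digit ds k z) * A $$ (?p i, ?p k) else 0"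
  \<comment> \<open>The two possible intermediate indices: \<open>m0\<close> changes the digit at z
    first, \<open>m1\<close> the digits at x and y.\<close>
  have "\<exists>m<prod_list ds. \<forall>t<length ds. digit ds m t = ((digit ds i)(z := digit ds k z)) t"
    using digit_less[OF ik(1)] digit_less[OF ik(2)] by (intro digits_surject) auto
  then obtain m0 where m0: "m0 < prod_list ds" "\<And>t. t < length ds \<Longrightarrow> digit ds m0 t = ((digit ds i)(z := digit ds k z)) t"
    by blast
  have "\<exists>m<prod_list ds. \<forall>t<length ds. digit ds m t = ((digit ds i)(x := digit ds k x, y := digit ds k y)) t"
    using digit_less[OF ik(1)] digit_less[OF ik(2)] by (intro digits_surject) auto
  then obtain m1 where m1: "m1 < prod_list ds"
    "\<And>t. t < length ds \<Longrightarrow> digit ds m1 t = ((digit ds i)(x := digit ds k x, y := digit ds k y)) t"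
    by blast
  have a0: "agree_off ds {z} i m \<and> agree_off ds {x, y} m k \<longleftrightarrow> agree_off ds {x, y, z} i k \<and> m = m0"
    if m: "m < prod_list ds" for m
  proof
    assume *: "agree_off ds {z} i m \<and> agree_off ds {x, y} m k"
    have "m = m0"
    proof (rule digits_inject[OF m m0(1)])
      fix t assume t: "t < length ds"
      show "digit ds m t = digit ds m0 t"
      proof (cases "t = z")
        case True
        then have "digit ds m t = digit ds k t" using * t xyz by (simp add: agree_off_def)
        then show ?thesis using m0(2)[OF t] True by simp
      next
        case False
        then have "digit ds i t = digit ds m t" using * t by (simp add: agree_off_def)
        then show ?thesis using m0(2)[OF t] False by simp
      qed
    qed
    moreover have "agree_off ds {x, y, z} i k" using * by (simp add: agree_off_def)
    ultimately show "agree_off ds {x, y, z} i k \<and> m = m0" by simp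
  qed (use m0 xyz in \<open>auto simp: agree_off_def\<close>)
  have a1: "agree_off ds {x, y} i m \<and> agree_off ds {z} m k \<longleftrightarrow> agree_off ds {x, y, z} i k \<and> m = m1"
    if m: "m < prod_list ds" for m
  proof
    assume *: "agree_off ds {x, y} i m \<and> agree_off ds {z} m k"
    have "m = m1"
    proof (rule digits_inject[OF m m1(1)])
      fix t assume t: "t < length ds"
      show "digit ds m t = digit ds m1 t"
      proof (cases "t = x \<or> t = y")
        case True
        then have "digit ds m t = digit ds k t" using * t xyz by (auto simp: agree_off_def)
        then show ?thesis using m1(2)[OF t] True by auto
      next
        case False
        then have "digit ds i t = digit ds m t" using * t by (simp add: agree_off_def)
        then show ?thesis using m1(2)[OF t] False by simp
      qed
    qed
    moreover have "agree_off ds {x, y, z} i k" using * by (simp add: agree_off_def)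
    ultimately show "agree_off ds {x, y, z} i k \<and> m = m1" by simp
  qed (use m1 xyz in \<open>auto simp: agree_off_def\<close>)
  have "(embed1 ds z C * embed2 ds x y A) $$ (i, k) = (\<Sum>m<prod_list ds.
      if agree_off ds {z} i m \<and> agree_off ds {x, y} m k then C $$ (digit ds i z, digit ds m z) * A $$ (?p m, ?p k) else 0)"
    using ik by (subst mat_mult_index) (auto simp: embed2_alt embed1_def intro!: sum.cong)
  also have "\<dots> = (\<Sum>m<prod_list ds. if m = m0 then ?v else 0)"
    using a0 m0 xyz by (intro sum.cong) auto
  also have "\<dots> = ?v" using m0 by simp
  finally have 1: "(embed1 ds z C * embed2 ds x y A) $$ (i, k) = ?v" .
  have "(embed2 ds x y A * embed1 ds z C) $$ (i, k) = (\<Sum>m<prod_list ds.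
      if agree_off ds {x, y} i m \<and> agree_off ds {z} m k then A $$ (?p i, ?p m) * C $$ (digit ds m z, digit ds k z) else 0)"
    using ik by (subst mat_mult_index) (auto simp: embed2_alt embed1_def intro!: sum.cong)
  also have "\<dots> = (\<Sum>m<prod_list ds. if m = m1 then ?v else 0)"
    using a1 m1 xyz by (intro sum.cong) auto
  also have "\<dots> = ?v" using m1 by simp
  finally show "(embed1 ds z C * embed2 ds x y A) $$ (i, k) = (embed2 ds x y A * embed1 ds z C) $$ (i, k)"
    using 1 by simp
qed auto

lemma embed1_Cons_0:
  assumes A: "A \<in> carrier_mat d d"
  shows "embed1 (d # ds) 0 A = A \<otimes>\<^sub>k 1\<^sub>m (prod_list ds)"
proof (rule eq_matI)
  fix i k assume "i < dim_row (A \<otimes>\<^sub>k 1\<^sub>m (prod_list ds))" "k < dim_col (A \<otimes>\<^sub>k 1\<^sub>m (prod_list ds))"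
  then have ik: "i < d * prod_list ds" "k < d * prod_list ds" using A by auto
  have "agree_off (d # ds) {0} i k \<longleftrightarrow> (\<forall>t<length ds. digit ds i t = digit ds k t)"
    by (auto simp: agree_off_def less_Suc_eq_0_disj digit_Cons_Suc)
  also have "\<dots> \<longleftrightarrow> (\<forall>t<length ds. digit ds (i mod prod_list ds) t = digit ds (k mod prod_list ds) t)"
    by (simp add: digit_mod)
  also have "\<dots> \<longleftrightarrow> i mod prod_list ds = k mod prod_list ds"
    using digits_inject[of "i mod prod_list ds" ds "k mod prod_list ds"] ik by (auto simp: mod_mult_less)
  finally show "embed1 (d # ds) 0 A $$ (i, k) = (A \<otimes>\<^sub>k 1\<^sub>m (prod_list ds)) $$ (i, k)"
    using ik A by (simp add: embed1_def kron_index digit_Cons_0 mod_mult_less)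
qed (use A in auto)

lemma embed1_Cons_Suc:
  assumes p: "p < length ds"
  shows "embed1 (d # ds) (Suc p) A = 1\<^sub>m d \<otimes>\<^sub>k embed1 ds p A"
proof (rule eq_matI)
  fix i k assume "i < dim_row (1\<^sub>m d \<otimes>\<^sub>k embed1 ds p A)" "k < dim_col (1\<^sub>m d \<otimes>\<^sub>k embed1 ds p A)"
  then have ik: "i < d * prod_list ds" "k < d * prod_list ds" by auto
  have "agree_off (d # ds) {Suc p} i k \<longleftrightarrow>
     i div prod_list ds = k div prod_list ds \<and> agree_off ds {p} (i mod prod_list ds) (k mod prod_list ds)"
    using ik by (auto simp: agree_off_def less_Suc_eq_0_disj digit_Cons_Suc digit_Cons_0 digit_mod)
  then show "embed1 (d # ds) (Suc p) A $$ (i, k) = (1\<^sub>m d \<otimes>\<^sub>k embed1 ds p A) $$ (i, k)"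
    using ik p by (simp add: embed1_def kron_index digit_Cons_Suc digit_mod div_mult_less mod_mult_less)
qed auto

lemma embed1_commute:
  assumes xz: "x < length ds" "z < length ds" "z \<noteq> x" and A: "A \<in> carrier_mat (ds ! x) (ds ! x)"
    and C: "C \<in> carrier_mat (ds ! z) (ds ! z)"
  shows "embed1 ds z C * embed1 ds x A = embed1 ds x A * embed1 ds z C"
proof -
  have "embed1 ds z C * embed1 ds x A = embed2 ds x z ((1\<^sub>m (ds ! x) \<otimes>\<^sub>k C) * (A \<otimes>\<^sub>k 1\<^sub>m (ds ! z)))"
    using assms by (subst embed2_mult) (auto simp: embed2_kron_one_right embed2_kron_one_left)
  also have "\<dots> = embed2 ds x z ((A \<otimes>\<^sub>k 1\<^sub>m (ds ! z)) * (1\<^sub>m (ds ! x) \<otimes>\<^sub>k C))"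
    using A C by (auto simp: kron_mult_kron)
  also have "\<dots> = embed1 ds x A * embed1 ds z C"
    using assms by (subst embed2_mult) (auto simp: embed2_kron_one_right embed2_kron_one_left)
  finally show ?thesis .
qed

subsection \<open>Partial trace\<close>

lemma dim_partial_trace [simp]: "dim_row (partial_trace d m T) = m" "dim_col (partial_trace d m T) = m"
  by (auto simp: partial_trace_def)

lemma kron_one_left_mult_index:
  assumes "W \<in> carrier_mat m m" "X \<in> carrier_mat (d * m) n" "a < d" "i < m" "k < n"
  shows "((1\<^sub>m d \<otimes>\<^sub>k W) * X) $$ (a * m + i, k) = (\<Sum>l<m. W $$ (i, l) * X $$ (a * m + l, k) :: complex)"
proof -
  have "((1\<^sub>m d \<otimes>\<^sub>k W) * X) $$ (a * m + i, k) = (\<Sum>c<d. \<Sum>l<m. (if a = c then W $$ (i, l) * X $$ (c * m + l, k) else 0))"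
    using assms kron_index_pair[of a "1\<^sub>m d" i W]
    by (subst mat_mult_index) (auto simp: pair_index_less sum_lessThan_times intro!: sum.cong)
  also have "\<dots> = (\<Sum>c<d. if a = c then (\<Sum>l<m. W $$ (i, l) * X $$ (c * m + l, k)) else 0)"
    by (intro sum.cong) auto
  finally show ?thesis using assms by simp
qed

lemma mult_kron_one_left_index:
  assumes "W \<in> carrier_mat m m" "X \<in> carrier_mat n (d * m)" "a < d" "k < m" "i < n"
  shows "(X * (1\<^sub>m d \<otimes>\<^sub>k W)) $$ (i, a * m + k) = (\<Sum>l<m. X $$ (i, a * m + l) * W $$ (l, k) :: complex)"
proof -
  have "(X * (1\<^sub>m d \<otimes>\<^sub>k W)) $$ (i, a * m + k) = (\<Sum>c<d. \<Sum>l<m. (if a = c then X $$ (i, c * m + l) * W $$ (l, k) else 0))"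
    using assms kron_index_pair[of _ "1\<^sub>m d" _ W a k]
    by (subst mat_mult_index) (auto simp: pair_index_less sum_lessThan_times intro!: sum.cong)
  also have "\<dots> = (\<Sum>c<d. if a = c then (\<Sum>l<m. X $$ (i, c * m + l) * W $$ (l, k)) else 0)"
    by (intro sum.cong) auto
  finally show ?thesis using assms by simp
qed

lemma partial_trace_mult_left:
  assumes "W \<in> carrier_mat m m" "X \<in> carrier_mat (d * m) (d * m)"
  shows "partial_trace d m ((1\<^sub>m d \<otimes>\<^sub>k W) * X) = W * partial_trace d m X"
proof (rule eq_matI)
  fix i k assume "i < dim_row (W * partial_trace d m X)" "k < dim_col (W * partial_trace d m X)"
  then have ik: "i < m" "k < m" using assms by auto
  have "partial_trace d m ((1\<^sub>m d \<otimes>\<^sub>k W) * X) $$ (i, k) = (\<Sum>a<d. \<Sum>l<m. W $$ (i, l) * X $$ (a * m + l, a * m + k))"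
    using ik assms by (auto simp: partial_trace_def kron_one_left_mult_index pair_index_less simp del: index_mult_mat(1) intro!: sum.cong)
  also have "\<dots> = (W * partial_trace d m X) $$ (i, k)"
    using ik assms by (subst sum.swap, subst mat_mult_index) (auto simp: partial_trace_def sum_distrib_left)
  finally show "partial_trace d m ((1\<^sub>m d \<otimes>\<^sub>k W) * X) $$ (i, k) = (W * partial_trace d m X) $$ (i, k)" .
qed (use assms in auto)

lemma partial_trace_mult_right:
  assumes "W \<in> carrier_mat m m" "X \<in> carrier_mat (d * m) (d * m)"
  shows "partial_trace d m (X * (1\<^sub>m d \<otimes>\<^sub>k W)) = partial_trace d m X * W"
proof (rule eq_matI)
  fix i k assume "i < dim_row (partial_trace d m X * W)" "k < dim_col (partial_trace d m X * W)"
  then have ik: "i < m" "k < m" using assms by auto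
  have "partial_trace d m (X * (1\<^sub>m d \<otimes>\<^sub>k W)) $$ (i, k) = (\<Sum>a<d. \<Sum>l<m. X $$ (a * m + i, a * m + l) * W $$ (l, k))"
    using ik assms by (auto simp: partial_trace_def mult_kron_one_left_index pair_index_less simp del: index_mult_mat(1) intro!: sum.cong)
  also have "\<dots> = (partial_trace d m X * W) $$ (i, k)"
    using ik assms by (subst sum.swap, subst mat_mult_index) (auto simp: partial_trace_def sum_distrib_right)
  finally show "partial_trace d m (X * (1\<^sub>m d \<otimes>\<^sub>k W)) $$ (i, k) = (partial_trace d m X * W) $$ (i, k)" .
qed (use assms in auto)

text \<open>Cyclicity survives for operators on the traced factor, because their entries are scalars
  for the remaining factors.\<close>

lemma partial_trace_cyclic:
  assumes A: "A \<in> carrier_mat d d" and X: "X \<in> carrier_mat (d * m) (d * m)"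
  shows "partial_trace d m ((A \<otimes>\<^sub>k 1\<^sub>m m) * X) = partial_trace d m (X * (A \<otimes>\<^sub>k 1\<^sub>m m))"
proof (rule eq_matI)
  fix i k assume "i < dim_row (partial_trace d m (X * (A \<otimes>\<^sub>k 1\<^sub>m m)))" "k < dim_col (partial_trace d m (X * (A \<otimes>\<^sub>k 1\<^sub>m m)))"
  then have ik: "i < m" "k < m" using assms by auto
  have dA: "dim_row A = d" "dim_col A = d" using A by auto
  have L: "((A \<otimes>\<^sub>k 1\<^sub>m m) * X) $$ (a * m + i, a * m + k) = (\<Sum>c<d. A $$ (a, c) * X $$ (c * m + i, a * m + k))" if "a < d" for a
  proof -
    have "((A \<otimes>\<^sub>k 1\<^sub>m m) * X) $$ (a * m + i, a * m + k) = (\<Sum>c<d. \<Sum>l<m. (if i = l then A $$ (a, c) * X $$ (c * m + l, a * m + k) else 0))"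
      using that ik X dA kron_index_pair[of a A i "1\<^sub>m m"]
      by (subst mat_mult_index) (auto simp: pair_index_less sum_lessThan_times simp del: sum.delta sum.delta' mult_delta_left intro!: sum.cong)
    then show ?thesis using ik by simp
  qed
  have R: "(X * (A \<otimes>\<^sub>k 1\<^sub>m m)) $$ (a * m + i, a * m + k) = (\<Sum>c<d. X $$ (a * m + i, c * m + k) * A $$ (c, a))" if "a < d" for a
  proof -
    have "(X * (A \<otimes>\<^sub>k 1\<^sub>m m)) $$ (a * m + i, a * m + k) = (\<Sum>c<d. \<Sum>l<m. (if k = l then X $$ (a * m + i, c * m + l) * A $$ (c, a) else 0))"
      using that ik X dA kron_index_pair[of _ A _ "1\<^sub>m m" a k]
      by (subst mat_mult_index) (auto simp: pair_index_less sum_lessThan_times simp del: sum.delta sum.delta' intro!: sum.cong)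
    then show ?thesis using ik by simp
  qed
  have "(\<Sum>a<d. \<Sum>c<d. A $$ (a, c) * X $$ (c * m + i, a * m + k)) = (\<Sum>a<d. \<Sum>c<d. X $$ (a * m + i, c * m + k) * A $$ (c, a))"
    by (subst sum.swap) (simp add: mult.commute)
  then show "partial_trace d m ((A \<otimes>\<^sub>k 1\<^sub>m m) * X) $$ (i, k) = partial_trace d m (X * (A \<otimes>\<^sub>k 1\<^sub>m m)) $$ (i, k)"
    using ik dA X by (simp add: partial_trace_def L R del: index_mult_mat(1))
qed auto

lemma partial_trace_add:
  "X \<in> carrier_mat (d * m) (d * m) \<Longrightarrow> Y \<in> carrier_mat (d * m) (d * m) \<Longrightarrow>
   partial_trace d m (X + Y) = partial_trace d m X + partial_trace d m Y"
  by (intro eq_matI) (auto simp: partial_trace_def pair_index_less sum.distrib)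

lemma partial_trace_smult:
  "X \<in> carrier_mat (d * m) (d * m) \<Longrightarrow> partial_trace d m (c \<cdot>\<^sub>m X) = c \<cdot>\<^sub>m partial_trace d m X"
  by (intro eq_matI) (auto simp: partial_trace_def pair_index_less sum_distrib_left)

subsection \<open>Band matrices\<close>

text \<open>In the weight basis the spin matrices and the blocks of the R-matrix are raising,
  lowering or diagonal matrices of these three kinds, so that products reduce to shifts of
  indices.\<close>

definition upm :: "nat \<Rightarrow> (nat \<Rightarrow> complex) \<Rightarrow> complex mat" where
  "upm n f = Matrix.mat n n (\<lambda>(i, k). if k = Suc i then f i else 0)"

definition dnm :: "nat \<Rightarrow> (nat \<Rightarrow> complex) \<Rightarrow> complex mat" where
  "dnm n f = Matrix.mat n n (\<lambda>(i, k). if i = Suc k then f k else 0)"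

definition dgm :: "nat \<Rightarrow> (nat \<Rightarrow> complex) \<Rightarrow> complex mat" where
  "dgm n f = Matrix.mat n n (\<lambda>(i, k). if i = k then f i else 0)"

lemma dim_band [simp]:
  "dim_row (upm n f) = n" "dim_col (upm n f) = n" "dim_row (dnm n f) = n" "dim_col (dnm n f) = n"
  "dim_row (dgm n f) = n" "dim_col (dgm n f) = n"
  by (auto simp: upm_def dnm_def dgm_def)

lemma band_carrier [simp]:
  "upm n f \<in> carrier_mat n n" "dnm n f \<in> carrier_mat n n" "dgm n f \<in> carrier_mat n n"
  by auto

lemma band_index:
  "i < n \<Longrightarrow> k < n \<Longrightarrow> upm n f $$ (i, k) = (if k = Suc i then f i else 0)"
  "i < n \<Longrightarrow> k < n \<Longrightarrow> dnm n f $$ (i, k) = (if i = Suc k then f k else 0)"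
  "i < n \<Longrightarrow> k < n \<Longrightarrow> dgm n f $$ (i, k) = (if i = k then f i else 0)"
  by (auto simp: upm_def dnm_def dgm_def)

lemma mult_band_index:
  assumes "i < dim_row M" "k < n" "dim_col M = n"
  shows "(M * upm n f) $$ (i, k) = (if k = 0 then 0 else M $$ (i, k - 1) * f (k - 1))"
    "(M * dnm n f) $$ (i, k) = (if Suc k < n then M $$ (i, Suc k) * f k else 0)"
    "(M * dgm n f) $$ (i, k) = M $$ (i, k) * f k"
proof -
  have "(M * upm n f) $$ (i, k) = (\<Sum>l<n. if l = k - 1 \<and> k \<noteq> 0 then M $$ (i, l) * f l else 0)"
    using assms by (subst mat_mult_index) (auto simp: band_index intro!: sum.cong)
  also have "\<dots> = (if k = 0 then 0 else (\<Sum>l<n. if l = k - 1 then M $$ (i, l) * f l else 0))"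
    by auto
  finally show "(M * upm n f) $$ (i, k) = (if k = 0 then 0 else M $$ (i, k - 1) * f (k - 1))"
    using assms by simp
  have "(M * dnm n f) $$ (i, k) = (\<Sum>l<n. if l = Suc k then M $$ (i, l) * f k else 0)"
    using assms by (subst mat_mult_index) (auto simp: band_index mult_delta_left mult_delta_right)
  then show "(M * dnm n f) $$ (i, k) = (if Suc k < n then M $$ (i, Suc k) * f k else 0)"
    by simp
  have "(M * dgm n f) $$ (i, k) = (\<Sum>l<n. if l = k then M $$ (i, l) * f k else 0)"
    using assms by (subst mat_mult_index) (auto simp: band_index mult_delta_left mult_delta_right)
  then show "(M * dgm n f) $$ (i, k) = M $$ (i, k) * f k"
    using assms by simp
qed

lemma band_mult_index:
  assumes "k < dim_col M" "i < n" "dim_row M = n"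
  shows "(upm n f * M) $$ (i, k) = (if Suc i < n then f i * M $$ (Suc i, k) else 0)"
    "(dnm n f * M) $$ (i, k) = (if i = 0 then 0 else f (i - 1) * M $$ (i - 1, k))"
    "(dgm n f * M) $$ (i, k) = f i * M $$ (i, k)"
proof -
  have "(upm n f * M) $$ (i, k) = (\<Sum>l<n. if l = Suc i then f i * M $$ (l, k) else 0)"
    using assms by (subst mat_mult_index) (auto simp: band_index mult_delta_left mult_delta_right)
  then show "(upm n f * M) $$ (i, k) = (if Suc i < n then f i * M $$ (Suc i, k) else 0)"
    by simp
  have "(dnm n f * M) $$ (i, k) = (\<Sum>l<n. if l = i - 1 \<and> i \<noteq> 0 then f l * M $$ (l, k) else 0)"
    using assms by (subst mat_mult_index) (auto simp: band_index intro!: sum.cong)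
  also have "\<dots> = (if i = 0 then 0 else (\<Sum>l<n. if l = i - 1 then f l * M $$ (l, k) else 0))"
    by auto
  finally show "(dnm n f * M) $$ (i, k) = (if i = 0 then 0 else f (i - 1) * M $$ (i - 1, k))"
    using assms by simp
  have "(dgm n f * M) $$ (i, k) = (\<Sum>l<n. if l = i then f i * M $$ (l, k) else 0)"
    using assms by (subst mat_mult_index) (auto simp: band_index mult_delta_left mult_delta_right)
  then show "(dgm n f * M) $$ (i, k) = f i * M $$ (i, k)"
    using assms by simp
qed

subsection \<open>Spin matrices\<close>

definition generic :: "complex \<Rightarrow> bool" where
  "generic r \<longleftrightarrow> r \<noteq> 0 \<and> (\<forall>n::nat. n > 0 \<longrightarrow> (r\<^sup>2) ^ n \<noteq> 1)"

lemma generic_nonzero: "generic r \<Longrightarrow> r \<noteq> 0"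
  by (simp add: generic_def)

text \<open>The assumption controls powers of q = \<open>r\<^sup>2\<close> only. If a power of r,
  possibly odd, were 1, then so would be its square, which is a power of q.\<close>

lemma generic_powi: "generic r \<Longrightarrow> m \<noteq> 0 \<Longrightarrow> r powi m \<noteq> 1"
proof
  assume g: "generic r" and m: "m \<noteq> 0" and 1: "r powi m = 1"
  have *: "(r\<^sup>2) ^ nat \<bar>m\<bar> = r powi (2 * \<bar>m\<bar>)"
    by (simp add: power_int_def nat_mult_distrib power_mult)
  have "r powi (2 * \<bar>m\<bar>) = (r powi m) ^ 2 \<or> r powi (2 * \<bar>m\<bar>) = inverse ((r powi m) ^ 2)"
    using generic_nonzero[OF g]
    by (cases "m \<ge> 0") (auto simp: power2_eq_square power_int_minus simp flip: power_int_add)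
  with 1 have "r powi (2 * \<bar>m\<bar>) = 1" by auto
  with * g m show False by (auto simp: generic_def)
qed

lemma generic_powi_eq_iff: "generic r \<Longrightarrow> r powi m = r powi n \<longleftrightarrow> m = n"
  using generic_powi[of r "m - n"] generic_nonzero[of r] by (auto simp: power_int_diff)

lemma generic_inverse: "generic r \<Longrightarrow> generic (inverse r)"
  by (auto simp: generic_def power_inverse)

text \<open>The eigenvalue of S_3 on basis vector number i, counted from 0; it is twice the usual
  weight and hence an integer.\<close>

definition wt :: "nat \<Rightarrow> nat \<Rightarrow> int" where "wt s i = int s - 2 * int i"

text \<open>The amplitude B that links the basis vectors i and i + 1. In 0-based numbering S_+ and
  S_- carry the same list of amplitudes.\<close>

definition bco :: "complex \<Rightarrow> nat \<Rightarrow> nat \<Rightarrow> complex" where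
  "bco r s i = Bcoef r (int s) (int s - 2 * int i)"

lemma qh_nonzero: "generic r \<Longrightarrow> r\<^sup>2 - inverse (r\<^sup>2) \<noteq> 0"
  using generic_powi[of r 4] generic_nonzero[of r] by (auto simp: field_simps simp flip: power_add)

lemma qnum_eq_0_iff: "generic r \<Longrightarrow> qnum r t = 0 \<longleftrightarrow> t = 0"
  using qh_nonzero[of r] generic_powi_eq_iff[of r t "- t"] by (auto simp: qnum_def)

lemma bco_square: "(bco r s i)\<^sup>2 = qnum r (2 * int s - 2 * int i) * qnum r (2 * int i + 2)"
  by (simp add: bco_def Bcoef_def algebra_simps)

lemma bco_nonzero: "generic r \<Longrightarrow> i < s \<Longrightarrow> bco r s i \<noteq> 0"
  using bco_square[of r s i] by (auto simp: qnum_eq_0_iff)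

lemma bco_top [simp]: "bco r s s = 0"
  using bco_square[of r s s] by (simp add: qnum_def)

definition Dm :: "complex \<Rightarrow> nat \<Rightarrow> complex mat" where
  "Dm r s = dgm (s + 1) (\<lambda>i. r powi (2 * wt s i))"

text \<open>The one-site part of W_0 with free coefficients. The raising part takes the weight at
  the column i + 1, since the factor q^(S_3/2) stands to the right of S_+.\<close>

definition Am :: "complex \<Rightarrow> nat \<Rightarrow> complex \<Rightarrow> complex \<Rightarrow> complex mat" where
  "Am r s a b = upm (s + 1) (\<lambda>i. a * r * bco r s i * r powi wt s (Suc i))
     + dnm (s + 1) (\<lambda>i. b * inverse r * bco r s i * r powi wt s i)"

lemma Splus_eq: "Splus r s = upm (s + 1) (bco r s)"
  by (intro eq_matI) (auto simp: Splus_def mat1_def upm_def bco_def algebra_simps)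

lemma Sminus_eq: "Sminus r s = dnm (s + 1) (bco r s)"
  by (intro eq_matI) (auto simp: Sminus_def mat1_def dnm_def bco_def algebra_simps)

lemma S3_index: "i \<le> s \<Longrightarrow> k \<le> s \<Longrightarrow> S3 s $$ (i, k) = (if i = k then wt s i else 0)"
  by (auto simp: S3_def mat1_def wt_def)

lemma dim_S3 [simp]: "dim_row (S3 s) = s + 1" "dim_col (S3 s) = s + 1"
  by (auto simp: S3_def mat1_def)

lemma qexp_half_S3:
  "qexp_half r (S3 s) = dgm (s + 1) (\<lambda>i. r powi wt s i)"
  "qexp_half r (2 \<cdot>\<^sub>m S3 s) = Dm r s"
  "qexp_half r (- S3 s) = dgm (s + 1) (\<lambda>i. r powi (- wt s i))"
  "qexp_half r (- (2 \<cdot>\<^sub>m S3 s)) = dgm (s + 1) (\<lambda>i. r powi (- (2 * wt s i)))"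
  by (intro eq_matI; auto simp: qexp_half_def dgm_def Dm_def S3_index)+

lemma Am_eq: "Am r s a b = (a * r) \<cdot>\<^sub>m (Splus r s * qexp_half r (S3 s))
   + (b * inverse r) \<cdot>\<^sub>m (Sminus r s * qexp_half r (S3 s))"
  unfolding Am_def Splus_eq Sminus_eq qexp_half_S3
  by (intro eq_matI) (auto simp: mult_band_index band_index simp del: index_mult_mat(1))

lemma dim_Am [simp]: "dim_row (Am r s a b) = s + 1" "dim_col (Am r s a b) = s + 1"
  "dim_row (Dm r s) = s + 1" "dim_col (Dm r s) = s + 1"
  by (auto simp: Am_def Dm_def)

lemma Am_carrier [simp]: "Am r s a b \<in> carrier_mat (s + 1) (s + 1)" "Dm r s \<in> carrier_mat (s + 1) (s + 1)"
  "Am r s a b \<in> carrier_mat (Suc s) (Suc s)" "Dm r s \<in> carrier_mat (Suc s) (Suc s)"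
  by auto

lemma Am_index: "i \<le> s \<Longrightarrow> k \<le> s \<Longrightarrow> Am r s a b $$ (i, k) =
   (if k = Suc i then a * r * bco r s i * r powi wt s k else if i = Suc k then b * inverse r * bco r s k * r powi wt s k else 0)"
  by (auto simp: Am_def band_index)

lemma Dm_index: "i \<le> s \<Longrightarrow> k \<le> s \<Longrightarrow> Dm r s $$ (i, k) = (if i = k then r powi (2 * wt s i) else 0)"
  by (auto simp: Dm_def band_index)

lemma wt_Suc: "wt s (Suc i) = wt s i - 2"
  by (simp add: wt_def)

text \<open>With x = q^(S_3/2) at level i and y = q^i, all powers of r and squared amplitudes become
  rational functions of x, y and r, so that identities between them can be decided by clearing
  denominators. The value y = 1 at i = 0 makes the formula for the amplitude below level i vanish at
  the edge.\<close>

lemma wt_parametrization: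
  assumes r: "r \<noteq> 0" and i: "i \<le> s"
  obtains x y where "x \<noteq> 0" "y \<noteq> 0" "r powi wt s i = x" "\<And>m. r powi (wt s i + m) = x * r powi m"
    "\<And>m. r powi (m + wt s i) = x * r powi m"
    "\<And>m. r powi (m - wt s i) = r powi m / x" "\<And>m. r powi (wt s i - m) = x / r powi m"
    "r powi (- wt s i) = inverse x" "r powi (2 * wt s i) = x\<^sup>2"
    "(bco r s i)\<^sup>2 = (x\<^sup>2 * y - inverse (x\<^sup>2 * y)) * (y * r\<^sup>2 - inverse (y * r\<^sup>2)) / (r\<^sup>2 - inverse (r\<^sup>2))\<^sup>2"
    "i \<ge> 1 \<Longrightarrow> (bco r s (i - 1))\<^sup>2 = (x\<^sup>2 * y * r\<^sup>2 - inverse (x\<^sup>2 * y * r\<^sup>2)) * (y - inverse y) / (r\<^sup>2 - inverse (r\<^sup>2))\<^sup>2"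
    "i = 0 \<Longrightarrow> y = 1"
proof -
  let ?x = "r powi wt s i" and ?y = "r powi (2 * int i)"
  have x2: "r powi (2 * wt s i) = ?x\<^sup>2"
    using r by (simp add: power2_eq_square flip: power_int_add)
  have a: "r powi (2 * int s - 2 * int i) = ?x\<^sup>2 * ?y"
    using r unfolding x2[symmetric] by (simp add: wt_def flip: power_int_add)
  have b: "r powi (2 * int i + 2) = ?y * r\<^sup>2"
    using r by (simp add: power_int_add)
  have c: "r powi (2 * int s - 2 * int i + 2) = ?x\<^sup>2 * ?y * r\<^sup>2"
    using r by (simp add: power_int_add a)
  have sq: "(bco r s i)\<^sup>2 = (?x\<^sup>2 * ?y - inverse (?x\<^sup>2 * ?y)) * (?y * r\<^sup>2 - inverse (?y * r\<^sup>2)) / (r\<^sup>2 - inverse (r\<^sup>2))\<^sup>2"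
    unfolding bco_square qnum_def power_int_minus a b by (simp add: power2_eq_square)
  have sq': "(bco r s (i - 1))\<^sup>2 = (?x\<^sup>2 * ?y * r\<^sup>2 - inverse (?x\<^sup>2 * ?y * r\<^sup>2)) * (?y - inverse ?y) / (r\<^sup>2 - inverse (r\<^sup>2))\<^sup>2"
    if "i \<ge> 1"
  proof -
    have e: "2 * int s - 2 * int (i - 1) = 2 * int s - 2 * int i + 2" "2 * int (i - 1) + 2 = 2 * int i"
      using that by auto
    show ?thesis unfolding bco_square qnum_def power_int_minus e c by (simp add: power2_eq_square)
  qed
  show ?thesis
    by (rule that[OF _ _ refl _ _ _ _ _ x2 sq sq']) (use r in \<open>auto simp: power_int_add power_int_diff power_int_minus mult.commute\<close>)
qed

subsection \<open>The two coproducts\<close>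

text \<open>Coproduct of the generator. Each factor has its own coefficients, because each carries
  its own spectral parameter.\<close>

definition cop :: "complex \<Rightarrow> nat \<Rightarrow> nat \<Rightarrow> complex \<Rightarrow> complex \<Rightarrow> complex \<Rightarrow> complex \<Rightarrow> complex mat" where
  "cop r s t a b c d = Am r s a b \<otimes>\<^sub>k 1\<^sub>m (t + 1) + Dm r s \<otimes>\<^sub>k Am r t c d"

text \<open>The opposite coproduct with the factors left in place: now q^(S_3) sits on the second
  factor.\<close>

definition copop :: "complex \<Rightarrow> nat \<Rightarrow> nat \<Rightarrow> complex \<Rightarrow> complex \<Rightarrow> complex \<Rightarrow> complex \<Rightarrow> complex mat" where
  "copop r s t a b c d = 1\<^sub>m (s + 1) \<otimes>\<^sub>k Am r t c d + Am r s a b \<otimes>\<^sub>k Dm r t"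

lemma dim_cop [simp]:
  "dim_row (cop r s t a b c d) = (s + 1) * (t + 1)" "dim_col (cop r s t a b c d) = (s + 1) * (t + 1)"
  "dim_row (copop r s t a b c d) = (s + 1) * (t + 1)" "dim_col (copop r s t a b c d) = (s + 1) * (t + 1)"
  by (auto simp: cop_def copop_def)

lemma bco_one [simp]: "generic r \<Longrightarrow> bco r (Suc 0) 0 = 1"
proof -
  assume g: "generic r"
  have "qnum r 2 = 1" using qh_nonzero[OF g] by (simp add: qnum_def power_int_minus)
  then show ?thesis by (simp add: bco_def Bcoef_def)
qed

lemma Am_one: "generic r \<Longrightarrow> Am r (Suc 0) a b = mat_of_rows_list 2 [[0, a], [b, 0]]"
  using generic_nonzero[of r]
  by (intro eq_matI) (auto simp: Am_index wt_def less_Suc_eq numeral_2_eq_2 mat_of_rows_list_def power_int_minus)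

lemma Dm_one: "Dm r (Suc 0) = mat_of_rows_list 2 [[r\<^sup>2, 0], [0, inverse (r\<^sup>2)]]"
  by (intro eq_matI) (auto simp: Dm_index wt_def less_Suc_eq numeral_2_eq_2 mat_of_rows_list_def power_int_def)

lemma one_mat2: "1\<^sub>m 2 = mat_of_rows_list 2 [[1, 0], [0, 1]]"
  by (intro eq_matI) (auto simp: less_Suc_eq numeral_2_eq_2 mat_of_rows_list_def)

lemma cop_one: "generic r \<Longrightarrow> cop r (Suc 0) t a b c d =
   four_block_mat (r\<^sup>2 \<cdot>\<^sub>m Am r t c d) (a \<cdot>\<^sub>m 1\<^sub>m (t + 1)) (b \<cdot>\<^sub>m 1\<^sub>m (t + 1)) (inverse (r\<^sup>2) \<cdot>\<^sub>m Am r t c d)"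
  unfolding cop_def Am_one Dm_one kron_mat2
  by (subst add_four_block_mat[of _ "t + 1" "t + 1" _ "t + 1" _ "t + 1"])
     (auto intro!: cong_four_block_mat eq_matI)

lemma copop_one: "generic r \<Longrightarrow> copop r (Suc 0) t a b c d =
   four_block_mat (Am r t c d) (a \<cdot>\<^sub>m Dm r t) (b \<cdot>\<^sub>m Dm r t) (Am r t c d)"
proof -
  assume g: "generic r"
  have 1: "1\<^sub>m (Suc 0 + 1) = mat_of_rows_list 2 [[1, 0], [0, 1 :: complex]]"
    using one_mat2 by (simp add: numeral_2_eq_2)
  show ?thesis
    unfolding copop_def Am_one[OF g] 1 kron_mat2
    by (subst add_four_block_mat[of _ "t + 1" "t + 1" _ "t + 1" _ "t + 1"])
       (auto intro!: cong_four_block_mat eq_matI)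
qed

subsection \<open>The R-matrix of spins one half and s/2\<close>

lemma smult_band: "c \<cdot>\<^sub>m upm n f = upm n (\<lambda>i. c * f i)" "c \<cdot>\<^sub>m dnm n f = dnm n (\<lambda>i. c * f i)"
  "c \<cdot>\<^sub>m dgm n f = dgm n (\<lambda>i. c * f i)" "c \<cdot>\<^sub>m 1\<^sub>m n = dgm n (\<lambda>i. c)"
  by (intro eq_matI; auto simp: band_index)+

definition qh :: "complex \<Rightarrow> complex" where "qh r = r\<^sup>2 - inverse (r\<^sup>2)"

text \<open>Eigenvalues of q^(S_3/2).\<close>

definition pw :: "complex \<Rightarrow> nat \<Rightarrow> nat \<Rightarrow> complex" where "pw r s i = r powi wt s i"

lemma pw_nonzero: "r \<noteq> 0 \<Longrightarrow> pw r s i \<noteq> 0"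
  by (simp add: pw_def)

lemma pw_Suc: "r \<noteq> 0 \<Longrightarrow> pw r s (Suc i) = pw r s i * inverse (r\<^sup>2)"
  by (simp add: pw_def wt_Suc power_int_diff divide_inverse)

lemma Am_pw: "Am r s a b = upm (s + 1) (\<lambda>i. a * r * bco r s i * pw r s (Suc i))
     + dnm (s + 1) (\<lambda>i. b * inverse r * bco r s i * pw r s i)"
  by (simp add: Am_def pw_def)

lemma Dm_pw: "Dm r s = dgm (s + 1) (\<lambda>i. pw r s i * pw r s i)"
proof -
  have "r powi (2 * wt s i) = pw r s i * pw r s i" for i
    unfolding pw_def by (metis mult.commute power_int_mult power2_eq_square power_int_numeral)
  then show ?thesis by (simp add: Dm_def)
qed

text \<open>The R-matrix of spins 1/2 and s/2 without its scalar product of c-factors, in blocks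
  with respect to the spin 1/2.\<close>

definition rcore :: "complex \<Rightarrow> nat \<Rightarrow> complex \<Rightarrow> complex mat" where
  "rcore r s u = four_block_mat
     (dgm (s + 1) (\<lambda>i. u * r * pw r s i - inverse (u * r * pw r s i)))
     (dnm (s + 1) (\<lambda>i. qh r * bco r s i)) (upm (s + 1) (\<lambda>i. qh r * bco r s i))
     (dgm (s + 1) (\<lambda>i. u * r * inverse (pw r s i) - inverse (u * r) * pw r s i))"

lemma dim_rcore [simp]: "dim_row (rcore r s u) = 2 * (s + 1)" "dim_col (rcore r s u) = 2 * (s + 1)"
  by (auto simp: rcore_def)

definition rpref :: "complex \<Rightarrow> nat \<Rightarrow> complex \<Rightarrow> complex" where
  "rpref r s u = (\<Prod>k<s - 1. cfun (u * r powi (int s - 1 - 2 * int k)))"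

lemma Rhalf_eq:
  assumes s: "s \<ge> 1" and r: "r \<noteq> 0"
  shows "Rhalf r s u = rpref r s u \<cdot>\<^sub>m rcore r s u"
proof -
  let ?D = "1\<^sub>m (2 * (s + 1)) + sigma_z \<otimes>\<^sub>k S3 s"
  have D: "?D $$ (i, i) = (if i < s + 1 then 1 + wt s i else 1 - wt s (i - (s + 1)))" if "i < 2 * (s + 1)" for i
    using that by (auto simp: sigma_z_def kron_mat2 S3_index)
  have dD: "dim_row ?D = 2 * (s + 1)" "dim_col ?D = 2 * (s + 1)"
    by (simp_all add: sigma_z_def mat_of_rows_list_def)
  have "(r\<^sup>2 - inverse (r\<^sup>2)) \<cdot>\<^sub>m (sigma_plus \<otimes>\<^sub>k Sminus r s + sigma_minus \<otimes>\<^sub>k Splus r s)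
           + u \<cdot>\<^sub>m qexp_half r ?D - inverse u \<cdot>\<^sub>m qexp_half r (- ?D) = rcore r s u" (is "?S + u \<cdot>\<^sub>m ?E - inverse u \<cdot>\<^sub>m ?F = _")
  proof -
    have E: "?E = four_block_mat (dgm (s + 1) (\<lambda>i. r powi (1 + wt s i))) (0\<^sub>m (s + 1) (s + 1)) (0\<^sub>m (s + 1) (s + 1))
        (dgm (s + 1) (\<lambda>i. r powi (1 - wt s i)))"
      using D by (intro eq_matI) (auto simp: qexp_half_def band_index sigma_z_def mat_of_rows_list_def)
    have F: "?F = four_block_mat (dgm (s + 1) (\<lambda>i. r powi (- (1 + wt s i)))) (0\<^sub>m (s + 1) (s + 1)) (0\<^sub>m (s + 1) (s + 1))
        (dgm (s + 1) (\<lambda>i. r powi (- (1 - wt s i))))"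
    proof (rule eq_matI, goal_cases)
      case (1 i k)
      then have ik: "i < 2 * (s + 1)" "k < 2 * (s + 1)" by auto
      have "?F $$ (i, k) = (if i = k then r powi (- (?D $$ (i, i))) else 0)"
        using ik by (simp add: qexp_half_def sigma_z_def mat_of_rows_list_def)
      then show ?case using ik unfolding D[OF ik(1)]
        by (cases "i = k") (auto simp: band_index)
    qed (auto simp: qexp_half_def sigma_z_def mat_of_rows_list_def)
    have S: "?S = four_block_mat (0\<^sub>m (s + 1) (s + 1)) (dnm (s + 1) (\<lambda>i. qh r * bco r s i))
       (upm (s + 1) (\<lambda>i. qh r * bco r s i)) (0\<^sub>m (s + 1) (s + 1))"
      unfolding sigma_plus_def sigma_minus_def kron_mat2 Sminus_eq Splus_eq
      by (rule eq_matI) (auto simp: band_index qh_def)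
    have pw: "r powi (1 + wt s i) = r * pw r s i" "r powi (1 - wt s i) = r * inverse (pw r s i)"
      "r powi (- (1 + wt s i)) = inverse (r * pw r s i)" "r powi (- (1 - wt s i)) = inverse r * pw r s i" for i
      unfolding pw_def power_int_minus using r by (simp_all add: power_int_add power_int_diff field_simps)
    show ?thesis
      unfolding S E F pw rcore_def
      by (rule eq_matI) (auto simp: band_index algebra_simps)
  qed
  with s show ?thesis
    unfolding Rhalf_def rpref_def Let_def by simp
qed

text \<open>The commutator of S_+ and S_- in components: it equals (q^(S_3) - q^(-S_3))/(q - 1/q).
  The case distinction puts a zero amplitude below level 0.\<close>

lemma bco_diff:
  assumes g: "generic r" and i: "i \<le> s"
  shows "qh r * (bco r s i * bco r s i - (if i = 0 then 0 else bco r s (i - 1) * bco r s (i - 1))) =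
    pw r s i * pw r s i - inverse (pw r s i * pw r s i)"
proof -
  have r: "r \<noteq> 0" using g by (rule generic_nonzero)
  have h: "r\<^sup>2 - inverse (r\<^sup>2) \<noteq> 0" using qh_nonzero[OF g] .
  obtain x y where xy: "x \<noteq> 0" "y \<noteq> 0" "r powi wt s i = x"
    and b: "(bco r s i)\<^sup>2 = (x\<^sup>2 * y - inverse (x\<^sup>2 * y)) * (y * r\<^sup>2 - inverse (y * r\<^sup>2)) / (r\<^sup>2 - inverse (r\<^sup>2))\<^sup>2"
    and b': "i \<ge> 1 \<Longrightarrow> (bco r s (i - 1))\<^sup>2 = (x\<^sup>2 * y * r\<^sup>2 - inverse (x\<^sup>2 * y * r\<^sup>2)) * (y - inverse y) / (r\<^sup>2 - inverse (r\<^sup>2))\<^sup>2"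
    and y: "i = 0 \<Longrightarrow> y = 1"
    by (rule wt_parametrization[OF r i]) blast
  have c: "(if i = 0 then 0 else (bco r s (i - 1))\<^sup>2) =
      (x\<^sup>2 * y * r\<^sup>2 - inverse (x\<^sup>2 * y * r\<^sup>2)) * (y - inverse y) / (r\<^sup>2 - inverse (r\<^sup>2))\<^sup>2"
    using b' y by (cases "i = 0") auto
  have *: "(p * y - inverse (p * y)) * (y * q - inverse (y * q)) -
      (p * y * q - inverse (p * y * q)) * (y - inverse y) = (q - inverse q) * (p - inverse p)"
    if "p \<noteq> 0" "q \<noteq> 0" for p q
    using that xy by (simp add: field_simps)
  have n: "(x\<^sup>2 * y - inverse (x\<^sup>2 * y)) * (y * r\<^sup>2 - inverse (y * r\<^sup>2)) -
      (x\<^sup>2 * y * r\<^sup>2 - inverse (x\<^sup>2 * y * r\<^sup>2)) * (y - inverse y) = (r\<^sup>2 - inverse (r\<^sup>2)) * (x\<^sup>2 - inverse (x\<^sup>2))"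
    by (rule *) (use xy r in auto)
  have "qh r * (((x\<^sup>2 * y - inverse (x\<^sup>2 * y)) * (y * r\<^sup>2 - inverse (y * r\<^sup>2)) -
      (x\<^sup>2 * y * r\<^sup>2 - inverse (x\<^sup>2 * y * r\<^sup>2)) * (y - inverse y)) / (r\<^sup>2 - inverse (r\<^sup>2))\<^sup>2) = x\<^sup>2 - inverse (x\<^sup>2)"
    unfolding n qh_def using h by (simp add: power2_eq_square)
  then have "qh r * ((bco r s i)\<^sup>2 - (if i = 0 then 0 else (bco r s (i - 1))\<^sup>2)) = x\<^sup>2 - inverse (x\<^sup>2)"
    unfolding b c diff_divide_distrib .
  then show ?thesis
    by (cases "i = 0") (simp_all add: pw_def xy(3)[symmetric] power2_eq_square)
qed

text \<open>A product of two band matrices lives on the five central diagonals; these are compared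
  by formulas, and all other entries together.\<close>

lemma mat_eq_bandI:
  fixes M N :: "complex mat"
  assumes "dim_row M = Suc s" "dim_col M = Suc s" "dim_row N = Suc s" "dim_col N = Suc s"
    and "\<And>i. i \<le> s \<Longrightarrow> M $$ (i, i) = N $$ (i, i)"
    and "\<And>i. i < s \<Longrightarrow> M $$ (i, Suc i) = N $$ (i, Suc i)"
    and "\<And>i. i < s \<Longrightarrow> M $$ (Suc i, i) = N $$ (Suc i, i)"
    and "\<And>i. Suc i < s \<Longrightarrow> M $$ (i, Suc (Suc i)) = N $$ (i, Suc (Suc i))"
    and "\<And>i. Suc i < s \<Longrightarrow> M $$ (Suc (Suc i), i) = N $$ (Suc (Suc i), i)"
    and "\<And>i k. i \<le> s \<Longrightarrow> k \<le> s \<Longrightarrow> i \<noteq> k \<Longrightarrow> k \<noteq> Suc i \<Longrightarrow> i \<noteq> Suc k \<Longrightarrow> k \<noteq> Suc (Suc i) \<Longrightarrow> i \<noteq> Suc (Suc k) \<Longrightarrow> M $$ (i, k) = N $$ (i, k)"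
  shows "M = N"
proof (rule eq_matI)
  fix i k assume "i < dim_row N" "k < dim_col N"
  then have "i \<le> s" "k \<le> s" using assms by auto
  then show "M $$ (i, k) = N $$ (i, k)"
    using assms(5)[of i] assms(6)[of i] assms(7)[of k] assms(8)[of i] assms(9)[of k] assms(10)[of i k]
    by (metis Suc_le_eq)
qed (use assms in auto)

text \<open>The block equations behind the two intertwining relations of \<open>rcore\<close>: the
  first four for the passage from the coproduct to its opposite, the last four for the reverse. The
  commutator of S_+ and S_- enters only on the diagonals of the second, third, sixth and
  seventh.\<close>

lemma rcore_blocks:
  fixes r u a b :: complex and s :: nat
  assumes g: "generic r" and u: "u \<noteq> 0"
  defines "X \<equiv> dgm (s + 1) (\<lambda>i. u * r * pw r s i - inverse (u * r * pw r s i))"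
    and "Y \<equiv> dgm (s + 1) (\<lambda>i. u * r * inverse (pw r s i) - inverse (u * r) * pw r s i)"
    and "P \<equiv> upm (s + 1) (\<lambda>i. qh r * bco r s i)" and "M \<equiv> dnm (s + 1) (\<lambda>i. qh r * bco r s i)"
    and "A \<equiv> Am r s a b" and "E \<equiv> Dm r s" and "I \<equiv> 1\<^sub>m (s + 1) :: complex mat"
  shows
    "X * (r\<^sup>2 \<cdot>\<^sub>m A) + M * ((b * inverse u) \<cdot>\<^sub>m I) = A * X + ((u * a) \<cdot>\<^sub>m E) * P" (is ?g1)
    "X * ((u * a) \<cdot>\<^sub>m I) + M * (inverse (r\<^sup>2) \<cdot>\<^sub>m A) = A * M + ((u * a) \<cdot>\<^sub>m E) * Y" (is ?g2)
    "P * (r\<^sup>2 \<cdot>\<^sub>m A) + Y * ((b * inverse u) \<cdot>\<^sub>m I) = ((b * inverse u) \<cdot>\<^sub>m E) * X + A * P" (is ?g3)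
    "P * ((u * a) \<cdot>\<^sub>m I) + Y * (inverse (r\<^sup>2) \<cdot>\<^sub>m A) = ((b * inverse u) \<cdot>\<^sub>m E) * M + A * Y" (is ?g4)
    "X * A + M * ((b * u) \<cdot>\<^sub>m E) = (r\<^sup>2 \<cdot>\<^sub>m A) * X + ((a * inverse u) \<cdot>\<^sub>m I) * P" (is ?g5)
    "X * ((a * inverse u) \<cdot>\<^sub>m E) + M * A = (r\<^sup>2 \<cdot>\<^sub>m A) * M + ((a * inverse u) \<cdot>\<^sub>m I) * Y" (is ?g6)
    "P * A + Y * ((b * u) \<cdot>\<^sub>m E) = ((b * u) \<cdot>\<^sub>m I) * X + (inverse (r\<^sup>2) \<cdot>\<^sub>m A) * P" (is ?g7)
    "P * ((a * inverse u) \<cdot>\<^sub>m E) + Y * A = ((b * u) \<cdot>\<^sub>m I) * M + (inverse (r\<^sup>2) \<cdot>\<^sub>m A) * Y" (is ?g8)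
proof -
  have r: "r \<noteq> 0" using g by (rule generic_nonzero)
  have x0: "pw r s i \<noteq> 0" for i using r by (rule pw_nonzero)
  note Sx = pw_Suc[OF r, of s]
  have Ai: "A $$ (i, k) = (if k = Suc i then a * r * bco r s i * pw r s k else if i = Suc k then b * inverse r * bco r s k * pw r s k else 0)"
    if "i \<le> s" "k \<le> s" for i k using that by (simp add: A_def Am_index pw_def)
  have dA: "dim_row A = Suc s" "dim_col A = Suc s" by (simp_all add: A_def)
  have B: "(C * upm n f) $$ (i, 0) = 0" "(C * upm n f) $$ (i, Suc k) = C $$ (i, k) * f k"
    if "i < dim_row C" "dim_col C = n" "Suc k < n" for C n f i k
    using that by (simp_all add: mult_band_index del: index_mult_mat(1))
  have B': "(dnm n f * C) $$ (0, k) = 0" "(dnm n f * C) $$ (Suc i, k) = f i * C $$ (i, k)"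
    if "k < dim_col C" "dim_row C = n" "Suc i < n" for C n f i k
    using that by (simp_all add: band_mult_index del: index_mult_mat(1))
  have B0: "(C * upm n f) $$ (i, 0) = 0" if "i < dim_row C" "dim_col C = n" "0 < n" for C n f i
    using that by (simp_all add: mult_band_index del: index_mult_mat(1))
  have B0': "(dnm n f * C) $$ (0, k) = 0" if "k < dim_col C" "dim_row C = n" "0 < n" for C n f k
    using that by (simp_all add: band_mult_index del: index_mult_mat(1))
  note idx = X_def Y_def P_def M_def E_def I_def Dm_pw smult_band mult_band_index(2,3) band_mult_index(1,3) B(2) B'(2) B0 B0' band_index Ai dA Sx
  note fs = field_simps power2_eq_square
  have comm: "qh r * (bco r s i * bco r s i) = pw r s i * pw r s i - inverse (pw r s i * pw r s i) + (if i = 0 then 0 else qh r * (bco r s (i - 1) * bco r s (i - 1)))"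
    if "i \<le> s" for i using bco_diff[OF g that] by (auto simp: algebra_simps)
  have top: "i < s \<or> bco r s i = 0" if "i \<le> s" for i using that by (cases "i = s") auto
  have pm: "i \<noteq> 0 \<Longrightarrow> pw r s (i - 1) = pw r s i * r\<^sup>2" for i using Sx[of "i - 1"] r by (cases i) simp_all
  \<comment> \<open>The four critical diagonals with entries abstracted to scalars: x and y are the
    weight factors at i and i - 1, d and c the amplitudes at i and i - 1, and h is q - 1/q.\<close>
  have diag:
   "(u * r * x - inverse (u * r * x)) * (u * a) + (if i = 0 then 0 else h * c * (inverse (r\<^sup>2) * (a * r * c * x)))
      = (if i < s then a * r * d * (x * inverse (r\<^sup>2)) * (h * d) else 0) + u * a * (x * x) * (u * r * inverse x - inverse (u * r) * x)" (is ?d2)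
   "(if i < s then h * d * (r\<^sup>2 * (b * inverse r * d * x)) else 0) + (u * r * inverse x - inverse (u * r) * x) * (b * inverse u)
      = b * inverse u * (x * x) * (u * r * x - inverse (u * r * x)) + (if i = 0 then 0 else b * inverse r * c * y * (h * c))" (is ?d3)
   "(u * r * x - inverse (u * r * x)) * (a * inverse u * (x * x)) + (if i = 0 then 0 else h * c * (a * r * c * x))
      = (if i < s then r\<^sup>2 * (a * r * d * (x * inverse (r\<^sup>2))) * (h * d) else 0) + a * inverse u * (u * r * inverse x - inverse (u * r) * x)" (is ?d6)
   "(if i < s then h * d * (b * inverse r * d * x) else 0) + (u * r * inverse x - inverse (u * r) * x) * (b * u * (x * x))
      = b * u * (u * r * x - inverse (u * r * x)) + (if i = 0 then 0 else inverse (r\<^sup>2) * (b * inverse r * c * y) * (h * c))" (is ?d7)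
    if x: "x \<noteq> 0" and h: "h * (d * d) = x * x - inverse (x * x) + (if i = 0 then 0 else h * (c * c))" and t: "i < s \<or> d = 0"
      and y: "i \<noteq> 0 \<Longrightarrow> y = x * r\<^sup>2"
    for x y h c d :: complex and i s :: nat
  proof -
    have e: "(if i < s then e * (h * (d * d)) else 0) = e * (h * (d * d))" for e
      using t by auto
    have e': "(if i = 0 then 0 else e * (h * (c * c))) = e * (if i = 0 then 0 else h * (c * c))" for e
      by auto
    have l: "h * c * (inverse (r\<^sup>2) * (a * r * c * x)) = a * x * inverse r * (h * (c * c))"
      "a * r * d * (x * inverse (r\<^sup>2)) * (h * d) = a * x * inverse r * (h * (d * d))"
      "h * d * (r\<^sup>2 * (b * inverse r * d * x)) = b * x * r * (h * (d * d))"
      "h * c * (a * r * c * x) = a * x * r * (h * (c * c))"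
      "r\<^sup>2 * (a * r * d * (x * inverse (r\<^sup>2))) * (h * d) = a * x * r * (h * (d * d))"
      "h * d * (b * inverse r * d * x) = b * x * inverse r * (h * (d * d))"
      using r by (simp_all add: fs)
    have l': "(if i = 0 then 0 else b * inverse r * c * y * (h * c)) = (if i = 0 then 0 else b * x * r * (h * (c * c)))"
      "(if i = 0 then 0 else inverse (r\<^sup>2) * (b * inverse r * c * y) * (h * c)) = (if i = 0 then 0 else b * x * inverse r * (h * (c * c)))"
      using r y by (simp_all add: fs)
    show ?d2 ?d3 ?d6 ?d7
      unfolding l l'
      unfolding e e'
      unfolding h using x r u by (simp_all add: fs)
  qed
  note Dg = diag[OF x0 comm top pm]
  show ?g1
  proof (rule mat_eq_bandI[where s = s], goal_cases)
    case (5 i)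
    then show ?case by (cases i) (simp_all add: idx del: index_mult_mat(1))
  next
    case (6 i)
    then show ?case by (cases i) (simp_all add: idx del: index_mult_mat(1), (use x0 r u in \<open>simp_all add: fs qh_def\<close>)?)
  next
    case (7 i)
    then show ?case by (cases i) (simp_all add: idx del: index_mult_mat(1), (use x0 r u in \<open>simp_all add: fs qh_def\<close>)?)
  next
    case (8 i)
    then show ?case by (cases i) (simp_all add: idx del: index_mult_mat(1), (use x0 r u in \<open>simp_all add: fs qh_def\<close>)?)
  next
    case (9 i)
    then show ?case by (cases i) (simp_all add: idx del: index_mult_mat(1), (use x0 r u in \<open>simp_all add: fs qh_def\<close>)?)
  next
    case (10 i k)
    then show ?case by (cases i; cases k) (simp_all add: idx del: index_mult_mat(1))
  qed (simp_all add: idx)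
  show ?g2
  proof (rule mat_eq_bandI[where s = s], goal_cases)
    case (5 i)
    show ?case
    proof (cases i)
      case 0
      then show ?thesis using Dg(1)[OF 5 5] by (cases "i < s") (simp_all add: idx del: index_mult_mat(1))
    next
      case (Suc j)
      have le: "Suc j \<le> s" using 5 Suc by simp
      have lt: "j < s" "Suc j < Suc s" "j < Suc s" "j \<le> s" using le by simp_all
      show ?thesis unfolding Suc using Dg(1)[OF le le]
        by (cases "Suc j < s") (simp_all add: idx le lt del: index_mult_mat(1))
    qed
  next
    case (6 i)
    then show ?case by (cases i) (simp_all add: idx del: index_mult_mat(1), (use x0 r u in \<open>simp_all add: fs qh_def\<close>)?)
  next
    case (7 i)
    then show ?case by (cases i) (simp_all add: idx del: index_mult_mat(1), (use x0 r u in \<open>simp_all add: fs qh_def\<close>)?)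
  next
    case (8 i)
    then show ?case by (cases i) (simp_all add: idx del: index_mult_mat(1), (use x0 r u in \<open>simp_all add: fs qh_def\<close>)?)
  next
    case (9 i)
    then show ?case by (cases i) (simp_all add: idx del: index_mult_mat(1), (use x0 r u in \<open>simp_all add: fs qh_def\<close>)?)
  next
    case (10 i k)
    then show ?case by (cases i; cases k) (simp_all add: idx del: index_mult_mat(1))
  qed (simp_all add: idx)
  show ?g3
  proof (rule mat_eq_bandI[where s = s], goal_cases)
    case (5 i)
    show ?case
    proof (cases i)
      case 0
      then show ?thesis using Dg(2)[OF 5 5] by (cases "i < s") (simp_all add: idx del: index_mult_mat(1))
    next
      case (Suc j)
      have le: "Suc j \<le> s" using 5 Suc by simp
      have lt: "j < s" "Suc j < Suc s" "j < Suc s" "j \<le> s" using le by simp_all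
      show ?thesis unfolding Suc using Dg(2)[OF le le]
        by (cases "Suc j < s") (simp_all add: idx le lt del: index_mult_mat(1))
    qed
  next
    case (6 i)
    then show ?case by (cases i) (simp_all add: idx del: index_mult_mat(1), (use x0 r u in \<open>simp_all add: fs qh_def\<close>)?)
  next
    case (7 i)
    then show ?case by (cases i) (simp_all add: idx del: index_mult_mat(1), (use x0 r u in \<open>simp_all add: fs qh_def\<close>)?)
  next
    case (8 i)
    then show ?case by (cases i) (simp_all add: idx del: index_mult_mat(1), (use x0 r u in \<open>simp_all add: fs qh_def\<close>)?)
  next
    case (9 i)
    then show ?case by (cases i) (simp_all add: idx del: index_mult_mat(1), (use x0 r u in \<open>simp_all add: fs qh_def\<close>)?)
  next
    case (10 i k)
    then show ?case by (cases i; cases k) (simp_all add: idx del: index_mult_mat(1))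
  qed (simp_all add: idx)
  show ?g4
  proof (rule mat_eq_bandI[where s = s], goal_cases)
    case (5 i)
    then show ?case by (cases i) (simp_all add: idx del: index_mult_mat(1))
  next
    case (6 i)
    then show ?case by (cases i) (simp_all add: idx del: index_mult_mat(1), (use x0 r u in \<open>simp_all add: fs qh_def\<close>)?)
  next
    case (7 i)
    then show ?case by (cases i) (simp_all add: idx del: index_mult_mat(1), (use x0 r u in \<open>simp_all add: fs qh_def\<close>)?)
  next
    case (8 i)
    then show ?case by (cases i) (simp_all add: idx del: index_mult_mat(1), (use x0 r u in \<open>simp_all add: fs qh_def\<close>)?)
  next
    case (9 i)
    then show ?case by (cases i) (simp_all add: idx del: index_mult_mat(1), (use x0 r u in \<open>simp_all add: fs qh_def\<close>)?)
  next
    case (10 i k)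
    then show ?case by (cases i; cases k) (simp_all add: idx del: index_mult_mat(1))
  qed (simp_all add: idx)
  show ?g5
  proof (rule mat_eq_bandI[where s = s], goal_cases)
    case (5 i)
    then show ?case by (cases i) (simp_all add: idx del: index_mult_mat(1))
  next
    case (6 i)
    then show ?case by (cases i) (simp_all add: idx del: index_mult_mat(1), (use x0 r u in \<open>simp_all add: fs qh_def\<close>)?)
  next
    case (7 i)
    then show ?case by (cases i) (simp_all add: idx del: index_mult_mat(1), (use x0 r u in \<open>simp_all add: fs qh_def\<close>)?)
  next
    case (8 i)
    then show ?case by (cases i) (simp_all add: idx del: index_mult_mat(1), (use x0 r u in \<open>simp_all add: fs qh_def\<close>)?)
  next
    case (9 i)
    then show ?case by (cases i) (simp_all add: idx del: index_mult_mat(1), (use x0 r u in \<open>simp_all add: fs qh_def\<close>)?)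
  next
    case (10 i k)
    then show ?case by (cases i; cases k) (simp_all add: idx del: index_mult_mat(1))
  qed (simp_all add: idx)
  show ?g6
  proof (rule mat_eq_bandI[where s = s], goal_cases)
    case (5 i)
    show ?case
    proof (cases i)
      case 0
      then show ?thesis using Dg(3)[OF 5 5] by (cases "i < s") (simp_all add: idx del: index_mult_mat(1))
    next
      case (Suc j)
      have le: "Suc j \<le> s" using 5 Suc by simp
      have lt: "j < s" "Suc j < Suc s" "j < Suc s" "j \<le> s" using le by simp_all
      show ?thesis unfolding Suc using Dg(3)[OF le le]
        by (cases "Suc j < s") (simp_all add: idx le lt del: index_mult_mat(1))
    qed
  next
    case (6 i)
    then show ?case by (cases i) (simp_all add: idx del: index_mult_mat(1), (use x0 r u in \<open>simp_all add: fs qh_def\<close>)?)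
  next
    case (7 i)
    then show ?case by (cases i) (simp_all add: idx del: index_mult_mat(1), (use x0 r u in \<open>simp_all add: fs qh_def\<close>)?)
  next
    case (8 i)
    then show ?case by (cases i) (simp_all add: idx del: index_mult_mat(1), (use x0 r u in \<open>simp_all add: fs qh_def\<close>)?)
  next
    case (9 i)
    then show ?case by (cases i) (simp_all add: idx del: index_mult_mat(1), (use x0 r u in \<open>simp_all add: fs qh_def\<close>)?)
  next
    case (10 i k)
    then show ?case by (cases i; cases k) (simp_all add: idx del: index_mult_mat(1))
  qed (simp_all add: idx)
  show ?g7
  proof (rule mat_eq_bandI[where s = s], goal_cases)
    case (5 i)
    show ?case
    proof (cases i)
      case 0
      then show ?thesis using Dg(4)[OF 5 5] by (cases "i < s") (simp_all add: idx del: index_mult_mat(1))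
    next
      case (Suc j)
      have le: "Suc j \<le> s" using 5 Suc by simp
      have lt: "j < s" "Suc j < Suc s" "j < Suc s" "j \<le> s" using le by simp_all
      show ?thesis unfolding Suc using Dg(4)[OF le le]
        by (cases "Suc j < s") (simp_all add: idx le lt del: index_mult_mat(1))
    qed
  next
    case (6 i)
    then show ?case by (cases i) (simp_all add: idx del: index_mult_mat(1), (use x0 r u in \<open>simp_all add: fs qh_def\<close>)?)
  next
    case (7 i)
    then show ?case by (cases i) (simp_all add: idx del: index_mult_mat(1), (use x0 r u in \<open>simp_all add: fs qh_def\<close>)?)
  next
    case (8 i)
    then show ?case by (cases i) (simp_all add: idx del: index_mult_mat(1), (use x0 r u in \<open>simp_all add: fs qh_def\<close>)?)
  next
    case (9 i)
    then show ?case by (cases i) (simp_all add: idx del: index_mult_mat(1), (use x0 r u in \<open>simp_all add: fs qh_def\<close>)?)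
  next
    case (10 i k)
    then show ?case by (cases i; cases k) (simp_all add: idx del: index_mult_mat(1))
  qed (simp_all add: idx)
  show ?g8
  proof (rule mat_eq_bandI[where s = s], goal_cases)
    case (5 i)
    then show ?case by (cases i) (simp_all add: idx del: index_mult_mat(1))
  next
    case (6 i)
    then show ?case by (cases i) (simp_all add: idx del: index_mult_mat(1), (use x0 r u in \<open>simp_all add: fs qh_def\<close>)?)
  next
    case (7 i)
    then show ?case by (cases i) (simp_all add: idx del: index_mult_mat(1), (use x0 r u in \<open>simp_all add: fs qh_def\<close>)?)
  next
    case (8 i)
    then show ?case by (cases i) (simp_all add: idx del: index_mult_mat(1), (use x0 r u in \<open>simp_all add: fs qh_def\<close>)?)
  next
    case (9 i)
    then show ?case by (cases i) (simp_all add: idx del: index_mult_mat(1), (use x0 r u in \<open>simp_all add: fs qh_def\<close>)?)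
  next
    case (10 i k)
    then show ?case by (cases i; cases k) (simp_all add: idx del: index_mult_mat(1))
  qed (simp_all add: idx)
qed

lemma mult_four_block_sq:
  fixes A B C D :: "'a::semiring_1 mat"
  assumes "A \<in> carrier_mat n n" "B \<in> carrier_mat n n" "C \<in> carrier_mat n n" "D \<in> carrier_mat n n"
    "A' \<in> carrier_mat n n" "B' \<in> carrier_mat n n" "C' \<in> carrier_mat n n" "D' \<in> carrier_mat n n"
  shows "four_block_mat A B C D * four_block_mat A' B' C' D' =
    four_block_mat (A * A' + B * C') (A * B' + B * D') (C * A' + D * C') (C * B' + D * D')"
  by (rule mult_four_block_mat[OF assms])

text \<open>The coefficients on the spin 1/2 differ from those on the other factor by u and 1/u, so
  u is the ratio of the two spectral parameters. Reversing the direction between the coproducts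
  inverts this ratio.\<close>

lemma rcore_intertwines:
  assumes g: "generic r" and u: "u \<noteq> 0"
  shows "rcore r s u * cop r (Suc 0) s (u * a) (b * inverse u) a b = copop r (Suc 0) s (u * a) (b * inverse u) a b * rcore r s u"
    "rcore r s u * copop r (Suc 0) s (a * inverse u) (b * u) a b = cop r (Suc 0) s (a * inverse u) (b * u) a b * rcore r s u"
proof -
  note B = rcore_blocks[OF g u, where s = s and a = a and b = b]
  note M = mult_four_block_sq[where n = "s + 1"] band_carrier smult_carrier_mat Am_carrier one_carrier_mat
  show "rcore r s u * cop r (Suc 0) s (u * a) (b * inverse u) a b = copop r (Suc 0) s (u * a) (b * inverse u) a b * rcore r s u"
    unfolding rcore_def cop_one[OF g] copop_one[OF g] by (simp only: M B(1-4))
  show "rcore r s u * copop r (Suc 0) s (a * inverse u) (b * u) a b = cop r (Suc 0) s (a * inverse u) (b * u) a b * rcore r s u"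
    unfolding rcore_def cop_one[OF g] copop_one[OF g] by (simp only: M B(5-8))
qed

lemma Dm_one_kron: "Dm r (Suc 0) \<otimes>\<^sub>k Dm r t = dgm (2 * (t + 1))
    (\<lambda>k. if k < t + 1 then r\<^sup>2 * (pw r t k * pw r t k) else inverse (r\<^sup>2) * (pw r t (k - (t + 1)) * pw r t (k - (t + 1))))"
  unfolding Dm_one kron_mat2 unfolding Dm_pw smult_band
  by (rule eq_matI) (auto simp: band_index)

lemma rcore_weight:
  assumes r: "r \<noteq> 0"
  shows "rcore r s u * (Dm r (Suc 0) \<otimes>\<^sub>k Dm r s) = (Dm r (Suc 0) \<otimes>\<^sub>k Dm r s) * rcore r s u"
proof -
  have S: "pw r s (Suc i) = pw r s i * inverse (r\<^sup>2)" for i using pw_Suc[OF r] .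
  show ?thesis
    unfolding Dm_one_kron
  proof (rule eq_matI, goal_cases)
    case (1 i k)
    then have "i < 2 * (s + 1)" "k < 2 * (s + 1)" by simp_all
    then show ?case using r
      by (cases "i < s + 1"; cases "k < s + 1")
         (simp_all add: mult_band_index(3) band_mult_index(3) rcore_def band_index S field_simps power2_eq_square del: index_mult_mat(1))
  qed simp_all
qed

text \<open>The highest weight vector is alone in its weight space, so it is only rescaled.\<close>

lemma rcore_column_0: "0 < i \<Longrightarrow> i < 2 * (s + 1) \<Longrightarrow> rcore r s u $$ (i, 0) = 0"
  by (auto simp: rcore_def band_index)

subsection \<open>Fusion maps\<close>

text \<open>0-based column numbers: \<open>fg r s k\<close> and \<open>fl r s k\<close> are the
  entries of column k of \<E> in the upper and lower block. Only the first needs a shift, since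
  \<open>fus_low\<close> is already numbered by the column minus one.\<close>

definition fg :: "complex \<Rightarrow> nat \<Rightarrow> nat \<Rightarrow> complex" where "fg r s k = fus_diag r s (Suc k)"
definition fl :: "complex \<Rightarrow> nat \<Rightarrow> nat \<Rightarrow> complex" where "fl r s k = fus_low r s k"

lemma fg_0 [simp]: "fg r s 0 = 1"
  by (simp add: fg_def fus_diag_def)

lemma fg_Suc: "generic r \<Longrightarrow> k < s \<Longrightarrow> fg r s (Suc k) * bco r s k = fg r s k * bco r (s - 1) k"
  using bco_nonzero[of r k s] by (auto simp: fg_def fus_diag_def bco_def of_nat_diff)

lemma fl_Suc: "generic r \<Longrightarrow> k < s \<Longrightarrow> fl r s (Suc k) * bco r s k = qnum r (2 * int k + 2) * fg r s k"
  using bco_nonzero[of r k s] by (auto simp: fg_def fl_def fus_low_def bco_def algebra_simps)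

lemma fg_nonzero: "generic r \<Longrightarrow> k < s \<Longrightarrow> fg r s k \<noteq> 0"
proof (induction k)
  case (Suc k)
  then have "fg r s (Suc k) * bco r s k \<noteq> 0"
    using fg_Suc[of r k s] bco_nonzero[of r k "s - 1"] by auto
  then show ?case by auto
qed auto

lemma fl_nonzero: "generic r \<Longrightarrow> k < s \<Longrightarrow> fl r s (Suc k) \<noteq> 0"
  using fl_Suc[of r k s] fg_nonzero[of r k s] qnum_eq_0_iff[of r "2 * int k + 2"] by auto

lemma dim_Emap [simp]: "dim_row (Emap r s) = 2 * s" "dim_col (Emap r s) = s + 1"
  "dim_row (Fmap r s) = s + 1" "dim_col (Fmap r s) = 2 * s"
  by (auto simp: Emap_def Fmap_def mat1_def)

lemma Emap_index: "i < 2 * s \<Longrightarrow> k \<le> s \<Longrightarrow> Emap r s $$ (i, k) =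
   (if i = k \<and> k < s then fg r s k else if 1 \<le> k \<and> i = s + (k - 1) then fl r s k else 0)"
  by (auto simp: Emap_def mat1_def fg_def fl_def)

lemma Emap_index_top: "i < s \<Longrightarrow> k \<le> s \<Longrightarrow> Emap r s $$ (i, k) = (if i = k then fg r s k else 0)"
  by (auto simp: Emap_index)

lemma Emap_index_bottom: "i < s \<Longrightarrow> k \<le> s \<Longrightarrow> Emap r s $$ (s + i, k) = (if k = Suc i then fl r s k else 0)"
  by (auto simp: Emap_index)

lemma mult_Emap_index:
  assumes "i < dim_row M" "dim_col M = 2 * s" "k \<le> s"
  shows "(M * Emap r s) $$ (i, k) = (if k < s then M $$ (i, k) * fg r s k else 0)
     + (if k = 0 then 0 else M $$ (i, s + (k - 1)) * fl r s k)"
proof -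
  have "(M * Emap r s) $$ (i, k) = (\<Sum>l<2 * s. M $$ (i, l) * Emap r s $$ (l, k))"
    using assms by (subst mat_mult_index) auto
  also have "\<dots> = (\<Sum>l<s. M $$ (i, l) * Emap r s $$ (l, k)) + (\<Sum>l<s. M $$ (i, s + l) * Emap r s $$ (s + l, k))"
    using sum_lessThan_times[of "\<lambda>l. M $$ (i, l) * Emap r s $$ (l, k)" 2 s] by (simp add: numeral_2_eq_2)
  also have "(\<Sum>l<s. M $$ (i, l) * Emap r s $$ (l, k)) = (\<Sum>l<s. if l = k then M $$ (i, k) * fg r s k else 0)"
    using assms by (intro sum.cong) (auto simp: Emap_index_top)
  also have "(\<Sum>l<s. M $$ (i, s + l) * Emap r s $$ (s + l, k)) = (\<Sum>l<s. if k \<noteq> 0 \<and> l = k - 1 then M $$ (i, s + (k - 1)) * fl r s k else 0)"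
    using assms by (intro sum.cong) (auto simp: Emap_index_bottom)
  also have "\<dots> = (if k = 0 then 0 else M $$ (i, s + (k - 1)) * fl r s k)"
    using assms by (cases k) auto
  finally show ?thesis by auto
qed

lemma Emap_mult_index:
  assumes "i < s" "k < dim_col N" "dim_row N = s + 1"
  shows "(Emap r s * N) $$ (i, k) = fg r s i * N $$ (i, k)"
    "(Emap r s * N) $$ (s + i, k) = fl r s (Suc i) * N $$ (Suc i, k)"
proof -
  have "(Emap r s * N) $$ (i, k) = (\<Sum>l<s + 1. if l = i then fg r s i * N $$ (i, k) else 0)"
    using assms by (subst mat_mult_index) (auto simp: Emap_index_top mult_delta_left simp del: sum.lessThan_Suc)
  then show "(Emap r s * N) $$ (i, k) = fg r s i * N $$ (i, k)" using assms by (simp del: sum.lessThan_Suc)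
  have "(Emap r s * N) $$ (s + i, k) = (\<Sum>l<s + 1. if l = Suc i then fl r s (Suc i) * N $$ (Suc i, k) else 0)"
    using assms by (subst mat_mult_index) (auto simp: Emap_index_bottom mult_delta_left simp del: sum.lessThan_Suc)
  then show "(Emap r s * N) $$ (s + i, k) = fl r s (Suc i) * N $$ (Suc i, k)" using assms by (simp del: sum.lessThan_Suc)
qed

lemma Fmap_index: "i \<le> s \<Longrightarrow> k < 2 * s \<Longrightarrow> s \<ge> 1 \<Longrightarrow> Fmap r s $$ (i, k) =
   (if i = 0 then (if k = 0 then 1 else 0)
    else if i = s then (if k = 2 * s - 1 then inverse (fl r s s) else 0)
    else if k = i then (1 - fus_inv r s (Suc i) * fl r s i) / fg r s i
    else if k = s + (i - 1) then fus_inv r s (Suc i) else 0)"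
  by (auto simp: Fmap_def mat1_def fg_def fl_def)

text \<open>In the inner rows the diagonal entry of \<F> is defined as the complement that makes the
  two contributions add up to 1; the first and last columns of \<E> have a single nonzero
  entry.\<close>

lemma Fmap_Emap: "generic r \<Longrightarrow> s \<ge> 1 \<Longrightarrow> Fmap r s * Emap r s = 1\<^sub>m (s + 1)"
proof (rule eq_matI)
  assume g: "generic r" and s: "s \<ge> 1"
  fix i k assume "i < dim_row (1\<^sub>m (s + 1) :: complex mat)" "k < dim_col (1\<^sub>m (s + 1) :: complex mat)"
  then have ik: "i \<le> s" "k \<le> s" by auto
  have fs: "fl r s s \<noteq> 0" using fl_nonzero[OF g, of "s - 1" s] s by simp
  have fi: "fg r s i \<noteq> 0" if "i < s" using fg_nonzero[OF g that] .
  have "(Fmap r s * Emap r s) $$ (i, k) = (if k < s then Fmap r s $$ (i, k) * fg r s k else 0)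
     + (if k = 0 then 0 else Fmap r s $$ (i, s + (k - 1)) * fl r s k)"
    using ik by (subst mult_Emap_index) auto
  also have "\<dots> = 1\<^sub>m (s + 1) $$ (i, k)"
  proof (cases "i = 0")
    case True
    then show ?thesis using ik s by (cases k) (simp_all add: Fmap_index)
  next
    case i0: False
    show ?thesis
    proof (cases "i = s")
      case True
      then have "Fmap r s $$ (i, k) = 0" if "k < s" using that s by (subst Fmap_index) auto
      moreover have "Fmap r s $$ (i, s + (k - 1)) = (if k = s then inverse (fl r s s) else 0)" if "k \<noteq> 0"
        using that True ik s by (subst Fmap_index) auto
      ultimately show ?thesis using True ik s fs by (cases "k = s") auto
    next
      case False
      then have "i < s" using ik by simp
      then have "Fmap r s $$ (i, k) = (if k = i then (1 - fus_inv r s (Suc i) * fl r s i) / fg r s i else 0)" if "k < s"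
        using that i0 False by (subst Fmap_index) auto
      moreover have "Fmap r s $$ (i, s + (k - 1)) = (if k = i then fus_inv r s (Suc i) else 0)" if "k \<noteq> 0"
        using that i0 False \<open>i < s\<close> ik by (subst Fmap_index) auto
      ultimately show ?thesis using i0 False \<open>i < s\<close> ik fi by (cases "k = i") auto
    qed
  qed
  finally show "(Fmap r s * Emap r s) $$ (i, k) = 1\<^sub>m (s + 1) $$ (i, k)" .
qed auto

text \<open>Nonzero entries of both maps connect vectors of equal total weight; \<open>d\<close>
  lists the weights of the unfused basis.\<close>

lemma Emap_weight:
  assumes r: "r \<noteq> 0" and s: "s \<ge> 1"
  shows "Emap r s * Dm r s = (Dm r (Suc 0) \<otimes>\<^sub>k Dm r (s - 1)) * Emap r s"
    "Fmap r s * (Dm r (Suc 0) \<otimes>\<^sub>k Dm r (s - 1)) = Dm r s * Fmap r s"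
proof -
  define d where "d k = (if k < s then pw r s k else pw r s (Suc (k - s)))" for k
  have w: "wt (s - Suc 0) i = wt s i - 1" for i using s by (simp add: wt_def of_nat_diff)
  have p: "pw r (s - Suc 0) i = pw r s i * inverse r" for i
    using r by (simp add: pw_def w power_int_diff divide_inverse)
  have D: "Dm r (Suc 0) \<otimes>\<^sub>k Dm r (s - 1) = dgm (2 * s) (\<lambda>k. d k * d k)"
    unfolding Dm_one_kron
    using r s by (intro eq_matI) (auto simp: band_index d_def p pw_Suc power2_eq_square field_simps)
  have D': "Dm r s = dgm (s + 1) (\<lambda>i. pw r s i * pw r s i)" by (rule Dm_pw)
  have E: "d i = pw r s k" if "i < 2 * s" "k \<le> s" "Emap r s $$ (i, k) \<noteq> 0" for i k
    using that s by (cases "i < s"; cases k) (auto simp: Emap_index d_def split: if_splits)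
  have F: "d k = pw r s i" if ki: "k < 2 * s" "i \<le> s" and nz: "Fmap r s $$ (i, k) \<noteq> 0" for i k
  proof -
    consider "i = 0" "k = 0" | "i \<noteq> 0" "i \<noteq> s" "k = i" | "i \<noteq> 0" "k = s + i - 1"
      using nz s unfolding Fmap_index[OF ki(2) ki(1) s] by (auto simp: mult_2 split: if_splits)
    then show ?thesis using ki s by cases (auto simp: d_def)
  qed
  show "Emap r s * Dm r s = (Dm r (Suc 0) \<otimes>\<^sub>k Dm r (s - 1)) * Emap r s"
    unfolding D D'
  proof (rule eq_matI, goal_cases)
    case (1 i k)
    then show ?case using E[of i k]
      by (cases "Emap r s $$ (i, k) = 0") (simp_all add: mult_band_index(3) band_mult_index(3) del: index_mult_mat(1))
  qed simp_all
  show "Fmap r s * (Dm r (Suc 0) \<otimes>\<^sub>k Dm r (s - 1)) = Dm r s * Fmap r s"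
    unfolding D D'
  proof (rule eq_matI, goal_cases)
    case (1 i k)
    then show ?case using F[of k i]
      by (cases "Fmap r s $$ (i, k) = 0") (simp_all add: mult_band_index(3) band_mult_index(3) del: index_mult_mat(1))
  qed simp_all
qed

lemma qnum_powers:
  assumes g: "generic r"
  shows "qnum r (2 * int k + 2) = (r powi (2 * int k) * r\<^sup>2 - inverse (r powi (2 * int k) * r\<^sup>2)) / qh r"
    "qnum r (2 * int k) = (r powi (2 * int k) - inverse (r powi (2 * int k))) / qh r"
    "qnum r (2 * int s - 2 * int k) = (pw r s k * pw r s k * r powi (2 * int k) - inverse (pw r s k * pw r s k * r powi (2 * int k))) / qh r"
    "qnum r (2 * int s - 2 * int k - 2) = (pw r s k * pw r s k * r powi (2 * int k) * inverse (r\<^sup>2)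
       - inverse (pw r s k * pw r s k * r powi (2 * int k) * inverse (r\<^sup>2))) / qh r"
    "r powi (int s - 1) = pw r s k * r powi (2 * int k) * inverse r"
    "r powi (1 - int s) = inverse (pw r s k * r powi (2 * int k)) * r"
proof -
  have r: "r \<noteq> 0" using g by (rule generic_nonzero)
  have a: "r powi (2 * int k + 2) = r powi (2 * int k) * r\<^sup>2" using r by (simp add: power_int_add)
  have b: "r powi (2 * int s - 2 * int k) = pw r s k * pw r s k * r powi (2 * int k)"
    using r by (simp add: pw_def wt_def flip: power_int_add)
  have c: "r powi (2 * int s - 2 * int k - 2) = pw r s k * pw r s k * r powi (2 * int k) * inverse (r\<^sup>2)"
    using r b power_int_diff[of r "2 * int s - 2 * int k" 2] by (simp add: divide_inverse)
  show "qnum r (2 * int k + 2) = (r powi (2 * int k) * r\<^sup>2 - inverse (r powi (2 * int k) * r\<^sup>2)) / qh r"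
    "qnum r (2 * int k) = (r powi (2 * int k) - inverse (r powi (2 * int k))) / qh r"
    "qnum r (2 * int s - 2 * int k) = (pw r s k * pw r s k * r powi (2 * int k) - inverse (pw r s k * pw r s k * r powi (2 * int k))) / qh r"
    "qnum r (2 * int s - 2 * int k - 2) = (pw r s k * pw r s k * r powi (2 * int k) * inverse (r\<^sup>2)
       - inverse (pw r s k * pw r s k * r powi (2 * int k) * inverse (r\<^sup>2))) / qh r"
    unfolding qnum_def power_int_minus a b c qh_def by simp_all
  have e: "r powi (int s) = pw r s k * r powi (2 * int k)"
    using r by (simp add: pw_def wt_def flip: power_int_add)
  show "r powi (int s - 1) = pw r s k * r powi (2 * int k) * inverse r"
    "r powi (1 - int s) = inverse (pw r s k * r powi (2 * int k)) * r"
    using r e by (simp_all add: power_int_diff divide_inverse mult.commute)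
qed

text \<open>All four are [n+1] = q [n] + q^(-n) or its mirror image under q to 1/q, for n = s - i -
  1 in the first two and n = i in the last two, multiplied by the weight factors with which they
  occur in \<open>Emap_intertwines\<close>.\<close>

lemma qnum_recurrences:
  fixes r :: complex and s i :: nat
  assumes g: "generic r"
  defines "h \<equiv> qh r"
  defines "K \<equiv> qnum r (2 * int s - 2 * int i)" and "K' \<equiv> qnum r (2 * int s - 2 * int i - 2)"
    and "N \<equiv> qnum r (2 * int i + 2)" and "N' \<equiv> qnum r (2 * int i)" and "x \<equiv> pw r s i"
  shows "K * (x * inverse r) = K' * (x * r) + r powi (1 - int s)"
    "K * (x * inverse r) = K' * (x * inverse r * inverse (r\<^sup>2)) + r powi (int s - 1) * (x * inverse r * (x * inverse r))"
    "N * (x * inverse r) = r powi (int s - 1) + x * inverse r * inverse (r\<^sup>2) * N'"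
    "N * (x * inverse r) = r powi (1 - int s) * (x * inverse r * (x * inverse r)) + x * r * N'"
proof -
  have r: "r \<noteq> 0" using g by (rule generic_nonzero)
  have x: "x \<noteq> 0" using r by (simp add: x_def pw_nonzero)
  define y where "y = r powi (2 * int i)"
  have y: "y \<noteq> 0" using r by (simp add: y_def)
  have h: "h \<noteq> 0" "h = r\<^sup>2 - inverse (r\<^sup>2)" using qh_nonzero[OF g] by (simp_all add: h_def qh_def)
  note Q = qnum_powers(1,2)[OF g, of i, folded h_def x_def y_def] qnum_powers(3-6)[OF g, of s i, folded h_def x_def y_def]
  note e = K_def[unfolded Q(3)] K'_def[unfolded Q(4)] N_def[unfolded Q(1)] N'_def[unfolded Q(2)] Q(5,6)
  have m: "A / h * c = B / h * d + f" if "A * c - B * d = f * (r\<^sup>2 - inverse (r\<^sup>2))" for A B c d f :: complex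
  proof -
    have "A * c - B * d = f * h" using that h(2) by metis
    then have "A * c = B * d + f * h" by (metis add.commute diff_add_cancel)
    then have "A * c / h = B * d / h + f" using h(1) by (simp add: add_divide_distrib)
    then show ?thesis by simp
  qed
  have m': "A / h * c = f + d * (B / h)" if "A * c - B * d = f * (r\<^sup>2 - inverse (r\<^sup>2))" for A B c d f :: complex
    using m[OF that] by (simp add: mult.commute add.commute)
  show "K * (x * inverse r) = K' * (x * r) + r powi (1 - int s)"
    "K * (x * inverse r) = K' * (x * inverse r * inverse (r\<^sup>2)) + r powi (int s - 1) * (x * inverse r * (x * inverse r))"
    unfolding e using r x y by (intro m; simp add: field_simps power2_eq_square)+
  show "N * (x * inverse r) = r powi (int s - 1) + x * inverse r * inverse (r\<^sup>2) * N'"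
    "N * (x * inverse r) = r powi (1 - int s) * (x * inverse r * (x * inverse r)) + x * r * N'"
    unfolding e using r x y by (intro m'; simp add: field_simps power2_eq_square)+
qed

text \<open>Relations between the two entries of a column of \<E>, kept free of denominators so that
  they persist where an amplitude vanishes. They follow from the recurrences and
  \<open>bco_square\<close> after cancelling a nonzero amplitude.\<close>

lemma fusion_coefficients:
  assumes g: "generic r" and k: "k < s"
  shows "fl r s (Suc k) * bco r (s - 1) k = qnum r (2 * int k + 2) * fg r s (Suc k)"
    "Suc k < s \<Longrightarrow> fl r s (Suc k) * bco r s (Suc k) = fl r s (Suc (Suc k)) * bco r (s - 1) k"
    "fg r s k * bco r s k = qnum r (2 * int s - 2 * int k) * fl r s (Suc k)"
    "fg r s (Suc k) * bco r (s - 1) k = qnum r (2 * int s - 2 * int k - 2) * fl r s (Suc k)"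
proof -
  let ?N = "\<lambda>k. qnum r (2 * int k + 2)"
  have b: "bco r s k \<noteq> 0" using bco_nonzero[OF g k] .
  note L1 = fg_Suc[OF g k] and L2 = fl_Suc[OF g k]
  have sq: "bco r s k * bco r s k = qnum r (2 * int s - 2 * int k) * ?N k"
    using bco_square[of r s k] by (simp add: power2_eq_square)
  have sq': "bco r (s - 1) k * bco r (s - 1) k = qnum r (2 * int s - 2 * int k - 2) * ?N k"
    using bco_square[of r "s - 1" k] k by (simp add: power2_eq_square of_nat_diff algebra_simps)
  have "fl r s (Suc k) * bco r (s - 1) k * bco r s k = (fl r s (Suc k) * bco r s k) * bco r (s - 1) k" by simp
  also have "\<dots> = ?N k * (fg r s k * bco r (s - 1) k)" unfolding L2 by simp
  also have "\<dots> = ?N k * fg r s (Suc k) * bco r s k" unfolding L1[symmetric] by simp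
  finally have "fl r s (Suc k) * bco r (s - 1) k * bco r s k = ?N k * fg r s (Suc k) * bco r s k" .
  with b show 1: "fl r s (Suc k) * bco r (s - 1) k = ?N k * fg r s (Suc k)" by simp
  have "fg r s k * bco r s k * bco r s k = qnum r (2 * int s - 2 * int k) * (?N k * fg r s k)"
    using sq by (simp add: mult_ac)
  also have "\<dots> = qnum r (2 * int s - 2 * int k) * fl r s (Suc k) * bco r s k"
    unfolding L2[symmetric] by simp
  finally show "fg r s k * bco r s k = qnum r (2 * int s - 2 * int k) * fl r s (Suc k)"
    using b by simp
  have "fg r s (Suc k) * bco r (s - 1) k * bco r s k = (fg r s (Suc k) * bco r s k) * bco r (s - 1) k" by simp
  also have "\<dots> = fg r s k * (bco r (s - 1) k * bco r (s - 1) k)"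
    unfolding L1 by simp
  also have "\<dots> = qnum r (2 * int s - 2 * int k - 2) * (?N k * fg r s k)"
    unfolding sq' by simp
  also have "\<dots> = qnum r (2 * int s - 2 * int k - 2) * fl r s (Suc k) * bco r s k"
    unfolding L2[symmetric] by simp
  finally show 4: "fg r s (Suc k) * bco r (s - 1) k = qnum r (2 * int s - 2 * int k - 2) * fl r s (Suc k)"
    using b by simp
  assume k': "Suc k < s"
  have b': "bco r s (Suc k) \<noteq> 0" using bco_nonzero[OF g k'] .
  have sq2: "bco r s (Suc k) * bco r s (Suc k) = qnum r (2 * int s - 2 * int k - 2) * ?N (Suc k)"
    using bco_square[of r s "Suc k"] by (simp add: power2_eq_square algebra_simps)
  have "fl r s (Suc k) * bco r s (Suc k) * bco r s (Suc k) = ?N (Suc k) * (qnum r (2 * int s - 2 * int k - 2) * fl r s (Suc k))"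
    using sq2 by (simp add: mult_ac)
  also have "\<dots> = ?N (Suc k) * fg r s (Suc k) * bco r (s - 1) k"
    unfolding 4[symmetric] by simp
  also have "\<dots> = fl r s (Suc (Suc k)) * bco r (s - 1) k * bco r s (Suc k)"
    unfolding fl_Suc[OF g k', symmetric] by simp
  finally show "fl r s (Suc k) * bco r s (Suc k) = fl r s (Suc (Suc k)) * bco r (s - 1) k"
    using b' by simp
qed

text \<open>\<E> embeds spin s/2 as a submodule once the spectral parameters of the constituents
  form a q-string. The shifts r^(1-s) and r are those at which the two factors stand in the fusion
  recursions.\<close>

lemma Emap_intertwines:
  assumes g: "generic r" and s: "s \<ge> 1"
  shows "Emap r s * Am r s a b = cop r (Suc 0) (s - 1) (r powi (1 - int s) * a) (r powi (int s - 1) * b) (r * a) (inverse r * b) * Emap r s"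
      (is "_ = ?C * _")
    "Emap r s * Am r s a b = copop r (Suc 0) (s - 1) (r powi (int s - 1) * a) (r powi (1 - int s) * b) (inverse r * a) (r * b) * Emap r s"
      (is "_ = ?O * _")
proof -
  have r: "r \<noteq> 0" using g by (rule generic_nonzero)
  have w: "wt (s - Suc 0) i = wt s i - 1" for i using s by (simp add: wt_def of_nat_diff)
  have p: "pw r (s - Suc 0) i = pw r s i * inverse r" for i
    using r by (simp add: pw_def w power_int_diff divide_inverse)
  note S = pw_Suc[OF r, of s]
  have Ai: "Am r s a b $$ (i, k) = (if k = Suc i then a * r * bco r s i * pw r s k else if i = Suc k then b * inverse r * bco r s k * pw r s k else 0)"
    if "i \<le> s" "k \<le> s" for i k a b using that by (simp add: Am_index pw_def)
  have At: "Am r (s - Suc 0) a b $$ (i, k) = (if k = Suc i then a * r * bco r (s - 1) i * (pw r s k * inverse r)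
      else if i = Suc k then b * inverse r * bco r (s - 1) k * (pw r s k * inverse r) else 0)"
    if "i < s" "k < s" for i k a b using that by (subst Am_index) (auto simp: pw_def[symmetric] p)
  have Dt: "Dm r (s - Suc 0) $$ (i, k) = (if i = k then pw r s i * inverse r * (pw r s i * inverse r) else 0)"
    if "i < s" "k < s" for i k using that by (simp add: Dm_pw band_index p)
  note L = fusion_coefficients[OF g] and F = fg_Suc[OF g] and F' = fl_Suc[OF g]
  note Q = qnum_recurrences[OF g, where s = s]
  \<comment> \<open>The recurrence continues the upper entries by zero, so the last column follows
    the general pattern.\<close>
  have fg_s: "fg r s s = 0" using fg_Suc[OF g, of "s - 1" s] bco_nonzero[OF g, of "s - 1" s] s by simp
  \<comment> \<open>\<open>F1\<close> and \<open>F2\<close> treat the raising and lowering entries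
    in the upper rows, \<open>F3\<close> and \<open>F4\<close> those in the lower rows. In each, the
    first equation serves the coproduct and the second its opposite.\<close>
  have F1: "r powi (1 - int s) * a * fl r s (Suc i) + r\<^sup>2 * (r * a * r * bco r (s - 1) i * (pw r s (Suc i) * inverse r)) * fg r s (Suc i)
      = fg r s i * (a * r * bco r s i * pw r s (Suc i))"
    "r powi (int s - 1) * a * (pw r s i * inverse r * (pw r s i * inverse r)) * fl r s (Suc i) + inverse r * a * r * bco r (s - 1) i * (pw r s (Suc i) * inverse r) * fg r s (Suc i)
      = fg r s i * (a * r * bco r s i * pw r s (Suc i))" if i: "i < s" for i
  proof -
    have "fg r s i * (a * r * bco r s i * pw r s (Suc i)) = (fg r s i * bco r s i) * (a * (pw r s i * inverse r))"
      using r by (simp add: S field_simps power2_eq_square)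
    also have "\<dots> = a * fl r s (Suc i) * (qnum r (2 * int s - 2 * int i) * (pw r s i * inverse r))"
      unfolding L(3)[OF i] by simp
    finally have e: "fg r s i * (a * r * bco r s i * pw r s (Suc i)) = a * fl r s (Suc i) * (qnum r (2 * int s - 2 * int i) * (pw r s i * inverse r))" .
    have "r\<^sup>2 * (r * a * r * bco r (s - 1) i * (pw r s (Suc i) * inverse r)) * fg r s (Suc i) = (fg r s (Suc i) * bco r (s - 1) i) * (a * (pw r s i * r))"
      using r by (simp add: S field_simps power2_eq_square)
    also have "\<dots> = a * fl r s (Suc i) * (qnum r (2 * int s - 2 * int i - 2) * (pw r s i * r))"
      unfolding L(4)[OF i] by simp
    finally show "r powi (1 - int s) * a * fl r s (Suc i) + r\<^sup>2 * (r * a * r * bco r (s - 1) i * (pw r s (Suc i) * inverse r)) * fg r s (Suc i)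
      = fg r s i * (a * r * bco r s i * pw r s (Suc i))"
      unfolding e Q(1)[where i = i] by (simp add: algebra_simps)
    have "inverse r * a * r * bco r (s - 1) i * (pw r s (Suc i) * inverse r) * fg r s (Suc i) = (fg r s (Suc i) * bco r (s - 1) i) * (a * (pw r s i * inverse r * inverse (r\<^sup>2)))"
      using r by (simp add: S field_simps power2_eq_square)
    also have "\<dots> = a * fl r s (Suc i) * (qnum r (2 * int s - 2 * int i - 2) * (pw r s i * inverse r * inverse (r\<^sup>2)))"
      unfolding L(4)[OF i] by simp
    finally show "r powi (int s - 1) * a * (pw r s i * inverse r * (pw r s i * inverse r)) * fl r s (Suc i) + inverse r * a * r * bco r (s - 1) i * (pw r s (Suc i) * inverse r) * fg r s (Suc i)
      = fg r s i * (a * r * bco r s i * pw r s (Suc i))"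
      unfolding e Q(2)[where i = i] by (simp add: algebra_simps)
  qed
  have F2: "r\<^sup>2 * (inverse r * b * inverse r * bco r (s - 1) k * (pw r s k * inverse r)) * fg r s k = fg r s (Suc k) * (b * inverse r * bco r s k * pw r s k)"
    "r * b * inverse r * bco r (s - 1) k * (pw r s k * inverse r) * fg r s k = fg r s (Suc k) * (b * inverse r * bco r s k * pw r s k)"
    if k: "k < s" for k
  proof -
    have "fg r s (Suc k) * (b * inverse r * bco r s k * pw r s k) = (fg r s (Suc k) * bco r s k) * (b * inverse r * pw r s k)" by simp
    then have e: "fg r s (Suc k) * (b * inverse r * bco r s k * pw r s k) = fg r s k * bco r (s - 1) k * (b * inverse r * pw r s k)"
      unfolding F[OF k] .
    show "r\<^sup>2 * (inverse r * b * inverse r * bco r (s - 1) k * (pw r s k * inverse r)) * fg r s k = fg r s (Suc k) * (b * inverse r * bco r s k * pw r s k)"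
      "r * b * inverse r * bco r (s - 1) k * (pw r s k * inverse r) * fg r s k = fg r s (Suc k) * (b * inverse r * bco r s k * pw r s k)"
      unfolding e using r by (simp_all add: field_simps power2_eq_square)
  qed
  have F3: "inverse (r\<^sup>2) * (r * a * r * bco r (s - 1) i * (pw r s (Suc i) * inverse r)) * fl r s (Suc (Suc i)) = fl r s (Suc i) * (a * r * bco r s (Suc i) * pw r s (Suc (Suc i)))"
    "inverse r * a * r * bco r (s - 1) i * (pw r s (Suc i) * inverse r) * fl r s (Suc (Suc i)) = fl r s (Suc i) * (a * r * bco r s (Suc i) * pw r s (Suc (Suc i)))"
    if i: "Suc i < s" for i
  proof -
    have "fl r s (Suc i) * (a * r * bco r s (Suc i) * pw r s (Suc (Suc i))) = (fl r s (Suc i) * bco r s (Suc i)) * (a * r * pw r s (Suc (Suc i)))" by simp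
    then have e: "fl r s (Suc i) * (a * r * bco r s (Suc i) * pw r s (Suc (Suc i))) = fl r s (Suc (Suc i)) * bco r (s - 1) i * (a * r * pw r s (Suc (Suc i)))"
      using L(2)[of i s] i by simp
    show "inverse (r\<^sup>2) * (r * a * r * bco r (s - 1) i * (pw r s (Suc i) * inverse r)) * fl r s (Suc (Suc i)) = fl r s (Suc i) * (a * r * bco r s (Suc i) * pw r s (Suc (Suc i)))"
      "inverse r * a * r * bco r (s - 1) i * (pw r s (Suc i) * inverse r) * fl r s (Suc (Suc i)) = fl r s (Suc i) * (a * r * bco r s (Suc i) * pw r s (Suc (Suc i)))"
      unfolding e using r by (simp_all add: S[of "Suc i"] field_simps power2_eq_square)
  qed
  have F4: "r powi (int s - 1) * b * fg r s i + (if i = 0 then 0 else inverse (r\<^sup>2) * (inverse r * b * inverse r * bco r (s - 1) (i - 1) * (pw r s (i - 1) * inverse r)) * fl r s i)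
       = fl r s (Suc i) * (b * inverse r * bco r s i * pw r s i)"
     "r powi (1 - int s) * b * (pw r s i * inverse r * (pw r s i * inverse r)) * fg r s i + (if i = 0 then 0 else r * b * inverse r * bco r (s - 1) (i - 1) * (pw r s (i - 1) * inverse r) * fl r s i)
       = fl r s (Suc i) * (b * inverse r * bco r s i * pw r s i)" if i: "i < s" for i
  proof -
    have "fl r s (Suc i) * (b * inverse r * bco r s i * pw r s i) = (fl r s (Suc i) * bco r s i) * (b * (pw r s i * inverse r))" by simp
    also have "\<dots> = b * fg r s i * (qnum r (2 * int i + 2) * (pw r s i * inverse r))" unfolding F'[OF i] by simp
    finally have e: "fl r s (Suc i) * (b * inverse r * bco r s i * pw r s i) = b * fg r s i * (qnum r (2 * int i + 2) * (pw r s i * inverse r))" .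
    have z: "qnum r 0 = 0" by (simp add: qnum_def)
    have c: "(if i = 0 then 0 else x * bco r (s - 1) (i - 1) * (pw r s (i - 1) * inverse r) * fl r s i) = x * (pw r s i * r) * qnum r (2 * int i) * fg r s i" for x
    proof (cases i)
      case 0 then show ?thesis by (simp add: z)
    next
      case (Suc j)
      have "x * bco r (s - 1) (i - 1) * (pw r s (i - 1) * inverse r) * fl r s i = x * (pw r s j * inverse r) * (fl r s (Suc j) * bco r (s - 1) j)"
        using Suc by simp
      also have "\<dots> = x * (pw r s j * inverse r) * (qnum r (2 * int j + 2) * fg r s (Suc j))"
        using L(1)[of j s] Suc i by simp
      also have "pw r s j * inverse r = pw r s i * r" using r Suc by (simp add: S field_simps power2_eq_square)
      finally show ?thesis using Suc by (simp add: algebra_simps)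
    qed
    have c': "(if i = 0 then 0 else inverse (r\<^sup>2) * (inverse r * b * inverse r * bco r (s - 1) (i - 1) * (pw r s (i - 1) * inverse r)) * fl r s i) =
       inverse (r\<^sup>2) * inverse r * b * inverse r * (pw r s i * r) * qnum r (2 * int i) * fg r s i"
      unfolding c[symmetric] by simp
    show "r powi (int s - 1) * b * fg r s i + (if i = 0 then 0 else inverse (r\<^sup>2) * (inverse r * b * inverse r * bco r (s - 1) (i - 1) * (pw r s (i - 1) * inverse r)) * fl r s i)
       = fl r s (Suc i) * (b * inverse r * bco r s i * pw r s i)"
      unfolding c' e Q(3)[where i = i] using r by (simp add: field_simps power2_eq_square)
    show "r powi (1 - int s) * b * (pw r s i * inverse r * (pw r s i * inverse r)) * fg r s i + (if i = 0 then 0 else r * b * inverse r * bco r (s - 1) (i - 1) * (pw r s (i - 1) * inverse r) * fl r s i)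
       = fl r s (Suc i) * (b * inverse r * bco r s i * pw r s i)"
      unfolding c e Q(4)[where i = i] using r by (simp add: field_simps power2_eq_square)
  qed
  have G1: "fg r s i * (a * r * bco r s i * pw r s (Suc i)) = r\<^sup>2 * (r * a * r * bco r (s - 1) i * (pw r s (Suc i) * inverse r)) * fg r s (Suc i) + r powi (1 - int s) * a * fl r s (Suc i)"
     "fg r s i * (a * r * bco r s i * pw r s (Suc i)) = inverse r * a * r * bco r (s - 1) i * (pw r s (Suc i) * inverse r) * fg r s (Suc i) + r powi (int s - 1) * a * (pw r s i * inverse r * (pw r s i * inverse r)) * fl r s (Suc i)"
    if "i < s" for i
    using F1[OF that] by (simp_all only: add.commute)
  have G4: "fl r s (Suc 0) * (b * inverse r * bco r s 0 * pw r s 0) = r powi (int s - 1) * b"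
    "fl r s (Suc 0) * (b * inverse r * bco r s 0 * pw r s 0) = r powi (1 - int s) * b * (pw r s 0 * inverse r * (pw r s 0 * inverse r))"
    by (use F4(1)[of 0, symmetric] s in simp, use F4(2)[of 0, symmetric] s in simp)
  have G4S: "fl r s (Suc (Suc j)) * (b * inverse r * bco r s (Suc j) * pw r s (Suc j)) = r powi (int s - 1) * b * fg r s (Suc j) + inverse (r\<^sup>2) * (inverse r * b * inverse r * bco r (s - 1) j * (pw r s j * inverse r)) * fl r s (Suc j)"
    "fl r s (Suc (Suc j)) * (b * inverse r * bco r s (Suc j) * pw r s (Suc j)) = r powi (1 - int s) * b * (pw r s (Suc j) * inverse r * (pw r s (Suc j) * inverse r)) * fg r s (Suc j) + r * b * inverse r * bco r (s - 1) j * (pw r s j * inverse r) * fl r s (Suc j)"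
    if "Suc j < s" for j
    using F4[OF that] by simp_all
  define C where "C = ?C"
  define Q where "Q = ?O"
  have C: "C $$ (i, k) = r\<^sup>2 * Am r (s - Suc 0) (r * a) (inverse r * b) $$ (i, k)"
      "C $$ (i, s + k) = (if i = k then r powi (1 - int s) * a else 0)"
      "C $$ (s + i, k) = (if i = k then r powi (int s - 1) * b else 0)"
      "C $$ (s + i, s + k) = inverse (r\<^sup>2) * Am r (s - Suc 0) (r * a) (inverse r * b) $$ (i, k)"
    if "i < s" "k < s" for i k
    unfolding C_def cop_one[OF g] using that s by simp_all
  have Q: "Q $$ (i, k) = Am r (s - Suc 0) (inverse r * a) (r * b) $$ (i, k)"
      "Q $$ (i, s + k) = r powi (int s - 1) * a * Dm r (s - Suc 0) $$ (i, k)"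
      "Q $$ (s + i, k) = r powi (1 - int s) * b * Dm r (s - Suc 0) $$ (i, k)"
      "Q $$ (s + i, s + k) = Am r (s - Suc 0) (inverse r * a) (r * b) $$ (i, k)"
    if "i < s" "k < s" for i k
    unfolding Q_def copop_one[OF g] using that s by simp_all
  have dimC: "dim_row C = 2 * s" "dim_col C = 2 * s" "dim_row Q = 2 * s" "dim_col Q = 2 * s"
    using s by (simp_all add: C_def Q_def)
  have C': "C $$ (s, k) = (if 0 = k then r powi (int s - 1) * b else 0)"
    "Q $$ (s, k) = r powi (1 - int s) * b * Dm r (s - Suc 0) $$ (0, k)" if "k < s" for k
    using C(3)[of 0 k] Q(3)[of 0 k] that s by simp_all
  have CS: "C $$ (Suc (s + i), k) = (if Suc i = k then r powi (int s - 1) * b else 0)"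
    "C $$ (Suc (s + i), s + k) = inverse (r\<^sup>2) * Am r (s - Suc 0) (r * a) (inverse r * b) $$ (Suc i, k)"
    "Q $$ (Suc (s + i), k) = r powi (1 - int s) * b * Dm r (s - Suc 0) $$ (Suc i, k)"
    "Q $$ (Suc (s + i), s + k) = Am r (s - Suc 0) (inverse r * a) (r * b) $$ (Suc i, k)" if "Suc i < s" "k < s" for i k
    using C(3,4)[of "Suc i" k] Q(3,4)[of "Suc i" k] that by simp_all
  have CS': "C $$ (s + i, Suc (s + k)) = inverse (r\<^sup>2) * Am r (s - Suc 0) (r * a) (inverse r * b) $$ (i, Suc k)"
    "Q $$ (s + i, Suc (s + k)) = Am r (s - Suc 0) (inverse r * a) (r * b) $$ (i, Suc k)" if "i < s" "Suc k < s" for i k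
    using C(4)[of i "Suc k"] Q(4)[of i "Suc k"] that by simp_all
  note C = C C' CS CS' and Q = Q C' CS CS'
  have eqI: "Emap r s * Am r s a b = M * Emap r s"
    if d: "dim_row M = 2 * s" "dim_col M = 2 * s"
    and T0: "\<And>i. i < s \<Longrightarrow> fg r s i * Am r s a b $$ (i, 0) = M $$ (i, 0)"
    and TS: "\<And>i j. i < s \<Longrightarrow> j < s \<Longrightarrow> fg r s i * Am r s a b $$ (i, Suc j) = (if Suc j < s then M $$ (i, Suc j) * fg r s (Suc j) else 0) + M $$ (i, s + j) * fl r s (Suc j)"
    and B0: "\<And>i. i < s \<Longrightarrow> fl r s (Suc i) * Am r s a b $$ (Suc i, 0) = M $$ (s + i, 0)"
    and BS: "\<And>i j. i < s \<Longrightarrow> j < s \<Longrightarrow> fl r s (Suc i) * Am r s a b $$ (Suc i, Suc j) = (if Suc j < s then M $$ (s + i, Suc j) * fg r s (Suc j) else 0) + M $$ (s + i, s + j) * fl r s (Suc j)"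
    for M
  proof (rule eq_matI)
    fix i k assume "i < dim_row (M * Emap r s)" "k < dim_col (M * Emap r s)"
    then have ik: "i < 2 * s" "k \<le> s" using d by auto
    show "(Emap r s * Am r s a b) $$ (i, k) = (M * Emap r s) $$ (i, k)"
    proof (cases "i < s")
      case True
      then show ?thesis using ik d T0[OF True] TS[OF True] s
        by (cases k) (simp_all add: Emap_mult_index mult_Emap_index del: index_mult_mat(1))
    next
      case False
      then obtain j where j: "i = s + j" "j < s" using ik by (metis add_diff_inverse_nat less_diff_conv2 linorder_not_less mult_2 nat_add_left_cancel_less)
      then show ?thesis using ik d B0[OF j(2)] BS[OF j(2)] s
        by (cases k) (simp_all add: Emap_mult_index mult_Emap_index del: index_mult_mat(1))
    qed
  qed (use d in auto)
  show "Emap r s * Am r s a b = ?C * Emap r s"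
    unfolding C_def[symmetric]
  proof (rule eqI)
    fix i assume i: "i < s"
    show "fg r s i * Am r s a b $$ (i, 0) = C $$ (i, 0)"
      using i s F2(1)[of 0, symmetric] by (cases "i = Suc 0") (simp_all add: C Ai At)
    show "fl r s (Suc i) * Am r s a b $$ (Suc i, 0) = C $$ (s + i, 0)"
      using i s G4(1) by (cases "i = 0") (simp_all add: C Ai At)
    fix j assume j: "j < s"
    show "fg r s i * Am r s a b $$ (i, Suc j) = (if Suc j < s then C $$ (i, Suc j) * fg r s (Suc j) else 0) + C $$ (i, s + j) * fl r s (Suc j)"
    proof (cases "j = i")
      case True
      then show ?thesis using i j G1(1)[OF i] fg_s by (cases "Suc i = s") (simp_all add: C Ai At)
    next
      case False
      then show ?thesis using i j F2(1)[of "Suc j", symmetric] by (cases "i = Suc (Suc j)") (simp_all add: C Ai At)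
    qed
    show "fl r s (Suc i) * Am r s a b $$ (Suc i, Suc j) = (if Suc j < s then C $$ (s + i, Suc j) * fg r s (Suc j) else 0) + C $$ (s + i, s + j) * fl r s (Suc j)"
    proof (cases "j = Suc i")
      case True
      then show ?thesis using i j F3(1)[of i, symmetric] by (simp add: C Ai At)
    next
      case False
      then show ?thesis using i j G4S(1)[of j] by (cases "i = Suc j") (simp_all add: C Ai At)
    qed
  qed (use dimC in simp_all)
  show "Emap r s * Am r s a b = ?O * Emap r s"
    unfolding Q_def[symmetric]
  proof (rule eqI)
    fix i assume i: "i < s"
    show "fg r s i * Am r s a b $$ (i, 0) = Q $$ (i, 0)"
      using i s F2(2)[of 0, symmetric] by (cases "i = Suc 0") (simp_all add: Q Ai At Dt)
    show "fl r s (Suc i) * Am r s a b $$ (Suc i, 0) = Q $$ (s + i, 0)"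
      using i s G4(2) by (cases "i = 0") (simp_all add: Q Ai At Dt)
    fix j assume j: "j < s"
    show "fg r s i * Am r s a b $$ (i, Suc j) = (if Suc j < s then Q $$ (i, Suc j) * fg r s (Suc j) else 0) + Q $$ (i, s + j) * fl r s (Suc j)"
    proof (cases "j = i")
      case True
      then show ?thesis using i j G1(2)[OF i] fg_s by (cases "Suc i = s") (simp_all add: Q Ai At Dt)
    next
      case False
      then show ?thesis using i j F2(2)[of "Suc j", symmetric] by (cases "i = Suc (Suc j)") (simp_all add: Q Ai At Dt)
    qed
    show "fl r s (Suc i) * Am r s a b $$ (Suc i, Suc j) = (if Suc j < s then Q $$ (s + i, Suc j) * fg r s (Suc j) else 0) + Q $$ (s + i, s + j) * fl r s (Suc j)"
    proof (cases "j = Suc i")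
      case True
      then show ?thesis using i j F3(2)[of i, symmetric] by (simp add: Q Ai At Dt)
    next
      case False
      then show ?thesis using i j G4S(2)[of j] by (cases "i = Suc j") (simp_all add: Q Ai At Dt)
    qed
  qed (use dimC in simp_all)
qed

text \<open>At this point the R-matrix drops rank and annihilates the spin s/2 component. The zero
  obtained here later cancels a pole of the dual K-matrix.\<close>

lemma rcore_Emap_degenerate:
  assumes g: "generic r" and s: "s \<ge> 1"
  shows "rcore r (s - 1) (r powi (- int s)) * Emap r s = 0\<^sub>m (2 * s) (s + 1)"
proof (rule eq_matI)
  have r: "r \<noteq> 0" using g by (rule generic_nonzero)
  have w: "wt (s - Suc 0) i = wt s i - 1" for i using s by (simp add: wt_def of_nat_diff)
  have p: "pw r (s - Suc 0) i = pw r s i * inverse r" for i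
    using r by (simp add: pw_def w power_int_diff divide_inverse)
  note L = fusion_coefficients[OF g] and F = fg_Suc[OF g] and F' = fl_Suc[OF g]
  define M where "M = rcore r (s - 1) (r powi (- int s))"
  \<comment> \<open>The diagonal entries turn into q-integers up to the factor -(q - 1/q), which
    reduces the claim to two of the relations in \<open>fusion_coefficients\<close>.\<close>
  have M: "M $$ (i, k) = (if i = k then - (qh r * qnum r (2 * int i)) else 0)"
    "M $$ (i, s + k) = (if i = Suc k then qh r * bco r (s - 1) k else 0)"
    "M $$ (s + i, k) = (if k = Suc i then qh r * bco r (s - 1) i else 0)"
    "M $$ (s + i, s + k) = (if i = k then - (qh r * qnum r (2 * int s - 2 * int i - 2)) else 0)" if "i < s" "k < s" for i k
  proof -
    have h: "qh r \<noteq> 0" using qh_nonzero[OF g] by (simp add: qh_def)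
    have e1: "r powi (- int s) * r powi wt s i = r powi (- (2 * int i))" for i
      using r by (simp add: wt_def flip: power_int_add)
    have e2: "r powi (- int s) * r powi (- wt s i) * r powi 2 = r powi (- (2 * int s - 2 * int i - 2))" for i
      using r by (simp add: wt_def algebra_simps flip: power_int_add del: power_int_numeral)
    have 1: "r powi (- int s) * r * pw r (s - Suc 0) i = r powi (- (2 * int i))" for i
      unfolding p e1[symmetric] pw_def[symmetric] using r by simp
    have 2: "r powi (- int s) * r * inverse (pw r (s - Suc 0) i) = r powi (- (2 * int s - 2 * int i - 2))" for i
      unfolding p e2[symmetric] power_int_minus[of r "wt s i"] pw_def[symmetric] using r by (simp add: power2_eq_square)
    have 3: "inverse (r powi (- int s) * r) * pw r (s - Suc 0) i = r powi (2 * int s - 2 * int i - 2)" for i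
      using arg_cong[OF 2, of inverse] r by (simp add: pw_nonzero flip: power_int_minus)
    have q: "r powi (- t) - r powi t = - (qh r * qnum r t)" for t
      using h by (simp add: qnum_def qh_def)
    have q1: "i = k \<Longrightarrow> r powi (- int s) * r * pw r (s - Suc 0) k - inverse (r powi (- int s) * r * pw r (s - Suc 0) k) = - (qh r * qnum r (2 * int k))"
      unfolding 1 using q[of "2 * int k"] by (simp add: power_int_minus)
    have q2: "r powi (- int s) * r * inverse (pw r (s - Suc 0) k) - inverse (r powi (- int s) * r) * pw r (s - Suc 0) k = - (qh r * qnum r (2 * int s - 2 * int k - 2))"
      unfolding 2 3 using q[of "2 * int s - 2 * int k - 2"] by simp
    show "M $$ (i, k) = (if i = k then - (qh r * qnum r (2 * int i)) else 0)"
      "M $$ (i, s + k) = (if i = Suc k then qh r * bco r (s - 1) k else 0)"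
      "M $$ (s + i, k) = (if k = Suc i then qh r * bco r (s - 1) i else 0)"
      "M $$ (s + i, s + k) = (if i = k then - (qh r * qnum r (2 * int s - 2 * int i - 2)) else 0)"
      unfolding M_def rcore_def using that s q1 q2
      by (simp_all add: band_index del: inverse_mult_distrib)
  qed
  have dM: "dim_row M = 2 * s" "dim_col M = 2 * s" using s by (simp_all add: M_def)
  fix i k assume "i < dim_row (0\<^sub>m (2 * s) (s + 1) :: complex mat)" "k < dim_col (0\<^sub>m (2 * s) (s + 1) :: complex mat)"
  then have ik: "i < 2 * s" "k \<le> s" by auto
  have fg_s: "fg r s s = 0" using fg_Suc[OF g, of "s - 1" s] bco_nonzero[OF g, of "s - 1" s] s by simp
  have q0: "qnum r 0 = 0" by (simp add: qnum_def)
  have "(M * Emap r s) $$ (i, k) = 0"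
  proof (cases k)
    case 0
    have e: "(M * Emap r s) $$ (i, k) = M $$ (i, 0)"
      using 0 ik dM s by (subst mult_Emap_index) auto
    show ?thesis
    proof (cases "i < s")
      case True
      then show ?thesis unfolding e using s by (simp add: M q0)
    next
      case False
      then obtain j where j: "i = s + j" "j < s" using ik by (metis add_diff_inverse_nat less_diff_conv2 linorder_not_less mult_2 nat_add_left_cancel_less)
      then show ?thesis unfolding e using M(3)[of j 0] s by simp
    qed
  next
    case (Suc j)
    then have j: "j < s" using ik by simp
    have e: "(M * Emap r s) $$ (i, k) = (if Suc j < s then M $$ (i, Suc j) * fg r s (Suc j) else 0) + M $$ (i, s + j) * fl r s (Suc j)"
      using Suc ik dM by (subst mult_Emap_index) auto
    have f: "fg r s (Suc j) = 0" if "\<not> Suc j < s" using that j fg_s by (metis Suc_lessI)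
    show ?thesis
    proof (cases "i < s")
      case True
      have "qh r * bco r (s - 1) j * fl r s (Suc j) = qh r * qnum r (2 * int (Suc j)) * fg r s (Suc j)"
        using L(1)[OF j] by (simp add: algebra_simps)
      then show ?thesis unfolding e M(2)[OF True j] using M(1)[OF True, of "Suc j"] f True j by auto
    next
      case False
      then obtain l where l: "i = s + l" "l < s" using ik by (metis add_diff_inverse_nat less_diff_conv2 linorder_not_less mult_2 nat_add_left_cancel_less)
      have "qh r * bco r (s - 1) j * fg r s (Suc j) = qh r * qnum r (2 * int s - 2 * int j - 2) * fl r s (Suc j)"
        using L(4)[OF j] by (simp add: algebra_simps)
      then show ?thesis unfolding l(1) e[unfolded l(1)] M(4)[OF l(2) j] using M(3)[OF l(2), of "Suc j"] f j by auto
    qed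
  qed
  then show "(rcore r (s - 1) (r powi (- int s)) * Emap r s) $$ (i, k) = 0\<^sub>m (2 * s) (s + 1) $$ (i, k)"
    using ik by (simp add: M_def)
qed (use s in auto)

subsection \<open>Matrix functions with holomorphic entries\<close>

text \<open>The dimensions are fixed for every u and not just on S, so that algebra with these
  functions needs no restriction on the argument.\<close>

definition mholo :: "complex set \<Rightarrow> (complex \<Rightarrow> complex mat) \<Rightarrow> nat \<Rightarrow> nat \<Rightarrow> bool" where
  "mholo S M n m \<longleftrightarrow> (\<forall>u. M u \<in> carrier_mat n m) \<and> (\<forall>i<n. \<forall>k<m. (\<lambda>u. M u $$ (i, k)) holomorphic_on S)"

lemma mholoI: "(\<And>u. dim_row (M u) = n) \<Longrightarrow> (\<And>u. dim_col (M u) = m) \<Longrightarrow>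
    (\<And>i k. i < n \<Longrightarrow> k < m \<Longrightarrow> (\<lambda>u. M u $$ (i, k)) holomorphic_on S) \<Longrightarrow> mholo S M n m"
  by (auto simp: mholo_def)

lemma mholoD: assumes "mholo S M n m"
  shows "dim_row (M u) = n" "dim_col (M u) = m" "i < n \<Longrightarrow> k < m \<Longrightarrow> (\<lambda>u. M u $$ (i, k)) holomorphic_on S"
  using assms by (auto simp: mholo_def)

lemma mholo_const: "A \<in> carrier_mat n m \<Longrightarrow> mholo S (\<lambda>u. A) n m"
  by (auto simp: mholo_def)

lemma mholo_mult:
  assumes A: "mholo S A n m" and B: "mholo S B m p"
  shows "mholo S (\<lambda>u. A u * B u) n p"
proof (rule mholoI)
  fix i k assume ik: "i < n" "k < p"
  have "(\<lambda>u. (A u * B u) $$ (i, k)) = (\<lambda>u. \<Sum>l<m. A u $$ (i, l) * B u $$ (l, k))"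
    using ik mholoD[OF A] mholoD[OF B] by (auto simp: mat_mult_index simp del: index_mult_mat(1))
  then show "(\<lambda>u. (A u * B u) $$ (i, k)) holomorphic_on S"
    using ik mholoD[OF A] mholoD[OF B] by (auto intro!: holomorphic_intros)
qed (use mholoD[OF A] mholoD[OF B] in auto)

lemma mholo_minus:
  assumes A: "mholo S A n m" and B: "mholo S B n m"
  shows "mholo S (\<lambda>u. A u - B u) n m"
  using mholoD[OF A] mholoD[OF B] by (intro mholoI) (auto intro!: holomorphic_intros)

lemma mholo_smult:
  assumes A: "mholo S A n m" and f: "f holomorphic_on S"
  shows "mholo S (\<lambda>u. f u \<cdot>\<^sub>m A u) n m"
  using mholoD[OF A] f by (intro mholoI) (auto intro!: holomorphic_intros)

lemma mholo_kron:
  assumes A: "mholo S A n m" and B: "mholo S B n' m'"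
  shows "mholo S (\<lambda>u. A u \<otimes>\<^sub>k B u) (n * n') (m * m')"
  using mholoD[OF A] mholoD[OF B]
  by (intro mholoI) (auto simp: kron_index div_mult_less mod_mult_less intro!: holomorphic_intros)

lemma mholo_embed2:
  assumes A: "mholo S A (ds ! x * ds ! y) (ds ! x * ds ! y)" and "x < length ds" "y < length ds"
  shows "mholo S (\<lambda>u. embed2 ds x y (A u)) (prod_list ds) (prod_list ds)"
proof (rule mholoI)
  fix i k assume ik: "i < prod_list ds" "k < prod_list ds"
  then show "(\<lambda>u. embed2 ds x y (A u) $$ (i, k)) holomorphic_on S"
    using mholoD(3)[OF A] assms by (cases "agree_off ds {x, y} i k") (auto simp: embed2_alt digit_less pair_index_less)
qed auto

lemma mholo_transpose:
  assumes A: "mholo S A n m"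
  shows "mholo S (\<lambda>u. (A u)\<^sup>T) m n"
  using mholoD[OF A] by (intro mholoI) auto

lemma mholo_compose:
  assumes A: "mholo T A n m" and f: "f holomorphic_on S" "f ` S \<subseteq> T"
  shows "mholo S (\<lambda>u. A (f u)) n m"
proof (rule mholoI)
  fix i k assume "i < n" "k < m"
  from holomorphic_on_compose_gen[OF f(1) mholoD(3)[OF A this] f(2)]
  show "(\<lambda>u. A (f u) $$ (i, k)) holomorphic_on S" by (simp add: o_def)
qed (use mholoD[OF A] in auto)

lemma mholo_rcore:
  assumes "r \<noteq> 0"
  shows "mholo (- {0}) (rcore r s) (2 * (s + 1)) (2 * (s + 1))"
proof (rule mholoI)
  fix i k assume ik: "i < 2 * (s + 1)" "k < 2 * (s + 1)"
  have pw: "pw r s j \<noteq> 0" for j using pw_nonzero[OF assms] .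
  show "(\<lambda>u. rcore r s u $$ (i, k)) holomorphic_on - {0}"
    using ik assms pw
    by (cases "i < s + 1"; cases "k < s + 1"; cases "i = k"; cases "i - Suc s = k - Suc s")
       (auto simp: rcore_def band_index intro!: holomorphic_intros)
qed auto

text \<open>Continuity at z suffices, as z is a limit of points outside the finite set.\<close>

lemma finite_exception_eq_0:
  fixes f :: "complex \<Rightarrow> complex"
  assumes f: "f holomorphic_on S" and S: "open S" "z \<in> S" and B: "finite B" "\<And>u. u \<in> S \<Longrightarrow> u \<notin> B \<Longrightarrow> f u = 0"
  shows "f z = 0"
proof -
  have "(f \<longlongrightarrow> f z) (at z)"
    using holomorphic_on_imp_continuous_on[OF f] S by (simp add: continuous_on_eq_continuous_at isContD)
  moreover have "eventually (\<lambda>u. f u = 0) (at z)"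
  proof -
    have "open (S - (B - {z}))" using S B by (intro open_Diff finite_imp_closed) auto
    then have "eventually (\<lambda>u. u \<in> S - (B - {z})) (at z)" using S by (intro eventually_at_in_open') auto
    moreover have "eventually (\<lambda>u. u \<noteq> z) (at z)" by (simp add: eventually_neq_at_within)
    ultimately show ?thesis by eventually_elim (use B in auto)
  qed
  ultimately show ?thesis
    using tendsto_unique[of "at z" f "f z" 0] tendsto_eventually by force
qed

lemma mholo_finite_exception:
  assumes M: "mholo S M n m" and S: "open S" "z \<in> S" and B: "finite B" "\<And>u. u \<in> S \<Longrightarrow> u \<notin> B \<Longrightarrow> M u = 0\<^sub>m n m"
  shows "M z = 0\<^sub>m n m"
proof (rule eq_matI)
  fix i k assume "i < dim_row (0\<^sub>m n m :: complex mat)" "k < dim_col (0\<^sub>m n m :: complex mat)"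
  then show "M z $$ (i, k) = 0\<^sub>m n m $$ (i, k)"
    using finite_exception_eq_0[OF mholoD(3)[OF M] S B(1), of i k] B(2) by auto
qed (use mholoD[OF M] in auto)

subsection \<open>Fusion\<close>

lemma mat_minus_mult_dim:
  fixes A B C :: "'a::ring mat"
  shows "dim_row A = dim_row B \<Longrightarrow> dim_col A = dim_col B \<Longrightarrow> dim_col B = dim_row C \<Longrightarrow> (A - B) * C = A * C - B * C"
  "dim_row A = dim_row B \<Longrightarrow> dim_col A = dim_col B \<Longrightarrow> dim_col C = dim_row A \<Longrightarrow> C * (A - B) = C * A - C * B"
  by (intro eq_matI; auto simp: scalar_prod_def sum_subtractf algebra_simps)+

text \<open>The complement of the image of the fusion map, and the action induced there.\<close>

lemma fused_defect_intertwines: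
  fixes Y Sg Th E F Sg' :: "complex mat"
  assumes d: "dim_row Y = n" "dim_col Y = m" "dim_row Sg = m" "dim_col Sg = m" "dim_row Th = n" "dim_col Th = n"
     "dim_row E = n" "dim_col E = l" "dim_row F = l" "dim_col F = n" "dim_row Sg' = l" "dim_col Sg' = l"
    and Y: "Y * Sg = Th * Y" and E: "E * Sg' = Th * E" and F: "F * E = 1\<^sub>m l"
  shows "(Y - E * (F * Y)) * Sg = (Th - E * (F * Th)) * (Y - E * (F * Y))"
proof -
  have 1: "Th * (E * (F * Y)) = E * (Sg' * (F * Y))"
    using d E by (metis mat_assoc_dim index_mult_mat(2,3))
  have 2: "F * (E * X) = X" if "dim_row X = l" for X
    using d F that by (metis mat_assoc_dim one_mult_dim)
  have "(Th - E * (F * Th)) * (Y - E * (F * Y)) =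
      (Th * Y - E * (F * (Th * Y))) - (Th * (E * (F * Y)) - E * (F * (Th * (E * (F * Y)))))"
    using d by (simp add: mat_minus_mult_dim mat_assoc_dim)
  also have "\<dots> = Th * Y - E * (F * (Th * Y))"
    unfolding 1 using d by (subst 2) (auto intro!: eq_matI)
  also have "\<dots> = (Y - E * (F * Y)) * Sg"
    using d by (simp add: mat_minus_mult_dim mat_assoc_dim Y)
  finally show ?thesis by simp
qed

text \<open>A vanishing defect means Y = E (F Y), so Y takes values in the image of E. There
  \<open>Th\<close> acts as \<open>Sg'\<close>, and F undoes E.\<close>

lemma fused_intertwines:
  fixes Y Sg Th E F Sg' :: "complex mat"
  assumes d: "dim_row Y = n" "dim_col Y = m" "dim_row Sg = m" "dim_col Sg = m" "dim_row Th = n" "dim_col Th = n"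
     "dim_row E = n" "dim_col E = l" "dim_row F = l" "dim_col F = n" "dim_row Sg' = l" "dim_col Sg' = l"
    and Y: "Y * Sg = Th * Y" and E: "E * Sg' = Th * E" and F: "F * E = 1\<^sub>m l" and Z: "Y - E * (F * Y) = 0\<^sub>m n m"
  shows "(F * Y) * Sg = Sg' * (F * Y)"
proof -
  have EFY: "E * (F * Y) = Y"
  proof (rule eq_matI)
    fix i k assume "i < dim_row Y" "k < dim_col Y"
    then show "(E * (F * Y)) $$ (i, k) = Y $$ (i, k)"
      using arg_cong[OF Z, of "\<lambda>M. M $$ (i, k)"] d by simp
  qed (use d in auto)
  have 2: "F * (E * X) = X" if "dim_row X = l" for X
    using d F that by (metis mat_assoc_dim one_mult_dim)
  have "(F * Y) * Sg = F * (Th * Y)" using d Y by (simp add: mat_assoc_dim)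
  also have "\<dots> = F * (Th * (E * (F * Y)))" by (simp add: EFY)
  also have "Th * (E * (F * Y)) = E * (Sg' * (F * Y))"
    using d E by (metis mat_assoc_dim index_mult_mat(2,3))
  also have "F * (E * (Sg' * (F * Y))) = Sg' * (F * Y)" using d by (intro 2) auto
  finally show ?thesis .
qed

lemma mult_kron_index:
  assumes "i < dim_row Z" "dim_col Z = dim_row M * dim_row N" "a < dim_col M" "b < dim_col N"
  shows "(Z * (M \<otimes>\<^sub>k N)) $$ (i, a * dim_col N + b) =
     (\<Sum>a'<dim_row M. \<Sum>b'<dim_row N. Z $$ (i, a' * dim_row N + b') * (M $$ (a', a) * N $$ (b', b)) :: complex)"
  using assms kron_index_pair[of _ M _ N a b] by (subst mat_mult_index) (auto simp: pair_index_less sum_lessThan_times)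

text \<open>The lowering operators of the two coproducts generate the tensor product from its highest weight vector.\<close>

lemma lowering_cyclic:
  assumes g: "generic r" and u: "u \<noteq> 0"
    and ne: "\<And>a b. a \<le> s \<Longrightarrow> b \<le> t \<Longrightarrow> u\<^sup>2 * (pw r s a)\<^sup>2 * (pw r t b)\<^sup>2 \<noteq> 1"
    and Z: "Z \<in> carrier_mat n ((s + 1) * (t + 1))" and T: "T1 \<in> carrier_mat n n" "T2 \<in> carrier_mat n n"
    and 1: "Z * cop r s t 0 (inverse u) 0 1 = T1 * Z" and 2: "Z * copop r s t 0 u 0 1 = T2 * Z"
    and 0: "\<And>i. i < n \<Longrightarrow> Z $$ (i, 0) = 0"
  shows "Z = 0\<^sub>m n ((s + 1) * (t + 1))"
proof -
  have r: "r \<noteq> 0" using g by (rule generic_nonzero)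
  define f where "f s i = inverse r * bco r s i * pw r s i" for s i
  define z where "z i a b = Z $$ (i, a * (t + 1) + b)" for i a b
  have f0: "f s i \<noteq> 0" if "i < s" for s i
    using bco_nonzero[OF g that] pw_nonzero[OF r] r by (simp add: f_def)
  have A: "Am r s 0 c $$ (i, k) = (if i = Suc k then c * f s k else 0)" if "i \<le> s" "k \<le> s" for s c i k
    using that by (auto simp: Am_index f_def pw_def)
  have D: "Dm r s $$ (i, k) = (if i = k then (pw r s k)\<^sup>2 else 0)" if "i \<le> s" "k \<le> s" for s i k
    using that by (auto simp: Dm_pw band_index power2_eq_square)
  have dZ: "dim_row Z = n" "dim_col Z = (s + 1) * (t + 1)" using Z by auto
  note del = sum.lessThan_Suc
  have c1: "(Z * (Am r s 0 c \<otimes>\<^sub>k 1\<^sub>m (t + 1))) $$ (i, a * (t + 1) + b) = (if a < s then c * f s a * z i (Suc a) b else 0)"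
    if "i < n" "a \<le> s" "b \<le> t" for i a b c
  proof -
    have "(Z * (Am r s 0 c \<otimes>\<^sub>k 1\<^sub>m (t + 1))) $$ (i, a * (t + 1) + b) =
       (\<Sum>a'<s + 1. \<Sum>b'<t + 1. Z $$ (i, a' * (t + 1) + b') * (Am r s 0 c $$ (a', a) * 1\<^sub>m (t + 1) $$ (b', b)))"
      using that dZ mult_kron_index[of i Z "Am r s 0 c" "1\<^sub>m (t + 1)" a b] by (simp del: del)
    also have "\<dots> = (\<Sum>a'<s + 1. \<Sum>b'<t + 1. if b' = b then (if a' = Suc a then z i (Suc a) b * (c * f s a) else 0) else 0)"
      using that by (intro sum.cong) (auto simp: A z_def)
    also have "\<dots> = (if a < s then c * f s a * z i (Suc a) b else 0)"
      using that by (simp del: del)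
    finally show ?thesis .
  qed
  have c2: "(Z * (Dm r s \<otimes>\<^sub>k Am r t 0 1)) $$ (i, a * (t + 1) + b) = (if b < t then (pw r s a)\<^sup>2 * f t b * z i a (Suc b) else 0)"
    if "i < n" "a \<le> s" "b \<le> t" for i a b
  proof -
    have "(Z * (Dm r s \<otimes>\<^sub>k Am r t 0 1)) $$ (i, a * (t + 1) + b) =
       (\<Sum>a'<s + 1. \<Sum>b'<t + 1. Z $$ (i, a' * (t + 1) + b') * (Dm r s $$ (a', a) * Am r t 0 1 $$ (b', b)))"
      using that dZ mult_kron_index[of i Z "Dm r s" "Am r t 0 1" a b] by (simp del: del)
    also have "\<dots> = (\<Sum>a'<s + 1. if a' = a then (\<Sum>b'<t + 1. if b' = Suc b then z i a (Suc b) * ((pw r s a)\<^sup>2 * f t b) else 0) else 0)"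
      using that by (intro sum.cong) (auto simp: A D z_def mult_delta_right simp del: del intro!: sum.neutral)
    also have "\<dots> = (if b < t then (pw r s a)\<^sup>2 * f t b * z i a (Suc b) else 0)"
      using that by (simp del: del)
    finally show ?thesis .
  qed
  have c3: "(Z * (1\<^sub>m (s + 1) \<otimes>\<^sub>k Am r t 0 1)) $$ (i, a * (t + 1) + b) = (if b < t then f t b * z i a (Suc b) else 0)"
    if "i < n" "a \<le> s" "b \<le> t" for i a b
  proof -
    have "(Z * (1\<^sub>m (s + 1) \<otimes>\<^sub>k Am r t 0 1)) $$ (i, a * (t + 1) + b) =
       (\<Sum>a'<s + 1. \<Sum>b'<t + 1. Z $$ (i, a' * (t + 1) + b') * (1\<^sub>m (s + 1) $$ (a', a) * Am r t 0 1 $$ (b', b)))"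
      using that dZ mult_kron_index[of i Z "1\<^sub>m (s + 1)" "Am r t 0 1" a b] by (simp del: del)
    also have "\<dots> = (\<Sum>a'<s + 1. if a' = a then (\<Sum>b'<t + 1. if b' = Suc b then z i a (Suc b) * f t b else 0) else 0)"
      using that by (intro sum.cong) (auto simp: A z_def mult_delta_right simp del: del intro!: sum.neutral)
    also have "\<dots> = (if b < t then f t b * z i a (Suc b) else 0)"
      using that by (simp del: del)
    finally show ?thesis .
  qed
  have c4: "(Z * (Am r s 0 c \<otimes>\<^sub>k Dm r t)) $$ (i, a * (t + 1) + b) = (if a < s then c * f s a * (pw r t b)\<^sup>2 * z i (Suc a) b else 0)"
    if "i < n" "a \<le> s" "b \<le> t" for i a b c
  proof -
    have "(Z * (Am r s 0 c \<otimes>\<^sub>k Dm r t)) $$ (i, a * (t + 1) + b) =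
       (\<Sum>a'<s + 1. \<Sum>b'<t + 1. Z $$ (i, a' * (t + 1) + b') * (Am r s 0 c $$ (a', a) * Dm r t $$ (b', b)))"
      using that dZ mult_kron_index[of i Z "Am r s 0 c" "Dm r t" a b] by (simp del: del)
    also have "\<dots> = (\<Sum>a'<s + 1. \<Sum>b'<t + 1. if b' = b then (if a' = Suc a then z i (Suc a) b * (c * f s a * (pw r t b)\<^sup>2) else 0) else 0)"
      using that by (intro sum.cong) (auto simp: A D z_def)
    also have "\<dots> = (if a < s then c * f s a * (pw r t b)\<^sup>2 * z i (Suc a) b else 0)"
      using that by (simp del: del)
    finally show ?thesis .
  qed
  have idx: "a * (t + 1) + b < (s + 1) * (t + 1)" if "a \<le> s" "b \<le> t" for a b
    using that by (intro pair_index_less) auto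
  \<comment> \<open>If column (a, b) vanishes, the two relations at that column involve only the
    neighbours (a + 1, b) and (a, b + 1). This 2 by 2 system has the determinant excluded by
    \<open>ne\<close>, up to a nonzero factor.\<close>
  have step: "(a < s \<longrightarrow> z i (Suc a) b = 0) \<and> (b < t \<longrightarrow> z i a (Suc b) = 0)"
    if z: "\<And>i. i < n \<Longrightarrow> z i a b = 0" and i: "i < n" and ab: "a \<le> s" "b \<le> t" for i a b
  proof -
    have T0: "(T' * Z) $$ (i, a * (t + 1) + b) = 0" if "T' \<in> carrier_mat n n" for T'
    proof -
      have "Z $$ (l, a * (t + 1) + b) = 0" if "l < n" for l using z[OF that] by (simp add: z_def)
      then show ?thesis using that dZ idx[OF ab] i by (subst mat_mult_index) auto
    qed
    define p where "p = (if a < s then f s a * z i (Suc a) b else 0)"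
    define w where "w = (if b < t then f t b * z i a (Suc b) else 0)"
    have "(Z * cop r s t 0 (inverse u) 0 1) $$ (i, a * (t + 1) + b) = inverse u * p + (pw r s a)\<^sup>2 * w"
      using i ab idx[OF ab] dZ by (simp add: cop_def mat_distrib_left_dim c1[simplified] c2[simplified] p_def w_def del: index_mult_mat(1))
    then have e1: "inverse u * p + (pw r s a)\<^sup>2 * w = 0" using 1 T0[OF T(1)] by simp
    have "(Z * copop r s t 0 u 0 1) $$ (i, a * (t + 1) + b) = w + u * (pw r t b)\<^sup>2 * p"
      using i ab idx[OF ab] dZ by (simp add: copop_def mat_distrib_left_dim c3[simplified] c4[simplified] p_def w_def del: index_mult_mat(1))
    then have e2: "w + u * (pw r t b)\<^sup>2 * p = 0" using 2 T0[OF T(2)] by simp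
    have "w = - (u * (pw r t b)\<^sup>2 * p)" using e2 by (simp add: eq_neg_iff_add_eq_0)
    with e1 have "inverse u * p - (pw r s a)\<^sup>2 * (u * (pw r t b)\<^sup>2 * p) = 0" by simp
    then have "u * (inverse u * p - (pw r s a)\<^sup>2 * (u * (pw r t b)\<^sup>2 * p)) = 0" by simp
    then have "(1 - u\<^sup>2 * (pw r s a)\<^sup>2 * (pw r t b)\<^sup>2) * p = 0" using u by (simp add: algebra_simps power2_eq_square)
    with ne[OF ab] have p: "p = 0" by simp
    with e2 have w: "w = 0" by simp
    from p w show ?thesis using f0 by (auto simp: p_def w_def)
  qed
  have all: "z i a b = 0" if "i < n" "a \<le> s" "b \<le> t" for i a b
    using that
  proof (induction "a + b" arbitrary: a b i)
    case 0
    then show ?case using 0 assms(9) by (simp add: z_def)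
  next
    case (Suc k)
    show ?case
    proof (cases a)
      case 0
      then obtain b' where "b = Suc b'" using Suc by (cases b) auto
      then show ?thesis using step[of a b' i] Suc 0 by auto
    next
      case (Suc a')
      then show ?thesis using step[of a' b i] Suc.hyps Suc.prems by auto
    qed
  qed
  show ?thesis
  proof (rule eq_matI)
    fix i k assume "i < dim_row (0\<^sub>m n ((s + 1) * (t + 1)) :: complex mat)" "k < dim_col (0\<^sub>m n ((s + 1) * (t + 1)) :: complex mat)"
    then have ik: "i < n" "k < (s + 1) * (t + 1)" by auto
    have "z i (k div (t + 1)) (k mod (t + 1)) = 0"
      using all[OF ik(1), of "k div (t + 1)" "k mod (t + 1)"] div_mult_less[OF ik(2)] mod_mult_less[OF ik(2)] by linarith
    then have "Z $$ (i, k) = 0" unfolding z_def div_mult_mod_eq .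
    then show "Z $$ (i, k) = 0\<^sub>m n ((s + 1) * (t + 1)) $$ (i, k)" using ik by simp
  qed (use dZ in auto)
qed

section \<open>Fusion of the R-matrix\<close>

text \<open>Sites 1 and 2 are the constituents being fused, site 3 is the other spin; Y and X stand
  for R_23 and R_13. In the threefold coproduct Y turns the part on sites 2 and 3, and X then the
  part on sites 1 and 3. The commutation hypotheses express that operators act on different sites or
  preserve the weight.\<close>

lemma three_site_intertwines:
  fixes A1 D1 A2 D2 A3 D3 X Y E Sg :: "complex mat"
  assumes d: "\<And>M. M \<in> {A1, D1, A2, D2, A3, D3, X, Y} \<Longrightarrow> dim_row M = n \<and> dim_col M = n"
    and d': "dim_row E = n" "dim_col E = m" "dim_row Sg = m" "dim_col Sg = m"
    and c: "Y * A1 = A1 * Y" "Y * D1 = D1 * Y" "X * A2 = A2 * X" "X * D2 = D2 * X" "A2 * D3 = D3 * A2" "A2 * D1 = D1 * A2"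
      "A1 * D2 = D2 * A1" "D1 * D2 = D2 * D1" "X * (D1 * D3) = D1 * D3 * X" "Y * (D2 * D3) = D2 * D3 * Y"
  shows
    "X * (A1 + D1 * A3) = (A3 + A1 * D3) * X \<Longrightarrow> Y * (A2 + D2 * A3) = (A3 + A2 * D3) * Y \<Longrightarrow>
      E * Sg = (A1 + D1 * A2 + D1 * D2 * A3) * E \<Longrightarrow> (X * (Y * E)) * Sg = (A3 + (A1 + D1 * A2) * D3) * (X * (Y * E))"
    "X * (A3 + A1 * D3) = (A1 + D1 * A3) * X \<Longrightarrow> Y * (A3 + A2 * D3) = (A2 + D2 * A3) * Y \<Longrightarrow>
      E * Sg = (A3 + (A2 + A1 * D2) * D3) * E \<Longrightarrow> (X * (Y * E)) * Sg = (A2 + A1 * D2 + D1 * D2 * A3) * (X * (Y * E))"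
proof -
  have dd: "dim_row A1 = n" "dim_col A1 = n" "dim_row D1 = n" "dim_col D1 = n" "dim_row A2 = n" "dim_col A2 = n"
    "dim_row D2 = n" "dim_col D2 = n" "dim_row A3 = n" "dim_col A3 = n" "dim_row D3 = n" "dim_col D3 = n"
    "dim_row X = n" "dim_col X = n" "dim_row Y = n" "dim_col Y = n"
    using d by auto
  note S = dd d' mat_assoc_dim
  have c2: "Y * (A1 * M) = A1 * (Y * M)" "Y * (D1 * M) = D1 * (Y * M)" "X * (A2 * M) = A2 * (X * M)" "X * (D2 * M) = D2 * (X * M)"
     "A2 * (D3 * M) = D3 * (A2 * M)" "A2 * (D1 * M) = D1 * (A2 * M)" "A1 * (D2 * M) = D2 * (A1 * M)" "D1 * (D2 * M) = D2 * (D1 * M)"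
     "X * (D1 * (D3 * M)) = D1 * (D3 * (X * M))" "Y * (D2 * (D3 * M)) = D2 * (D3 * (Y * M))"
    if "dim_row M = n" for M
  proof -
    have *: "P * (Q * M) = Q * (P * M)" if "P * Q = Q * P" "dim_row P = n" "dim_col P = n" "dim_row Q = n" "dim_col Q = n" for P Q
      using that \<open>dim_row M = n\<close> by (metis mat_assoc_dim)
    have **: "P * (Q * (R * M)) = Q * (R * (P * M))" if "P * (Q * R) = Q * R * P" "dim_row P = n" "dim_col P = n" "dim_row Q = n" "dim_col Q = n" "dim_row R = n" "dim_col R = n" for P Q R
      using *[of P "Q * R"] that \<open>dim_row M = n\<close> by (simp add: mat_assoc_dim)
    show "Y * (A1 * M) = A1 * (Y * M)" by (rule *[OF c(1)]) (simp_all add: dd)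
    show "Y * (D1 * M) = D1 * (Y * M)" by (rule *[OF c(2)]) (simp_all add: dd)
    show "X * (A2 * M) = A2 * (X * M)" by (rule *[OF c(3)]) (simp_all add: dd)
    show "X * (D2 * M) = D2 * (X * M)" by (rule *[OF c(4)]) (simp_all add: dd)
    show "A2 * (D3 * M) = D3 * (A2 * M)" by (rule *[OF c(5)]) (simp_all add: dd)
    show "A2 * (D1 * M) = D1 * (A2 * M)" by (rule *[OF c(6)]) (simp_all add: dd)
    show "A1 * (D2 * M) = D2 * (A1 * M)" by (rule *[OF c(7)]) (simp_all add: dd)
    show "D1 * (D2 * M) = D2 * (D1 * M)" by (rule *[OF c(8)]) (simp_all add: dd)
    show "X * (D1 * (D3 * M)) = D1 * (D3 * (X * M))" by (rule **[OF c(9)]) (simp_all add: dd)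
    show "Y * (D2 * (D3 * M)) = D2 * (D3 * (Y * M))" by (rule **[OF c(10)]) (simp_all add: dd)
  qed
  {
    assume h: "X * (A1 + D1 * A3) = (A3 + A1 * D3) * X" "Y * (A2 + D2 * A3) = (A3 + A2 * D3) * Y" "E * Sg = (A1 + D1 * A2 + D1 * D2 * A3) * E"
    have h1: "X * (A1 * M) + X * (D1 * (A3 * M)) = A3 * (X * M) + A1 * (D3 * (X * M))" if "dim_row M = n" for M
      using arg_cong[OF h(1), of "\<lambda>N. N * M"] that by (simp add: S mat_distrib_left_dim mat_distrib_right_dim)
    have h2: "Y * (A2 * M) + Y * (D2 * (A3 * M)) = A3 * (Y * M) + A2 * (D3 * (Y * M))" if "dim_row M = n" for M
      using arg_cong[OF h(2), of "\<lambda>N. N * M"] that by (simp add: S mat_distrib_left_dim mat_distrib_right_dim)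
    have "(X * (Y * E)) * Sg = X * (Y * (A1 * E)) + X * (D1 * (Y * (A2 * E) + Y * (D2 * (A3 * E))))"
      using h(3) by (simp add: S mat_distrib_left_dim mat_distrib_right_dim mat_add_assoc_dim c2(1-7,9,10))
    also have "Y * (A2 * E) + Y * (D2 * (A3 * E)) = A3 * (Y * E) + A2 * (D3 * (Y * E))"
      by (rule h2) (simp add: S)
    also have "X * (Y * (A1 * E)) + X * (D1 * (A3 * (Y * E) + A2 * (D3 * (Y * E)))) =
        (X * (A1 * (Y * E)) + X * (D1 * (A3 * (Y * E)))) + D1 * (D3 * (A2 * (X * (Y * E))))"
      by (simp add: S mat_distrib_left_dim mat_add_assoc_dim c2)
    also have "X * (A1 * (Y * E)) + X * (D1 * (A3 * (Y * E))) = A3 * (X * (Y * E)) + A1 * (D3 * (X * (Y * E)))"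
      by (rule h1) (simp add: S)
    also have "A3 * (X * (Y * E)) + A1 * (D3 * (X * (Y * E))) + D1 * (D3 * (A2 * (X * (Y * E)))) = (A3 + (A1 + D1 * A2) * D3) * (X * (Y * E))"
      by (simp add: S mat_distrib_right_dim mat_add_assoc_dim c2)
    finally show "(X * (Y * E)) * Sg = (A3 + (A1 + D1 * A2) * D3) * (X * (Y * E))" .
  }
  {
    assume h: "X * (A3 + A1 * D3) = (A1 + D1 * A3) * X" "Y * (A3 + A2 * D3) = (A2 + D2 * A3) * Y" "E * Sg = (A3 + (A2 + A1 * D2) * D3) * E"
    have h1: "X * (A3 * M) + X * (A1 * (D3 * M)) = A1 * (X * M) + D1 * (A3 * (X * M))" if "dim_row M = n" for M
      using arg_cong[OF h(1), of "\<lambda>N. N * M"] that by (simp add: S mat_distrib_left_dim mat_distrib_right_dim)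
    have h2: "Y * (A3 * M) + Y * (A2 * (D3 * M)) = A2 * (Y * M) + D2 * (A3 * (Y * M))" if "dim_row M = n" for M
      using arg_cong[OF h(2), of "\<lambda>N. N * M"] that by (simp add: S mat_distrib_left_dim mat_distrib_right_dim)
    have "(X * (Y * E)) * Sg = X * (Y * (A3 * E) + Y * (A2 * (D3 * E))) + X * (A1 * (D2 * (D3 * (Y * E))))"
      using h(3) c2(7)[of "D3 * E"] c2(1)[of "D2 * (D3 * E)"] c2(10)[of E]
      by (simp add: S mat_distrib_left_dim mat_distrib_right_dim mat_add_assoc_dim del: c2)
    also have "Y * (A3 * E) + Y * (A2 * (D3 * E)) = A2 * (Y * E) + D2 * (A3 * (Y * E))"
      by (rule h2) (simp add: S)
    also have "X * (A2 * (Y * E) + D2 * (A3 * (Y * E))) + X * (A1 * (D2 * (D3 * (Y * E)))) =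
       A2 * (X * (Y * E)) + D2 * (X * (A3 * (Y * E)) + X * (A1 * (D3 * (Y * E))))"
      by (simp add: S mat_distrib_left_dim mat_add_assoc_dim c2)
    also have "X * (A3 * (Y * E)) + X * (A1 * (D3 * (Y * E))) = A1 * (X * (Y * E)) + D1 * (A3 * (X * (Y * E)))"
      by (rule h1) (simp add: S)
    also have "A2 * (X * (Y * E)) + D2 * (A1 * (X * (Y * E)) + D1 * (A3 * (X * (Y * E)))) = (A2 + A1 * D2 + D1 * D2 * A3) * (X * (Y * E))"
      by (simp add: S mat_distrib_left_dim mat_distrib_right_dim mat_add_assoc_dim c2)
    finally show "(X * (Y * E)) * Sg = (A2 + A1 * D2 + D1 * D2 * A3) * (X * (Y * E))" .
  }
qed

lemma embed2_cop:
  assumes "x < length ds" "y < length ds" "x \<noteq> y" "ds ! x = s + 1" "ds ! y = t + 1"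
  shows "embed2 ds x y (cop r s t a b c d) = embed1 ds x (Am r s a b) + embed1 ds x (Dm r s) * embed1 ds y (Am r t c d)"
    "embed2 ds x y (copop r s t a b c d) = embed1 ds y (Am r t c d) + embed1 ds x (Am r s a b) * embed1 ds y (Dm r t)"
proof -
  have 1: "embed2 ds x y (Am r s a b \<otimes>\<^sub>k 1\<^sub>m (t + 1)) = embed1 ds x (Am r s a b)"
    using embed2_kron_one_right[of x ds y "Am r s a b"] assms by simp
  have 2: "embed2 ds x y (1\<^sub>m (s + 1) \<otimes>\<^sub>k Am r t c d) = embed1 ds y (Am r t c d)"
    using embed2_kron_one_left[of x ds y "Am r t c d"] assms by simp
  show "embed2 ds x y (cop r s t a b c d) = embed1 ds x (Am r s a b) + embed1 ds x (Dm r s) * embed1 ds y (Am r t c d)"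
    unfolding cop_def using assms by (subst embed2_add) (auto simp: 1[simplified] embed2_kron)
  show "embed2 ds x y (copop r s t a b c d) = embed1 ds y (Am r t c d) + embed1 ds x (Am r s a b) * embed1 ds y (Dm r t)"
    unfolding copop_def using assms by (subst embed2_add) (auto simp: 2[simplified] embed2_kron)
qed

text \<open>The highest weight vector is sent to a multiple of the highest weight vector.\<close>

definition col0 :: "complex mat \<Rightarrow> bool" where
  "col0 M \<longleftrightarrow> (\<forall>i<dim_row M. 0 < i \<longrightarrow> M $$ (i, 0) = 0)"

lemma col0_mult:
  assumes "col0 A" "col0 B" "dim_col A = dim_row B" "0 < dim_row B" "0 < dim_col B"
  shows "col0 (A * B)"
  unfolding col0_def
proof (intro allI impI)
  fix i assume i: "i < dim_row (A * B)" "0 < i"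
  have "A $$ (i, l) * B $$ (l, 0) = 0" if "l < dim_row B" for l
    using assms that i by (cases "l = 0") (auto simp: col0_def)
  then have "(\<Sum>l<dim_row B. A $$ (i, l) * B $$ (l, 0)) = 0" by (intro sum.neutral) auto
  then show "(A * B) $$ (i, 0) = 0"
    using assms i by (subst mat_mult_index) auto
qed

lemma col0_mult_00:
  assumes "col0 B" "dim_col A = dim_row B" "0 < dim_row A" "0 < dim_row B" "0 < dim_col B"
  shows "(A * B) $$ (0, 0) = A $$ (0, 0) * B $$ (0, 0)"
proof -
  have "(A * B) $$ (0, 0) = (\<Sum>l<dim_row B. A $$ (0, l) * B $$ (l, 0))"
    using assms by (subst mat_mult_index) auto
  also have "\<dots> = (\<Sum>l<dim_row B. if l = 0 then A $$ (0, 0) * B $$ (0, 0) else 0)"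
    using assms by (intro sum.cong) (auto simp: col0_def)
  finally have "(A * B) $$ (0, 0) = (\<Sum>l<dim_row B. if l = 0 then A $$ (0, 0) * B $$ (0, 0) else 0)" .
  then show ?thesis using assms by simp
qed

lemma col0_kron:
  assumes "col0 A" "col0 B" "0 < dim_col A" "0 < dim_col B"
  shows "col0 (A \<otimes>\<^sub>k B)"
  unfolding col0_def
proof (intro allI impI)
  fix i assume "i < dim_row (A \<otimes>\<^sub>k B)" "0 < i"
  then have i: "i < dim_row A * dim_row B" "0 < i" by auto
  have "0 < i div dim_row B \<or> 0 < i mod dim_row B"
    using i by (metis div_mult_mod_eq add.right_neutral mult_0 neq0_conv)
  then show "(A \<otimes>\<^sub>k B) $$ (i, 0) = 0"
    using i assms div_mult_less[OF i(1)] mod_mult_less[OF i(1)] by (auto simp: kron_index col0_def)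
qed

lemma col0_one: "col0 (1\<^sub>m n)"
  by (auto simp: col0_def)

lemma col0_smult: "col0 A \<Longrightarrow> 0 < dim_col A \<Longrightarrow> col0 (c \<cdot>\<^sub>m A)"
  by (auto simp: col0_def)

lemma col0_Emap: "col0 (Emap r s)"
  by (auto simp: col0_def Emap_index)

lemma col0_Fmap: "s \<ge> 1 \<Longrightarrow> col0 (Fmap r s)"
  by (auto simp: col0_def Fmap_index)

lemma digit_0: "digit ds 0 p = 0"
  by (simp add: digit_def)

lemma col0_embed2:
  assumes "col0 A" "dim_row A = ds ! x * ds ! y" "x < length ds" "y < length ds"
  shows "col0 (embed2 ds x y A)"
  unfolding col0_def
proof (intro allI impI)
  fix i assume "i < dim_row (embed2 ds x y A)" "0 < i"
  then have i: "i < prod_list ds" "0 < i" by auto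
  show "embed2 ds x y A $$ (i, 0) = 0"
  proof (cases "agree_off ds {x, y} i 0")
    case True
    have "digit ds i x \<noteq> 0 \<or> digit ds i y \<noteq> 0"
    proof (rule ccontr)
      assume "\<not> ?thesis"
      then have z: "digit ds i x = 0" "digit ds i y = 0" by auto
      have "i = 0"
      proof (rule digits_inject[OF i(1)])
        fix t assume "t < length ds"
        then show "digit ds i t = digit ds 0 t"
          using True z by (cases "t = x \<or> t = y") (auto simp: agree_off_def digit_0)
      qed (use i in auto)
      with i show False by simp
    qed
    moreover have "ds ! y \<noteq> 0" using digit_less[OF i(1) assms(4)] by simp
    ultimately have "0 < digit ds i x * ds ! y + digit ds i y" by auto
    then show ?thesis
      using assms i pair_index_less[OF digit_less[OF i(1) assms(3)] digit_less[OF i(1) assms(4)]]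
      by (auto simp: embed2_alt digit_0 col0_def)
  qed (use i in \<open>auto simp: embed2_alt\<close>)
qed

lemma dim_Rhalf: "r \<noteq> 0 \<Longrightarrow> s \<ge> 1 \<Longrightarrow> dim_row (Rhalf r s u) = 2 * (s + 1) \<and> dim_col (Rhalf r s u) = 2 * (s + 1)"
  by (simp add: Rhalf_eq)

lemma mholo_Rhalf: "r \<noteq> 0 \<Longrightarrow> s \<ge> 1 \<Longrightarrow> mholo (- {0}) (Rhalf r s) (2 * (s + 1)) (2 * (s + 1))"
proof -
  assume r: "r \<noteq> 0" and s: "s \<ge> 1"
  have "rpref r s holomorphic_on - {0}"
    unfolding rpref_def cfun_def using r by (auto intro!: holomorphic_intros)
  with mholo_smult[OF mholo_rcore[OF r]] have "mholo (- {0}) (\<lambda>u. rpref r s u \<cdot>\<^sub>m rcore r s u) (2 * (s + 1)) (2 * (s + 1))" by blast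
  moreover have "Rhalf r s = (\<lambda>u. rpref r s u \<cdot>\<^sub>m rcore r s u)" using Rhalf_eq[OF s r] by auto
  ultimately show ?thesis by simp
qed

lemma col0_Rhalf: "r \<noteq> 0 \<Longrightarrow> s \<ge> 1 \<Longrightarrow> col0 (Rhalf r s u)"
  by (simp add: Rhalf_eq col0_smult) (rule col0_smult, auto simp: col0_def rcore_column_0)

lemma Rhalf_intertwines:
  assumes g: "generic r" and s: "s \<ge> 1" and u: "u \<noteq> 0"
  shows "Rhalf r s u * cop r (Suc 0) s (u * a) (b * inverse u) a b = copop r (Suc 0) s (u * a) (b * inverse u) a b * Rhalf r s u"
    "Rhalf r s u * copop r (Suc 0) s (a * inverse u) (b * u) a b = cop r (Suc 0) s (a * inverse u) (b * u) a b * Rhalf r s u"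
    "Rhalf r s u * (Dm r (Suc 0) \<otimes>\<^sub>k Dm r s) = (Dm r (Suc 0) \<otimes>\<^sub>k Dm r s) * Rhalf r s u"
  using generic_nonzero[OF g] rcore_intertwines[OF g u, of s a b] rcore_weight[of r s u]
  by (simp_all add: Rhalf_eq[OF s] mat_smult_mult_left_dim mat_smult_mult_right_dim)

text \<open>The package carried through the induction on s: holomorphy to reach exceptional u,
  \<open>col0\<close> to start the propagation through columns, conservation of weight and the two
  coproduct relations for the next fusion step.\<close>

definition R_intertwining :: "complex \<Rightarrow> nat \<Rightarrow> nat \<Rightarrow> bool" where
  "R_intertwining r s t \<longleftrightarrow> mholo (- {0}) (Rmat r s t) ((s + 1) * (t + 1)) ((s + 1) * (t + 1)) \<and> (\<forall>u. col0 (Rmat r s t u)) \<and>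
     (\<forall>u. u \<noteq> 0 \<longrightarrow> Rmat r s t u * (Dm r s \<otimes>\<^sub>k Dm r t) = (Dm r s \<otimes>\<^sub>k Dm r t) * Rmat r s t u) \<and>
     (\<forall>u a b. u \<noteq> 0 \<longrightarrow>
        Rmat r s t u * cop r s t (u * a) (b * inverse u) a b = copop r s t (u * a) (b * inverse u) a b * Rmat r s t u \<and>
        Rmat r s t u * copop r s t (a * inverse u) (b * u) a b = cop r s t (a * inverse u) (b * u) a b * Rmat r s t u)"

lemma R_intertwining_1: "generic r \<Longrightarrow> t \<ge> 1 \<Longrightarrow> R_intertwining r (Suc 0) t"
proof -
  assume g: "generic r" and t: "t \<ge> 1"
  note r = generic_nonzero[OF g]
  have e: "Rmat r (Suc 0) t = Rhalf r t" by (rule ext) simp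
  show ?thesis
    unfolding R_intertwining_def e
    using mholo_Rhalf[OF r t] col0_Rhalf[OF r t] Rhalf_intertwines[OF g t] by (simp add: mult_2)
qed

lemma finite_square_eq: "c \<noteq> 0 \<Longrightarrow> finite {u :: complex. u\<^sup>2 * c = 1}"
proof -
  assume "c \<noteq> 0"
  then have "{u :: complex. u\<^sup>2 * c = 1} = {u. u ^ 2 = 1 / c}" by (auto simp: field_simps)
  then show ?thesis using finite_nth_roots[of 2 "1 / c"] by simp
qed

lemma R_intertwining_Suc:
  assumes g: "generic r" and t: "t \<ge> 1" and s: "s \<ge> 1" and IH: "R_intertwining r s t"
  shows "R_intertwining r (Suc s) t"
proof -
  define S where "S = Suc s"
  define ds where "ds = [2, S, t + 1]"
  define n where "n = prod_list ds"
  define E where "E = Emap r S \<otimes>\<^sub>k 1\<^sub>m (t + 1)"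
  define F where "F = Fmap r S \<otimes>\<^sub>k 1\<^sub>m (t + 1)"
  define X where "X u = embed2 ds 0 2 (Rhalf r t (u * r powi (1 - int S)))" for u
  define Y where "Y u = 1\<^sub>m 2 \<otimes>\<^sub>k Rmat r s t (u * r)" for u
  define V where "V u = X u * (Y u * E)" for u
  define m where "m = (S + 1) * (t + 1)"
  have r: "r \<noteq> 0" using generic_nonzero[OF g] .
  have S1: "S \<ge> 1" "S - 1 = s" by (simp_all add: S_def)
  obtain n' where n': "s = Suc n'" using s by (cases s) auto
  have IH': "mholo (- {0}) (Rmat r s t) ((s + 1) * (t + 1)) ((s + 1) * (t + 1))" "\<And>u. col0 (Rmat r s t u)"
     "\<And>u. u \<noteq> 0 \<Longrightarrow> Rmat r s t u * (Dm r s \<otimes>\<^sub>k Dm r t) = (Dm r s \<otimes>\<^sub>k Dm r t) * Rmat r s t u"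
     "\<And>u a b. u \<noteq> 0 \<Longrightarrow> Rmat r s t u * cop r s t (u * a) (b * inverse u) a b = copop r s t (u * a) (b * inverse u) a b * Rmat r s t u"
     "\<And>u a b. u \<noteq> 0 \<Longrightarrow> Rmat r s t u * copop r s t (a * inverse u) (b * u) a b = cop r s t (a * inverse u) (b * u) a b * Rmat r s t u"
    using IH by (auto simp: R_intertwining_def)
  note dR = mholoD(1,2)[OF IH'(1)]
  have nn: "n = 2 * S * (t + 1)" "prod_list ds = n" "length ds = 3" "ds ! 0 = 2" "ds ! 1 = S" "ds ! 2 = t + 1"
    by (simp_all add: n_def ds_def)
  note dH = dim_Rhalf[OF r t]
  have dims: "dim_row E = n" "dim_col E = m" "dim_row F = m" "dim_col F = n" "dim_row (X u) = n" "dim_col (X u) = n"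
    "dim_row (Y u) = n" "dim_col (Y u) = n" "dim_row (V u) = n" "dim_col (V u) = m" for u
    using dR by (simp_all add: E_def F_def X_def Y_def V_def nn m_def S_def)
  have Rm: "Rmat r S t u = F * V u" for u
    unfolding S_def n' Rmat.simps Let_def
    unfolding n'[symmetric] S_def[symmetric] ds_def[symmetric] E_def[symmetric] F_def[symmetric] X_def[symmetric] Y_def[symmetric]
    using dims by (simp add: V_def mat_assoc_dim)
  have FE: "F * E = 1\<^sub>m m"
    unfolding F_def E_def using Fmap_Emap[OF g S1(1)] by (subst kron_mult_kron) (auto simp: kron_one m_def)
  have e0: "embed1 ds 0 A = A \<otimes>\<^sub>k 1\<^sub>m (S * (t + 1))" if "A \<in> carrier_mat 2 2" for A
    unfolding ds_def using embed1_Cons_0[OF that, of "[S, t + 1]"] by simp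
  have e1: "embed1 ds 1 A = 1\<^sub>m 2 \<otimes>\<^sub>k (A \<otimes>\<^sub>k 1\<^sub>m (t + 1))" if "A \<in> carrier_mat S S" for A
    unfolding ds_def using embed1_Cons_Suc[of 0 "[S, t + 1]" 2 A] embed1_Cons_0[OF that, of "[t + 1]"] by simp
  have e2: "embed1 ds 2 A = 1\<^sub>m 2 \<otimes>\<^sub>k (1\<^sub>m S \<otimes>\<^sub>k A)" if "A \<in> carrier_mat (t + 1) (t + 1)" for A
    unfolding ds_def using embed1_Cons_Suc[of 1 "[S, t + 1]" 2 A] embed1_Cons_Suc[of 0 "[t + 1]" S A] embed1_Cons_0[OF that, of "[]"]
      kron_one_one(2)[of A] by (simp add: numeral_2_eq_2)
  have carr: "Am r (Suc 0) a b \<in> carrier_mat 2 2" "Dm r (Suc 0) \<in> carrier_mat 2 2" "Am r s a b \<in> carrier_mat S S" "Dm r s \<in> carrier_mat S S"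
     "Am r t a b \<in> carrier_mat (t + 1) (t + 1)" "Dm r t \<in> carrier_mat (t + 1) (t + 1)" for a b
    by (auto simp: S_def)
  define D1 where "D1 = embed1 ds 0 (Dm r (Suc 0))"
  define D2 where "D2 = embed1 ds 1 (Dm r s)"
  define D3 where "D3 = embed1 ds 2 (Dm r t)"
  have emb_dim: "dim_row (embed1 ds p A) = n" "dim_col (embed1 ds p A) = n" for p A using nn by simp_all
  have cY: "Y u * embed1 ds 0 A = embed1 ds 0 A * Y u" if "A \<in> carrier_mat 2 2" for A u
    unfolding e0[OF that] Y_def using that dR by (auto simp: kron_mult_kron S_def)
  have cX: "X u * embed1 ds 1 A = embed1 ds 1 A * X u" for A u
    unfolding X_def using embed1_commute_embed2[of 0 ds 2 1 A] nn by simp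
  have c12: "embed1 ds x A * embed1 ds y B = embed1 ds y B * embed1 ds x A"
    if "x < 3" "y < 3" "x \<noteq> y" "A \<in> carrier_mat (ds ! x) (ds ! x)" "B \<in> carrier_mat (ds ! y) (ds ! y)" for x y A B
    using embed1_commute[of y ds x B A] that nn by simp
  have XD: "X u * (D1 * D3) = D1 * D3 * X u" if u: "u \<noteq> 0" for u
  proof -
    have "embed2 ds 0 2 (Dm r (Suc 0) \<otimes>\<^sub>k Dm r t) = D1 * D3"
      unfolding D1_def D3_def using nn by (intro embed2_kron) auto
    moreover have "embed2 ds 0 2 (Rhalf r t w * (Dm r (Suc 0) \<otimes>\<^sub>k Dm r t)) = embed2 ds 0 2 (Rhalf r t w) * embed2 ds 0 2 (Dm r (Suc 0) \<otimes>\<^sub>k Dm r t)" for w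
      using nn dH by (intro embed2_mult) auto
    moreover have "embed2 ds 0 2 ((Dm r (Suc 0) \<otimes>\<^sub>k Dm r t) * Rhalf r t w) = embed2 ds 0 2 (Dm r (Suc 0) \<otimes>\<^sub>k Dm r t) * embed2 ds 0 2 (Rhalf r t w)" for w
      using nn dH by (intro embed2_mult) auto
    moreover have "embed2 ds 0 2 (Rhalf r t (u * r powi (1 - int S)) * (Dm r (Suc 0) \<otimes>\<^sub>k Dm r t)) =
        embed2 ds 0 2 ((Dm r (Suc 0) \<otimes>\<^sub>k Dm r t) * Rhalf r t (u * r powi (1 - int S)))"
      using u r by (subst Rhalf_intertwines(3)[OF g t]) simp_all
    ultimately show ?thesis
      unfolding X_def by metis
  qed
  have YD: "Y u * (D2 * D3) = D2 * D3 * Y u" if u: "u \<noteq> 0" for u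
  proof -
    have D: "D2 * D3 = 1\<^sub>m 2 \<otimes>\<^sub>k (Dm r s \<otimes>\<^sub>k Dm r t)"
      unfolding D2_def D3_def e1[OF carr(4)] e2[OF carr(6)] using S_def by (simp add: kron_mult_kron)
    show ?thesis unfolding Y_def D using dR IH'(3)[of "u * r"] u r by (simp add: kron_mult_kron)
  qed
  have VD: "V u * (Dm r S \<otimes>\<^sub>k Dm r t) = D1 * D2 * D3 * V u" if u: "u \<noteq> 0" for u
  proof -
    have E1: "E * (Dm r S \<otimes>\<^sub>k Dm r t) = D1 * D2 * D3 * E"
    proof -
      have "D1 * D2 * D3 = (Dm r (Suc 0) \<otimes>\<^sub>k Dm r s) \<otimes>\<^sub>k Dm r t"
        unfolding D1_def D2_def D3_def e0[OF carr(2)] e1[OF carr(4)] e2[OF carr(6)] kron_assoc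
        using kron_one[of S "t + 1", where 'a = complex] by (simp add: kron_mult_kron S_def flip: kron_one)
      then show ?thesis unfolding E_def using Emap_weight(1)[OF r S1(1)] S1(2) by (simp add: kron_mult_kron S_def)
    qed
    have "V u * (Dm r S \<otimes>\<^sub>k Dm r t) = X u * (Y u * (D1 * D2 * D3 * E))"
      unfolding V_def E1[symmetric] using dims by (simp add: mat_assoc_dim m_def)
    also have "\<dots> = X u * (D1 * (Y u * (D2 * D3) * E))"
    proof -
      have "Y u * (D1 * (D2 * D3 * E)) = D1 * (Y u * (D2 * D3 * E))"
        using cY[OF carr(2), folded D1_def, of u] dims emb_dim by (metis D1_def D2_def D3_def mat_assoc_dim index_mult_mat(2,3))
      then show ?thesis using dims emb_dim by (simp add: mat_assoc_dim D1_def D2_def D3_def)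
    qed
    also have "\<dots> = X u * (D1 * (D2 * (D3 * (Y u * E))))"
      unfolding YD[OF u] using dims emb_dim by (simp add: mat_assoc_dim D1_def D2_def D3_def)
    also have "\<dots> = D2 * (X u * (D1 * D3) * (Y u * E))"
    proof -
      have a: "D1 * (D2 * M) = D2 * (D1 * M)" if "dim_row M = n" for M
        using c12[of 0 1 "Dm r (Suc 0)" "Dm r s"] carr nn that emb_dim
        by (metis D1_def D2_def mat_assoc_dim one_less_numeral_iff semiring_norm(77) zero_less_numeral zero_neq_one)
      have b: "X u * (D2 * M) = D2 * (X u * M)" if "dim_row M = n" for M
        using cX[of u "Dm r s", folded D2_def] dims emb_dim that by (metis D2_def mat_assoc_dim)
      have dD: "dim_row D1 = n" "dim_col D1 = n" "dim_row D2 = n" "dim_col D2 = n" "dim_row D3 = n" "dim_col D3 = n"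
        by (simp_all add: D1_def D2_def D3_def nn(2))
      show ?thesis using dims dD by (simp add: mat_assoc_dim a b)
    qed
    also have "\<dots> = D1 * D2 * D3 * V u"
    proof -
      have a: "D1 * (D2 * M) = D2 * (D1 * M)" if "dim_row M = n" for M
        using c12[of 0 1 "Dm r (Suc 0)" "Dm r s"] carr nn that emb_dim
        by (metis D1_def D2_def mat_assoc_dim one_less_numeral_iff semiring_norm(77) zero_less_numeral zero_neq_one)
      have dD: "dim_row D1 = n" "dim_col D1 = n" "dim_row D2 = n" "dim_col D2 = n" "dim_row D3 = n" "dim_col D3 = n"
        by (simp_all add: D1_def D2_def D3_def nn(2))
      show ?thesis unfolding XD[OF u] V_def using dims dD by (simp add: mat_assoc_dim a)
    qed
    finally show ?thesis .
  qed
  have FD: "F * (D1 * D2 * D3) = (Dm r S \<otimes>\<^sub>k Dm r t) * F"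
  proof -
    have "D1 * D2 * D3 = (Dm r (Suc 0) \<otimes>\<^sub>k Dm r s) \<otimes>\<^sub>k Dm r t"
      unfolding D1_def D2_def D3_def e0[OF carr(2)] e1[OF carr(4)] e2[OF carr(6)] kron_assoc
      using kron_one[of S "t + 1", where 'a = complex] by (simp add: kron_mult_kron S_def flip: kron_one)
    then show ?thesis unfolding F_def using Emap_weight(2)[OF r S1(1)] S1(2) by (simp add: kron_mult_kron S_def)
  qed
  have weight: "Rmat r S t u * (Dm r S \<otimes>\<^sub>k Dm r t) = (Dm r S \<otimes>\<^sub>k Dm r t) * Rmat r S t u" if u: "u \<noteq> 0" for u
  proof -
    have dD: "dim_row D1 = n" "dim_col D1 = n" "dim_row D2 = n" "dim_col D2 = n" "dim_row D3 = n" "dim_col D3 = n"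
      by (simp_all add: D1_def D2_def D3_def nn(2))
    have "Rmat r S t u * (Dm r S \<otimes>\<^sub>k Dm r t) = F * (D1 * D2 * D3 * V u)"
      unfolding Rm VD[OF u, symmetric] using dims by (simp add: mat_assoc_dim m_def)
    also have "\<dots> = F * (D1 * D2 * D3) * V u" using dims dD by (simp add: mat_assoc_dim)
    also have "\<dots> = (Dm r S \<otimes>\<^sub>k Dm r t) * Rmat r S t u" unfolding FD Rm using dims by (simp add: mat_assoc_dim m_def)
    finally show ?thesis .
  qed
  have copk: "cop r (Suc 0) s a b c d \<otimes>\<^sub>k 1\<^sub>m (t + 1) = embed1 ds 0 (Am r (Suc 0) a b) + D1 * embed1 ds 1 (Am r s c d)"
    "copop r (Suc 0) s a b c d \<otimes>\<^sub>k 1\<^sub>m (t + 1) = embed1 ds 1 (Am r s c d) + embed1 ds 0 (Am r (Suc 0) a b) * D2" for a b c d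
    unfolding D1_def D2_def e0[OF carr(1)] e0[OF carr(2)] e1[OF carr(3)] e1[OF carr(4)] cop_def copop_def
    by (simp_all add: kron_add_left kron_assoc kron_mult_kron S_def kron_one numeral_2_eq_2
        del: mult_Suc mult_Suc_right)
  have one3: "1\<^sub>m (2 * S) \<otimes>\<^sub>k A = embed1 ds 2 A" if "A \<in> carrier_mat (t + 1) (t + 1)" for A
    unfolding e2[OF that] kron_one[symmetric] by (rule kron_assoc)
  have DDA: "(Dm r (Suc 0) \<otimes>\<^sub>k Dm r s) \<otimes>\<^sub>k A = D1 * D2 * embed1 ds 2 A" if "A \<in> carrier_mat (t + 1) (t + 1)" for A
    unfolding D1_def D2_def e0[OF carr(2)] e1[OF carr(4)] e2[OF that] kron_assoc
    using that kron_one[of S "t + 1", where 'a = complex] by (simp add: kron_mult_kron S_def flip: kron_one)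
  have split: "(M * N) \<otimes>\<^sub>k A = (M \<otimes>\<^sub>k 1\<^sub>m (t + 1)) * embed1 ds 2 A * (N \<otimes>\<^sub>k 1\<^sub>m (t + 1))"
    if "dim_row M = 2 * S" "dim_col M = 2 * S" "dim_row N = 2 * S" "A \<in> carrier_mat (t + 1) (t + 1)" for M N A
    unfolding one3[OF that(4), symmetric] using that by (simp add: kron_mult_kron)
  have split1: "(M * N) \<otimes>\<^sub>k 1\<^sub>m (t + 1) = (M \<otimes>\<^sub>k 1\<^sub>m (t + 1)) * (N \<otimes>\<^sub>k 1\<^sub>m (t + 1))"
    if "dim_col M = dim_row N" for M N :: "complex mat"
    using that by (simp add: kron_mult_kron)
  define A1 where "A1 a b = embed1 ds 0 (Am r (Suc 0) a b)" for a b
  define A2 where "A2 a b = embed1 ds 1 (Am r s a b)" for a b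
  define A3 where "A3 a b = embed1 ds 2 (Am r t a b)" for a b
  have sd: "dim_row D1 = n" "dim_col D1 = n" "dim_row D2 = n" "dim_col D2 = n" "dim_row D3 = n" "dim_col D3 = n"
    "dim_row (A1 a b) = n" "dim_col (A1 a b) = n" "dim_row (A2 a b) = n" "dim_col (A2 a b) = n"
    "dim_row (A3 a b) = n" "dim_col (A3 a b) = n" for a b
    by (simp_all add: D1_def D2_def D3_def A1_def A2_def A3_def nn(2))
  have Es: "Emap r S * Am r S a b = cop r (Suc 0) s (r powi (1 - int S) * a) (r powi (int S - 1) * b) (r * a) (inverse r * b) * Emap r S"
    "Emap r S * Am r S a b = copop r (Suc 0) s (r powi (int S - 1) * a) (r powi (1 - int S) * b) (inverse r * a) (r * b) * Emap r S"
    "Emap r S * Dm r S = (Dm r (Suc 0) \<otimes>\<^sub>k Dm r s) * Emap r S" for a b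
    using Emap_intertwines[OF g S1(1), of a b] Emap_weight(1)[OF r S1(1)] S1(2) by simp_all
  have cd: "dim_row (cop r (Suc 0) s a b c d) = 2 * S" "dim_col (cop r (Suc 0) s a b c d) = 2 * S"
     "dim_row (copop r (Suc 0) s a b c d) = 2 * S" "dim_col (copop r (Suc 0) s a b c d) = 2 * S" for a b c d
    by (simp_all add: S_def)
  have EA: "E * (Am r S a b \<otimes>\<^sub>k 1\<^sub>m (t + 1)) = (A1 (r powi (1 - int S) * a) (r powi (int S - 1) * b) + D1 * A2 (r * a) (inverse r * b)) * E"
    "E * (Am r S a b \<otimes>\<^sub>k 1\<^sub>m (t + 1)) = (A2 (inverse r * a) (r * b) + A1 (r powi (int S - 1) * a) (r powi (1 - int S) * b) * D2) * E"
    "E * (Am r S a b \<otimes>\<^sub>k Dm r t) = (A1 (r powi (1 - int S) * a) (r powi (int S - 1) * b) + D1 * A2 (r * a) (inverse r * b)) * D3 * E"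
    "E * (Am r S a b \<otimes>\<^sub>k Dm r t) = (A2 (inverse r * a) (r * b) + A1 (r powi (int S - 1) * a) (r powi (1 - int S) * b) * D2) * D3 * E" for a b
  proof -
    have k: "E * (Am r S a b \<otimes>\<^sub>k M) = (Emap r S * Am r S a b) \<otimes>\<^sub>k M" if "dim_row M = t + 1" for M
      unfolding E_def using that by (simp add: kron_mult_kron)
    show "E * (Am r S a b \<otimes>\<^sub>k 1\<^sub>m (t + 1)) = (A1 (r powi (1 - int S) * a) (r powi (int S - 1) * b) + D1 * A2 (r * a) (inverse r * b)) * E"
      unfolding A1_def A2_def copk(1)[symmetric] by (subst k, simp, subst Es(1), subst split1) (simp_all add: cd E_def S_def)
    show "E * (Am r S a b \<otimes>\<^sub>k 1\<^sub>m (t + 1)) = (A2 (inverse r * a) (r * b) + A1 (r powi (int S - 1) * a) (r powi (1 - int S) * b) * D2) * E"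
      unfolding A1_def A2_def copk(2)[symmetric] by (subst k, simp, subst Es(2), subst split1) (simp_all add: cd E_def S_def)
    show "E * (Am r S a b \<otimes>\<^sub>k Dm r t) = (A1 (r powi (1 - int S) * a) (r powi (int S - 1) * b) + D1 * A2 (r * a) (inverse r * b)) * D3 * E"
      unfolding A1_def A2_def copk(1)[symmetric] by (subst k, simp, subst Es(1), subst split) (simp_all add: cd E_def D3_def S_def)
    show "E * (Am r S a b \<otimes>\<^sub>k Dm r t) = (A2 (inverse r * a) (r * b) + A1 (r powi (int S - 1) * a) (r powi (1 - int S) * b) * D2) * D3 * E"
      unfolding A1_def A2_def copk(2)[symmetric] by (subst k, simp, subst Es(2), subst split) (simp_all add: cd E_def D3_def S_def)
  qed
  have ED: "E * (Dm r S \<otimes>\<^sub>k Am r t c d) = D1 * D2 * A3 c d * E" for c d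
  proof -
    have "E * (Dm r S \<otimes>\<^sub>k Am r t c d) = (Emap r S * Dm r S) \<otimes>\<^sub>k Am r t c d"
      unfolding E_def by (simp add: kron_mult_kron)
    also have "\<dots> = ((Dm r (Suc 0) \<otimes>\<^sub>k Dm r s) \<otimes>\<^sub>k Am r t c d) * E"
      unfolding Es(3) E_def by (simp add: kron_mult_kron S_def)
    finally show ?thesis unfolding DDA[OF carr(5)] A3_def .
  qed
  have E3: "E * (1\<^sub>m (S + 1) \<otimes>\<^sub>k Am r t c d) = A3 c d * E" for c d
    unfolding A3_def one3[OF carr(5), symmetric] E_def by (simp add: kron_mult_kron)
  have Edims: "dim_col E = m" "dim_row E = n" by (fact dims)+
  have Ecop: "E * cop r S t a b c d = (A1 (r powi (1 - int S) * a) (r powi (int S - 1) * b) + D1 * A2 (r * a) (inverse r * b) + D1 * D2 * A3 c d) * E"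
    "E * cop r S t a b c d = (A2 (inverse r * a) (r * b) + A1 (r powi (int S - 1) * a) (r powi (1 - int S) * b) * D2 + D1 * D2 * A3 c d) * E"
    "E * copop r S t a b c d = (A3 c d + (A1 (r powi (1 - int S) * a) (r powi (int S - 1) * b) + D1 * A2 (r * a) (inverse r * b)) * D3) * E"
    "E * copop r S t a b c d = (A3 c d + (A2 (inverse r * a) (r * b) + A1 (r powi (int S - 1) * a) (r powi (1 - int S) * b) * D2) * D3) * E" for a b c d
  proof -
    have k: "E * (M + N) = E * M + E * N" if "dim_row M = m" "dim_row N = m" "dim_col M = m" "dim_col N = m" for M N
      using that Edims by (intro mat_distrib_left_dim) auto
    have k': "(M + N) * E = M * E + N * E" if "dim_row M = n" "dim_row N = n" "dim_col M = n" "dim_col N = n" for M N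
      using that Edims by (intro mat_distrib_right_dim) auto
    have c: "E * cop r S t a b c d = E * (Am r S a b \<otimes>\<^sub>k 1\<^sub>m (t + 1)) + E * (Dm r S \<otimes>\<^sub>k Am r t c d)"
      unfolding cop_def by (rule k) (simp_all add: m_def)
    have o: "E * copop r S t a b c d = E * (1\<^sub>m (S + 1) \<otimes>\<^sub>k Am r t c d) + E * (Am r S a b \<otimes>\<^sub>k Dm r t)"
      unfolding copop_def by (rule k) (simp_all add: m_def)
    note kk = k'[of "_ + _" "_ * _ * _"] k'[of "A3 _ _" "_ * _"]
    show "E * cop r S t a b c d = (A1 (r powi (1 - int S) * a) (r powi (int S - 1) * b) + D1 * A2 (r * a) (inverse r * b) + D1 * D2 * A3 c d) * E"
      by (subst c, subst EA(1), subst ED, rule k'[symmetric]) (simp_all add: sd)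
    show "E * cop r S t a b c d = (A2 (inverse r * a) (r * b) + A1 (r powi (int S - 1) * a) (r powi (1 - int S) * b) * D2 + D1 * D2 * A3 c d) * E"
      by (subst c, subst EA(2), subst ED, rule k'[symmetric]) (simp_all add: sd)
    show "E * copop r S t a b c d = (A3 c d + (A1 (r powi (1 - int S) * a) (r powi (int S - 1) * b) + D1 * A2 (r * a) (inverse r * b)) * D3) * E"
      by (subst o, subst EA(3), subst E3, rule k'[symmetric]) (simp_all add: sd)
    show "E * copop r S t a b c d = (A3 c d + (A2 (inverse r * a) (r * b) + A1 (r powi (int S - 1) * a) (r powi (1 - int S) * b) * D2) * D3) * E"
      by (subst o, subst EA(4), subst E3, rule k'[symmetric]) (simp_all add: sd)
  qed
  have Xr: "X u * (A1 (w * a) (b * inverse w) + D1 * A3 a b) = (A3 a b + A1 (w * a) (b * inverse w) * D3) * X u"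
    "X u * (A3 a b + A1 (a * inverse w) (b * w) * D3) = (A1 (a * inverse w) (b * w) + D1 * A3 a b) * X u"
    if u: "u \<noteq> 0" and w: "w = u * r powi (1 - int S)" for u w a b
  proof -
    have w0: "w \<noteq> 0" using u r w by simp
    note e = embed2_cop[where x = 0 and ds = ds and y = 2 and s = "Suc 0" and t = t and r = r] and R = Rhalf_intertwines(1,2)[OF g t w0, of a b]
    have m1: "embed2 ds 0 2 (Rhalf r t w * M) = X u * embed2 ds 0 2 M" "embed2 ds 0 2 (M * Rhalf r t w) = embed2 ds 0 2 M * X u"
      if "M \<in> carrier_mat (2 * (t + 1)) (2 * (t + 1))" for M
      unfolding X_def w[symmetric] using nn dH that by (intro embed2_mult; auto)+
    show "X u * (A1 (w * a) (b * inverse w) + D1 * A3 a b) = (A3 a b + A1 (w * a) (b * inverse w) * D3) * X u"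
      using arg_cong[OF R(1), of "embed2 ds 0 2"] nn by (simp add: m1 e A1_def A3_def D1_def D3_def carrier_matI)
    show "X u * (A3 a b + A1 (a * inverse w) (b * w) * D3) = (A1 (a * inverse w) (b * w) + D1 * A3 a b) * X u"
      using arg_cong[OF R(2), of "embed2 ds 0 2"] nn by (simp add: m1 e A1_def A3_def D1_def D3_def carrier_matI)
  qed
  have k2: "1\<^sub>m 2 \<otimes>\<^sub>k cop r s t a b c d = A2 a b + D2 * A3 c d" "1\<^sub>m 2 \<otimes>\<^sub>k copop r s t a b c d = A3 c d + A2 a b * D3" for a b c d
    unfolding A2_def A3_def D2_def D3_def e1[OF carr(3)] e1[OF carr(4)] e2[OF carr(5)] e2[OF carr(6)] cop_def copop_def
    by (simp_all add: kron_add_right kron_mult_kron S_def)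
  have Yr: "Y u * (A2 (w * a) (b * inverse w) + D2 * A3 a b) = (A3 a b + A2 (w * a) (b * inverse w) * D3) * Y u"
    "Y u * (A3 a b + A2 (a * inverse w) (b * w) * D3) = (A2 (a * inverse w) (b * w) + D2 * A3 a b) * Y u"
    if u: "u \<noteq> 0" and w: "w = u * r" for u w a b
  proof -
    have w0: "w \<noteq> 0" using u r w by simp
    have m1: "1\<^sub>m 2 \<otimes>\<^sub>k (Rmat r s t w * M) = Y u * (1\<^sub>m 2 \<otimes>\<^sub>k M)" "1\<^sub>m 2 \<otimes>\<^sub>k (M * Rmat r s t w) = (1\<^sub>m 2 \<otimes>\<^sub>k M) * Y u"
      if "dim_row M = (s + 1) * (t + 1)" "dim_col M = (s + 1) * (t + 1)" for M
      unfolding Y_def w[symmetric] using dR that by (simp_all add: kron_mult_kron)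
    show "Y u * (A2 (w * a) (b * inverse w) + D2 * A3 a b) = (A3 a b + A2 (w * a) (b * inverse w) * D3) * Y u"
      using arg_cong[OF IH'(4)[OF w0, of a b], of "\<lambda>M. 1\<^sub>m 2 \<otimes>\<^sub>k M"] by (subst (asm) m1, simp, simp, subst (asm) m1, simp, simp, simp add: k2)
    show "Y u * (A3 a b + A2 (a * inverse w) (b * w) * D3) = (A2 (a * inverse w) (b * w) + D2 * A3 a b) * Y u"
      using arg_cong[OF IH'(5)[OF w0, of a b], of "\<lambda>M. 1\<^sub>m 2 \<otimes>\<^sub>k M"] by (subst (asm) m1, simp, simp, subst (asm) m1, simp, simp, simp add: k2)
  qed
  have c: "Y u * A1 a b = A1 a b * Y u" "Y u * D1 = D1 * Y u" "X u * A2 a b = A2 a b * X u" "X u * D2 = D2 * X u"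
    "A2 a b * D3 = D3 * A2 a b" "A2 a b * D1 = D1 * A2 a b" "A1 a b * D2 = D2 * A1 a b" "D1 * D2 = D2 * D1" for u a b
    unfolding A1_def A2_def D1_def D2_def D3_def using carr nn by (intro cY cX c12; simp)+
  have r_pow: "r powi (int S - 1) = inverse (r powi (1 - int S))"
    using power_int_minus[of r "1 - int S"] by simp
  \<comment> \<open>One operator \<open>Th\<close> serves both as the action on the left of V and as
    the unfused form of the opposite coproduct on \<E>; this is the input of the defect
    argument.\<close>
  have Va: "\<exists>Th. dim_row Th = n \<and> dim_col Th = n \<and> V u * cop r S t (u * a) (b * inverse u) a b = Th * V u \<and>
      E * copop r S t (u * a) (b * inverse u) a b = Th * E" if u: "u \<noteq> 0" for u a b
  proof -
    \<comment> \<open>The spectral parameter of the first constituent; that of the second is u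
      r.\<close>
    define w where "w = u * r powi (1 - int S)"
    have w: "r powi (1 - int S) * (u * a) = w * a" "r powi (int S - 1) * (b * inverse u) = b * inverse w"
      "r * (u * a) = (u * r) * a" "inverse r * (b * inverse u) = b * inverse (u * r)"
      using r u by (simp_all add: w_def r_pow)
    have "(X u * (Y u * E)) * cop r S t (u * a) (b * inverse u) a b =
       (A3 a b + (A1 (w * a) (b * inverse w) + D1 * A2 (u * r * a) (b * inverse (u * r))) * D3) * (X u * (Y u * E))"
      by (rule three_site_intertwines(1)[where n = n and m = m, OF _ _ _ _ _ c(1,2,3,4,5,6,7,8) XD[OF u] YD[OF u] Xr(1)[OF u w_def] Yr(1)[OF u refl]])
         (use dims sd Ecop(1)[of "u * a" "b * inverse u" a b] in \<open>auto simp: m_def w\<close>)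
    then show ?thesis
      using Ecop(3)[of "u * a" "b * inverse u" a b] sd unfolding V_def w
      by (intro exI[of _ "A3 a b + (A1 (w * a) (b * inverse w) + D1 * A2 (u * r * a) (b * inverse (u * r))) * D3"]) simp
  qed
  have Vb: "\<exists>Th. dim_row Th = n \<and> dim_col Th = n \<and> V u * copop r S t (a * inverse u) (b * u) a b = Th * V u \<and>
      E * cop r S t (a * inverse u) (b * u) a b = Th * E" if u: "u \<noteq> 0" for u a b
  proof -
    define w where "w = u * r powi (1 - int S)"
    have w: "r powi (1 - int S) * (b * u) = b * w" "r powi (int S - 1) * (a * inverse u) = a * inverse w"
      "r * (b * u) = b * (u * r)" "inverse r * (a * inverse u) = a * inverse (u * r)"
      using r u by (simp_all add: w_def r_pow)
    have "(X u * (Y u * E)) * copop r S t (a * inverse u) (b * u) a b =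
       (A2 (a * inverse (u * r)) (b * (u * r)) + A1 (a * inverse w) (b * w) * D2 + D1 * D2 * A3 a b) * (X u * (Y u * E))"
      by (rule three_site_intertwines(2)[where n = n and m = m, OF _ _ _ _ _ c(1,2,3,4,5,6,7,8) XD[OF u] YD[OF u] Xr(2)[OF u w_def] Yr(2)[OF u refl]])
         (use dims sd Ecop(4)[of "a * inverse u" "b * u" a b] in \<open>auto simp: m_def w\<close>)
    then show ?thesis
      using Ecop(2)[of "a * inverse u" "b * u" a b] sd unfolding V_def w
      by (intro exI[of _ "A2 (a * inverse (u * r)) (b * (u * r)) + A1 (a * inverse w) (b * w) * D2 + D1 * D2 * A3 a b"]) simp
  qed
  have hX: "mholo (- {0}) X n n"
  proof -
    have "mholo (- {0}) (\<lambda>u. Rhalf r t (u * r powi (1 - int S))) (2 * (t + 1)) (2 * (t + 1))"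
      using r by (intro mholo_compose[OF mholo_Rhalf[OF r t]]) (auto intro!: holomorphic_intros)
    then show ?thesis
      unfolding X_def using mholo_embed2[of "- {0}" "\<lambda>u. Rhalf r t (u * r powi (1 - int S))" ds 0 2] nn by simp
  qed
  have hR: "mholo (- {0}) (\<lambda>u. Rmat r s t (u * r)) ((s + 1) * (t + 1)) ((s + 1) * (t + 1))"
    using r by (intro mholo_compose[OF IH'(1)]) (auto intro!: holomorphic_intros)
  have hY: "mholo (- {0}) Y n n"
    unfolding Y_def using mholo_kron[OF mholo_const[of "1\<^sub>m 2" 2 2] hR] by (simp add: nn S_def mult.assoc)
  have hV: "mholo (- {0}) V n m"
    unfolding V_def using dims by (intro mholo_mult[OF hX] mholo_mult[OF hY] mholo_const) auto
  have hF: "mholo (- {0}) (\<lambda>u. F * V u) m m"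
    using dims by (intro mholo_mult[OF _ hV] mholo_const) auto
  have hZ: "mholo (- {0}) (\<lambda>u. V u - E * (F * V u)) n m"
    using dims by (intro mholo_minus[OF hV] mholo_mult[OF _ hF] mholo_const) auto
  have cE: "col0 E" "col0 F"
    unfolding E_def F_def by (intro col0_kron col0_Emap col0_Fmap col0_one S1; simp add: S_def)+
  have cXY: "col0 (X u)" "col0 (Y u)" for u
    unfolding X_def Y_def using nn dH dR
    by (intro col0_embed2 col0_Rhalf[OF r t] col0_kron col0_one IH'(2); simp)+
  have pos: "0 < n" "0 < m" using nn by (simp_all add: m_def S_def)
  have cV: "col0 (V u)" for u
    unfolding V_def using dims pos by (intro col0_mult cXY cE) auto
  have cFV: "col0 (F * V u)" for u
    using dims pos by (intro col0_mult cE cV) auto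
  have E00: "E $$ (0, 0) = 1" "F $$ (0, 0) = 1"
    using S1 by (simp_all add: E_def F_def kron_index Emap_index Fmap_index)
  \<comment> \<open>V maps the first basis vector to a multiple of the first one, and \<E>\<F> fixes
    that vector; hence the defect kills it.\<close>
  have Z0: "(V u - E * (F * V u)) $$ (i, 0) = 0" if "i < n" for i u
  proof (cases "i = 0")
    case True
    then show ?thesis using col0_mult_00[OF cFV, of E u] col0_mult_00[OF cV, of F u] dims pos E00
      by simp
  next
    case False
    have "col0 (E * (F * V u))" using dims pos by (intro col0_mult cE cFV) auto
    then show ?thesis using False that cV[of u] dims pos by (simp add: col0_def)
  qed
  \<comment> \<open>The finitely many u at which the determinant in \<open>lowering_cyclic\<close>
    vanishes.\<close>
  define B where "B = (\<Union>a\<in>{..S}. \<Union>b\<in>{..t}. {u :: complex. u\<^sup>2 * ((pw r S a)\<^sup>2 * (pw r t b)\<^sup>2) = 1})"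
  have "finite B"
    unfolding B_def using pw_nonzero[OF r] by (intro finite_UN_I finite_square_eq) auto
  have Zgen: "V u - E * (F * V u) = 0\<^sub>m n m" if u: "u \<noteq> 0" and nb: "u \<notin> B" for u
  proof -
    \<comment> \<open>The coefficients 0 and 1 leave the pure lowering operators.\<close>
    obtain Th where Th: "dim_row Th = n" "dim_col Th = n" "V u * cop r S t (u * 0) (1 * inverse u) 0 1 = Th * V u"
      "E * copop r S t (u * 0) (1 * inverse u) 0 1 = Th * E" using Va[OF u, of 0 1] by blast
    obtain Th' where Th': "dim_row Th' = n" "dim_col Th' = n" "V u * copop r S t (0 * inverse u) (1 * u) 0 1 = Th' * V u"
      "E * cop r S t (0 * inverse u) (1 * u) 0 1 = Th' * E" using Vb[OF u, of 0 1] by blast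
    have 1: "(V u - E * (F * V u)) * cop r S t (u * 0) (1 * inverse u) 0 1 = (Th - E * (F * Th)) * (V u - E * (F * V u))"
      by (rule fused_defect_intertwines[where n = n and m = m and l = m, OF _ _ _ _ _ _ _ _ _ _ _ _ Th(3,4) FE]) (use dims Th in \<open>simp_all add: m_def\<close>)
    have 2: "(V u - E * (F * V u)) * copop r S t (0 * inverse u) (1 * u) 0 1 = (Th' - E * (F * Th')) * (V u - E * (F * V u))"
      by (rule fused_defect_intertwines[where n = n and m = m and l = m, OF _ _ _ _ _ _ _ _ _ _ _ _ Th'(3,4) FE]) (use dims Th' in \<open>simp_all add: m_def\<close>)
    show ?thesis
      unfolding m_def
    proof (rule lowering_cyclic[OF g u])
      show "u\<^sup>2 * (pw r S a)\<^sup>2 * (pw r t b)\<^sup>2 \<noteq> 1" if "a \<le> S" "b \<le> t" for a b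
        using nb that by (auto simp: B_def mult.assoc)
      show "(V u - E * (F * V u)) * cop r S t 0 (inverse u) 0 1 = (Th - E * (F * Th)) * (V u - E * (F * V u))" using 1 by simp
      show "(V u - E * (F * V u)) * copop r S t 0 u 0 1 = (Th' - E * (F * Th')) * (V u - E * (F * V u))" using 2 by simp
    qed (use dims Th Th' Z0 in \<open>auto simp: m_def\<close>)
  qed
  have Zall: "V u - E * (F * V u) = 0\<^sub>m n m" if "u \<noteq> 0" for u
    by (rule mholo_finite_exception[OF hZ _ _ \<open>finite B\<close>]) (use that Zgen in auto)
  have RF: "Rmat r S t = (\<lambda>u. F * V u)" using Rm by auto
  show ?thesis
    unfolding R_intertwining_def S_def[symmetric]
  proof (intro conjI allI impI)
    show "mholo (- {0}) (Rmat r S t) ((S + 1) * (t + 1)) ((S + 1) * (t + 1))"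
      unfolding RF using hF by (simp add: m_def)
    show "col0 (Rmat r S t u)" for u unfolding Rm by (rule cFV)
    show "Rmat r S t u * (Dm r S \<otimes>\<^sub>k Dm r t) = (Dm r S \<otimes>\<^sub>k Dm r t) * Rmat r S t u" if "u \<noteq> 0" for u
      using weight[OF that] .
    fix u a b :: complex assume u: "u \<noteq> 0"
    obtain Th where Th: "dim_row Th = n" "dim_col Th = n" "V u * cop r S t (u * a) (b * inverse u) a b = Th * V u"
      "E * copop r S t (u * a) (b * inverse u) a b = Th * E" using Va[OF u, of a b] by blast
    show "Rmat r S t u * cop r S t (u * a) (b * inverse u) a b = copop r S t (u * a) (b * inverse u) a b * Rmat r S t u"
      unfolding Rm
      by (rule fused_intertwines[where n = n and m = m and l = m, OF _ _ _ _ _ _ _ _ _ _ _ _ Th(3,4) FE Zall[OF u]]) (use dims Th in \<open>simp_all add: m_def\<close>)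
    obtain Th' where Th': "dim_row Th' = n" "dim_col Th' = n" "V u * copop r S t (a * inverse u) (b * u) a b = Th' * V u"
      "E * cop r S t (a * inverse u) (b * u) a b = Th' * E" using Vb[OF u, of a b] by blast
    show "Rmat r S t u * copop r S t (a * inverse u) (b * u) a b = cop r S t (a * inverse u) (b * u) a b * Rmat r S t u"
      unfolding Rm
      by (rule fused_intertwines[where n = n and m = m and l = m, OF _ _ _ _ _ _ _ _ _ _ _ _ Th'(3,4) FE Zall[OF u]]) (use dims Th' in \<open>simp_all add: m_def\<close>)
  qed
qed

lemma R_intertwining:
  assumes g: "generic r" and t: "t \<ge> 1" and s: "s \<ge> 1"
  shows "R_intertwining r s t"
  using s
proof (induction s rule: nat_induct_at_least)
  case base
  then show ?case using R_intertwining_1[OF g t] by simp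
next
  case (Suc s)
  then show ?case by (intro R_intertwining_Suc[OF g t]) auto
qed

subsection \<open>Inversion of the deformation parameter\<close>

text \<open>As q-integers are even in the exponent of q, the spin amplitudes and the fusion maps are
  common to q and 1/q; only the weights get inverted.\<close>

lemma qnum_inverse: "qnum (inverse r) t = qnum r t"
proof -
  have "qnum (inverse r) t = (r powi (- t) - r powi t) / (inverse (r\<^sup>2) - r\<^sup>2)"
    by (simp add: qnum_def power_int_inverse power_int_minus power_inverse)
  also have "\<dots> = (- (r powi t - r powi (- t))) / (- (r\<^sup>2 - inverse (r\<^sup>2)))" by simp
  also have "\<dots> = qnum r t" unfolding minus_divide_divide by (simp add: qnum_def)
  finally show ?thesis .
qed

lemma Bcoef_inverse: "Bcoef (inverse r) s t = Bcoef r s t"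
  by (simp add: Bcoef_def qnum_inverse)

lemma fus_inverse: "fus_diag (inverse r) s n = fus_diag r s n" "fus_low (inverse r) s n = fus_low r s n"
  "fus_inv (inverse r) s n = fus_inv r s n"
  by (simp_all add: fus_diag_def fus_low_def fus_inv_def Bcoef_inverse qnum_inverse)

lemma Emap_inverse: "Emap (inverse r) s = Emap r s" "Fmap (inverse r) s = Fmap r s"
  unfolding Emap_def Fmap_def fus_inverse by simp_all

lemma bco_inverse: "bco (inverse r) s i = bco r s i"
  by (simp add: bco_def Bcoef_inverse)

lemma pw_inverse: "pw (inverse r) s i = inverse (pw r s i)"
  by (simp add: pw_def power_int_inverse)

lemma qh_inverse: "qh (inverse r) = - qh r"
  by (simp add: qh_def power_inverse)

text \<open>The diagonal entries are odd under inversion of u, r and the weights, and the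
  off-diagonal ones change sign through q - 1/q.\<close>

lemma rcore_inverse: "r \<noteq> 0 \<Longrightarrow> rcore (inverse r) s (inverse u) = (- 1) \<cdot>\<^sub>m rcore r s u"
  unfolding rcore_def
  by (rule eq_matI) (auto simp: band_index bco_inverse pw_inverse qh_inverse)

lemma cfun_inverse: "cfun (inverse u) = - cfun u"
  by (simp add: cfun_def)

lemma rpref_inverse: "rpref (inverse r) s (inverse u) = (- 1) ^ (s - 1) * rpref r s u"
proof -
  have "cfun (inverse u * inverse r powi k) = - cfun (u * r powi k)" for k
    using cfun_inverse[of "u * r powi k"] by (simp add: power_int_inverse)
  then show ?thesis by (simp add: rpref_def prod.distrib prod_uminus)
qed

lemma Rhalf_inverse:
  "r \<noteq> 0 \<Longrightarrow> s \<ge> 1 \<Longrightarrow> Rhalf (inverse r) s (inverse u) = ((- 1) ^ (s - 1) * (- 1)) \<cdot>\<^sub>m Rhalf r s u"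
  by (simp add: Rhalf_eq rcore_inverse rpref_inverse mat_smult_smult mult_ac del: mult_minus1_right mult_minus1)

lemma embed2_smult_dim:
  assumes "x < length ds" "y < length ds" "dim_row A = ds ! x * ds ! y" "dim_col A = ds ! x * ds ! y"
  shows "embed2 ds x y (c \<cdot>\<^sub>m A) = c \<cdot>\<^sub>m embed2 ds x y A"
  using assms by (intro embed2_smult) auto

text \<open>The constant is a product of the signs collected at the fusion steps. What matters is
  that it does not depend on u.\<close>

lemma Rmat_inverse:
  assumes g: "generic r" and t: "t \<ge> 1" and s: "s \<ge> 1"
  shows "\<exists>c. c \<noteq> 0 \<and> (\<forall>u. Rmat (inverse r) s t (inverse u) = c \<cdot>\<^sub>m Rmat r s t u)"
  using s
proof (induction s rule: nat_induct_at_least)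
  case base
  have r: "r \<noteq> 0" using generic_nonzero[OF g] .
  show ?case using Rhalf_inverse[OF r t] by (intro exI[of _ "(- 1) ^ (t - 1) * (- 1)"]) simp
next
  case (Suc s)
  then obtain c where c: "c \<noteq> 0" "\<And>u. Rmat (inverse r) s t (inverse u) = c \<cdot>\<^sub>m Rmat r s t u" by auto
  have r: "r \<noteq> 0" using generic_nonzero[OF g] .
  obtain n where n: "s = Suc n" using Suc.hyps by (cases s) auto
  have d: "dim_row (Rmat r s t u) = Suc s * (t + 1)" "dim_col (Rmat r s t u) = Suc s * (t + 1)" for u
    using mholoD(1,2) R_intertwining[OF g t Suc.hyps] by (auto simp: R_intertwining_def)
  note dH = dim_Rhalf[OF r t]
  define e where "e = (- 1) ^ (t - 1) * (- 1 :: complex)"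
  have "Rmat (inverse r) (Suc s) t (inverse u) = (e * c) \<cdot>\<^sub>m Rmat r (Suc s) t u" for u
  proof -
    have 1: "inverse u * inverse r powi k = inverse (u * r powi k)" "inverse u * inverse r = inverse (u * r)" for k
      by (simp_all add: power_int_inverse)
    show ?thesis
      unfolding n Rmat.simps Let_def 1 Rhalf_inverse[OF r t] Emap_inverse e_def[symmetric]
      unfolding n[symmetric] c(2)
      using d dH
      by (simp add: embed2_smult_dim kron_smult_right mat_smult_mult_left_dim mat_smult_mult_right_dim mat_smult_smult mult_ac)
  qed
  moreover have "e * c \<noteq> 0" using c by (simp add: e_def)
  ultimately show ?case by blast
qed

subsection \<open>K-matrices\<close>

lemma dim_Khalf [simp]: "dim_row (Khalf r \<kappa> u) = 2" "dim_col (Khalf r \<kappa> u) = 2"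
  by (simp_all add: Khalf_def mat_of_rows_list_def)

lemma dim_Kmat [simp]: "dim_row (Kmat r \<kappa> s u) = s + 1" "dim_col (Kmat r \<kappa> s u) = s + 1"
  by (induction r \<kappa> s u rule: Kmat.induct) (simp_all add: Let_def)

definition swap_eps :: "bparams \<Rightarrow> bparams" where
  "swap_eps \<kappa> = BParams (kp \<kappa>) (km \<kappa>) (em \<kappa>) (ep \<kappa>)"

lemma one_smult_mat: "1 \<cdot>\<^sub>m A = (A :: 'a::semiring_1 mat)"
  by (intro eq_matI) auto

text \<open>Both c(u^2) and q - 1/q change sign, so their ratio stays; exchanging the two \<epsilon>
  compensates the inversion of u on the diagonal.\<close>

lemma Khalf_inverse: "Khalf (inverse r) (swap_eps \<kappa>) (inverse u) = Khalf r \<kappa> u"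
proof -
  have "cfun ((inverse u)\<^sup>2) / ((inverse r)\<^sup>2 - inverse ((inverse r)\<^sup>2)) = cfun (u\<^sup>2) / (r\<^sup>2 - inverse (r\<^sup>2))"
  proof -
    have "cfun ((inverse u)\<^sup>2) / ((inverse r)\<^sup>2 - inverse ((inverse r)\<^sup>2)) = (- cfun (u\<^sup>2)) / (- (r\<^sup>2 - inverse (r\<^sup>2)))"
      using cfun_inverse[of "u\<^sup>2"] by (simp add: power_inverse)
    then show ?thesis unfolding minus_divide_divide .
  qed
  then have *: "z * cfun ((inverse u)\<^sup>2) / ((inverse r)\<^sup>2 - inverse ((inverse r)\<^sup>2)) = z * cfun (u\<^sup>2) / (r\<^sup>2 - inverse (r\<^sup>2))" for z
    by (metis times_divide_eq_right)
  show ?thesis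
    unfolding Khalf_def * by (simp add: swap_eps_def add.commute)
qed

lemma Kmat_inverse:
  assumes r: "r \<noteq> 0"
  shows "\<exists>c. c \<noteq> 0 \<and> (\<forall>u. Kmat (inverse r) (swap_eps \<kappa>) s (inverse u) = c \<cdot>\<^sub>m Kmat r \<kappa> s u)"
proof (induction s)
  case 0
  show ?case by (rule exI[of _ 1]) (simp add: one_smult_mat)
next
  case (Suc s)
  then obtain c where c: "c \<noteq> 0" "\<And>u. Kmat (inverse r) (swap_eps \<kappa>) s (inverse u) = c \<cdot>\<^sub>m Kmat r \<kappa> s u" by auto
  show ?case
  proof (cases s)
    case 0
    then show ?thesis by (intro exI[of _ 1]) (simp add: Khalf_inverse one_smult_mat)
  next
    case n: (Suc n)
    define e where "e = (- 1) ^ (s - 1) * (- 1 :: complex)"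
    have s1: "s \<ge> 1" using n by simp
    note dH = dim_Rhalf[OF r s1]
    have "Kmat (inverse r) (swap_eps \<kappa>) (Suc s) (inverse u) = (e * c) \<cdot>\<^sub>m Kmat r \<kappa> (Suc s) u" for u
    proof -
      have 1: "inverse u * inverse r powi k = inverse (u * r powi k)" "inverse u * inverse r = inverse (u * r)"
        "(inverse u)\<^sup>2 * inverse r powi k = inverse (u\<^sup>2 * r powi k)" for k
        by (simp_all add: power_int_inverse power_inverse)
      show ?thesis
        unfolding n Kmat.simps Let_def
        unfolding n[symmetric] 1 Rhalf_inverse[OF r s1] Emap_inverse e_def[symmetric] Khalf_inverse c(2)
        using dH
        by (simp add: kron_smult_right mat_smult_mult_left_dim mat_smult_mult_right_dim mat_smult_smult mult_ac)
    qed
    moreover have "e * c \<noteq> 0" using c by (simp add: e_def)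
    ultimately show ?thesis by blast
  qed
qed

text \<open>The boundary parameters may vary together with the spectral parameter, because
  continuation takes place in u as well as in the parameters.\<close>

lemma mholo_Kmat:
  assumes r: "r \<noteq> 0" and p: "a holomorphic_on S" "b holomorphic_on S" "c holomorphic_on S" "d holomorphic_on S"
    and f: "f holomorphic_on S" "0 \<notin> f ` S"
  shows "mholo S (\<lambda>z. Kmat r (BParams (a z) (b z) (c z) (d z)) s (f z)) (s + 1) (s + 1)"
  using f
proof (induction s arbitrary: f)
  case 0
  then show ?case by (simp add: mholo_const)
next
  case (Suc s)
  have K: "mholo S (\<lambda>z. Khalf r (BParams (a z) (b z) (c z) (d z)) (f z)) 2 2" if "f holomorphic_on S" "0 \<notin> f ` S" for f
  proof (rule mholoI)
    fix i k :: nat assume "i < 2" "k < 2"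
    moreover have "f z \<noteq> 0" if "z \<in> S" for z using \<open>0 \<notin> f ` S\<close> that by force
    ultimately show "(\<lambda>z. Khalf r (BParams (a z) (b z) (c z) (d z)) (f z) $$ (i, k)) holomorphic_on S"
      using p \<open>f holomorphic_on S\<close>
      by (auto simp: Khalf_def mat_of_rows_list_def less_Suc_eq numeral_2_eq_2 cfun_def divide_inverse intro!: holomorphic_intros)
  qed simp_all
  show ?case
  proof (cases s)
    case 0
    then show ?thesis using K[OF Suc.prems] by (simp add: numeral_2_eq_2)
  next
    case n: (Suc n)
    have s1: "s \<ge> 1" using n by simp
    have K1: "mholo S (\<lambda>z. Khalf r (BParams (a z) (b z) (c z) (d z)) (f z * r powi (1 - int (Suc s))) \<otimes>\<^sub>k 1\<^sub>m (Suc s)) (2 * Suc s) (2 * Suc s)"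
      by (rule mholo_kron[OF K mholo_const]) (use Suc.prems r in \<open>auto intro!: holomorphic_intros\<close>)
    have R: "mholo S (\<lambda>z. Rhalf r s ((f z)\<^sup>2 * r powi (2 - int (Suc s)))) (2 * Suc s) (2 * Suc s)"
      using mholo_compose[OF mholo_Rhalf[OF r s1], of "\<lambda>z. (f z)\<^sup>2 * r powi (2 - int (Suc s))" S] Suc.prems r
      by (simp add: holomorphic_intros image_iff del: of_nat_Suc)
    have K2: "mholo S (\<lambda>z. 1\<^sub>m 2 \<otimes>\<^sub>k Kmat r (BParams (a z) (b z) (c z) (d z)) s (f z * r)) (2 * Suc s) (2 * Suc s)"
    proof -
      have "mholo S (\<lambda>z. Kmat r (BParams (a z) (b z) (c z) (d z)) s (f z * r)) (s + 1) (s + 1)"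
        by (rule Suc.IH) (use Suc.prems r in \<open>auto intro!: holomorphic_intros\<close>)
      from mholo_kron[OF mholo_const[of "1\<^sub>m 2" 2 2] this] show ?thesis by simp
    qed
    have E: "mholo S (\<lambda>z. Emap r (Suc s)) (2 * Suc s) (Suc s + 1)" "mholo S (\<lambda>z. Fmap r (Suc s)) (Suc s + 1) (2 * Suc s)"
      by (intro mholo_const; auto)+
    show ?thesis
      using mholo_mult[OF mholo_mult[OF mholo_mult[OF mholo_mult[OF E(2) K1] R] K2] E(1)]
      unfolding n Kmat.simps Let_def .
  qed
qed

section \<open>The intertwining relation of the unfused K-matrix\<close>

text \<open>The generator W_0 on a single site, with the spectral parameter absorbed into a and b; e
  stands for \<epsilon>_+.\<close>

definition Wm :: "complex \<Rightarrow> nat \<Rightarrow> complex \<Rightarrow> complex \<Rightarrow> complex \<Rightarrow> complex mat" where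
  "Wm r s a b e = Am r s a b + e \<cdot>\<^sub>m Dm r s"

lemma dim_Wm [simp]: "dim_row (Wm r s a b e) = s + 1" "dim_col (Wm r s a b e) = s + 1"
  by (simp_all add: Wm_def)

text \<open>The diagonal entries agree by commutativity. The off-diagonal ones agree because the
  quotient c(u^2)/(q - 1/q) in K, multiplied by q - 1/q, gives u^2 - u^(-2).\<close>

lemma Khalf_intertwines:
  assumes g: "generic r" and u: "u \<noteq> 0"
  shows "Khalf r \<kappa> u * Wm r (Suc 0) (kp \<kappa> * u) (km \<kappa> * inverse u) (ep \<kappa>) =
    Wm r (Suc 0) (kp \<kappa> * inverse u) (km \<kappa> * u) (ep \<kappa>) * Khalf r \<kappa> u"
proof -
  have r: "r \<noteq> 0" using generic_nonzero[OF g] .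
  define h where "h = r\<^sup>2 - inverse (r\<^sup>2)"
  have h: "h \<noteq> 0" using qh_nonzero[OF g] by (simp add: h_def)
  define C where "C = cfun (u\<^sup>2) / h"
  have C: "C * (r\<^sup>2 - inverse (r\<^sup>2)) = u\<^sup>2 - inverse (u\<^sup>2)" using h by (simp add: C_def h_def cfun_def)
  have W: "Wm r (Suc 0) a b e = mat_of_rows_list 2 [[e * r\<^sup>2, a], [b, e * inverse (r\<^sup>2)]]" for a b e
    unfolding Wm_def Am_one[OF g] Dm_one
    by (intro eq_matI) (auto simp: mat_of_rows_list_def less_Suc_eq numeral_2_eq_2)
  have K: "Khalf r \<kappa> u = mat_of_rows_list 2 [[u * ep \<kappa> + inverse u * em \<kappa>, kp \<kappa> * C], [km \<kappa> * C, u * em \<kappa> + inverse u * ep \<kappa>]]"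
    by (simp add: Khalf_def C_def h_def)
  have M: "mat_of_rows_list 2 [[a, b], [c, d]] * mat_of_rows_list 2 [[a', b'], [c', d']] =
    mat_of_rows_list 2 [[a * a' + b * c', a * b' + b * d'], [c * a' + d * c', c * b' + d * (d' :: complex)]]" for a b c d a' b' c' d'
    by (intro eq_matI) (auto simp: mat_of_rows_list_def scalar_prod_def less_Suc_eq numeral_2_eq_2)
  have 1: "(u * e + inverse u * f) * (k * u) + k * C * (e * inverse (r\<^sup>2)) = e * r\<^sup>2 * (k * C) + k * inverse u * (u * f + inverse u * e)" for e f k
  proof -
    have "e * r\<^sup>2 * (k * C) - k * C * (e * inverse (r\<^sup>2)) = e * k * (C * (r\<^sup>2 - inverse (r\<^sup>2)))" by (simp add: algebra_simps)
    also have "\<dots> = (u * e + inverse u * f) * (k * u) - k * inverse u * (u * f + inverse u * e)"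
      unfolding C using u by (simp add: field_simps power2_eq_square)
    finally show ?thesis by (simp add: algebra_simps)
  qed
  have 2: "k * C * (e * r\<^sup>2) + (u * f + inverse u * e) * (k * inverse u) = k * u * (u * e + inverse u * f) + e * inverse (r\<^sup>2) * (k * C)" for e f k
  proof -
    have "k * C * (e * r\<^sup>2) - e * inverse (r\<^sup>2) * (k * C) = e * k * (C * (r\<^sup>2 - inverse (r\<^sup>2)))" by (simp add: algebra_simps)
    also have "\<dots> = k * u * (u * e + inverse u * f) - (u * f + inverse u * e) * (k * inverse u)"
      unfolding C using u by (simp add: field_simps power2_eq_square)
    finally show ?thesis by (simp add: algebra_simps)
  qed
  show ?thesis
    unfolding W K M using 1[of "ep \<kappa>" "em \<kappa>" "kp \<kappa>"] 2[of "km \<kappa>" "ep \<kappa>" "em \<kappa>"] by (simp add: mult_ac add_ac)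
qed

text \<open>The generator is carried through the factors of the fused K-matrix: X2 reflects the
  second constituent, Y exchanges the coproducts, X1 reflects the first. G1 and G2 are the one-site
  generators and the primes mark them after reflection.\<close>

lemma boundary_two_site:
  fixes A1 D1 A2 D2 G1 G1' G2 G2' X1 X2 Y E Sg :: "complex mat"
  assumes d: "\<And>M. M \<in> {A1, D1, A2, D2, G1, G1', G2, G2', X1, X2, Y} \<Longrightarrow> dim_row M = n \<and> dim_col M = n"
    and d': "dim_row E = n" "dim_col E = m" "dim_row Sg = m" "dim_col Sg = m"
    and c: "X2 * A1 = A1 * X2" "X2 * D1 = D1 * X2" "X1 * A2 = A2 * X1" "X1 * D2 = D2 * X1" "G1 * D2 = D2 * G1" "G1' * D2 = D2 * G1'"
    and h: "X2 * G2 = G2' * X2" "Y * (A1 + D1 * G2') = (A2 + G1 * D2) * Y" "X1 * G1 = G1' * X1" "E * Sg = (A1 + D1 * G2) * E"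
  shows "(X1 * (Y * (X2 * E))) * Sg = (A2 + G1' * D2) * (X1 * (Y * (X2 * E)))"
proof -
  have dd: "dim_row A1 = n" "dim_col A1 = n" "dim_row D1 = n" "dim_col D1 = n" "dim_row A2 = n" "dim_col A2 = n"
    "dim_row D2 = n" "dim_col D2 = n" "dim_row G1 = n" "dim_col G1 = n" "dim_row G1' = n" "dim_col G1' = n"
    "dim_row G2 = n" "dim_col G2 = n" "dim_row G2' = n" "dim_col G2' = n"
    "dim_row X1 = n" "dim_col X1 = n" "dim_row X2 = n" "dim_col X2 = n" "dim_row Y = n" "dim_col Y = n"
    using d by auto
  note S = dd d' mat_assoc_dim
  have l: "P * (Q * M) = P' * (Q' * M)"
    if "P * Q = P' * Q'" "dim_row M = n" "dim_col P = n" "dim_row Q = n" "dim_col Q = n" "dim_col P' = n" "dim_row Q' = n" "dim_col Q' = n" for P Q P' Q' M :: "complex mat"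
    using that by (metis mat_assoc_dim)
  have c1: "X2 * (A1 * M) = A1 * (X2 * M)" if "dim_row M = n" for M by (rule l[OF c(1) that]) (simp_all add: dd)
  have c2: "X2 * (D1 * M) = D1 * (X2 * M)" if "dim_row M = n" for M by (rule l[OF c(2) that]) (simp_all add: dd)
  have c3: "X1 * (A2 * M) = A2 * (X1 * M)" if "dim_row M = n" for M by (rule l[OF c(3) that]) (simp_all add: dd)
  have c4: "X1 * (D2 * M) = D2 * (X1 * M)" if "dim_row M = n" for M by (rule l[OF c(4) that]) (simp_all add: dd)
  have c5: "G1 * (D2 * M) = D2 * (G1 * M)" if "dim_row M = n" for M by (rule l[OF c(5) that]) (simp_all add: dd)
  have c6: "G1' * (D2 * M) = D2 * (G1' * M)" if "dim_row M = n" for M by (rule l[OF c(6) that]) (simp_all add: dd)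
  have h1: "X2 * (G2 * M) = G2' * (X2 * M)" if "dim_row M = n" for M by (rule l[OF h(1) that]) (simp_all add: dd)
  have h3: "X1 * (G1 * M) = G1' * (X1 * M)" if "dim_row M = n" for M by (rule l[OF h(3) that]) (simp_all add: dd)
  have h2: "Y * (A1 * M + D1 * (G2' * M)) = A2 * (Y * M) + G1 * (D2 * (Y * M))" if "dim_row M = n" for M
    using arg_cong[OF h(2), of "\<lambda>N. N * M"] that by (simp add: S mat_distrib_left_dim mat_distrib_right_dim)
  have "(X1 * (Y * (X2 * E))) * Sg = X1 * (Y * (A1 * (X2 * E) + D1 * (G2' * (X2 * E))))"
    using h(4) by (simp add: S mat_distrib_left_dim mat_distrib_right_dim c1 c2 h1)
  also have "\<dots> = X1 * (A2 * (Y * (X2 * E)) + G1 * (D2 * (Y * (X2 * E))))"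
    by (subst h2) (simp_all add: S)
  also have "\<dots> = (A2 + G1' * D2) * (X1 * (Y * (X2 * E)))"
    by (simp add: S mat_distrib_left_dim mat_distrib_right_dim c3 c4 c5 c6 h3)
  finally show ?thesis .
qed

definition unfused_K :: "complex \<Rightarrow> bparams \<Rightarrow> nat \<Rightarrow> complex \<Rightarrow> complex mat" where
  "unfused_K r \<kappa> s u = (Khalf r \<kappa> (u * r powi (1 - int s)) \<otimes>\<^sub>k 1\<^sub>m s) *
     (Rhalf r (s - 1) (u\<^sup>2 * r powi (2 - int s)) * ((1\<^sub>m 2 \<otimes>\<^sub>k Kmat r \<kappa> (s - 1) (u * r)) * Emap r s))"

text \<open>The reflected generator on the unfused product: both constituents carry inverted
  spectral parameters, and \<epsilon>_+ multiplies the total weight operator.\<close>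

definition unfused_action :: "complex \<Rightarrow> bparams \<Rightarrow> nat \<Rightarrow> complex \<Rightarrow> complex mat" where
  "unfused_action r \<kappa> s u = copop r (Suc 0) (s - 1) (kp \<kappa> * inverse (u * r powi (1 - int s))) (km \<kappa> * (u * r powi (1 - int s)))
      (kp \<kappa> * inverse (u * r)) (km \<kappa> * (u * r)) + ep \<kappa> \<cdot>\<^sub>m (Dm r (Suc 0) \<otimes>\<^sub>k Dm r (s - 1))"

lemma dim_unfused_K:
  assumes "r \<noteq> 0" "s \<ge> 2"
  shows "dim_row (unfused_K r \<kappa> s u) = 2 * s" "dim_col (unfused_K r \<kappa> s u) = s + 1" "dim_row (unfused_action r \<kappa> s u) = 2 * s" "dim_col (unfused_action r \<kappa> s u) = 2 * s"
  using assms dim_Rhalf[of r "s - 1"] by (simp_all add: unfused_K_def unfused_action_def)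

lemma Kmat_unfused_K:
  assumes "r \<noteq> 0" "s \<ge> 2"
  shows "Kmat r \<kappa> s u = Fmap r s * unfused_K r \<kappa> s u"
proof -
  obtain n where n: "s = Suc (Suc n)" using assms(2) by (metis One_nat_def Suc_1 Suc_le_D Suc_le_mono)
  show ?thesis
    using assms dim_Rhalf[of r "s - 1"] unfolding n unfused_K_def Kmat.simps Let_def by (simp add: mat_assoc_dim)
qed

text \<open>As for the R-matrix, the same operator acts on the unfused K-matrix and on \<E>, so that
  the defect inherits a relation.\<close>

lemma unfused_K_intertwines:
  assumes g: "generic r" and s: "s \<ge> 2" and u: "u \<noteq> 0"
    and IH: "Kmat r \<kappa> (s - 1) (u * r) * Wm r (s - 1) (kp \<kappa> * (u * r)) (km \<kappa> * inverse (u * r)) (ep \<kappa>) =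
      Wm r (s - 1) (kp \<kappa> * inverse (u * r)) (km \<kappa> * (u * r)) (ep \<kappa>) * Kmat r \<kappa> (s - 1) (u * r)"
  shows "unfused_K r \<kappa> s u * Wm r s (kp \<kappa> * u) (km \<kappa> * inverse u) (ep \<kappa>) = unfused_action r \<kappa> s u * unfused_K r \<kappa> s u"
    "Emap r s * Wm r s (kp \<kappa> * inverse u) (km \<kappa> * u) (ep \<kappa>) = unfused_action r \<kappa> s u * Emap r s"
proof -
  define t where "t = s - 1"
  have t: "s = Suc t" "t \<ge> 1" using s by (auto simp: t_def)
  have r: "r \<noteq> 0" using generic_nonzero[OF g] .
  have s1: "s \<ge> 1" using s by simp
  \<comment> \<open>v and w are the spectral parameters of the constituents; their product is the
    argument of the R-matrix between the two reflections.\<close>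
  define v where "v = u * r powi (1 - int s)"
  define w where "w = u * r"
  have v0: "v \<noteq> 0" "w \<noteq> 0" using u r by (simp_all add: v_def w_def)
  have vw: "u\<^sup>2 * r powi (2 - int s) = v * w"
  proof -
    have "r powi (2 - int s) = r powi (1 - int s) * r" using r power_int_add_1[of r "1 - int s"] by (simp add: algebra_simps)
    then show ?thesis by (simp add: v_def w_def power2_eq_square)
  qed
  define a where "a = kp \<kappa>" define b where "b = km \<kappa>" define e where "e = ep \<kappa>"
  define A1 where "A1 a b = Am r (Suc 0) a b \<otimes>\<^sub>k 1\<^sub>m (t + 1)" for a b
  define A2 where "A2 a b = 1\<^sub>m (Suc 0 + 1) \<otimes>\<^sub>k Am r t a b" for a b
  define D1 where "D1 = Dm r (Suc 0) \<otimes>\<^sub>k 1\<^sub>m (t + 1)"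
  define D2 where "D2 = 1\<^sub>m (Suc 0 + 1) \<otimes>\<^sub>k Dm r t"
  define n where "n = 2 * s"
  have dims: "dim_row (A1 a b) = n" "dim_col (A1 a b) = n" "dim_row (A2 a b) = n" "dim_col (A2 a b) = n"
    "dim_row D1 = n" "dim_col D1 = n" "dim_row D2 = n" "dim_col D2 = n" for a b
    by (simp_all add: A1_def A2_def D1_def D2_def n_def t)
  have DD: "Dm r (Suc 0) \<otimes>\<^sub>k Dm r t = D1 * D2" unfolding D1_def D2_def by (simp add: kron_mult_kron)
  have C: "cop r (Suc 0) t a b c d = A1 a b + D1 * A2 c d" "copop r (Suc 0) t a b c d = A2 c d + A1 a b * D2" for a b c d
    unfolding cop_def copop_def A1_def A2_def D1_def D2_def by (simp_all add: kron_mult_kron)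
  have rs: "r powi (1 - int s) * (a * u) = a * v" "r powi (int s - 1) * (b * inverse u) = b * inverse v"
    "r * (a * u) = a * w" "inverse r * (b * inverse u) = b * inverse w"
    "r powi (int s - 1) * (a * inverse u) = a * inverse v" "r powi (1 - int s) * (b * u) = b * v"
    "inverse r * (a * inverse u) = a * inverse w" "r * (b * u) = b * w"
    using r u power_int_minus[of r "1 - int s"] by (simp_all add: v_def w_def)
  have Ed: "dim_row (Emap r s) = n" "dim_col (Emap r s) = s + 1" by (simp_all add: n_def)
  have EW: "Emap r s * Wm r s x y e = Emap r s * Am r s x y + e \<cdot>\<^sub>m (D1 * D2 * Emap r s)" for x y
    unfolding Wm_def using Emap_weight(1)[OF r s1] DD
    by (simp add: mat_distrib_left_dim mat_smult_mult_right_dim t_def)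
  have E1: "Emap r s * Wm r s (a * u) (b * inverse u) e = (A1 (a * v) (b * inverse v) + D1 * (A2 (a * w) (b * inverse w) + e \<cdot>\<^sub>m D2)) * Emap r s"
    unfolding EW Emap_intertwines(1)[OF g s1] rs t_def[symmetric] C
    using dims Ed by (simp add: mat_distrib_left_dim mat_distrib_right_dim mat_smult_mult_left_dim mat_smult_mult_right_dim mat_add_assoc_dim mat_assoc_dim)
  have Th: "unfused_action r \<kappa> s u = A2 (a * inverse w) (b * w) + (A1 (a * inverse v) (b * v) + e \<cdot>\<^sub>m D1) * D2"
    unfolding unfused_action_def t_def[symmetric] C DD a_def[symmetric] b_def[symmetric] e_def[symmetric] v_def[symmetric] w_def[symmetric]
    using dims by (simp add: mat_distrib_right_dim mat_smult_mult_left_dim mat_add_assoc_dim)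
  show "Emap r s * Wm r s (kp \<kappa> * inverse u) (km \<kappa> * u) (ep \<kappa>) = unfused_action r \<kappa> s u * Emap r s"
    unfolding Th a_def[symmetric] b_def[symmetric] e_def[symmetric] EW Emap_intertwines(2)[OF g s1] rs t_def[symmetric] C
    using dims Ed by (simp add: mat_distrib_right_dim mat_smult_mult_left_dim mat_add_assoc_dim mat_assoc_dim)
  define X1 where "X1 = Khalf r \<kappa> v \<otimes>\<^sub>k 1\<^sub>m (t + 1)"
  define X2 where "X2 = 1\<^sub>m (Suc 0 + 1) \<otimes>\<^sub>k Kmat r \<kappa> t w"
  define Y where "Y = Rhalf r t (v * w)"
  have dX: "dim_row X1 = n" "dim_col X1 = n" "dim_row X2 = n" "dim_col X2 = n" "dim_row Y = n" "dim_col Y = n"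
    using dim_Rhalf[OF r t(2)] by (simp_all add: X1_def X2_def Y_def n_def t)
  have one2: "1\<^sub>m (Suc 0 + 1) = (1\<^sub>m 2 :: complex mat)" by (simp add: numeral_2_eq_2)
  have KVe: "unfused_K r \<kappa> s u = X1 * (Y * (X2 * Emap r s))"
    unfolding unfused_K_def X1_def X2_def Y_def one2 vw v_def[symmetric] w_def[symmetric] t_def[symmetric] using t by simp
  have 1: "X2 * (A2 (a * w) (b * inverse w) + e \<cdot>\<^sub>m D2) = (A2 (a * inverse w) (b * w) + e \<cdot>\<^sub>m D2) * X2"
  proof -
    have k: "A2 x y + e \<cdot>\<^sub>m D2 = 1\<^sub>m (Suc 0 + 1) \<otimes>\<^sub>k Wm r t x y e" for x y
      unfolding A2_def D2_def Wm_def by (simp add: kron_add_right kron_smult_right)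
    show ?thesis unfolding k X2_def using IH unfolding t_def[symmetric] w_def[symmetric] a_def[symmetric] b_def[symmetric] e_def[symmetric]
      by (simp add: kron_mult_kron)
  qed
  have 3: "X1 * (A1 (a * v) (b * inverse v) + e \<cdot>\<^sub>m D1) = (A1 (a * inverse v) (b * v) + e \<cdot>\<^sub>m D1) * X1"
  proof -
    have k: "A1 x y + e \<cdot>\<^sub>m D1 = Wm r (Suc 0) x y e \<otimes>\<^sub>k 1\<^sub>m (t + 1)" for x y
      unfolding A1_def D1_def Wm_def by (simp add: kron_add_left kron_smult_left)
    show ?thesis unfolding k X1_def using Khalf_intertwines[OF g v0(1), of \<kappa>] unfolding a_def[symmetric] b_def[symmetric] e_def[symmetric]
      by (simp add: kron_mult_kron numeral_2_eq_2)
  qed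
  \<comment> \<open>At this stage the second constituent is reflected and has parameter 1/w, the
    first still has v; the ratio is v w.\<close>
  have 2: "Y * (A1 (a * v) (b * inverse v) + D1 * (A2 (a * inverse w) (b * w) + e \<cdot>\<^sub>m D2)) =
     (A2 (a * inverse w) (b * w) + (A1 (a * v) (b * inverse v) + e \<cdot>\<^sub>m D1) * D2) * Y"
  proof -
    have R: "Y * (A1 (a * v) (b * inverse v) + D1 * A2 (a * inverse w) (b * w)) = (A2 (a * inverse w) (b * w) + A1 (a * v) (b * inverse v) * D2) * Y"
      using Rhalf_intertwines(1)[OF g t(2), of "v * w" "a * inverse w" "b * w"] v0 unfolding Y_def C by (simp add: field_simps)
    have W: "Y * (D1 * D2) = D1 * D2 * Y" using Rhalf_intertwines(3)[OF g t(2), of "v * w"] v0 unfolding Y_def DD by simp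
    have "Y * (A1 (a * v) (b * inverse v) + D1 * (A2 (a * inverse w) (b * w) + e \<cdot>\<^sub>m D2)) =
       Y * (A1 (a * v) (b * inverse v) + D1 * A2 (a * inverse w) (b * w)) + e \<cdot>\<^sub>m (Y * (D1 * D2))"
      using dims dX by (simp add: mat_distrib_left_dim mat_smult_mult_right_dim mat_add_assoc_dim)
    also have "\<dots> = (A2 (a * inverse w) (b * w) + (A1 (a * v) (b * inverse v) + e \<cdot>\<^sub>m D1) * D2) * Y"
      unfolding R W using dims dX
      by (simp add: mat_distrib_right_dim mat_smult_mult_left_dim mat_add_assoc_dim)
    finally show ?thesis .
  qed
  have c: "X2 * A1 x y = A1 x y * X2" "X2 * D1 = D1 * X2" "X1 * A2 x y = A2 x y * X1" "X1 * D2 = D2 * X1" for x y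
    unfolding X1_def X2_def A1_def A2_def D1_def D2_def by (simp_all add: kron_mult_kron numeral_2_eq_2)
  have c': "(A1 x y + e \<cdot>\<^sub>m D1) * D2 = D2 * (A1 x y + e \<cdot>\<^sub>m D1)" for x y
    using dims unfolding A1_def D1_def D2_def
    by (simp add: mat_distrib_left_dim mat_distrib_right_dim mat_smult_mult_left_dim mat_smult_mult_right_dim kron_mult_kron)
  show "unfused_K r \<kappa> s u * Wm r s (kp \<kappa> * u) (km \<kappa> * inverse u) (ep \<kappa>) = unfused_action r \<kappa> s u * unfused_K r \<kappa> s u"
    unfolding Th KVe a_def[symmetric] b_def[symmetric] e_def[symmetric]
    by (rule boundary_two_site[where n = n and m = "s + 1", OF _ _ _ _ _ c c' c' 1 2 3 E1]) (use dims dX Ed in auto)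
qed

lemma mult_Wm_index:
  assumes "i < dim_row Z" "dim_col Z = s + 1" "k \<le> s"
  shows "(Z * Wm r s a b e) $$ (i, k) = (if k = 0 then 0 else Z $$ (i, k - 1) * (a * r * bco r s (k - 1) * pw r s k))
     + (if k < s then Z $$ (i, Suc k) * (b * inverse r * bco r s k * pw r s k) else 0) + Z $$ (i, k) * (e * (pw r s k * pw r s k))"
proof -
  have "Z * Wm r s a b e = Z * upm (s + 1) (\<lambda>i. a * r * bco r s i * pw r s (Suc i)) + Z * dnm (s + 1) (\<lambda>i. b * inverse r * bco r s i * pw r s i)
     + Z * dgm (s + 1) (\<lambda>i. e * (pw r s i * pw r s i))"
    unfolding Wm_def Am_pw Dm_pw smult_band using assms by (simp add: mat_distrib_left_dim)
  then show ?thesis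
    using assms by (cases k) (auto simp: mult_band_index simp del: index_mult_mat(1))
qed

text \<open>Evaluated on column k, the relation expresses column k + 1 through columns k and k - 1,
  and the coefficient of column k + 1 is nonzero since b is.\<close>

lemma boundary_lowering:
  assumes g: "generic r" and b: "b \<noteq> 0" and Z: "dim_row Z = n" "dim_col Z = s + 1" and T: "dim_row T = n" "dim_col T = n"
    and 1: "Z * Wm r s a b e = T * Z" and 0: "\<And>i. i < n \<Longrightarrow> Z $$ (i, 0) = 0"
  shows "Z = 0\<^sub>m n (s + 1)"
proof -
  have r: "r \<noteq> 0" using generic_nonzero[OF g] .
  have "\<forall>j\<le>k. \<forall>i<n. Z $$ (i, j) = 0" if "k \<le> s" for k
    using that
  proof (induction k)
    case 0
    then show ?case using assms(8) by simp
  next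
    case (Suc k)
    then have IH: "\<And>j i. j \<le> k \<Longrightarrow> i < n \<Longrightarrow> Z $$ (i, j) = 0" by auto
    have "Z $$ (i, Suc k) = 0" if i: "i < n" for i
    proof -
      have "(T * Z) $$ (i, k) = 0"
        using i T Z Suc.prems IH by (subst mat_mult_index) auto
      then have "(Z * Wm r s a b e) $$ (i, k) = 0" using 1 by simp
      then have "Z $$ (i, Suc k) * (b * inverse r * bco r s k * pw r s k) = 0"
        using i Z Suc.prems IH[of k i] IH[of "k - 1" i] by (subst (asm) mult_Wm_index) (auto split: if_splits)
      moreover have "b * inverse r * bco r s k * pw r s k \<noteq> 0"
        using b r bco_nonzero[OF g, of k s] pw_nonzero[OF r] Suc.prems by auto
      ultimately show ?thesis by simp
    qed
    with IH show ?case by (auto simp: le_Suc_eq)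
  qed
  then have "Z $$ (i, j) = 0" if "i < n" "j \<le> s" for i j using that by blast
  then show ?thesis using Z by (intro eq_matI) auto
qed

text \<open>The combination of the two boundary operators that has the highest weight vector as an eigenvector.\<close>

lemma boundary_first_column:
  assumes g: "generic r" and u: "u \<noteq> 0" and s: "s \<ge> 1" and Z: "dim_row Z = n" "dim_col Z = s + 1"
    and i: "i < n"
  shows "u * r powi (1 - int s) * (Z * Wm r s (a * u) (b * inverse u) e) $$ (i, 0) -
      inverse (u * r powi (1 - int s)) * (Z * Wm (inverse r) s (a * inverse u) (b * u) f) $$ (i, 0) =
    (u * r powi (1 - int s) * e * (pw r s 0 * pw r s 0) - inverse (u * r powi (1 - int s)) * f * inverse (pw r s 0 * pw r s 0)) * Z $$ (i, 0)"
proof -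
  have r: "r \<noteq> 0" using generic_nonzero[OF g] .
  have p: "r powi (1 - int s) = r * inverse (pw r s 0)"
    using r by (simp add: pw_def wt_def power_int_diff divide_inverse)
  have c: "u * r powi (1 - int s) * (b * inverse u * inverse r * bco r s 0 * pw r s 0) =
      inverse (u * r powi (1 - int s)) * (b * u * inverse (inverse r) * bco (inverse r) s 0 * pw (inverse r) s 0)"
    unfolding p bco_inverse pw_inverse using r u pw_nonzero[OF r, of s 0] by (simp add: field_simps)
  have "(Z * Wm r s (a * u) (b * inverse u) e) $$ (i, 0) = Z $$ (i, Suc 0) * (b * inverse u * inverse r * bco r s 0 * pw r s 0) + Z $$ (i, 0) * (e * (pw r s 0 * pw r s 0))"
    using Z i s by (subst mult_Wm_index) auto
  moreover have "(Z * Wm (inverse r) s (a * inverse u) (b * u) f) $$ (i, 0) = Z $$ (i, Suc 0) * (b * u * inverse (inverse r) * bco (inverse r) s 0 * pw (inverse r) s 0)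
      + Z $$ (i, 0) * (f * (pw (inverse r) s 0 * pw (inverse r) s 0))"
    using Z i s by (subst mult_Wm_index) auto
  ultimately show ?thesis
    using arg_cong[OF c, of "\<lambda>x. Z $$ (i, Suc 0) * x"] by (simp add: pw_inverse algebra_simps)
qed

section \<open>The defect of the K-matrix: perturbation in the off-diagonal boundary
  parameters\<close>

text \<open>At the position of the largest entry the equation bounds the diagonal coefficient by the
  norm of \<tau> times a row sum, which is impossible for small \<tau> unless v = 0. Position 0,
  where the diagonal coefficient is allowed to vanish, is covered by v 0 = 0.\<close>

lemma diagonal_dominance:
  fixes \<delta> :: "nat \<Rightarrow> complex" and M :: "nat \<Rightarrow> nat \<Rightarrow> complex"
  assumes \<delta>: "\<And>k. 0 < k \<Longrightarrow> k < n \<Longrightarrow> \<delta> k \<noteq> 0"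
  shows "\<exists>\<eta>>0. \<forall>\<tau> v. norm \<tau> < \<eta> \<longrightarrow> v 0 = 0 \<longrightarrow>
     (\<forall>k<n. \<delta> k * v k = \<tau> * (\<Sum>l<n. M k l * v l)) \<longrightarrow> (\<forall>k<n. v k = (0 :: complex))"
proof -
  \<comment> \<open>The inserted 1 keeps the minimum meaningful when no position lies strictly
    between 0 and n.\<close>
  define m where "m = Min (insert 1 ((\<lambda>k. norm (\<delta> k)) ` {0<..<n}))"
  define C where "C = 1 + (\<Sum>k<n. \<Sum>l<n. norm (M k l))"
  have m: "m > 0" "\<And>k. 0 < k \<Longrightarrow> k < n \<Longrightarrow> m \<le> norm (\<delta> k)"
    using \<delta> by (auto simp: m_def)
  have C: "C > 0" unfolding C_def by (simp add: add_pos_nonneg sum_nonneg)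
  show ?thesis
  proof (intro exI[of _ "m / C"] conjI allI impI)
    show "m / C > 0" using m C by simp
    fix \<tau> :: complex and v :: "nat \<Rightarrow> complex" and k
    assume t: "norm \<tau> < m / C" and v0: "v 0 = 0" and eq: "\<forall>k<n. \<delta> k * v k = \<tau> * (\<Sum>l<n. M k l * v l)" and k: "k < n"
    show "v k = 0"
    proof (rule ccontr)
      assume vk: "v k \<noteq> 0"
      define B where "B = Max ((\<lambda>l. norm (v l)) ` {..<n})"
      have "B \<in> (\<lambda>l. norm (v l)) ` {..<n}" unfolding B_def using k by (intro Max_in) auto
      then obtain b where b: "b < n" "B = norm (v b)" by auto
      have le: "norm (v l) \<le> B" if "l < n" for l unfolding B_def using that by simp
      have B: "B > 0" using le[OF k] vk by (meson less_le_trans zero_less_norm_iff)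
      have b0: "0 < b" using b B v0 by (cases b) auto
      have "norm (\<Sum>l<n. M b l * v l) \<le> (\<Sum>l<n. norm (M b l) * B)"
        by (rule order_trans[OF norm_sum]) (auto simp: norm_mult intro!: sum_mono mult_left_mono le)
      also have "\<dots> = (\<Sum>l<n. norm (M b l)) * B" by (simp add: sum_distrib_right)
      also have "(\<Sum>l<n. norm (M b l)) \<le> C"
        unfolding C_def using b(1) member_le_sum[of b "{..<n}" "\<lambda>k. \<Sum>l<n. norm (M k l)"] by (simp add: sum_nonneg)
      finally have "norm (\<Sum>l<n. M b l * v l) \<le> C * B" using B by simp
      then have "norm \<tau> * norm (\<Sum>l<n. M b l * v l) \<le> norm \<tau> * (C * B)" by (intro mult_left_mono) auto
      moreover have "norm (\<delta> b) * B = norm \<tau> * norm (\<Sum>l<n. M b l * v l)"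
        using arg_cong[OF eq[rule_format, OF b(1)], of norm] by (simp add: norm_mult b(2))
      moreover have "m * B \<le> norm (\<delta> b) * B" using m(2)[OF b0 b(1)] B by simp
      moreover have "norm \<tau> * (C * B) < m * B" using t C B by (simp add: field_simps)
      ultimately show False by linarith
    qed
  qed
qed

text \<open>Eigenvalues of q^(S_3/2) for the total weight of spin 1/2 times spin (s-1)/2. Indices
  from s on have the spin 1/2 pointing down, hence one more lowering.\<close>

definition fused_weight :: "complex \<Rightarrow> nat \<Rightarrow> nat \<Rightarrow> complex" where
  "fused_weight r s k = (if k < s then pw r s k else pw r s (Suc (k - s)))"

lemma Dm_kron_fused_weight:
  assumes r: "r \<noteq> 0" and s: "s \<ge> 1"
  shows "Dm r (Suc 0) \<otimes>\<^sub>k Dm r (s - 1) = dgm (2 * s) (\<lambda>k. fused_weight r s k * fused_weight r s k)"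
proof -
  have w: "wt (s - Suc 0) i = wt s i - 1" for i using s by (simp add: wt_def of_nat_diff)
  have p: "pw r (s - Suc 0) i = pw r s i * inverse r" for i
    using r by (simp add: pw_def w power_int_diff divide_inverse)
  show ?thesis
    unfolding Dm_one_kron
    using r s by (intro eq_matI) (auto simp: band_index fused_weight_def p pw_Suc power2_eq_square field_simps)
qed

lemma fused_weight_inverse: "fused_weight (inverse r) s k = inverse (fused_weight r s k)"
  by (simp add: fused_weight_def pw_inverse)

lemma pw_square_ne:
  assumes g: "generic r" and i: "0 < i" "i \<le> s"
  shows "pw r s i * pw r s i \<noteq> pw r s 0 * pw r s 0"
proof -
  have r: "r \<noteq> 0" using generic_nonzero[OF g] .
  have *: "pw r s j * pw r s j = r powi (2 * wt s j)" for j
    unfolding pw_def by (metis mult.commute power_int_mult power2_eq_square power_int_numeral)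
  show ?thesis unfolding * generic_powi_eq_iff[OF g] using i by (simp add: wt_def)
qed

text \<open>Eigenvalue differences of the diagonal part of the boundary operators.\<close>

lemma boundary_gap:
  fixes \<alpha> e f p d :: complex
  assumes "\<alpha> \<noteq> 0" "p \<noteq> 0" "d \<noteq> 0" "d * d \<noteq> p * p" "\<alpha>\<^sup>2 * (e * (d * d * (p * p))) \<noteq> - f"
  shows "\<alpha> * e * (d * d) - inverse \<alpha> * f * inverse (d * d) - (\<alpha> * e * (p * p) - inverse \<alpha> * f * inverse (p * p)) \<noteq> 0"
proof -
  have "(\<alpha> * e * (d * d) - inverse \<alpha> * f * inverse (d * d) - (\<alpha> * e * (p * p) - inverse \<alpha> * f * inverse (p * p))) * (\<alpha> * (d * d) * (p * p))
     = (d * d - p * p) * (\<alpha>\<^sup>2 * (e * (d * d * (p * p))) + f)"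
    using assms by (simp add: field_simps power2_eq_square)
  moreover have "(d * d - p * p) * (\<alpha>\<^sup>2 * (e * (d * d * (p * p))) + f) \<noteq> 0"
    using assms by (simp add: add_eq_0_iff2)
  ultimately show ?thesis by auto
qed

lemma mholo_unfused_K:
  assumes r: "r \<noteq> 0" and s: "s \<ge> 2" and p: "a holomorphic_on S" "b holomorphic_on S" "c holomorphic_on S" "d holomorphic_on S"
    and f: "f holomorphic_on S" "0 \<notin> f ` S"
  shows "mholo S (\<lambda>z. unfused_K r (BParams (a z) (b z) (c z) (d z)) s (f z)) (2 * s) (s + 1)"
proof -
  have s1: "s - 1 \<ge> 1" using s by simp
  have K1: "mholo S (\<lambda>z. Khalf r (BParams (a z) (b z) (c z) (d z)) (f z * r powi (1 - int s)) \<otimes>\<^sub>k 1\<^sub>m s) (2 * s) (2 * s)"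
  proof -
    have h: "(\<lambda>z. f z * r powi (1 - int s)) holomorphic_on S" using f by (intro holomorphic_intros)
    have "mholo S (\<lambda>z. Kmat r (BParams (a z) (b z) (c z) (d z)) (Suc 0) (f z * r powi (1 - int s))) (Suc 0 + 1) (Suc 0 + 1)"
      by (rule mholo_Kmat[OF r p h]) (use f r in auto)
    from mholo_kron[OF this mholo_const[of "1\<^sub>m s" s s]] show ?thesis by (simp add: mult_2)
  qed
  have R: "mholo S (\<lambda>z. Rhalf r (s - 1) ((f z)\<^sup>2 * r powi (2 - int s))) (2 * s) (2 * s)"
    using mholo_compose[OF mholo_Rhalf[OF r s1], of "\<lambda>z. (f z)\<^sup>2 * r powi (2 - int s)" S] f r s
    by (simp add: holomorphic_intros image_iff)
  have K2: "mholo S (\<lambda>z. 1\<^sub>m 2 \<otimes>\<^sub>k Kmat r (BParams (a z) (b z) (c z) (d z)) (s - 1) (f z * r)) (2 * s) (2 * s)"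
  proof -
    have "mholo S (\<lambda>z. Kmat r (BParams (a z) (b z) (c z) (d z)) (s - 1) (f z * r)) (s - 1 + 1) (s - 1 + 1)"
      by (rule mholo_Kmat[OF r p]) (use f r in \<open>auto intro!: holomorphic_intros\<close>)
    from mholo_kron[OF mholo_const[of "1\<^sub>m 2" 2 2] this] show ?thesis using s by simp
  qed
  have E: "mholo S (\<lambda>z. Emap r s) (2 * s) (s + 1)" by (intro mholo_const) auto
  show ?thesis
    unfolding unfused_K_def by (intro mholo_mult[OF K1] mholo_mult[OF R] mholo_mult[OF K2] E)
qed

lemma unfused_K_inverse:
  assumes r: "r \<noteq> 0" and s: "s \<ge> 2"
  shows "\<exists>c. c \<noteq> 0 \<and> unfused_K (inverse r) (swap_eps \<kappa>) s (inverse u) = c \<cdot>\<^sub>m unfused_K r \<kappa> s u"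
proof -
  obtain c where c: "c \<noteq> 0" "\<And>u. Kmat (inverse r) (swap_eps \<kappa>) (s - 1) (inverse u) = c \<cdot>\<^sub>m Kmat r \<kappa> (s - 1) u"
    using Kmat_inverse[OF r] by blast
  have s1: "s - 1 \<ge> 1" using s by simp
  define e where "e = (- 1) ^ (s - 1 - 1) * (- 1 :: complex)"
  have 1: "inverse u * inverse r powi k = inverse (u * r powi k)" "inverse u * inverse r = inverse (u * r)"
    "(inverse u)\<^sup>2 * inverse r powi k = inverse (u\<^sup>2 * r powi k)" for k
    by (simp_all add: power_int_inverse power_inverse)
  have "unfused_K (inverse r) (swap_eps \<kappa>) s (inverse u) = (e * c) \<cdot>\<^sub>m unfused_K r \<kappa> s u"
    unfolding unfused_K_def 1 Rhalf_inverse[OF r s1] Emap_inverse e_def[symmetric] Khalf_inverse c(2)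
    using dim_Rhalf[OF r s1] s
    by (simp add: kron_smult_right mat_smult_mult_left_dim mat_smult_mult_right_dim mat_smult_smult mult_ac)
  moreover have "e * c \<noteq> 0" using c by (simp add: e_def)
  ultimately show ?thesis by blast
qed

lemma Am_smult: "Am r s (t * a) (t * b) = t \<cdot>\<^sub>m Am r s a b"
  by (intro eq_matI) (auto simp: Am_index)

lemma copop_smult: "copop r s t (x * a) (x * b) (x * c) (x * d) = x \<cdot>\<^sub>m copop r s t a b c d"
  unfolding copop_def Am_smult by (simp add: kron_smult_left kron_smult_right mat_smult_add_dim)

text \<open>A family that joins the given boundary at t = 1 to a diagonal one at t = 0.\<close>

definition tau_scale :: "bparams \<Rightarrow> complex \<Rightarrow> bparams" where
  "tau_scale \<kappa> t = BParams (t * kp \<kappa>) (t * km \<kappa>) (ep \<kappa>) (em \<kappa>)"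

text \<open>The action is affine in t with diagonal constant term. The zeros in place of \<epsilon>
  isolate the linear term.\<close>

lemma unfused_action_tau:
  "unfused_action r (tau_scale \<kappa> t) s u = t \<cdot>\<^sub>m unfused_action r (BParams (kp \<kappa>) (km \<kappa>) 0 0) s u + ep \<kappa> \<cdot>\<^sub>m (Dm r (Suc 0) \<otimes>\<^sub>k Dm r (s - 1))"
  by (intro eq_matI) (auto simp: unfused_action_def tau_scale_def copop_smult mult.assoc)

text \<open>The hypothesis on spin (s-1)/2 ranges over all r and \<kappa>: it is applied at q and at
  1/q with the two \<epsilon> exchanged, and for every member of the family in t. The condition
  \<open>ne\<close> says that no other eigenvalue of the diagonal part meets that of the first
  column.\<close>

lemma unfused_K_defect_tau:
  assumes g: "generic r" and s: "s \<ge> 2" and u: "u \<noteq> 0"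
    and IH: "\<And>r \<kappa> u. generic r \<Longrightarrow> km \<kappa> \<noteq> 0 \<Longrightarrow> ep \<kappa> \<noteq> 0 \<or> em \<kappa> \<noteq> 0 \<Longrightarrow> u \<noteq> 0 \<Longrightarrow>
       Kmat r \<kappa> (s - 1) u * Wm r (s - 1) (kp \<kappa> * u) (km \<kappa> * inverse u) (ep \<kappa>) =
       Wm r (s - 1) (kp \<kappa> * inverse u) (km \<kappa> * u) (ep \<kappa>) * Kmat r \<kappa> (s - 1) u"
    and k: "km \<kappa> \<noteq> 0" and e: "ep \<kappa> \<noteq> 0 \<or> em \<kappa> \<noteq> 0"
    and ne: "\<And>k. k < 2 * s \<Longrightarrow> (u * r powi (1 - int s))\<^sup>2 * (ep \<kappa> * (fused_weight r s k * fused_weight r s k * (pw r s 0 * pw r s 0))) \<noteq> - em \<kappa>"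
  shows "unfused_K r \<kappa> s u - Emap r s * (Fmap r s * unfused_K r \<kappa> s u) = 0\<^sub>m (2 * s) (s + 1)"
proof -
  have r: "r \<noteq> 0" using generic_nonzero[OF g] .
  have s1: "s \<ge> 1" using s by simp
  define n where "n = 2 * s"
  define E where "E = Emap r s"
  define F where "F = Fmap r s"
  define DD where "DD = Dm r (Suc 0) \<otimes>\<^sub>k Dm r (s - 1)"
  define DD' where "DD' = Dm (inverse r) (Suc 0) \<otimes>\<^sub>k Dm (inverse r) (s - 1)"
  define V where "V t = unfused_K r (tau_scale \<kappa> t) s u" for t
  define Z where "Z t = V t - E * (F * V t)" for t
  define \<alpha> where "\<alpha> = u * r powi (1 - int s)"
  define N0 where "N0 = unfused_action r (BParams (kp \<kappa>) (km \<kappa>) 0 0) s u"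
  define N1 where "N1 = unfused_action (inverse r) (BParams (kp \<kappa>) (km \<kappa>) 0 0) s (inverse u)"
  define Q0 where "Q0 = N0 - E * (F * N0)"
  define Q1 where "Q1 = N1 - E * (F * N1)"
  define p where "p = pw r s 0"
  have a0: "\<alpha> \<noteq> 0" using u r by (simp add: \<alpha>_def)
  have dEF: "dim_row E = n" "dim_col E = s + 1" "dim_row F = s + 1" "dim_col F = n" by (simp_all add: E_def F_def n_def)
  have FE: "F * E = 1\<^sub>m (s + 1)" unfolding E_def F_def using Fmap_Emap[OF g s1] .
  have dV: "dim_row (V t) = n" "dim_col (V t) = s + 1" for t unfolding V_def n_def using dim_unfused_K[OF r s] by auto
  have dZ: "dim_row (Z t) = n" "dim_col (Z t) = s + 1" for t using dV dEF by (simp_all add: Z_def)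
  have dN: "dim_row N0 = n" "dim_col N0 = n" "dim_row N1 = n" "dim_col N1 = n" "dim_row DD = n" "dim_col DD = n" "dim_row DD' = n" "dim_col DD' = n"
    using dim_unfused_K[OF r s] dim_unfused_K[of "inverse r" s] r s by (simp_all add: N0_def N1_def n_def DD_def DD'_def)
  have dQ: "dim_row Q0 = n" "dim_col Q0 = n" "dim_row Q1 = n" "dim_col Q1 = n" using dN dEF by (simp_all add: Q0_def Q1_def)
  have FZ: "F * Z t = 0\<^sub>m (s + 1) (s + 1)" for t
  proof -
    have "F * Z t = F * V t - F * E * (F * V t)" using dV dEF by (simp add: Z_def mat_minus_mult_dim mat_assoc_dim)
    then show ?thesis unfolding FE using dV dEF by (intro eq_matI) auto
  qed
  have FD: "F * DD = Dm r s * F" "F * DD' = Dm (inverse r) s * F"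
    unfolding F_def DD_def DD'_def using Emap_weight(2)[OF r s1] Emap_weight(2)[of "inverse r" s] r s1 by (simp_all add: Emap_inverse)
  have z0: "M * 0\<^sub>m (s + 1) (s + 1) = 0\<^sub>m k (s + 1)" if "dim_row M = k" "dim_col M = s + 1" for M :: "complex mat" and k
    using that by (intro right_mult_zero_mat carrier_matI)
  \<comment> \<open>The defect is killed by F, and the diagonal D preserves the kernel of F. Hence
    the projection 1 - E F acts trivially on the diagonal term and survives only in the term of
    order t.\<close>
  have red: "(Th - E * (F * Th)) * Z t = t \<cdot>\<^sub>m (Q * Z t) + c \<cdot>\<^sub>m (D * Z t)"
    if Th: "Th = t \<cdot>\<^sub>m N + c \<cdot>\<^sub>m D" and d: "dim_row N = n" "dim_col N = n" "dim_row D = n" "dim_col D = n"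
      and Q: "Q = N - E * (F * N)" and FD: "F * D = G * F" "dim_row G = s + 1" "dim_col G = s + 1" for Th N D Q G c t
  proof -
    have "F * (D * Z t) = G * (F * Z t)" using FD d dEF dZ by (metis mat_assoc_dim)
    then have D0: "F * (D * Z t) = 0\<^sub>m (s + 1) (s + 1)" unfolding FZ using FD by (simp add: z0)
    have "F * (Th * Z t) = t \<cdot>\<^sub>m (F * (N * Z t)) + c \<cdot>\<^sub>m (F * (D * Z t))"
      unfolding Th using d dEF dZ by (simp add: mat_distrib_right_dim mat_distrib_left_dim mat_smult_mult_left_dim mat_smult_mult_right_dim)
    then have "F * (Th * Z t) = t \<cdot>\<^sub>m (F * (N * Z t))" unfolding D0 using d dEF dZ by (intro eq_matI) auto
    then have 1: "E * (F * (Th * Z t)) = t \<cdot>\<^sub>m (E * (F * (N * Z t)))" using d dEF dZ by (simp add: mat_smult_mult_right_dim)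
    have 2: "Th * Z t = t \<cdot>\<^sub>m (N * Z t) + c \<cdot>\<^sub>m (D * Z t)"
      unfolding Th using d dEF dZ by (simp add: mat_distrib_right_dim mat_smult_mult_left_dim)
    have dT: "dim_row Th = n" "dim_col Th = n" using Th d by simp_all
    have "(Th - E * (F * Th)) * Z t = Th * Z t - E * (F * (Th * Z t))"
      using dT dEF dZ by (simp add: mat_minus_mult_dim mat_assoc_dim)
    also have "\<dots> = t \<cdot>\<^sub>m (N * Z t - E * (F * (N * Z t))) + c \<cdot>\<^sub>m (D * Z t)"
      unfolding 1 unfolding 2 using d dEF dZ by (intro eq_matI) (auto simp: algebra_simps simp del: index_mult_mat(1))
    also have "N * Z t - E * (F * (N * Z t)) = Q * Z t"
      unfolding Q using d dEF dZ by (simp add: mat_minus_mult_dim mat_assoc_dim)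
    finally show ?thesis .
  qed
  have rel: "Z t * Wm r s (kp \<kappa> * t * u) (km \<kappa> * t * inverse u) (ep \<kappa>) = t \<cdot>\<^sub>m (Q0 * Z t) + ep \<kappa> \<cdot>\<^sub>m (DD * Z t)"
    "Z t * Wm (inverse r) s (kp \<kappa> * t * inverse u) (km \<kappa> * t * u) (em \<kappa>) = t \<cdot>\<^sub>m (Q1 * Z t) + em \<kappa> \<cdot>\<^sub>m (DD' * Z t)"
    "Z t * Wm r s (kp \<kappa> * t * u) (km \<kappa> * t * inverse u) (ep \<kappa>) = (unfused_action r (tau_scale \<kappa> t) s u - E * (F * unfused_action r (tau_scale \<kappa> t) s u)) * Z t"
    if t: "t \<noteq> 0" for t
  proof -
    define \<kappa>' where "\<kappa>' = tau_scale \<kappa> t"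
    have k': "kp \<kappa>' = t * kp \<kappa>" "km \<kappa>' = t * km \<kappa>" "ep \<kappa>' = ep \<kappa>" "em \<kappa>' = em \<kappa>" by (simp_all add: \<kappa>'_def tau_scale_def)
    have kne: "km \<kappa>' \<noteq> 0" using k t k' by simp
    note I = unfused_K_intertwines[OF g s u IH[OF g kne], unfolded k']
    have I1: "V t * Wm r s (t * kp \<kappa> * u) (t * km \<kappa> * inverse u) (ep \<kappa>) = unfused_action r \<kappa>' s u * V t"
      "E * Wm r s (t * kp \<kappa> * inverse u) (t * km \<kappa> * u) (ep \<kappa>) = unfused_action r \<kappa>' s u * E"
      using unfused_K_intertwines[OF g s u IH[OF g kne]] e u r unfolding k' V_def E_def \<kappa>'_def[symmetric] by simp_all
    have dK: "dim_row (unfused_action r \<kappa>' s u) = n" "dim_col (unfused_action r \<kappa>' s u) = n" using dim_unfused_K[OF r s] by (simp_all add: n_def)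
    have Z1: "Z t * Wm r s (t * kp \<kappa> * u) (t * km \<kappa> * inverse u) (ep \<kappa>) = (unfused_action r \<kappa>' s u - E * (F * unfused_action r \<kappa>' s u)) * Z t"
      unfolding Z_def
      by (rule fused_defect_intertwines[where n = n and m = "s + 1" and l = "s + 1", OF _ _ _ _ _ _ _ _ _ _ _ _ I1 FE]) (use dV dEF dK in simp_all)
    then show "Z t * Wm r s (kp \<kappa> * t * u) (km \<kappa> * t * inverse u) (ep \<kappa>) = (unfused_action r (tau_scale \<kappa> t) s u - E * (F * unfused_action r (tau_scale \<kappa> t) s u)) * Z t"
      by (simp add: \<kappa>'_def mult.commute[of t])
    show "Z t * Wm r s (kp \<kappa> * t * u) (km \<kappa> * t * inverse u) (ep \<kappa>) = t \<cdot>\<^sub>m (Q0 * Z t) + ep \<kappa> \<cdot>\<^sub>m (DD * Z t)"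
      using Z1 red[OF unfused_action_tau[of r \<kappa> t s u, folded DD_def N0_def] _ _ _ _ Q0_def FD(1)] dN by (simp add: \<kappa>'_def mult.commute[of t])
    have g': "generic (inverse r)" using generic_inverse[OF g] .
    have sw: "kp (swap_eps \<kappa>') = t * kp \<kappa>" "km (swap_eps \<kappa>') = t * km \<kappa>" "ep (swap_eps \<kappa>') = em \<kappa>" "em (swap_eps \<kappa>') = ep \<kappa>"
      "swap_eps \<kappa>' = tau_scale (swap_eps \<kappa>) t"
      by (simp_all add: swap_eps_def k') (simp_all add: \<kappa>'_def tau_scale_def)
    have kne': "km (swap_eps \<kappa>') \<noteq> 0" using k t sw by simp
    obtain c where c: "c \<noteq> 0" "unfused_K (inverse r) (swap_eps \<kappa>') s (inverse u) = c \<cdot>\<^sub>m V t"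
      using unfused_K_inverse[OF r s, of \<kappa>' u] by (auto simp: V_def \<kappa>'_def)
    have u': "inverse u \<noteq> 0" using u by simp
    have J: "unfused_K (inverse r) (swap_eps \<kappa>') s (inverse u) * Wm (inverse r) s (t * kp \<kappa> * inverse u) (t * km \<kappa> * u) (em \<kappa>) =
         unfused_action (inverse r) (swap_eps \<kappa>') s (inverse u) * unfused_K (inverse r) (swap_eps \<kappa>') s (inverse u)"
      "E * Wm (inverse r) s (t * kp \<kappa> * u) (t * km \<kappa> * inverse u) (em \<kappa>) = unfused_action (inverse r) (swap_eps \<kappa>') s (inverse u) * E"
      using unfused_K_intertwines[OF g' s u' IH[OF g' kne']] e u r unfolding sw(1-4) E_def Emap_inverse by (simp_all add: disj_commute)
    have dK': "dim_row (unfused_action (inverse r) (swap_eps \<kappa>') s (inverse u)) = n" "dim_col (unfused_action (inverse r) (swap_eps \<kappa>') s (inverse u)) = n"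
      using dim_unfused_K[of "inverse r" s] r s by (simp_all add: n_def)
    have J1: "V t * Wm (inverse r) s (t * kp \<kappa> * inverse u) (t * km \<kappa> * u) (em \<kappa>) = unfused_action (inverse r) (swap_eps \<kappa>') s (inverse u) * V t"
    proof -
      have "c \<cdot>\<^sub>m (V t * Wm (inverse r) s (t * kp \<kappa> * inverse u) (t * km \<kappa> * u) (em \<kappa>)) = c \<cdot>\<^sub>m (unfused_action (inverse r) (swap_eps \<kappa>') s (inverse u) * V t)"
        using J(1) dV dK' unfolding c(2) by (simp add: mat_smult_mult_left_dim mat_smult_mult_right_dim)
      then have "inverse c \<cdot>\<^sub>m (c \<cdot>\<^sub>m (V t * Wm (inverse r) s (t * kp \<kappa> * inverse u) (t * km \<kappa> * u) (em \<kappa>))) = inverse c \<cdot>\<^sub>m (c \<cdot>\<^sub>m (unfused_action (inverse r) (swap_eps \<kappa>') s (inverse u) * V t))"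
        by simp
      then show ?thesis unfolding mat_smult_smult using c(1) by (simp add: one_smult_mat)
    qed
    have Z2: "Z t * Wm (inverse r) s (t * kp \<kappa> * inverse u) (t * km \<kappa> * u) (em \<kappa>) =
       (unfused_action (inverse r) (swap_eps \<kappa>') s (inverse u) - E * (F * unfused_action (inverse r) (swap_eps \<kappa>') s (inverse u))) * Z t"
      unfolding Z_def
      by (rule fused_defect_intertwines[where n = n and m = "s + 1" and l = "s + 1", OF _ _ _ _ _ _ _ _ _ _ _ _ J1 J(2) FE]) (use dV dEF dK' in simp_all)
    have Th': "unfused_action (inverse r) (swap_eps \<kappa>') s (inverse u) = t \<cdot>\<^sub>m N1 + em \<kappa> \<cdot>\<^sub>m DD'"
      unfolding sw(5) unfused_action_tau by (simp add: N1_def DD'_def swap_eps_def)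
    show "Z t * Wm (inverse r) s (kp \<kappa> * t * inverse u) (km \<kappa> * t * u) (em \<kappa>) = t \<cdot>\<^sub>m (Q1 * Z t) + em \<kappa> \<cdot>\<^sub>m (DD' * Z t)"
      using Z2 red[OF Th' _ _ _ _ Q1_def FD(2)] dN by (simp add: mult.commute[of t])
  qed
  \<comment> \<open>Diagonal entry at k of the combined action, minus the eigenvalue that
    \<open>boundary_first_column\<close> gives for the first column.\<close>
  define \<delta> where "\<delta> k = \<alpha> * ep \<kappa> * (fused_weight r s k * fused_weight r s k) - inverse \<alpha> * em \<kappa> * inverse (fused_weight r s k * fused_weight r s k)
      - (\<alpha> * ep \<kappa> * (p * p) - inverse \<alpha> * em \<kappa> * inverse (p * p))" for k
  define M where "M k l = - (\<alpha> * Q0 $$ (k, l) - inverse \<alpha> * Q1 $$ (k, l))" for k l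
  have dk: "\<delta> k \<noteq> 0" if "0 < k" "k < n" for k
    unfolding \<delta>_def
  proof (rule boundary_gap)
    show "fused_weight r s k * fused_weight r s k \<noteq> p * p"
      using that pw_square_ne[OF g, of k s] pw_square_ne[OF g, of "Suc (k - s)" s] by (auto simp: fused_weight_def p_def n_def)
    show "\<alpha>\<^sup>2 * (ep \<kappa> * (fused_weight r s k * fused_weight r s k * (p * p))) \<noteq> - em \<kappa>" using ne[of k] that by (simp add: \<alpha>_def p_def n_def)
  qed (use a0 pw_nonzero[OF r] in \<open>auto simp: p_def fused_weight_def\<close>)
  obtain \<eta> where \<eta>: "\<eta> > 0" "\<And>\<tau> v. norm \<tau> < \<eta> \<Longrightarrow> v 0 = 0 \<Longrightarrow>
     \<forall>k<n. \<delta> k * v k = \<tau> * (\<Sum>l<n. M k l * v l) \<Longrightarrow> \<forall>k<n. v k = (0 :: complex)"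
    using diagonal_dominance[of n \<delta> M, OF dk] by blast
  have DDi: "(DD * Z t) $$ (i, 0) = fused_weight r s i * fused_weight r s i * Z t $$ (i, 0)" "(DD' * Z t) $$ (i, 0) = inverse (fused_weight r s i * fused_weight r s i) * Z t $$ (i, 0)" if "i < n" for i t
    unfolding DD_def DD'_def Dm_kron_fused_weight[OF r s1] Dm_kron_fused_weight[OF nonzero_imp_inverse_nonzero[OF r] s1]
    using that dZ by (simp_all add: band_mult_index(3) fused_weight_inverse n_def del: index_mult_mat(1))
  \<comment> \<open>The first rows of \<E> and \<F> are unit vectors, so E F leaves the top entry of
    every column unchanged.\<close>
  have Z00: "Z t $$ (0, 0) = 0" for t
  proof -
    have n0: "0 < n" using s by (simp add: n_def)
    have "(E * (F * V t)) $$ (0, 0) = (F * V t) $$ (0, 0)"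
      unfolding E_def using dV dEF s1 by (subst Emap_mult_index(1)) auto
    also have "\<dots> = (\<Sum>l<n. F $$ (0, l) * V t $$ (l, 0))" using dV dEF by (subst mat_mult_index) auto
    also have "\<dots> = (\<Sum>l<n. if l = 0 then V t $$ (0, 0) else 0)"
      using s1 by (intro sum.cong) (auto simp: F_def Fmap_index n_def)
    also have "\<dots> = V t $$ (0, 0)" using n0 by simp
    finally show ?thesis using dV dEF n0 by (simp add: Z_def)
  qed
  have small: "Z t = 0\<^sub>m n (s + 1)" if t: "t \<noteq> 0" "norm t < \<eta>" for t
  proof -
    have eq: "\<delta> k * Z t $$ (k, 0) = t * (\<Sum>l<n. M k l * Z t $$ (l, 0))" if k: "k < n" for k
    proof -
      have "\<alpha> * (t \<cdot>\<^sub>m (Q0 * Z t) + ep \<kappa> \<cdot>\<^sub>m (DD * Z t)) $$ (k, 0) - inverse \<alpha> * (t \<cdot>\<^sub>m (Q1 * Z t) + em \<kappa> \<cdot>\<^sub>m (DD' * Z t)) $$ (k, 0)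
         = (\<alpha> * ep \<kappa> * (p * p) - inverse \<alpha> * em \<kappa> * inverse (p * p)) * Z t $$ (k, 0)"
        using boundary_first_column[OF g u s1 dZ[of t] k, of "kp \<kappa> * t" "km \<kappa> * t" "ep \<kappa>" "em \<kappa>"]
        unfolding rel(1,2)[OF t(1)] \<alpha>_def[symmetric] p_def[symmetric] by simp
      then have "\<alpha> * (t * (Q0 * Z t) $$ (k, 0) + ep \<kappa> * (fused_weight r s k * fused_weight r s k * Z t $$ (k, 0))) -
          inverse \<alpha> * (t * (Q1 * Z t) $$ (k, 0) + em \<kappa> * (inverse (fused_weight r s k * fused_weight r s k) * Z t $$ (k, 0)))
         = (\<alpha> * ep \<kappa> * (p * p) - inverse \<alpha> * em \<kappa> * inverse (p * p)) * Z t $$ (k, 0)"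
        using k dQ dZ dN by (simp add: DDi[OF k, simplified] del: index_mult_mat(1))
      then have "\<delta> k * Z t $$ (k, 0) = t * (- (\<alpha> * (Q0 * Z t) $$ (k, 0) - inverse \<alpha> * (Q1 * Z t) $$ (k, 0)))"
        unfolding \<delta>_def by (simp add: algebra_simps del: index_mult_mat(1))
      also have "- (\<alpha> * (Q0 * Z t) $$ (k, 0) - inverse \<alpha> * (Q1 * Z t) $$ (k, 0)) = (\<Sum>l<n. M k l * Z t $$ (l, 0))"
        using k dQ dZ by (simp add: mat_mult_index M_def sum_distrib_left sum_subtractf algebra_simps del: index_mult_mat(1))
      finally show ?thesis .
    qed
    have col: "Z t $$ (i, 0) = 0" if "i < n" for i
      using \<eta>(2)[OF t(2), of "\<lambda>k. Z t $$ (k, 0)"] Z00 eq that by blast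
    have "km \<kappa> * t * inverse u \<noteq> 0" using k t u by simp
    from boundary_lowering[OF g this dZ[of t] _ _ rel(3)[OF t(1)] col] show ?thesis
      using dim_unfused_K[OF r s] dEF by (simp add: n_def)
  qed
  \<comment> \<open>u is fixed and t varies: K is polynomial in the boundary parameters, so the
    defect is entire in t and its vanishing near 0 reaches t = 1.\<close>
  have hV: "mholo UNIV V n (s + 1)"
    unfolding V_def tau_scale_def n_def by (rule mholo_unfused_K[OF r s]) (use u in \<open>auto intro!: holomorphic_intros\<close>)
  have hZ: "mholo UNIV Z n (s + 1)"
    unfolding Z_def using dEF by (intro mholo_minus[OF hV] mholo_mult[OF _ mholo_mult[OF _ hV]] mholo_const) auto
  have "Z 1 $$ (i, j) = 0" if "i < n" "j < s + 1" for i j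
  proof (rule analytic_continuation[of "\<lambda>t. Z t $$ (i, j)" UNIV "ball 0 \<eta> - {0}" 0])
    show "(\<lambda>t. Z t $$ (i, j)) holomorphic_on UNIV" using mholoD(3)[OF hZ that] .
    show "0 islimpt (ball 0 \<eta> - {0 :: complex})"
      by (rule islimpt_punctured[THEN iffD1]) (use \<eta>(1) in \<open>simp add: islimpt_ball\<close>)
    show "Z t $$ (i, j) = 0" if "t \<in> ball 0 \<eta> - {0}" for t
      using small[of t] that \<open>i < n\<close> \<open>j < s + 1\<close> by auto
  qed auto
  then have "Z 1 = 0\<^sub>m n (s + 1)" using dZ by (intro eq_matI) auto
  moreover have "tau_scale \<kappa> 1 = \<kappa>" by (cases \<kappa>) (simp add: tau_scale_def)
  ultimately show ?thesis by (simp add: Z_def V_def E_def F_def n_def)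
qed

lemma finite_square_eq_const: "c \<noteq> 0 \<Longrightarrow> finite {u :: complex. (u * a)\<^sup>2 * c = d}" if "a \<noteq> 0"
proof -
  assume c: "c \<noteq> 0"
  have "{u :: complex. (u * a)\<^sup>2 * c = d} = {u. u ^ 2 = d / (a\<^sup>2 * c)}"
    using that c by (auto simp: field_simps power2_eq_square)
  then show ?thesis using finite_nth_roots[of 2 "d / (a\<^sup>2 * c)"] by simp
qed

text \<open>A nonzero k_- drives the propagation through columns, and a nonzero \<epsilon> keeps the
  set of excluded u finite. The induction generalizes r, \<kappa> and u, because each step also uses
  the relation at 1/q.\<close>

lemma Kmat_intertwines:
  assumes "s \<ge> 1" "generic r" "km \<kappa> \<noteq> 0" "ep \<kappa> \<noteq> 0 \<or> em \<kappa> \<noteq> 0" "u \<noteq> 0"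
  shows "Kmat r \<kappa> s u * Wm r s (kp \<kappa> * u) (km \<kappa> * inverse u) (ep \<kappa>) =
    Wm r s (kp \<kappa> * inverse u) (km \<kappa> * u) (ep \<kappa>) * Kmat r \<kappa> s u"
  using assms
proof (induction s arbitrary: r \<kappa> u rule: nat_induct_at_least)
  case base
  then show ?case using Khalf_intertwines[of r u \<kappa>] by simp
next
  case (Suc t)
  define s where "s = Suc t"
  have s: "s \<ge> 2" "s \<ge> 1" "s - 1 = t" using Suc.hyps by (auto simp: s_def)
  note g = \<open>generic r\<close> and k = \<open>km \<kappa> \<noteq> 0\<close> and e = \<open>ep \<kappa> \<noteq> 0 \<or> em \<kappa> \<noteq> 0\<close> and u = \<open>u \<noteq> 0\<close>
  have r: "r \<noteq> 0" using generic_nonzero[OF g] .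
  \<comment> \<open>The u at which an eigenvalue meets that of the first column. Each condition is
    quadratic in u; for \<epsilon>_+ = 0 it reads 0 = -\<epsilon>_- and has no solution.\<close>
  define B where "B = {u. \<exists>k<2 * s. (u * r powi (1 - int s))\<^sup>2 * (ep \<kappa> * (fused_weight r s k * fused_weight r s k * (pw r s 0 * pw r s 0))) = - em \<kappa>}"
  have fB: "finite B"
  proof (cases "ep \<kappa> = 0")
    case True
    then have "B = {}" using e by (auto simp: B_def)
    then show ?thesis by simp
  next
    case False
    have "B = (\<Union>k<2 * s. {u. (u * r powi (1 - int s))\<^sup>2 * (ep \<kappa> * (fused_weight r s k * fused_weight r s k * (pw r s 0 * pw r s 0))) = - em \<kappa>})"
      by (auto simp: B_def)
    also have "finite \<dots>"
      using False r pw_nonzero[OF r] by (intro finite_UN_I finite_square_eq_const) (auto simp: fused_weight_def)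
    finally show ?thesis .
  qed
  have Z: "unfused_K r \<kappa> s u - Emap r s * (Fmap r s * unfused_K r \<kappa> s u) = 0\<^sub>m (2 * s) (s + 1)"
  proof (rule mholo_finite_exception[of "- {0}" "\<lambda>u. unfused_K r \<kappa> s u - Emap r s * (Fmap r s * unfused_K r \<kappa> s u)", OF _ _ _ fB])
    have V: "mholo (- {0}) (\<lambda>u. unfused_K r \<kappa> s u) (2 * s) (s + 1)"
      using mholo_unfused_K[OF r s(1), of "\<lambda>_. kp \<kappa>" "- {0}" "\<lambda>_. km \<kappa>" "\<lambda>_. ep \<kappa>" "\<lambda>_. em \<kappa>" "\<lambda>u. u"] by simp
    show "mholo (- {0}) (\<lambda>u. unfused_K r \<kappa> s u - Emap r s * (Fmap r s * unfused_K r \<kappa> s u)) (2 * s) (s + 1)"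
      by (intro mholo_minus[OF V] mholo_mult[OF _ mholo_mult[OF _ V]] mholo_const) auto
    fix v :: complex assume v: "v \<in> - {0}" "v \<notin> B"
    show "unfused_K r \<kappa> s v - Emap r s * (Fmap r s * unfused_K r \<kappa> s v) = 0\<^sub>m (2 * s) (s + 1)"
      by (rule unfused_K_defect_tau[OF g s(1) _ _ k e]) (use v Suc.IH s in \<open>auto simp: B_def\<close>)
  qed (use u in auto)
  have IH: "Kmat r \<kappa> (s - 1) (u * r) * Wm r (s - 1) (kp \<kappa> * (u * r)) (km \<kappa> * inverse (u * r)) (ep \<kappa>) =
      Wm r (s - 1) (kp \<kappa> * inverse (u * r)) (km \<kappa> * (u * r)) (ep \<kappa>) * Kmat r \<kappa> (s - 1) (u * r)"
    unfolding s(3) using Suc.IH[OF g k e, of "u * r"] u r by simp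
  show ?case
    unfolding s_def[symmetric] Kmat_unfused_K[OF r s(1)]
    by (rule fused_intertwines[OF _ _ _ _ _ _ _ _ _ _ _ _ unfused_K_intertwines(1)[OF g s(1) u IH] unfused_K_intertwines(2)[OF g s(1) u IH] Fmap_Emap[OF g s(2)] Z])
       (use dim_unfused_K[OF r s(1)] in auto)
qed

text \<open>The relation for the second generator W_1, obtained from that for W_0 at 1/q.\<close>

lemma Kmat_intertwines':
  assumes "s \<ge> 1" "generic r" "km \<kappa> \<noteq> 0" "ep \<kappa> \<noteq> 0 \<or> em \<kappa> \<noteq> 0" "u \<noteq> 0"
  shows "Kmat r \<kappa> s u * Wm (inverse r) s (kp \<kappa> * inverse u) (km \<kappa> * u) (em \<kappa>) =
    Wm (inverse r) s (kp \<kappa> * u) (km \<kappa> * inverse u) (em \<kappa>) * Kmat r \<kappa> s u"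
proof -
  obtain c where c: "c \<noteq> 0" "\<And>u. Kmat (inverse r) (swap_eps \<kappa>) s (inverse u) = c \<cdot>\<^sub>m Kmat r \<kappa> s u"
    using Kmat_inverse[of r] generic_nonzero[OF assms(2)] by blast
  have "c \<cdot>\<^sub>m (Kmat r \<kappa> s u * Wm (inverse r) s (kp \<kappa> * inverse u) (km \<kappa> * u) (em \<kappa>)) =
    c \<cdot>\<^sub>m (Wm (inverse r) s (kp \<kappa> * u) (km \<kappa> * inverse u) (em \<kappa>) * Kmat r \<kappa> s u)"
    using Kmat_intertwines[OF assms(1) generic_inverse[OF assms(2)], of "swap_eps \<kappa>" "inverse u"] assms(3-)
    unfolding c(2) by (simp add: swap_eps_def disj_commute mat_smult_mult_left_dim mat_smult_mult_right_dim)
  from arg_cong[OF this, of "(\<cdot>\<^sub>m) (inverse c)"] show ?thesis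
    using c(1) by (simp add: mat_smult_smult one_smult_mat)
qed

section \<open>K-matrices stripped of scalar factors, and their value at u = 1\<close>

text \<open>The fused K-matrix with the c-factors of R omitted and c(u^2 q) divided out at every
  fusion step. Where such a divisor vanishes, division by zero makes the value meaningless;
  \<open>Khat_regular\<close> deals with those points.\<close>

fun Khat :: "complex \<Rightarrow> bparams \<Rightarrow> nat \<Rightarrow> complex \<Rightarrow> complex mat" where
  "Khat r \<kappa> 0 u = 1\<^sub>m 1"
| "Khat r \<kappa> (Suc 0) u = Khalf r \<kappa> u"
| "Khat r \<kappa> (Suc (Suc n)) u = inverse (cfun (u\<^sup>2 * r\<^sup>2)) \<cdot>\<^sub>m (Fmap r (Suc (Suc n)) *
     ((Khalf r \<kappa> (u * r powi (1 - int (Suc (Suc n)))) \<otimes>\<^sub>k 1\<^sub>m (Suc (Suc n))) *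
      (rcore r (Suc n) (u\<^sup>2 * r powi (2 - int (Suc (Suc n)))) * ((1\<^sub>m 2 \<otimes>\<^sub>k Khat r \<kappa> (Suc n) (u * r)) * Emap r (Suc (Suc n))))))"

lemma dim_Khat [simp]: "dim_row (Khat r \<kappa> s u) = s + 1" "dim_col (Khat r \<kappa> s u) = s + 1"
  by (induction r \<kappa> s u rule: Khat.induct) simp_all

lemma Khat_unfold:
  assumes "s \<ge> 2"
  shows "Khat r \<kappa> s u = inverse (cfun (u\<^sup>2 * r\<^sup>2)) \<cdot>\<^sub>m (Fmap r s *
     ((Khalf r \<kappa> (u * r powi (1 - int s)) \<otimes>\<^sub>k 1\<^sub>m s) *
      (rcore r (s - 1) (u\<^sup>2 * r powi (2 - int s)) * ((1\<^sub>m 2 \<otimes>\<^sub>k Khat r \<kappa> (s - 1) (u * r)) * Emap r s))))"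
proof -
  obtain n where n: "s = Suc (Suc n)" using assms by (metis One_nat_def Suc_1 Suc_le_D Suc_le_mono)
  show ?thesis unfolding n by simp
qed

text \<open>The product of all the scalar factors that K acquires in fusion, as in the normalization
  with all layers removed.\<close>

definition Kpref :: "complex \<Rightarrow> nat \<Rightarrow> complex \<Rightarrow> complex" where
  "Kpref r s u = (\<Prod>k<s - 1. \<Prod>l<s - 1 - k. cfun (u\<^sup>2 * r powi (2 * (1 + int k - int l))))"

text \<open>The layer k = 0 is the prefactor of the last R-matrix together with c(u^2 q) from l = 0;
  the layers k >= 1 are those of the lower spin at u r, with k shifted by one.\<close>

lemma Kpref_rec:
  assumes r: "r \<noteq> 0" and s: "s \<ge> 2"
  shows "Kpref r s u = rpref r (s - 1) (u\<^sup>2 * r powi (2 - int s)) * Kpref r (s - 1) (u * r) * cfun (u\<^sup>2 * r\<^sup>2)"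
proof -
  obtain n where n: "s = Suc (Suc n)" using assms by (metis One_nat_def Suc_1 Suc_le_D Suc_le_mono)
  have 1: "rpref r (s - 1) (u\<^sup>2 * r powi (2 - int s)) = (\<Prod>l<n. cfun (u\<^sup>2 * r powi (2 * (1 - int (Suc l)))))"
    unfolding rpref_def n using r by (intro prod.cong) (simp_all add: mult.assoc flip: power_int_add)
  have 2: "Kpref r (s - 1) (u * r) = (\<Prod>k<n. \<Prod>l<n - k. cfun (u\<^sup>2 * r powi (2 * (1 + int (Suc k) - int l))))"
  proof -
    have "(u * r)\<^sup>2 * r powi (2 * (1 + int k - int l)) = u\<^sup>2 * r powi (2 * (1 + int (Suc k) - int l))" for k l
    proof -
      have "2 * (1 + int (Suc k) - int l) = 2 * (1 + int k - int l) + 2" by simp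
      then have "r powi (2 * (1 + int (Suc k) - int l)) = r powi (2 * (1 + int k - int l)) * r powi 2"
        by (metis power_int_add[OF disjI1, OF r])
      then show ?thesis by (simp add: power_mult_distrib mult_ac)
    qed
    then show ?thesis unfolding Kpref_def n by simp
  qed
  have "Kpref r s u = (\<Prod>l<Suc n. cfun (u\<^sup>2 * r powi (2 * (1 - int l)))) * (\<Prod>k<n. \<Prod>l<n - k. cfun (u\<^sup>2 * r powi (2 * (1 + int (Suc k) - int l))))"
    unfolding Kpref_def n by (subst diff_Suc_1, subst prod.lessThan_Suc_shift) simp
  also have "(\<Prod>l<Suc n. cfun (u\<^sup>2 * r powi (2 * (1 - int l)))) = cfun (u\<^sup>2 * r\<^sup>2) * (\<Prod>l<n. cfun (u\<^sup>2 * r powi (2 * (1 - int (Suc l)))))"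
    by (subst prod.lessThan_Suc_shift) simp
  finally show ?thesis unfolding 1 2 by (simp only: mult_ac)
qed

text \<open>Unwinding the recursion, the level of spin (s-m+1)/2 is evaluated at u r^(m-1) and
  divides by c(u^2 q^m); this gives the range of m.\<close>

lemma Kmat_Khat:
  assumes r: "r \<noteq> 0" and "\<And>m. 1 \<le> m \<Longrightarrow> m < s \<Longrightarrow> cfun (u\<^sup>2 * r ^ (2 * m)) \<noteq> 0"
  shows "Kmat r \<kappa> s u = Kpref r s u \<cdot>\<^sub>m Khat r \<kappa> s u"
  using assms(2)
proof (induction s arbitrary: u rule: less_induct)
  case (less s)
  consider "s = 0" | "s = 1" | "s \<ge> 2" by linarith
  then show ?case
  proof cases
    case 3
    have c: "cfun (u\<^sup>2 * r\<^sup>2) \<noteq> 0" using less.prems[of 1] 3 by simp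
    have ih: "Kmat r \<kappa> (s - 1) (u * r) = Kpref r (s - 1) (u * r) \<cdot>\<^sub>m Khat r \<kappa> (s - 1) (u * r)"
    proof (rule less.IH)
      fix m assume "1 \<le> m" "m < s - 1"
      then show "cfun ((u * r)\<^sup>2 * r ^ (2 * m)) \<noteq> 0"
        using less.prems[of "Suc m"] by (simp add: power_mult_distrib power_add mult_ac power2_eq_square)
    qed (use 3 in auto)
    have "s - 1 \<ge> 1" using 3 by simp
    define c where "c = cfun (u\<^sup>2 * r\<^sup>2)"
    have c0: "c * (inverse c * x) = x" for x using c by (simp add: c_def)
    show ?thesis
      unfolding Kmat_unfused_K[OF r 3] unfused_K_def ih Khat_unfold[OF 3] Rhalf_eq[OF \<open>s - 1 \<ge> 1\<close> r] Kpref_rec[OF r 3] c_def[symmetric] using 3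
      by (simp add: c0 kron_smult_right mat_smult_mult_left_dim mat_smult_mult_right_dim mat_smult_smult mult_ac)
  qed (simp_all add: Kpref_def one_smult_mat)
qed

lemma mholo_Khalf:
  assumes p: "a holomorphic_on S" "b holomorphic_on S" "c holomorphic_on S" "d holomorphic_on S"
    and f: "f holomorphic_on S" "\<And>z. z \<in> S \<Longrightarrow> f z \<noteq> 0" and r: "r \<noteq> 0"
  shows "mholo S (\<lambda>z. Khalf r (BParams (a z) (b z) (c z) (d z)) (f z)) 2 2"
proof -
  have "0 \<notin> f ` S" using f(2) by auto
  from mholo_Kmat[OF r p f(1) this, of "Suc 0"] show ?thesis by (simp add: numeral_2_eq_2)
qed

lemma mholo_Khat:
  assumes r: "r \<noteq> 0" and p: "a holomorphic_on S" "b holomorphic_on S" "c holomorphic_on S" "d holomorphic_on S"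
    and f: "f holomorphic_on S" "\<And>z. z \<in> S \<Longrightarrow> f z \<noteq> 0" "\<And>z m. z \<in> S \<Longrightarrow> 1 \<le> m \<Longrightarrow> m < s \<Longrightarrow> cfun ((f z)\<^sup>2 * r ^ (2 * m)) \<noteq> 0"
  shows "mholo S (\<lambda>z. Khat r (BParams (a z) (b z) (c z) (d z)) s (f z)) (s + 1) (s + 1)"
  using f
proof (induction s arbitrary: f rule: less_induct)
  case (less s)
  consider "s = 0" | "s = 1" | "s \<ge> 2" by linarith
  then show ?case
  proof cases
    case 1
    then show ?thesis by (simp add: mholo_const)
  next
    case 2
    then show ?thesis using mholo_Khalf[OF p less.prems(1,2) r] by (simp add: numeral_2_eq_2)
  next
    case 3
    have K1: "mholo S (\<lambda>z. Khalf r (BParams (a z) (b z) (c z) (d z)) (f z * r powi (1 - int s)) \<otimes>\<^sub>k 1\<^sub>m s) (2 * s) (2 * s)"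
      by (intro mholo_kron mholo_Khalf[OF p _ _ r] mholo_const holomorphic_intros less.prems) (use r less.prems in auto)
    have R: "mholo S (\<lambda>z. rcore r (s - 1) ((f z)\<^sup>2 * r powi (2 - int s))) (2 * s) (2 * s)"
    proof -
      have "(\<lambda>z. (f z)\<^sup>2 * r powi (2 - int s)) holomorphic_on S" using less.prems(1) by (intro holomorphic_intros)
      moreover have "(\<lambda>z. (f z)\<^sup>2 * r powi (2 - int s)) ` S \<subseteq> - {0}" using less.prems(2) r by auto
      ultimately show ?thesis using mholo_compose[OF mholo_rcore[OF r, of "s - 1"]] 3 by simp
    qed
    have "mholo S (\<lambda>z. Khat r (BParams (a z) (b z) (c z) (d z)) (s - 1) (f z * r)) (s - 1 + 1) (s - 1 + 1)"
    proof (rule less.IH)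
      fix z m assume "z \<in> S" "1 \<le> m" "m < s - 1"
      then show "cfun ((f z * r)\<^sup>2 * r ^ (2 * m)) \<noteq> 0"
        using less.prems(3)[of z "Suc m"] by (simp add: power_mult_distrib power_add mult_ac power2_eq_square)
    qed (use less.prems r 3 in \<open>auto intro!: holomorphic_intros\<close>)
    from mholo_kron[OF mholo_const[of "1\<^sub>m 2" 2 2] this]
    have K2: "mholo S (\<lambda>z. 1\<^sub>m 2 \<otimes>\<^sub>k Khat r (BParams (a z) (b z) (c z) (d z)) (s - 1) (f z * r)) (2 * s) (2 * s)" using 3 by simp
    have c: "(\<lambda>z. inverse (cfun ((f z)\<^sup>2 * r\<^sup>2))) holomorphic_on S"
      using less.prems(3)[of _ 1] less.prems(1,2) r 3 unfolding cfun_def by (auto intro!: holomorphic_intros)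
    show ?thesis
      unfolding Khat_unfold[OF 3]
      by (intro mholo_smult[OF _ c] mholo_mult[OF _ mholo_mult[OF K1 mholo_mult[OF R mholo_mult[OF K2]]]] mholo_const) auto
  qed
qed

lemma cfun_eq_0_iff: "cfun w = 0 \<longleftrightarrow> w = 0 \<or> w\<^sup>2 = 1"
  by (cases "w = 0") (auto simp: cfun_def power2_eq_square field_simps)

lemma finite_cfun_zeros:
  assumes "c \<noteq> 0"
  shows "finite {u. cfun (u\<^sup>2 * c) = 0}"
proof -
  have "{u. cfun (u\<^sup>2 * c) = 0} \<subseteq> {0} \<union> {u. u ^ 4 = 1 / c\<^sup>2}"
    using assms by (auto simp: cfun_eq_0_iff field_simps power_mult_distrib simp flip: power_mult)
  then show ?thesis using finite_nth_roots[of 4 "1 / c\<^sup>2"] by (meson finite.emptyI finite.insertI finite_UnI finite_subset zero_less_numeral)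
qed

lemma finite_Kpref_zeros: "r \<noteq> 0 \<Longrightarrow> finite {u. Kpref r s u = 0}"
proof -
  assume r: "r \<noteq> 0"
  have "{u. Kpref r s u = 0} \<subseteq> (\<Union>k<s. \<Union>l<s. {u. cfun (u\<^sup>2 * r powi (2 * (1 + int k - int l))) = 0})"
  proof
    fix u assume "u \<in> {u. Kpref r s u = 0}"
    then obtain k l where "k < s - 1" "l < s - 1 - k" "cfun (u\<^sup>2 * r powi (2 * (1 + int k - int l))) = 0"
      by (auto simp: Kpref_def)
    then show "u \<in> (\<Union>k<s. \<Union>l<s. {u. cfun (u\<^sup>2 * r powi (2 * (1 + int k - int l))) = 0})"
      by (intro UN_I[of k] UN_I[of l] CollectI) simp_all
  qed
  moreover have "finite \<dots>" using r by (intro finite_UN_I finite_cfun_zeros) auto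
  ultimately show ?thesis by (rule finite_subset)
qed

lemma open_cfun_nonzero: "open {u. u \<noteq> 0 \<and> (\<forall>m. 1 \<le> m \<longrightarrow> m < s \<longrightarrow> cfun (u\<^sup>2 * r ^ (2 * m)) \<noteq> 0)}" if r: "r \<noteq> 0" for r :: complex and s :: nat
proof -
  have fin: "finite ({0} \<union> (\<Union>m\<in>{1..<s}. {u. cfun (u\<^sup>2 * r ^ (2 * m)) = 0}))"
    using r by (intro finite_UnI finite_UN_I finite_cfun_zeros) auto
  have eq: "{u. u \<noteq> 0 \<and> (\<forall>m. 1 \<le> m \<longrightarrow> m < s \<longrightarrow> cfun (u\<^sup>2 * r ^ (2 * m)) \<noteq> 0)} = - ({0} \<union> (\<Union>m\<in>{1..<s}. {u. cfun (u\<^sup>2 * r ^ (2 * m)) = 0}))"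
    by auto
  show ?thesis unfolding eq using finite_imp_closed[OF fin] by (rule open_Compl)
qed

lemma generic_cfun: "generic r \<Longrightarrow> m > 0 \<Longrightarrow> cfun (r ^ m) \<noteq> 0"
  using generic_powi_eq_iff[of r "2 * int m" 0] generic_nonzero[of r] by (auto simp: cfun_eq_0_iff power_int_def nat_mult_distrib simp flip: power_mult mult.commute[of _ 2])

text \<open>At u = 1 the generators on the two sides coincide, so that the relations become
  commutators. Since \<open>Kpref\<close> may vanish there, it is cancelled at nearby points and the
  result extended by continuity.\<close>

lemma Khat_one_intertwines:
  assumes s: "s \<ge> 1" and g: "generic r" and k: "km \<kappa> \<noteq> 0" and e: "ep \<kappa> \<noteq> 0 \<or> em \<kappa> \<noteq> 0"
  shows "Khat r \<kappa> s 1 * Wm r s (kp \<kappa>) (km \<kappa>) (ep \<kappa>) = Wm r s (kp \<kappa>) (km \<kappa>) (ep \<kappa>) * Khat r \<kappa> s 1"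
    "Khat r \<kappa> s 1 * Wm (inverse r) s (kp \<kappa>) (km \<kappa>) (em \<kappa>) = Wm (inverse r) s (kp \<kappa>) (km \<kappa>) (em \<kappa>) * Khat r \<kappa> s 1"
proof -
  have r: "r \<noteq> 0" using generic_nonzero[OF g] .
  define S where "S = {u. u \<noteq> 0 \<and> (\<forall>m. 1 \<le> m \<longrightarrow> m < s \<longrightarrow> cfun (u\<^sup>2 * r ^ (2 * m)) \<noteq> 0)}"
  have S: "open S" unfolding S_def by (rule open_cfun_nonzero[OF r])
  have 1: "1 \<in> S" using generic_cfun[OF g] by (simp add: S_def)
  have K: "mholo S (\<lambda>u. Khat r \<kappa> s u) (s + 1) (s + 1)"
  proof -
    have "mholo S (\<lambda>u. Khat r (BParams (kp \<kappa>) (km \<kappa>) (ep \<kappa>) (em \<kappa>)) s u) (s + 1) (s + 1)"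
      by (rule mholo_Khat[OF r holomorphic_on_const holomorphic_on_const holomorphic_on_const holomorphic_on_const holomorphic_on_ident])
        (auto simp: S_def)
    then show ?thesis by simp
  qed
  have A: "mholo S (\<lambda>u. Wm p s (f u) (h u) c) (s + 1) (s + 1)"
    if "f holomorphic_on S" "h holomorphic_on S" for p f h c
  proof (rule mholoI)
    fix i k assume "i < s + 1" "k < s + 1"
    then have "Wm p s x y c $$ (i, k) = x * (if k = Suc i then p * bco p s i * p powi wt s k else 0)
       + y * (if i = Suc k then inverse p * bco p s k * p powi wt s k else 0) + c * Dm p s $$ (i, k)" for x y
      by (simp add: Wm_def Am_index)
    then show "(\<lambda>u. Wm p s (f u) (h u) c $$ (i, k)) holomorphic_on S"
      using that by (simp only:) (intro holomorphic_intros)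
  qed (auto simp: Wm_def)
  have S0: "\<And>u. u \<in> S \<Longrightarrow> u \<noteq> 0" by (auto simp: S_def)
  have canc: "Khat r \<kappa> s u * X = Y * Khat r \<kappa> s u" if "u \<in> S" "Kpref r s u \<noteq> 0" "Kmat r \<kappa> s u * X = Y * Kmat r \<kappa> s u"
    "dim_row X = s + 1" "dim_col Y = s + 1" for u X Y
  proof -
    have "Kmat r \<kappa> s u = Kpref r s u \<cdot>\<^sub>m Khat r \<kappa> s u" using that(1) by (intro Kmat_Khat[OF r]) (auto simp: S_def)
    then have "Kpref r s u \<cdot>\<^sub>m (Khat r \<kappa> s u * X) = Kpref r s u \<cdot>\<^sub>m (Y * Khat r \<kappa> s u)"
      using that(3-) by (simp add: mat_smult_mult_left_dim mat_smult_mult_right_dim)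
    from arg_cong[OF this, of "(\<cdot>\<^sub>m) (inverse (Kpref r s u))"] show ?thesis
      using that(2) by (simp add: mat_smult_smult one_smult_mat)
  qed
  have z: "X = Y" if "X - Y = 0\<^sub>m n n" "dim_row X = n" "dim_col X = n" "dim_row Y = n" "dim_col Y = n" for X Y :: "complex mat" and n
  proof (rule eq_matI)
    fix i k assume "i < dim_row Y" "k < dim_col Y"
    then have "(X - Y) $$ (i, k) = 0" using that by simp
    then show "X $$ (i, k) = Y $$ (i, k)" using \<open>i < dim_row Y\<close> \<open>k < dim_col Y\<close> by simp
  qed (use that in auto)
  have ms: "X - X = 0\<^sub>m (s + 1) (s + 1)" if "dim_row X = s + 1" "dim_col X = s + 1" for X :: "complex mat"
    using that by (intro eq_matI) auto
  let ?Z = "\<lambda>u. Khat r \<kappa> s u * Wm r s (kp \<kappa> * u) (km \<kappa> * inverse u) (ep \<kappa>) - Wm r s (kp \<kappa> * inverse u) (km \<kappa> * u) (ep \<kappa>) * Khat r \<kappa> s u"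
  have "?Z 1 = 0\<^sub>m (s + 1) (s + 1)"
  proof (rule mholo_finite_exception[OF _ S 1 finite_Kpref_zeros[OF r, of s]])
    show "mholo S ?Z (s + 1) (s + 1)"
      by (intro mholo_minus mholo_mult[where m = "s + 1"] K A holomorphic_intros) (use S0 in auto)
    show "?Z u = 0\<^sub>m (s + 1) (s + 1)" if "u \<in> S" "u \<notin> {u. Kpref r s u = 0}" for u
      using canc[OF that(1) _ Kmat_intertwines[OF s g k e]] S0[OF that(1)] that(2) ms by simp
  qed
  from z[OF this] show "Khat r \<kappa> s 1 * Wm r s (kp \<kappa>) (km \<kappa>) (ep \<kappa>) = Wm r s (kp \<kappa>) (km \<kappa>) (ep \<kappa>) * Khat r \<kappa> s 1"
    by simp
  let ?Y = "\<lambda>u. Khat r \<kappa> s u * Wm (inverse r) s (kp \<kappa> * inverse u) (km \<kappa> * u) (em \<kappa>) - Wm (inverse r) s (kp \<kappa> * u) (km \<kappa> * inverse u) (em \<kappa>) * Khat r \<kappa> s u"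
  have "?Y 1 = 0\<^sub>m (s + 1) (s + 1)"
  proof (rule mholo_finite_exception[OF _ S 1 finite_Kpref_zeros[OF r, of s]])
    show "mholo S ?Y (s + 1) (s + 1)"
      by (intro mholo_minus mholo_mult[where m = "s + 1"] K A holomorphic_intros) (use S0 in auto)
    show "?Y u = 0\<^sub>m (s + 1) (s + 1)" if "u \<in> S" "u \<notin> {u. Kpref r s u = 0}" for u
      using canc[OF that(1) _ Kmat_intertwines'[OF s g k e]] S0[OF that(1)] that(2) ms by simp
  qed
  from z[OF this] show "Khat r \<kappa> s 1 * Wm (inverse r) s (kp \<kappa>) (km \<kappa>) (em \<kappa>) = Wm (inverse r) s (kp \<kappa>) (km \<kappa>) (em \<kappa>) * Khat r \<kappa> s 1"
    by simp
qed

text \<open>The perturbation argument once more, for K(1) minus its top left entry times the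
  identity, which commutes with both generators. As exactly one \<epsilon> is nonzero, the condition
  in \<open>boundary_gap\<close> compares zero with a nonzero number, so it holds at the single
  point u = 1.\<close>

lemma Khat_one_scalar:
  assumes s: "s \<ge> 1" and g: "generic r" and k: "km \<kappa> \<noteq> 0" and e: "ep \<kappa> \<noteq> 0 \<and> em \<kappa> = 0 \<or> ep \<kappa> = 0 \<and> em \<kappa> \<noteq> 0"
  shows "Khat r \<kappa> s 1 = Khat r \<kappa> s 1 $$ (0, 0) \<cdot>\<^sub>m 1\<^sub>m (s + 1)"
proof -
  have r: "r \<noteq> 0" using generic_nonzero[OF g] .
  define n where "n = s + 1"
  define Y where "Y t = Khat r (tau_scale \<kappa> t) s 1" for t
  define Z where "Z t = Y t - Y t $$ (0, 0) \<cdot>\<^sub>m 1\<^sub>m n" for t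
  define \<alpha> where "\<alpha> = r powi (1 - int s)"
  define A0 where "A0 = Am r s (kp \<kappa>) (km \<kappa>)"
  define A1 where "A1 = Am (inverse r) s (kp \<kappa>) (km \<kappa>)"
  define p where "p = pw r s 0"
  have a0: "\<alpha> \<noteq> 0" using r by (simp add: \<alpha>_def)
  have dY: "dim_row (Y t) = n" "dim_col (Y t) = n" for t by (simp_all add: Y_def n_def)
  have dZ: "dim_row (Z t) = n" "dim_col (Z t) = s + 1" for t by (simp_all add: Z_def dY n_def)
  have dA: "dim_row A0 = n" "dim_col A0 = n" "dim_row A1 = n" "dim_col A1 = n" by (simp_all add: A0_def A1_def n_def)
  have com: "Z t * X = X * Z t" if "Y t * X = X * Y t" "dim_row X = n" "dim_col X = n" for X t
  proof -
    have "Z t * X = Y t * X - Y t $$ (0, 0) \<cdot>\<^sub>m X"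
      unfolding Z_def using that dY by (simp add: mat_minus_mult_dim mat_smult_mult_left_dim one_mult_dim)
    moreover have "X * Z t = X * Y t - Y t $$ (0, 0) \<cdot>\<^sub>m X"
      unfolding Z_def using that dY by (simp add: mat_minus_mult_dim mat_smult_mult_right_dim mult_one_dim)
    ultimately show ?thesis using that by simp
  qed
  have W: "Wm r s (kp \<kappa> * t) (km \<kappa> * t) x = t \<cdot>\<^sub>m A0 + x \<cdot>\<^sub>m Dm r s"
    "Wm (inverse r) s (kp \<kappa> * t) (km \<kappa> * t) x = t \<cdot>\<^sub>m A1 + x \<cdot>\<^sub>m Dm (inverse r) s" for t x
    unfolding Wm_def A0_def A1_def by (simp_all add: Am_smult mult.commute[of _ t])
  have rel: "Z t * Wm r s (kp \<kappa> * t) (km \<kappa> * t) (ep \<kappa>) = Wm r s (kp \<kappa> * t) (km \<kappa> * t) (ep \<kappa>) * Z t"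
    "Z t * Wm (inverse r) s (kp \<kappa> * t) (km \<kappa> * t) (em \<kappa>) = Wm (inverse r) s (kp \<kappa> * t) (km \<kappa> * t) (em \<kappa>) * Z t"
    if t: "t \<noteq> 0" for t
    using Khat_one_intertwines[OF s g, of "tau_scale \<kappa> t"] k e t
    by (auto intro!: com simp: Y_def tau_scale_def n_def mult.commute[of t])
  define \<delta> where "\<delta> k = \<alpha> * ep \<kappa> * (pw r s k * pw r s k) - inverse \<alpha> * em \<kappa> * inverse (pw r s k * pw r s k)
      - (\<alpha> * ep \<kappa> * (p * p) - inverse \<alpha> * em \<kappa> * inverse (p * p))" for k
  define M where "M k l = - (\<alpha> * A0 $$ (k, l) - inverse \<alpha> * A1 $$ (k, l))" for k l
  have dk: "\<delta> k \<noteq> 0" if "0 < k" "k < n" for k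
    unfolding \<delta>_def
  proof (rule boundary_gap)
    show "pw r s k * pw r s k \<noteq> p * p"
      using that pw_square_ne[OF g, of k s] by (auto simp: p_def n_def)
    show "\<alpha>\<^sup>2 * (ep \<kappa> * (pw r s k * pw r s k * (p * p))) \<noteq> - em \<kappa>" using e a0 pw_nonzero[OF r] by (auto simp: p_def)
  qed (use a0 pw_nonzero[OF r] in \<open>auto simp: p_def\<close>)
  obtain \<eta> where \<eta>: "\<eta> > 0" "\<And>\<tau> v. norm \<tau> < \<eta> \<Longrightarrow> v 0 = 0 \<Longrightarrow>
     \<forall>k<n. \<delta> k * v k = \<tau> * (\<Sum>l<n. M k l * v l) \<Longrightarrow> \<forall>k<n. v k = (0 :: complex)"
    using diagonal_dominance[of n \<delta> M, OF dk] by blast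
  have Di: "(Dm r s * Z t) $$ (i, 0) = pw r s i * pw r s i * Z t $$ (i, 0)"
    "(Dm (inverse r) s * Z t) $$ (i, 0) = inverse (pw r s i * pw r s i) * Z t $$ (i, 0)" if "i < n" for i t
    unfolding Dm_pw using that dZ by (simp_all add: band_mult_index(3) pw_inverse n_def del: index_mult_mat(1))
  have Z00: "Z t $$ (0, 0) = 0" for t using dY by (simp add: Z_def n_def)
  have small: "Z t = 0\<^sub>m n (s + 1)" if t: "t \<noteq> 0" "norm t < \<eta>" for t
  proof -
    have eq: "\<delta> k * Z t $$ (k, 0) = t * (\<Sum>l<n. M k l * Z t $$ (l, 0))" if k: "k < n" for k
    proof -
      have "\<alpha> * (t \<cdot>\<^sub>m (A0 * Z t) + ep \<kappa> \<cdot>\<^sub>m (Dm r s * Z t)) $$ (k, 0) - inverse \<alpha> * (t \<cdot>\<^sub>m (A1 * Z t) + em \<kappa> \<cdot>\<^sub>m (Dm (inverse r) s * Z t)) $$ (k, 0)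
         = (\<alpha> * ep \<kappa> * (p * p) - inverse \<alpha> * em \<kappa> * inverse (p * p)) * Z t $$ (k, 0)"
        using boundary_first_column[OF g one_neq_zero s dZ[of t] k, of "kp \<kappa> * t" "km \<kappa> * t" "ep \<kappa>" "em \<kappa>"] rel[OF t(1)] dA dZ
        by (simp add: W \<alpha>_def[symmetric] p_def[symmetric] mat_distrib_right_dim mat_smult_mult_left_dim n_def del: index_mult_mat(1))
      then have "\<alpha> * (t * (A0 * Z t) $$ (k, 0) + ep \<kappa> * (pw r s k * pw r s k * Z t $$ (k, 0))) -
          inverse \<alpha> * (t * (A1 * Z t) $$ (k, 0) + em \<kappa> * (inverse (pw r s k * pw r s k) * Z t $$ (k, 0)))
         = (\<alpha> * ep \<kappa> * (p * p) - inverse \<alpha> * em \<kappa> * inverse (p * p)) * Z t $$ (k, 0)"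
        using k dA dZ by (simp add: Di[OF k, simplified] n_def del: index_mult_mat(1))
      then have "\<delta> k * Z t $$ (k, 0) = t * (- (\<alpha> * (A0 * Z t) $$ (k, 0) - inverse \<alpha> * (A1 * Z t) $$ (k, 0)))"
        unfolding \<delta>_def by (simp add: algebra_simps del: index_mult_mat(1))
      also have "- (\<alpha> * (A0 * Z t) $$ (k, 0) - inverse \<alpha> * (A1 * Z t) $$ (k, 0)) = (\<Sum>l<n. M k l * Z t $$ (l, 0))"
        using k dA dZ by (simp add: mat_mult_index M_def sum_distrib_left sum_subtractf algebra_simps del: index_mult_mat(1))
      finally show ?thesis .
    qed
    have col: "Z t $$ (i, 0) = 0" if "i < n" for i
      using \<eta>(2)[OF t(2), of "\<lambda>k. Z t $$ (k, 0)"] Z00 eq that by blast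
    have "km \<kappa> * t \<noteq> 0" using k t by simp
    from boundary_lowering[OF g this dZ[of t] _ _ rel(1)[OF t(1)] col] show ?thesis
      by (simp add: n_def)
  qed
  have hY: "mholo UNIV Y n n"
    unfolding Y_def tau_scale_def n_def by (rule mholo_Khat[OF r _ _ holomorphic_on_const holomorphic_on_const holomorphic_on_const])
      (intro holomorphic_intros, intro holomorphic_intros, simp, simp add: generic_cfun[OF g])
  have hZ: "mholo UNIV Z n n"
  proof -
    have 0: "0 < n" by (simp add: n_def)
    show ?thesis unfolding Z_def by (rule mholo_minus[OF hY mholo_smult[OF mholo_const mholoD(3)[OF hY 0 0]]]) simp
  qed
  have Z1: "Z 1 $$ (i, j) = 0" if "i < n" "j < n" for i j
  proof (rule analytic_continuation[of "\<lambda>t. Z t $$ (i, j)" UNIV "ball 0 \<eta> - {0}" 0])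
    show "(\<lambda>t. Z t $$ (i, j)) holomorphic_on UNIV" using mholoD(3)[OF hZ that] .
    show "0 islimpt (ball 0 \<eta> - {0 :: complex})"
      by (rule islimpt_punctured[THEN iffD1]) (use \<eta>(1) in \<open>simp add: islimpt_ball\<close>)
    show "Z t $$ (i, j) = 0" if "t \<in> ball 0 \<eta> - {0}" for t
      using small[of t] that \<open>i < n\<close> \<open>j < n\<close> by (auto simp: n_def)
  qed auto
  have Y1: "Y 1 $$ (i, j) = (Y 1 $$ (0, 0) \<cdot>\<^sub>m 1\<^sub>m n) $$ (i, j)" if "i < n" "j < n" for i j
    using Z1[OF that] that dY unfolding Z_def by auto
  have "Y 1 = Y 1 $$ (0, 0) \<cdot>\<^sub>m 1\<^sub>m n"
    by (rule eq_matI, rule Y1) (use dY in auto)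
  moreover have "tau_scale \<kappa> 1 = \<kappa>" by (cases \<kappa>) (simp add: tau_scale_def)
  ultimately show ?thesis by (simp add: Y_def n_def)
qed

subsection \<open>Gauge transformations and dual K-matrices\<close>

definition scale_params :: "complex \<Rightarrow> bparams \<Rightarrow> bparams" where
  "scale_params l \<kappa> = BParams (l * kp \<kappa>) (l * km \<kappa>) (l * ep \<kappa>) (l * em \<kappa>)"

text \<open>The effect of conjugation by q^(S_3): k_+ is multiplied by q^2 = \<open>r ^ 4\<close>,
  and k_- is divided by it.\<close>

definition gauge_params :: "complex \<Rightarrow> bparams \<Rightarrow> bparams" where
  "gauge_params r \<kappa> = BParams (kp \<kappa> * r ^ 4) (km \<kappa> * inverse (r ^ 4)) (ep \<kappa>) (em \<kappa>)"

lemma Khalf_scale: "Khalf r (scale_params l \<kappa>) u = l \<cdot>\<^sub>m Khalf r \<kappa> u"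
  by (intro eq_matI) (auto simp: Khalf_def scale_params_def mat_of_rows_list_def less_Suc_eq numeral_2_eq_2 algebra_simps)

text \<open>K is homogeneous of degree s in the boundary parameters, one for each spin-1/2
  constituent.\<close>

lemma Kmat_scale:
  assumes r: "r \<noteq> 0"
  shows "Kmat r (scale_params l \<kappa>) s u = l ^ s \<cdot>\<^sub>m Kmat r \<kappa> s u"
proof (induction s arbitrary: u)
  case 0
  then show ?case by (simp add: one_smult_mat)
next
  case (Suc s)
  show ?case
  proof (cases s)
    case 0
    then show ?thesis by (simp add: Khalf_scale)
  next
    case n: (Suc n)
    then have S: "Suc s \<ge> 2" "s \<ge> 1" by auto
    show ?thesis
      unfolding Kmat_unfused_K[OF r S(1)] unfused_K_def diff_Suc_1 Suc Khalf_scale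
      using dim_Rhalf[OF r S(2)]
      by (simp add: kron_smult_left kron_smult_right mat_smult_mult_left_dim mat_smult_mult_right_dim mat_smult_smult mult_ac)
  qed
qed

lemma Khalf_gauge: "Khalf r (gauge_params r \<kappa>) u * Dm r (Suc 0) = Dm r (Suc 0) * Khalf r \<kappa> u" if r: "r \<noteq> 0"
proof -
  define C where "C = cfun (u\<^sup>2) / (r\<^sup>2 - inverse (r\<^sup>2))"
  have K: "Khalf r \<kappa> u = mat_of_rows_list 2 [[u * ep \<kappa> + inverse u * em \<kappa>, kp \<kappa> * C], [km \<kappa> * C, u * em \<kappa> + inverse u * ep \<kappa>]]" for \<kappa>
    by (simp add: Khalf_def C_def)
  have D: "Dm r (Suc 0) = mat_of_rows_list 2 [[r\<^sup>2, 0], [0, inverse (r\<^sup>2)]]"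
    unfolding Dm_one by (intro eq_matI) (auto simp: mat_of_rows_list_def less_Suc_eq numeral_2_eq_2)
  have M: "mat_of_rows_list 2 [[a, b], [c, d]] * mat_of_rows_list 2 [[a', b'], [c', d']] =
    mat_of_rows_list 2 [[a * a' + b * c', a * b' + b * d'], [c * a' + d * c', c * b' + d * (d' :: complex)]]" for a b c d a' b' c' d'
    by (intro eq_matI) (auto simp: mat_of_rows_list_def scalar_prod_def less_Suc_eq numeral_2_eq_2)
  have "r ^ 4 * inverse (r\<^sup>2) = r\<^sup>2" "inverse (r ^ 4) * r\<^sup>2 = inverse (r\<^sup>2)"
    using r by (simp_all add: field_simps power2_eq_square eval_nat_numeral)
  then show ?thesis
    unfolding K D M by (simp add: gauge_params_def mult_ac)
qed

text \<open>The weight operator passes through every factor of the fused K-matrix; only the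
  K-factors change their parameters on the way.\<close>

lemma weight_conjugation:
  fixes D DD F E X1 X1' X2 X2' Y :: "complex mat"
  assumes d: "\<And>M. M \<in> {DD, X1, X1', X2, X2', Y} \<Longrightarrow> dim_row M = n \<and> dim_col M = n"
    and d': "dim_row D = m" "dim_col D = m" "dim_row F = m" "dim_col F = n" "dim_row E = n" "dim_col E = m"
    and h: "F * DD = D * F" "X1' * DD = DD * X1" "Y * DD = DD * Y" "X2' * DD = DD * X2" "E * D = DD * E"
  shows "(F * (X1' * (Y * (X2' * E)))) * D = D * (F * (X1 * (Y * (X2 * E))))"
proof -
  have dd: "dim_row DD = n" "dim_col DD = n" "dim_row X1 = n" "dim_col X1 = n" "dim_row X1' = n" "dim_col X1' = n"
    "dim_row X2 = n" "dim_col X2 = n" "dim_row X2' = n" "dim_col X2' = n" "dim_row Y = n" "dim_col Y = n"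
    using d by auto
  have "(F * (X1' * (Y * (X2' * E)))) * D = F * (X1' * (Y * (X2' * (DD * E))))"
    using dd d' h(5) by (simp add: mat_assoc_dim)
  also have "X2' * (DD * E) = DD * (X2 * E)" using dd d' h(4) by (metis mat_assoc_dim)
  also have "Y * (DD * (X2 * E)) = DD * (Y * (X2 * E))" using dd d' h(3) by (metis mat_assoc_dim index_mult_mat(2))
  also have "X1' * (DD * (Y * (X2 * E))) = DD * (X1 * (Y * (X2 * E)))" using dd d' h(2) by (metis mat_assoc_dim index_mult_mat(2))
  also have "F * (DD * (X1 * (Y * (X2 * E)))) = D * (F * (X1 * (Y * (X2 * E))))" using dd d' h(1) by (metis mat_assoc_dim index_mult_mat(2))
  finally show ?thesis .
qed

lemma Kmat_gauge:
  assumes g: "generic r" and s: "s \<ge> 1" and u: "u \<noteq> 0"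
  shows "Kmat r (gauge_params r \<kappa>) s u * Dm r s = Dm r s * Kmat r \<kappa> s u"
  using s u
proof (induction s arbitrary: u rule: nat_induct_at_least)
  case base
  then show ?case using Khalf_gauge[OF generic_nonzero[OF g]] by simp
next
  case (Suc t)
  have r: "r \<noteq> 0" using generic_nonzero[OF g] .
  have S: "Suc t \<ge> 2" "Suc t \<ge> 1" using Suc.hyps by auto
  have u: "u * r \<noteq> 0" "u\<^sup>2 * r powi (2 - int (Suc t)) \<noteq> 0" using Suc.prems r by auto
  define DD where "DD = Dm r (Suc 0) \<otimes>\<^sub>k Dm r t"
  show ?case
    unfolding Kmat_unfused_K[OF r S(1)] unfused_K_def diff_Suc_1
  proof (rule weight_conjugation[where n = "2 * Suc t" and m = "Suc t + 1" and DD = DD])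
    show "Fmap r (Suc t) * DD = Dm r (Suc t) * Fmap r (Suc t)" "Emap r (Suc t) * Dm r (Suc t) = DD * Emap r (Suc t)"
      using Emap_weight[OF r S(2)] by (simp_all add: DD_def)
    show "Rhalf r t (u\<^sup>2 * r powi (2 - int (Suc t))) * DD = DD * Rhalf r t (u\<^sup>2 * r powi (2 - int (Suc t)))"
      unfolding DD_def using Rhalf_intertwines(3)[OF g Suc.hyps u(2)] .
    show "Khalf r (gauge_params r \<kappa>) (u * r powi (1 - int (Suc t))) \<otimes>\<^sub>k 1\<^sub>m (Suc t) * DD =
      DD * (Khalf r \<kappa> (u * r powi (1 - int (Suc t))) \<otimes>\<^sub>k 1\<^sub>m (Suc t))"
      unfolding DD_def using Khalf_gauge[OF r] by (simp add: kron_mult_kron numeral_2_eq_2)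
    show "1\<^sub>m 2 \<otimes>\<^sub>k Kmat r (gauge_params r \<kappa>) t (u * r) * DD = DD * (1\<^sub>m 2 \<otimes>\<^sub>k Kmat r \<kappa> t (u * r))"
      unfolding DD_def using Suc.IH[OF u(1)] by (simp add: kron_mult_kron numeral_2_eq_2)
  qed (use dim_Rhalf[OF r Suc.hyps] in \<open>auto simp: DD_def\<close>)
qed

lemma Am_transpose: "r \<noteq> 0 \<Longrightarrow> (Am r s a b)\<^sup>T = Am r s b a"
  using pw_Suc[of r s] by (intro eq_matI) (auto simp: Am_index pw_def power2_eq_square)

lemma Dm_transpose: "(Dm r s)\<^sup>T = Dm r s"
  by (intro eq_matI) (auto simp: Dm_index)

lemma Am_Dm_inverse:
  assumes r: "r \<noteq> 0"
  shows "Am r s (a * inverse (r ^ 4)) (b * r ^ 4) * Dm (inverse r) s = Dm (inverse r) s * Am r s a b"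
proof -
  have A: "Am r s a b $$ (i, k) = (if k = Suc i then a * r * bco r s i * pw r s k else if i = Suc k then b * inverse r * bco r s k * pw r s k else 0)"
    if "i \<le> s" "k \<le> s" for i k a b using that by (simp add: Am_index pw_def)
  show ?thesis
    unfolding Dm_pw using r pw_nonzero[OF r, of s]
    by (intro eq_matI) (auto simp: band_mult_index(3) mult_band_index(3) A pw_inverse pw_Suc field_simps power2_eq_square eval_nat_numeral simp del: index_mult_mat(1))
qed

section \<open>Dual K-matrices\<close>

definition dual_params :: "bparams \<Rightarrow> bparams" where
  "dual_params \<kappa> = BParams (- km \<kappa>) (- kp \<kappa>) (em \<kappa>) (ep \<kappa>)"

definition Kdual :: "complex \<Rightarrow> bparams \<Rightarrow> nat \<Rightarrow> complex \<Rightarrow> complex mat" where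
  "Kdual r \<kappa> s u = (Kmat r (dual_params \<kappa>) s (inverse u * inverse (r\<^sup>2)))\<^sup>T"

lemma dim_Kdual [simp]: "dim_row (Kdual r \<kappa> s u) = s + 1" "dim_col (Kdual r \<kappa> s u) = s + 1"
  by (simp_all add: Kdual_def)

lemma Wm_0: "Wm r s a b 0 = Am r s a b"
  by (intro eq_matI) (auto simp: Wm_def)

lemma Kdual_intertwines_aux:
  assumes g: "generic r" and s: "s \<ge> 1" and u: "u \<noteq> 0" and e: "e \<noteq> 0" and k: "a \<noteq> 0" "b \<noteq> 0"
  shows "Am r s (a * u) (b * inverse u) * (Kmat r (BParams (t * (- (r\<^sup>2 * b))) (t * (- (inverse (r\<^sup>2) * a))) 0 e) s (inverse u * inverse (r\<^sup>2)))\<^sup>T =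
    (Kmat r (BParams (t * (- (r\<^sup>2 * b))) (t * (- (inverse (r\<^sup>2) * a))) 0 e) s (inverse u * inverse (r\<^sup>2)))\<^sup>T * Am r s (a * inverse (r ^ 4) * inverse u) (b * r ^ 4 * u)"
proof -
  have r: "r \<noteq> 0" using generic_nonzero[OF g] .
  define v where "v = inverse u * inverse (r\<^sup>2)"
  have v: "v \<noteq> 0" using u r by (simp add: v_def)
  define K where "K t = (Kmat r (BParams (t * (- (r\<^sup>2 * b))) (t * (- (inverse (r\<^sup>2) * a))) 0 e) s v)\<^sup>T" for t
  define X where "X = Am r s (a * u) (b * inverse u)"
  define Y where "Y = Am r s (a * inverse (r ^ 4) * inverse u) (b * r ^ 4 * u)"
  have dK: "dim_row (K t) = s + 1" "dim_col (K t) = s + 1" for t by (simp_all add: K_def)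
  have dX: "dim_row X = s + 1" "dim_col X = s + 1" "dim_row Y = s + 1" "dim_col Y = s + 1" by (simp_all add: X_def Y_def)
  have ne: "X * K t = K t * Y" if t: "t \<noteq> 0" for t
  proof -
    define \<kappa> where "\<kappa> = BParams (t * (- (r\<^sup>2 * b))) (t * (- (inverse (r\<^sup>2) * a))) 0 e"
    have "km \<kappa> \<noteq> 0" "ep \<kappa> \<noteq> 0 \<or> em \<kappa> \<noteq> 0" using t k e r by (simp_all add: \<kappa>_def)
    note I = Kmat_intertwines[OF s g this v]
    have "Am r s (km \<kappa> * inverse v) (kp \<kappa> * v) * K t = (Kmat r \<kappa> s v * Wm r s (kp \<kappa> * v) (km \<kappa> * inverse v) (ep \<kappa>))\<^sup>T"
      by (subst transpose_mult[of _ "s + 1" "s + 1" _ "s + 1"]) (auto simp: \<kappa>_def K_def Wm_0 Am_transpose[OF r] intro!: carrier_matI)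
    also have "\<dots> = K t * Am r s (km \<kappa> * v) (kp \<kappa> * inverse v)"
      unfolding I by (subst transpose_mult[of _ "s + 1" "s + 1" _ "s + 1"]) (auto simp: \<kappa>_def K_def Wm_0 Am_transpose[OF r] intro!: carrier_matI)
    also have "Am r s (km \<kappa> * v) (kp \<kappa> * inverse v) = (- t) \<cdot>\<^sub>m Y"
      unfolding Y_def Am_smult[symmetric] by (rule arg_cong2[of _ _ _ _ "Am r s"]) (use r u in \<open>simp_all add: \<kappa>_def v_def field_simps power2_eq_square eval_nat_numeral\<close>)
    also have "Am r s (km \<kappa> * inverse v) (kp \<kappa> * v) = (- t) \<cdot>\<^sub>m X"
      unfolding X_def Am_smult[symmetric] by (rule arg_cong2[of _ _ _ _ "Am r s"]) (use r u in \<open>simp_all add: \<kappa>_def v_def field_simps power2_eq_square eval_nat_numeral\<close>)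
    finally have "(- t) \<cdot>\<^sub>m (X * K t) = (- t) \<cdot>\<^sub>m (K t * Y)" using dK dX by (simp add: mat_smult_mult_left_dim mat_smult_mult_right_dim)
    from arg_cong[OF this, of "(\<cdot>\<^sub>m) (inverse (- t))"] show ?thesis using t by (simp add: mat_smult_smult one_smult_mat)
  qed
  have K: "mholo UNIV K (s + 1) (s + 1)"
    unfolding K_def
    by (rule mholo_transpose[OF mholo_Kmat[OF r _ _ holomorphic_on_const holomorphic_on_const holomorphic_on_const]])
      (intro holomorphic_intros, intro holomorphic_intros, use v in auto)
  have "X * K t - K t * Y = 0\<^sub>m (s + 1) (s + 1)"
  proof (rule mholo_finite_exception[of UNIV "\<lambda>t. X * K t - K t * Y" _ _ _ "{0}"])
    show "mholo UNIV (\<lambda>t. X * K t - K t * Y) (s + 1) (s + 1)"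
      by (intro mholo_minus mholo_mult[where m = "s + 1"] K mholo_const) (auto simp: dX intro!: carrier_matI)
    show "X * K t - K t * Y = 0\<^sub>m (s + 1) (s + 1)" if "t \<notin> {0}" for t
      using ne[of t] that dK dX by (intro eq_matI) auto
  qed auto
  then have "(X * K t) $$ (i, k) - (K t * Y) $$ (i, k) = 0" if "i < s + 1" "k < s + 1" for i k
    using that dK dX by (metis index_minus_mat(1) index_mult_mat(2,3) index_zero_mat(1))
  then have "X * K t = K t * Y" using dK dX by (intro eq_matI) auto
  then show ?thesis by (simp add: K_def X_def Y_def v_def)
qed

lemma Kdual_intertwines:
  assumes g: "generic r" and s: "s \<ge> 1" and u: "u \<noteq> 0" and k: "kp \<kappa> \<noteq> 0" "km \<kappa> \<noteq> 0"
    and b: "em \<kappa>b = 0" "ep \<kappa>b \<noteq> 0" and h: "kp \<kappa> * km \<kappa>b = r ^ 4 * (km \<kappa> * kp \<kappa>b)"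
  shows "Am r s (kp \<kappa> * u) (km \<kappa> * inverse u) * (Kdual r \<kappa>b s u * Dm (inverse r) s) =
    (Kdual r \<kappa>b s u * Dm (inverse r) s) * Am r s (kp \<kappa> * inverse u) (km \<kappa> * u)"
proof -
  have r: "r \<noteq> 0" using generic_nonzero[OF g] .
  \<comment> \<open>This ratio is chosen to match kbar_+; the hypothesis \<open>h\<close> is exactly
    what makes it match kbar_- as well.\<close>
  define t where "t = kp \<kappa>b * r\<^sup>2 / kp \<kappa>"
  have t: "t * (- (r\<^sup>2 * km \<kappa>)) = - km \<kappa>b" "t * (- (inverse (r\<^sup>2) * kp \<kappa>)) = - kp \<kappa>b"
    using k h r by (simp_all add: t_def field_simps eval_nat_numeral)
  have K: "Am r s (kp \<kappa> * u) (km \<kappa> * inverse u) * Kdual r \<kappa>b s u = Kdual r \<kappa>b s u * Am r s (kp \<kappa> * inverse (r ^ 4) * inverse u) (km \<kappa> * r ^ 4 * u)"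
    unfolding Kdual_def dual_params_def b(1) using Kdual_intertwines_aux[OF g s u b(2) k, of t] unfolding t .
  have D: "Am r s (kp \<kappa> * inverse (r ^ 4) * inverse u) (km \<kappa> * r ^ 4 * u) * Dm (inverse r) s = Dm (inverse r) s * Am r s (kp \<kappa> * inverse u) (km \<kappa> * u)"
    using Am_Dm_inverse[OF r, of s "kp \<kappa> * inverse u" "km \<kappa> * u"] by (simp add: mult_ac)
  have "Am r s (kp \<kappa> * u) (km \<kappa> * inverse u) * (Kdual r \<kappa>b s u * Dm (inverse r) s) = Kdual r \<kappa>b s u * Am r s (kp \<kappa> * inverse (r ^ 4) * inverse u) (km \<kappa> * r ^ 4 * u) * Dm (inverse r) s"
    unfolding K[symmetric] by (simp add: mat_assoc_dim)
  also have "\<dots> = (Kdual r \<kappa>b s u * Dm (inverse r) s) * Am r s (kp \<kappa> * inverse u) (km \<kappa> * u)"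
    using D by (simp add: mat_assoc_dim)
  finally show ?thesis .
qed

text \<open>Passing to the dual exchanges k_+ and k_-, so it turns the gauge transformation into its
  inverse. Scaling contributes the factor of degree s.\<close>

lemma Kdual_gauge:
  assumes g: "generic r" and s: "s \<ge> 1" and u: "u \<noteq> 0"
  shows "Kdual r (scale_params l (gauge_params r \<kappa>)) s u * Dm r s = l ^ s \<cdot>\<^sub>m (Dm r s * Kdual r \<kappa> s u)"
proof -
  have r: "r \<noteq> 0" using generic_nonzero[OF g] .
  define v where "v = inverse u * inverse (r\<^sup>2)"
  have v: "v \<noteq> 0" using u r by (simp add: v_def)
  define \<kappa>1 where "\<kappa>1 = dual_params (gauge_params r \<kappa>)"
  have 1: "gauge_params r \<kappa>1 = dual_params \<kappa>" using r by (simp add: \<kappa>1_def gauge_params_def dual_params_def)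
  have 2: "dual_params (scale_params l (gauge_params r \<kappa>)) = scale_params l \<kappa>1" by (simp add: \<kappa>1_def scale_params_def dual_params_def)
  have "Dm r s * (Kmat r (dual_params \<kappa>) s v)\<^sup>T = (Kmat r (gauge_params r \<kappa>1) s v * Dm r s)\<^sup>T"
    unfolding 1 by (subst transpose_mult[of _ "s + 1" "s + 1" _ "s + 1"]) (auto simp: Dm_transpose intro!: carrier_matI)
  also have "\<dots> = (Kmat r \<kappa>1 s v)\<^sup>T * Dm r s"
    unfolding Kmat_gauge[OF g s v] by (subst transpose_mult[of _ "s + 1" "s + 1" _ "s + 1"]) (auto simp: Dm_transpose intro!: carrier_matI)
  finally have *: "Dm r s * (Kmat r (dual_params \<kappa>) s v)\<^sup>T = (Kmat r \<kappa>1 s v)\<^sup>T * Dm r s" .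
  have T: "(c \<cdot>\<^sub>m A)\<^sup>T = c \<cdot>\<^sub>m A\<^sup>T" for c and A :: "complex mat" by (intro eq_matI) auto
  show ?thesis
    unfolding Kdual_def 2 Kmat_scale[OF r] v_def[symmetric] * T
    by (simp add: mat_smult_mult_left_dim)
qed

lemma Dm_inverse_mult:
  assumes "r \<noteq> 0"
  shows "Dm r s * Dm (inverse r) s = 1\<^sub>m (s + 1)" "Dm (inverse r) s * Dm r s = 1\<^sub>m (s + 1)"
proof -
  have "pw r s j * pw r s j * (inverse (pw r s j) * inverse (pw r s j)) = 1" for j
    using pw_nonzero[OF assms, of s j] by (simp add: field_simps)
  then show "Dm r s * Dm (inverse r) s = 1\<^sub>m (s + 1)" "Dm (inverse r) s * Dm r s = 1\<^sub>m (s + 1)"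
    unfolding Dm_pw pw_inverse by (intro eq_matI; auto simp: band_mult_index(3) band_index mult.commute simp del: index_mult_mat(1))+
qed

subsection \<open>Regularity of the K-matrices\<close>

text \<open>Near z, apart from z itself, \<open>Khat\<close> agrees with a holomorphic function; the
  value of \<open>Khat\<close> at z may be an artefact of division by zero.\<close>

definition Khat_regular :: "complex \<Rightarrow> bparams \<Rightarrow> nat \<Rightarrow> complex \<Rightarrow> bool" where
  "Khat_regular r \<kappa> s z \<longleftrightarrow> (\<exists>S G. open S \<and> z \<in> S \<and> mholo S G (s + 1) (s + 1) \<and> (\<forall>u\<in>S - {z}. Khat r \<kappa> s u = G u))"

lemma mholo_Khat_self:
  assumes r: "r \<noteq> 0"
  shows "mholo {u. u \<noteq> 0 \<and> (\<forall>m. 1 \<le> m \<longrightarrow> m < s \<longrightarrow> cfun (u\<^sup>2 * r ^ (2 * m)) \<noteq> 0)} (Khat r \<kappa> s) (s + 1) (s + 1)" (is "mholo ?S _ _ _")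
proof -
  have "mholo ?S (\<lambda>u. Khat r (BParams (kp \<kappa>) (km \<kappa>) (ep \<kappa>) (em \<kappa>)) s u) (s + 1) (s + 1)"
    by (rule mholo_Khat[OF r holomorphic_on_const holomorphic_on_const holomorphic_on_const holomorphic_on_const holomorphic_on_ident]) auto
  then show ?thesis by simp
qed

lemma Khat_regular_1:
  assumes g: "generic r"
  shows "Khat_regular r \<kappa> s 1"
  unfolding Khat_regular_def
  using open_cfun_nonzero[OF generic_nonzero[OF g], of s] mholo_Khat_self[OF generic_nonzero[OF g], of s \<kappa>] generic_cfun[OF g]
  by (intro exI[of _ "{u. u \<noteq> 0 \<and> (\<forall>m. 1 \<le> m \<longrightarrow> m < s \<longrightarrow> cfun (u\<^sup>2 * r ^ (2 * m)) \<noteq> 0)}"] exI[of _ "Khat r \<kappa> s"]) simp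

text \<open>The case k_- = 0 by continuity in k_-. It is needed because barred parameters are
  allowed to vanish.\<close>

lemma Khat_one_scalar_degenerate:
  assumes s: "s \<ge> 1" and g: "generic r" and e: "ep \<kappa> \<noteq> 0 \<and> em \<kappa> = 0 \<or> ep \<kappa> = 0 \<and> em \<kappa> \<noteq> 0"
  shows "Khat r \<kappa> s 1 = Khat r \<kappa> s 1 $$ (0, 0) \<cdot>\<^sub>m 1\<^sub>m (s + 1)"
proof -
  have r: "r \<noteq> 0" using generic_nonzero[OF g] .
  define Y where "Y t = Khat r (BParams (kp \<kappa>) t (ep \<kappa>) (em \<kappa>)) s 1" for t
  have Y: "mholo UNIV Y (s + 1) (s + 1)"
    unfolding Y_def
    by (rule mholo_Khat[OF r holomorphic_on_const holomorphic_on_ident holomorphic_on_const holomorphic_on_const holomorphic_on_const])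
      (simp, simp add: generic_cfun[OF g])
  have 0: "0 < s + 1" by simp
  have "Y (km \<kappa>) - Y (km \<kappa>) $$ (0, 0) \<cdot>\<^sub>m 1\<^sub>m (s + 1) = 0\<^sub>m (s + 1) (s + 1)"
  proof (rule mholo_finite_exception[of UNIV "\<lambda>t. Y t - Y t $$ (0, 0) \<cdot>\<^sub>m 1\<^sub>m (s + 1)" _ _ _ "{0}"])
    show "mholo UNIV (\<lambda>t. Y t - Y t $$ (0, 0) \<cdot>\<^sub>m 1\<^sub>m (s + 1)) (s + 1) (s + 1)"
      by (rule mholo_minus[OF Y mholo_smult[OF mholo_const mholoD(3)[OF Y 0 0]]]) simp
    fix t :: complex assume "t \<notin> {0}"
    then have "Y t = Y t $$ (0, 0) \<cdot>\<^sub>m 1\<^sub>m (s + 1)"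
      unfolding Y_def using e by (intro Khat_one_scalar[OF s g]) auto
    moreover have "X - X = 0\<^sub>m (s + 1) (s + 1)" if "dim_row X = s + 1" "dim_col X = s + 1" for X :: "complex mat"
      using that by (intro eq_matI) auto
    ultimately show "Y t - Y t $$ (0, 0) \<cdot>\<^sub>m 1\<^sub>m (s + 1) = 0\<^sub>m (s + 1) (s + 1)"
      using mholoD(1,2)[OF Y, of t] by metis
  qed auto
  then have Z: "(Y (km \<kappa>) - Y (km \<kappa>) $$ (0, 0) \<cdot>\<^sub>m 1\<^sub>m (s + 1)) $$ (i, k) = 0" if "i < s + 1" "k < s + 1" for i k using that by simp
  have "Y (km \<kappa>) = Y (km \<kappa>) $$ (0, 0) \<cdot>\<^sub>m 1\<^sub>m (s + 1)"
  proof (rule eq_matI)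
    fix i k assume "i < dim_row (Y (km \<kappa>) $$ (0, 0) \<cdot>\<^sub>m 1\<^sub>m (s + 1))" "k < dim_col (Y (km \<kappa>) $$ (0, 0) \<cdot>\<^sub>m 1\<^sub>m (s + 1))"
    then show "Y (km \<kappa>) $$ (i, k) = (Y (km \<kappa>) $$ (0, 0) \<cdot>\<^sub>m 1\<^sub>m (s + 1)) $$ (i, k)"
      using Z[of i k] mholoD(1,2)[OF Y] by auto
  qed (use mholoD(1,2)[OF Y] in auto)
  moreover have "BParams (kp \<kappa>) (km \<kappa>) (ep \<kappa>) (em \<kappa>) = \<kappa>" by simp
  ultimately show ?thesis unfolding Y_def by metis
qed

text \<open>The fusion step before division, with a slot G for the lower K-matrix into which a
  regularized version can be put.\<close>

definition Khat_numerator :: "complex \<Rightarrow> bparams \<Rightarrow> nat \<Rightarrow> (complex \<Rightarrow> complex mat) \<Rightarrow> complex \<Rightarrow> complex mat" where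
  "Khat_numerator r \<kappa> s G u = Fmap r s * ((Khalf r \<kappa> (u * r powi (1 - int s)) \<otimes>\<^sub>k 1\<^sub>m s) *
      (rcore r (s - 1) (u\<^sup>2 * r powi (2 - int s)) * ((1\<^sub>m 2 \<otimes>\<^sub>k G (u * r)) * Emap r s)))"

lemma mholo_Khat_numerator:
  assumes r: "r \<noteq> 0" and s: "s \<ge> 2" and G: "mholo S0 G (s - 1 + 1) (s - 1 + 1)" and S: "\<And>u. u \<in> S \<Longrightarrow> u \<noteq> 0 \<and> u * r \<in> S0"
  shows "mholo S (Khat_numerator r \<kappa> s G) (s + 1) (s + 1)"
proof -
  have K1: "mholo S (\<lambda>z. Khalf r \<kappa> (z * r powi (1 - int s)) \<otimes>\<^sub>k 1\<^sub>m s) (2 * s) (2 * s)"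
  proof -
    have "mholo S (\<lambda>z. Khalf r (BParams (kp \<kappa>) (km \<kappa>) (ep \<kappa>) (em \<kappa>)) (z * r powi (1 - int s)) \<otimes>\<^sub>k 1\<^sub>m s) (2 * s) (2 * s)"
      by (intro mholo_kron mholo_Khalf[OF _ _ _ _ _ _ r] mholo_const holomorphic_intros) (use r S in auto)
    then show ?thesis by simp
  qed
  have R: "mholo S (\<lambda>z. rcore r (s - 1) (z\<^sup>2 * r powi (2 - int s))) (2 * s) (2 * s)"
  proof -
    have "(\<lambda>z. z\<^sup>2 * r powi (2 - int s)) holomorphic_on S" by (intro holomorphic_intros)
    moreover have "(\<lambda>z. z\<^sup>2 * r powi (2 - int s)) ` S \<subseteq> - {0}" using S r by auto
    ultimately show ?thesis using mholo_compose[OF mholo_rcore[OF r, of "s - 1"]] s by simp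
  qed
  have h: "(\<lambda>z. z * r) holomorphic_on S" by (intro holomorphic_intros)
  have i: "(\<lambda>z. z * r) ` S \<subseteq> S0" using S by auto
  from mholo_kron[OF mholo_const[of "1\<^sub>m 2" 2 2] mholo_compose[OF G h i]]
  have K2: "mholo S (\<lambda>z. 1\<^sub>m 2 \<otimes>\<^sub>k G (z * r)) (2 * s) (2 * s)" using s by simp
  show ?thesis
    unfolding Khat_numerator_def
    by (intro mholo_mult[OF _ mholo_mult[OF K1 mholo_mult[OF R mholo_mult[OF K2]]]] mholo_const) auto
qed

lemma Khat_regular_inverse:
  assumes g: "generic r" and s: "s \<ge> 1" and e: "ep \<kappa> \<noteq> 0 \<and> em \<kappa> = 0 \<or> ep \<kappa> = 0 \<and> em \<kappa> \<noteq> 0"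
  shows "Khat_regular r \<kappa> s (inverse r)"
proof -
  have r: "r \<noteq> 0" using generic_nonzero[OF g] .
  consider "s = 1" | "s \<ge> 2" using s by linarith
  then show ?thesis
  proof cases
    case 1
    have "mholo (- {0}) (Khat r \<kappa> s) (s + 1) (s + 1)" using mholo_Khat_self[OF r, of s \<kappa>] 1 by (simp add: Compl_eq)
    then show ?thesis unfolding Khat_regular_def using r by (intro exI[of _ "- {0}"] exI[of _ "Khat r \<kappa> s"]) auto
  next
    case 2
    define z where "z = inverse r"
    define S0 where "S0 = {u. u \<noteq> 0 \<and> (\<forall>m. 1 \<le> m \<longrightarrow> m < s - 1 \<longrightarrow> cfun (u\<^sup>2 * r ^ (2 * m)) \<noteq> 0)}"
    \<comment> \<open>With w = u r the divisor c(u^2 q) vanishes for w^4 = 1. The roots other than w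
      = 1 are removed.\<close>
    define S where "S = (\<lambda>u. u * r) -` S0 - {- z, \<i> * z, - \<i> * z}"
    have S0: "open S0" "1 \<in> S0" unfolding S0_def using open_cfun_nonzero[OF r, of "s - 1"] generic_cfun[OF g] by auto
    have G: "mholo S0 (Khat r \<kappa> (s - 1)) (s - 1 + 1) (s - 1 + 1)" unfolding S0_def by (rule mholo_Khat_self[OF r])
    have oS: "open S" unfolding S_def by (intro open_Diff open_vimage S0(1) continuous_intros finite_imp_closed) auto
    have i2: "\<i> * z \<noteq> z" "- \<i> * z \<noteq> z" "- z \<noteq> z" using r by (auto simp: z_def complex_eq_iff)
    have zS: "z \<in> S" using S0(2) i2 r by (auto simp: S_def z_def)
    have SS: "u \<noteq> 0 \<and> u * r \<in> S0" if "u \<in> S" for u using that by (auto simp: S_def S0_def)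
    define X where "X = Khat_numerator r \<kappa> s (Khat r \<kappa> (s - 1))"
    have X: "mholo S X (s + 1) (s + 1)" unfolding X_def by (rule mholo_Khat_numerator[OF r 2 G SS])
    \<comment> \<open>At u = 1/r the lower K-matrix is taken at 1, where it is scalar, so the
      R-matrix at its degenerate point meets \<E> directly.\<close>
    have Xz: "X z = 0\<^sub>m (s + 1) (s + 1)"
    proof -
      have s1: "s - 1 \<ge> 1" using 2 by simp
      obtain c where c: "Khat r \<kappa> (s - 1) 1 = c \<cdot>\<^sub>m 1\<^sub>m s" using Khat_one_scalar_degenerate[OF s1 g e] 2 by auto
      have zr: "z * r = 1" "z\<^sup>2 * r powi (2 - int s) = r powi (- int s)"
        using r by (simp_all add: z_def power_int_diff power_int_minus divide_inverse power_inverse)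
      have "(1\<^sub>m 2 \<otimes>\<^sub>k (c \<cdot>\<^sub>m 1\<^sub>m s)) * Emap r s = c \<cdot>\<^sub>m Emap r s"
        by (simp add: kron_smult_right kron_one mat_smult_mult_left_dim one_mult_dim)
      then have "rcore r (s - 1) (r powi (- int s)) * ((1\<^sub>m 2 \<otimes>\<^sub>k (c \<cdot>\<^sub>m 1\<^sub>m s)) * Emap r s) = c \<cdot>\<^sub>m 0\<^sub>m (2 * s) (s + 1)"
        using rcore_Emap_degenerate[OF g s] 2 by (simp add: mat_smult_mult_right_dim)
      also have "\<dots> = 0\<^sub>m (2 * s) (s + 1)" by (intro eq_matI) auto
      finally show ?thesis unfolding X_def Khat_numerator_def zr c by simp
    qed
    \<comment> \<open>The difference quotient of the numerator times what remains of 1/c(u^2 q) =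
      \<open>w\<^sup>2 / ((w - 1) * (w + 1) * (w\<^sup>2 + 1))\<close> once w - 1 = (u - z) r is
      split off.\<close>
    define G where "G u = Matrix.mat (s + 1) (s + 1) (\<lambda>(i, k). (if u = z then deriv (\<lambda>w. X w $$ (i, k)) z else (X u $$ (i, k) - X z $$ (i, k)) / (u - z))
       * ((u * r)\<^sup>2 / (r * (u * r + 1) * ((u * r)\<^sup>2 + 1))))" for u
    have ne: "r * (u * r + 1) * ((u * r)\<^sup>2 + 1) \<noteq> 0" if "u \<in> S" for u
    proof -
      have "u * r \<noteq> - 1" using that r by (auto simp: S_def z_def field_simps)
      moreover have "(u * r)\<^sup>2 \<noteq> - 1"
      proof
        assume "(u * r)\<^sup>2 = - 1"
        then have "(u * r - \<i>) * (u * r + \<i>) = 0" by (simp add: algebra_simps power2_eq_square)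
        then have "u * r = \<i> \<or> u * r = - \<i>" by (auto simp: eq_neg_iff_add_eq_0)
        then have "u = \<i> * z \<or> u = - \<i> * z" using r by (auto simp: z_def field_simps)
        then show False using that by (auto simp: S_def)
      qed
      ultimately show ?thesis using r by (simp add: eq_neg_iff_add_eq_0)
    qed
    have "mholo S G (s + 1) (s + 1)"
    proof (rule mholoI)
      fix i k assume ik: "i < s + 1" "k < s + 1"
      have "(\<lambda>u. if u = z then deriv (\<lambda>w. X w $$ (i, k)) z else (X u $$ (i, k) - X z $$ (i, k)) / (u - z)) holomorphic_on S"
        by (rule pole_lemma_open[OF mholoD(3)[OF X ik] oS])
      then have "(\<lambda>u. (if u = z then deriv (\<lambda>w. X w $$ (i, k)) z else (X u $$ (i, k) - X z $$ (i, k)) / (u - z))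
       * ((u * r)\<^sup>2 / (r * (u * r + 1) * ((u * r)\<^sup>2 + 1)))) holomorphic_on S"
        by (intro holomorphic_on_mult holomorphic_on_divide) (auto intro!: holomorphic_intros dest: ne)
      then show "(\<lambda>u. G u $$ (i, k)) holomorphic_on S" using ik by (simp add: G_def)
    qed (simp_all add: G_def)
    moreover have "Khat r \<kappa> s u = G u" if u: "u \<in> S - {z}" for u
    proof (rule eq_matI)
      fix i k assume ik: "i < dim_row (G u)" "k < dim_col (G u)"
      define w where "w = u * r"
      have "w \<noteq> 0" using u SS[of u] r by (simp add: w_def)
      moreover have "w \<noteq> 1" using u r by (auto simp: w_def z_def field_simps)
      moreover have "(w + 1) * (w\<^sup>2 + 1) \<noteq> 0" using u ne[of u] by (simp add: w_def)
      ultimately have w: "w \<noteq> 0" "w - 1 \<noteq> 0" "(w + 1) * (w\<^sup>2 + 1) \<noteq> 0" by simp_all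
      have "cfun (u\<^sup>2 * r\<^sup>2) = (w - 1) * ((w + 1) * (w\<^sup>2 + 1)) / w\<^sup>2"
        unfolding cfun_def power_mult_distrib[symmetric] w_def[symmetric] using w(1) by (simp add: field_simps power2_eq_square)
      then have c: "inverse (cfun (u\<^sup>2 * r\<^sup>2)) = w\<^sup>2 / ((w - 1) * ((w + 1) * (w\<^sup>2 + 1)))" by simp
      have uz: "(u - z) * r = w - 1" using r by (simp add: w_def z_def algebra_simps)
      have "Khat r \<kappa> s u = inverse (cfun (u\<^sup>2 * r\<^sup>2)) \<cdot>\<^sub>m X u" unfolding Khat_unfold[OF 2] X_def Khat_numerator_def ..
      then have "Khat r \<kappa> s u $$ (i, k) = w\<^sup>2 / ((w - 1) * ((w + 1) * (w\<^sup>2 + 1))) * X u $$ (i, k)"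
        unfolding c using ik mholoD(1,2)[OF X, of u] by (simp add: G_def)
      also have "\<dots> = X u $$ (i, k) / (u - z) * (w\<^sup>2 / (r * (w + 1) * (w\<^sup>2 + 1)))"
        unfolding uz[symmetric] using r u by (simp add: field_simps)
      also have "\<dots> = G u $$ (i, k)" using ik u Xz by (simp add: G_def w_def)
      finally show "Khat r \<kappa> s u $$ (i, k) = G u $$ (i, k)" .
    qed (simp_all add: G_def)
    ultimately show ?thesis unfolding Khat_regular_def z_def[symmetric] using oS zS by blast
  qed
qed

text \<open>The dual K-matrix at u = 1 is evaluated at 1/q. There the lower K-matrix stands at 1/r,
  which the previous lemma covers, and the outer divisor is -c(q), hence nonzero.\<close>

lemma Khat_regular_inverse_square:
  assumes g: "generic r" and s: "s \<ge> 1" and e: "ep \<kappa> \<noteq> 0 \<and> em \<kappa> = 0 \<or> ep \<kappa> = 0 \<and> em \<kappa> \<noteq> 0"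
  shows "Khat_regular r \<kappa> s (inverse (r\<^sup>2))"
proof -
  have r: "r \<noteq> 0" using generic_nonzero[OF g] .
  consider "s = 1" | "s \<ge> 2" using s by linarith
  then show ?thesis
  proof cases
    case 1
    have "mholo (- {0}) (Khat r \<kappa> s) (s + 1) (s + 1)" using mholo_Khat_self[OF r, of s \<kappa>] 1 by (simp add: Compl_eq)
    then show ?thesis unfolding Khat_regular_def using r by (intro exI[of _ "- {0}"] exI[of _ "Khat r \<kappa> s"]) auto
  next
    case 2
    define z where "z = inverse (r\<^sup>2)"
    have s1: "s - 1 \<ge> 1" using 2 by simp
    obtain S0 G where S0: "open S0" "inverse r \<in> S0" and G: "mholo S0 G (s - 1 + 1) (s - 1 + 1)"
      and eq: "\<And>u. u \<in> S0 - {inverse r} \<Longrightarrow> Khat r \<kappa> (s - 1) u = G u"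
      using Khat_regular_inverse[OF g s1 e] unfolding Khat_regular_def by blast
    define S where "S = (\<lambda>u. u * r) -` S0 - {u. cfun (u\<^sup>2 * r\<^sup>2) = 0} - {0}"
    have oS: "open S" unfolding S_def using r by (intro open_Diff open_vimage S0(1) continuous_intros finite_imp_closed finite_cfun_zeros) auto
    have "cfun (z\<^sup>2 * r\<^sup>2) = - cfun (r ^ 2)"
      using r by (simp add: z_def cfun_def field_simps power2_eq_square)
    then have c: "cfun (z\<^sup>2 * r\<^sup>2) \<noteq> 0" using generic_cfun[OF g, of 2] by simp
    have "z * r = inverse r" "z \<noteq> 0" using r by (simp_all add: z_def power2_eq_square)
    then have zS: "z \<in> S" using S0(2) c by (simp add: S_def)
    have X: "mholo S (Khat_numerator r \<kappa> s G) (s + 1) (s + 1)"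
      by (rule mholo_Khat_numerator[OF r 2 G]) (auto simp: S_def)
    have "mholo S (\<lambda>u. inverse (cfun (u\<^sup>2 * r\<^sup>2)) \<cdot>\<^sub>m Khat_numerator r \<kappa> s G u) (s + 1) (s + 1)"
    proof (rule mholo_smult[OF X])
      have "cfun (u\<^sup>2 * r\<^sup>2) \<noteq> 0 \<and> u \<noteq> 0" if "u \<in> S" for u using that by (auto simp: S_def)
      then show "(\<lambda>u. inverse (cfun (u\<^sup>2 * r\<^sup>2))) holomorphic_on S"
        unfolding cfun_def using r by (intro holomorphic_intros) auto
    qed
    moreover have "Khat r \<kappa> s u = inverse (cfun (u\<^sup>2 * r\<^sup>2)) \<cdot>\<^sub>m Khat_numerator r \<kappa> s G u" if u: "u \<in> S - {z}" for u
    proof -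
      have "u * r \<noteq> inverse r" using u r by (auto simp: z_def field_simps power2_eq_square)
      then have "Khat r \<kappa> (s - 1) (u * r) = G (u * r)" using u by (intro eq) (auto simp: S_def)
      then show ?thesis unfolding Khat_unfold[OF 2] Khat_numerator_def by simp
    qed
    ultimately show ?thesis unfolding Khat_regular_def z_def[symmetric] using oS zS by blast
  qed
qed

subsection \<open>Regularity of the normalized matrices\<close>

lemma mholo_subset: "mholo T M n m \<Longrightarrow> S \<subseteq> T \<Longrightarrow> mholo S M n m"
  unfolding mholo_def using holomorphic_on_subset by blast

text \<open>The value depends only on a punctured neighbourhood of u; the exceptional point z may be
  u itself or another point.\<close>

lemma remove_sings_mat_eq:
  assumes S: "open S" "u \<in> S" and G: "mholo S G n m" and d: "\<And>u. dim_row (N u) = n" "\<And>u. dim_col (N u) = m"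
    and eq: "\<And>u. u \<in> S - {z} \<Longrightarrow> N u = G u"
  shows "remove_sings_mat N u = G u"
proof (rule eq_matI)
  fix i k assume "i < dim_row (G u)" "k < dim_col (G u)"
  then have ik: "i < n" "k < m" using mholoD[OF G] by auto
  have "remove_sings (\<lambda>w. N w $$ (i, k)) u = remove_sings (\<lambda>w. G w $$ (i, k)) u"
  proof (rule remove_sings_cong)
    have "open (S - ({z} - {u}))" using S by (intro open_Diff finite_imp_closed) auto
    then show "\<forall>\<^sub>F w in at u. N w $$ (i, k) = G w $$ (i, k)"
      unfolding eventually_at_topological using S eq by (intro exI[of _ "S - ({z} - {u})"]) (cases "z = u"; auto)
  qed simp
  also have "\<dots> = G u $$ (i, k)"
    using mholoD(3)[OF G ik] S by (intro remove_sings_at_analytic) (auto simp: analytic_at)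
  finally show "remove_sings_mat N u $$ (i, k) = G u $$ (i, k)" using ik d by (simp add: remove_sings_mat_def)
qed (use mholoD[OF G] d in \<open>auto simp: remove_sings_mat_def\<close>)

text \<open>A normalized matrix M is holomorphic near z and, away from z, an explicit scalar
  multiple of X. Exchange relations for X then pass to M, and derivatives of M at z make
  sense.\<close>

definition regular_multiple :: "complex \<Rightarrow> nat \<Rightarrow> (complex \<Rightarrow> complex mat) \<Rightarrow> (complex \<Rightarrow> complex) \<Rightarrow> (complex \<Rightarrow> complex mat) \<Rightarrow> bool" where
  "regular_multiple z n M c X \<longleftrightarrow> (\<exists>S. open S \<and> z \<in> S \<and> mholo S M n n \<and> (\<forall>u\<in>S - {z}. M u = c u \<cdot>\<^sub>m X u))"

lemma regular_multiple_remove_sings: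
  assumes S: "open S" "z \<in> S" and G: "mholo S G n n" and d: "\<And>u. dim_row (X u) = n" "\<And>u. dim_col (X u) = n"
    and eq: "\<And>u. u \<in> S - {z} \<Longrightarrow> c u \<cdot>\<^sub>m X u = G u"
  shows "regular_multiple z n (remove_sings_mat (\<lambda>u. c u \<cdot>\<^sub>m X u)) c X"
proof -
  have e: "remove_sings_mat (\<lambda>u. c u \<cdot>\<^sub>m X u) u = G u" if "u \<in> S" for u
    by (rule remove_sings_mat_eq[OF S(1) that G _ _ eq]) (use d in auto)
  have "mholo S (remove_sings_mat (\<lambda>u. c u \<cdot>\<^sub>m X u)) n n"
  proof (rule mholoI)
    fix i k assume "i < n" "k < n"
    then show "(\<lambda>u. remove_sings_mat (\<lambda>u. c u \<cdot>\<^sub>m X u) u $$ (i, k)) holomorphic_on S"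
      using mholoD(3)[OF G, of i k] e by (subst holomorphic_cong[OF refl]) auto
  qed (use d in \<open>auto simp: remove_sings_mat_def\<close>)
  then show ?thesis unfolding regular_multiple_def using S e eq by (intro exI[of _ S]) auto
qed

text \<open>The fusion recursion with \<open>rcore\<close> for the R-matrix: all scalar c-factors
  are left out.\<close>

fun Rhat :: "complex \<Rightarrow> nat \<Rightarrow> nat \<Rightarrow> complex \<Rightarrow> complex mat" where
  "Rhat r 0 t u = 1\<^sub>m (t + 1)"
| "Rhat r (Suc 0) t u = rcore r t u"
| "Rhat r (Suc (Suc n)) t u = (Fmap r (Suc (Suc n)) \<otimes>\<^sub>k 1\<^sub>m (t + 1))
       * embed2 [2, Suc (Suc n), t + 1] 0 2 (rcore r t (u * r powi (1 - int (Suc (Suc n)))))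
       * (1\<^sub>m 2 \<otimes>\<^sub>k Rhat r (Suc n) t (u * r)) * (Emap r (Suc (Suc n)) \<otimes>\<^sub>k 1\<^sub>m (t + 1))"

text \<open>The arguments u q^((2i+1-s)/2) are the spectral parameters of the s constituents of spin
  1/2; each contributes the prefactor of its own R-matrix.\<close>

lemma Rmat_Rhat:
  assumes r: "r \<noteq> 0" and t: "t \<ge> 1" and s: "s \<ge> 1"
  shows "Rmat r s t u = (\<Prod>i<s. rpref r t (u * r powi (2 * int i + 1 - int s))) \<cdot>\<^sub>m Rhat r s t u \<and>
    mholo (- {0}) (Rhat r s t) ((s + 1) * (t + 1)) ((s + 1) * (t + 1))"
  using s
proof (induction s arbitrary: u rule: nat_induct_at_least)
  case base
  have "Rhat r (Suc 0) t = rcore r t" by (rule ext) simp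
  then show ?case using Rhalf_eq[OF t r] mholo_rcore[OF r, of t] by (simp add: mult_2)
next
  case (Suc s)
  obtain n where n: "s = Suc n" using Suc.hyps by (cases s) auto
  define P where "P u = (\<Prod>i<s. rpref r t (u * r powi (2 * int i + 1 - int s)))" for u
  have ih: "Rmat r s t u = P u \<cdot>\<^sub>m Rhat r s t u" "mholo (- {0}) (Rhat r s t) (Suc s * (t + 1)) (Suc s * (t + 1))" for u
    using Suc.IH by (simp_all add: P_def)
  note dR = mholoD(1,2)[OF ih(2)]
  have p: "(\<Prod>i<Suc s. rpref r t (u * r powi (2 * int i + 1 - int (Suc s)))) = rpref r t (u * r powi (1 - int (Suc s))) * P (u * r)"
  proof -
    have e: "u * r powi (2 * int (Suc i) + 1 - int (Suc s)) = u * r * r powi (2 * int i + 1 - int s)" for i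
    proof -
      have "2 * int (Suc i) + 1 - int (Suc s) = 1 + (2 * int i + 1 - int s)" by simp
      then show ?thesis using power_int_add[OF disjI1, OF r] by (metis mult.assoc power_int_1_right)
    qed
    show ?thesis unfolding P_def prod.lessThan_Suc_shift e by simp
  qed
  have "Rmat r (Suc s) t u = (rpref r t (u * r powi (1 - int (Suc s))) * P (u * r)) \<cdot>\<^sub>m Rhat r (Suc s) t u"
    unfolding n Rmat.simps Rhat.simps Let_def
    unfolding n[symmetric] ih(1) Rhalf_eq[OF t r]
    using dR
    by (simp add: embed2_smult_dim kron_smult_right mat_smult_mult_left_dim mat_smult_mult_right_dim mat_smult_smult mult_ac)
  moreover have "mholo (- {0}) (\<lambda>u. Rhat r (Suc s) t u) ((Suc s + 1) * (t + 1)) ((Suc s + 1) * (t + 1))"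
  proof -
    define ds where "ds = [2, Suc s, t + 1]"
    define N where "N = 2 * (Suc s * (t + 1))"
    have ds: "prod_list ds = N" "ds ! 0 = 2" "ds ! 2 = t + 1" "length ds = 3" by (simp_all add: ds_def N_def)
    have X: "mholo (- {0}) (\<lambda>u. embed2 ds 0 2 (rcore r t (u * r powi (1 - int (Suc s))))) N N"
    proof -
      have "mholo (- {0}) (\<lambda>u. rcore r t (u * r powi (1 - int (Suc s)))) (2 * (t + 1)) (2 * (t + 1))"
        by (rule mholo_compose[OF mholo_rcore[OF r]]) (use r in \<open>auto intro!: holomorphic_intros\<close>)
      from mholo_embed2[of _ _ ds 0 2, unfolded ds, OF this] show ?thesis by simp
    qed
    have "mholo (- {0}) (\<lambda>u. Rhat r s t (u * r)) (Suc s * (t + 1)) (Suc s * (t + 1))"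
      by (rule mholo_compose[OF ih(2)]) (use r in \<open>auto intro!: holomorphic_intros\<close>)
    from mholo_kron[OF mholo_const[of "1\<^sub>m 2" 2 2] this]
    have Y: "mholo (- {0}) (\<lambda>u. 1\<^sub>m 2 \<otimes>\<^sub>k Rhat r s t (u * r)) N N" by (simp add: N_def)
    have E: "mholo (- {0}) (\<lambda>u. Emap r (Suc s) \<otimes>\<^sub>k 1\<^sub>m (t + 1)) N ((Suc s + 1) * (t + 1))"
      and F: "mholo (- {0}) (\<lambda>u. Fmap r (Suc s) \<otimes>\<^sub>k 1\<^sub>m (t + 1)) ((Suc s + 1) * (t + 1)) N"
      by (rule mholo_const, rule carrier_matI, simp_all add: N_def)+
    show ?thesis
      unfolding n Rhat.simps unfolding n[symmetric] ds_def[symmetric] by (intro mholo_mult[OF mholo_mult[OF mholo_mult[OF F X] Y] E])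
  qed
  ultimately show ?case unfolding p by simp
qed

lemma finite_cfun_zeros_linear:
  assumes "c \<noteq> 0"
  shows "finite {u. cfun (u * c) = 0}"
proof -
  have "{u. cfun (u * c) = 0} \<subseteq> {0} \<union> {u. u\<^sup>2 * c\<^sup>2 = 1}"
    using assms by (auto simp: cfun_eq_0_iff power_mult_distrib)
  moreover have "finite \<dots>" using finite_square_eq[of "c\<^sup>2"] assms by simp
  ultimately show ?thesis by (rule finite_subset)
qed

text \<open>The normalizing product is P0 Q, where Q is the prefactor of the fused R-matrix and
  cancels, while P0 collects the factors c(u q^(i+1)), none of which vanishes at u = 1.\<close>

lemma Rtilde_regular:
  assumes g: "generic r" and s: "s \<ge> 1"
  shows "regular_multiple 1 ((s + 1) * (s + 1)) (Rtilde r s s)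
    (\<lambda>u. inverse (\<Prod>k<s. \<Prod>l<s. cfun (u * r powi (int s + int s - 2 * int k - 2 * int l)))) (Rmat r s s)"
proof -
  have r: "r \<noteq> 0" using generic_nonzero[OF g] .
  define P0 where "P0 u = (\<Prod>i<s. cfun (u * r powi (2 * int i + 2)))" for u
  define Q where "Q u = (\<Prod>i<s. rpref r s (u * r powi (2 * int i + 1 - int s)))" for u
  \<comment> \<open>Reversing the order of k to i = s - 1 - k, the factor l = 0 goes into P0 and the
    others form the prefactor of the constituent number i.\<close>
  have PQ: "(\<Prod>k<s. \<Prod>l<s. cfun (u * r powi (int s + int s - 2 * int k - 2 * int l))) = P0 u * Q u" for u
  proof -
    have e: "u * r powi (2 * int i + 1 - int s) * r powi (int s - 1 - 2 * int k) = u * r powi (2 * int i - 2 * int k)" for i k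
      using r by (simp add: mult.assoc flip: power_int_add)
    have "(\<Prod>k<s. \<Prod>l<s. cfun (u * r powi (int s + int s - 2 * int k - 2 * int l))) =
       (\<Prod>i<s. \<Prod>l<s. cfun (u * r powi (int s + int s - 2 * int (s - Suc i) - 2 * int l)))"
      by (subst prod.nat_diff_reindex[symmetric]) simp
    also have "\<dots> = (\<Prod>i<s. cfun (u * r powi (2 * int i + 2)) * rpref r s (u * r powi (2 * int i + 1 - int s)))"
    proof (rule prod.cong)
      fix i assume i: "i \<in> {..<s}"
      obtain s' where s': "s = Suc s'" using s by (cases s) auto
      have "(\<Prod>l<s. cfun (u * r powi (int s + int s - 2 * int (s - Suc i) - 2 * int l))) =
         (\<Prod>l<s. cfun (u * r powi (2 * int i + 2 - 2 * int l)))"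
        using i by (intro prod.cong) (auto simp: of_nat_diff algebra_simps)
      also have "\<dots> = cfun (u * r powi (2 * int i + 2)) * (\<Prod>l<s'. cfun (u * r powi (2 * int i - 2 * int l)))"
        unfolding s' by (subst prod.lessThan_Suc_shift) simp
      also have "(\<Prod>l<s'. cfun (u * r powi (2 * int i - 2 * int l))) = rpref r s (u * r powi (2 * int i + 1 - int s))"
        unfolding rpref_def e by (simp add: s')
      finally show "(\<Prod>l<s. cfun (u * r powi (int s + int s - 2 * int (s - Suc i) - 2 * int l))) =
        cfun (u * r powi (2 * int i + 2)) * rpref r s (u * r powi (2 * int i + 1 - int s))" .
    qed simp
    finally show ?thesis by (simp add: P0_def Q_def prod.distrib)
  qed
  have fQ: "finite {u. Q u = 0}"
  proof -
    have "{u. Q u = 0} = (\<Union>i<s. \<Union>k<s - 1. {u. cfun (u * (r powi (2 * int i + 1 - int s) * r powi (int s - 1 - 2 * int k))) = 0})"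
      by (auto simp: Q_def rpref_def mult.assoc)
    also have "finite \<dots>" using r by (intro finite_UN_I finite_cfun_zeros_linear) auto
    finally show ?thesis .
  qed
  have fP: "finite {u. P0 u = 0}"
  proof -
    have "{u. P0 u = 0} = (\<Union>i<s. {u. cfun (u * r powi (2 * int i + 2)) = 0})" by (auto simp: P0_def)
    also have "finite \<dots>" using r by (intro finite_UN_I finite_cfun_zeros_linear) auto
    finally show ?thesis .
  qed
  have P01: "P0 1 \<noteq> 0"
  proof -
    have "cfun (r powi (2 * int i + 2)) \<noteq> 0" for i
      using generic_cfun[OF g, of "2 * i + 2"] by (simp add: power_int_def nat_add_distrib nat_mult_distrib)
    then show ?thesis by (simp add: P0_def)
  qed
  define S where "S = - ({0} \<union> {u. P0 u = 0} \<union> ({u. Q u = 0} - {1}))"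
  have S: "open S" "1 \<in> S" unfolding S_def using fQ fP P01 by (auto intro!: open_Compl finite_imp_closed)
  note RR = Rmat_Rhat[OF r s s]
  show ?thesis
    unfolding Rtilde_def PQ
  proof (rule regular_multiple_remove_sings[OF S])
    have "mholo S (Rhat r s s) ((s + 1) * (s + 1)) ((s + 1) * (s + 1))"
      by (rule mholo_subset[OF conjunct2[OF RR]]) (auto simp: S_def)
    moreover have "(\<lambda>u. inverse (P0 u)) holomorphic_on S"
      unfolding P0_def cfun_def using r by (intro holomorphic_intros) (auto simp: S_def P0_def cfun_def)
    ultimately show "mholo S (\<lambda>u. inverse (P0 u) \<cdot>\<^sub>m Rhat r s s u) ((s + 1) * (s + 1)) ((s + 1) * (s + 1))"
      by (rule mholo_smult)
    show "inverse (P0 u * Q u) \<cdot>\<^sub>m Rmat r s s u = inverse (P0 u) \<cdot>\<^sub>m Rhat r s s u" if "u \<in> S - {1}" for u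
    proof -
      have "Q u \<noteq> 0" using that by (auto simp: S_def)
      moreover have "Rmat r s s u = Q u \<cdot>\<^sub>m Rhat r s s u" using RR unfolding Q_def by blast
      ultimately show ?thesis by (simp add: mat_smult_smult mult.assoc)
    qed
    show "dim_row (Rmat r s s u) = (s + 1) * (s + 1)" "dim_col (Rmat r s s u) = (s + 1) * (s + 1)" for u
      using mholoD(1,2) R_intertwining[OF g s s] by (auto simp: R_intertwining_def)
  qed
qed

lemma Ktilde_regular:
  assumes r: "r \<noteq> 0" and z: "z \<noteq> 0" and K: "Khat_regular r \<kappa> s z"
  shows "regular_multiple z (s + 1) (Ktilde r d \<kappa> s)
    (\<lambda>u. inverse (\<Prod>k<d. \<Prod>l<s - 1 - k. cfun (u\<^sup>2 * r powi (2 * (1 + int k - int l))))) (Kmat r \<kappa> s)"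
proof -
  obtain S0 G where S0: "open S0" "z \<in> S0" and G: "mholo S0 G (s + 1) (s + 1)" and GK: "\<And>u. u \<in> S0 - {z} \<Longrightarrow> Khat r \<kappa> s u = G u"
    using K unfolding Khat_regular_def by blast
  define P where "P k u = (\<Prod>l<s - 1 - k. cfun (u\<^sup>2 * r powi (2 * (1 + int k - int l))))" for k u
  define L where "L u = (\<Prod>k\<in>{d..<max d (s - 1)}. P k u)" for u
  have DL: "Kpref r s u = (\<Prod>k<d. P k u) * L u" for u
  proof -
    \<comment> \<open>Layers with k >= s - 1 are empty products, so the product may be extended to
      the larger of d and s - 1 and split at d. L holds the layers that the normalization leaves in
      place.\<close>
    have "Kpref r s u = (\<Prod>k<max d (s - 1). P k u)"
      unfolding Kpref_def P_def[symmetric] by (rule prod.mono_neutral_left) (auto simp: P_def)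
    also have "{..<max d (s - 1)} = {..<d} \<union> {d..<max d (s - 1)}" by auto
    also have "(\<Prod>k\<in>\<dots>. P k u) = (\<Prod>k<d. P k u) * L u" unfolding L_def by (rule prod.union_disjoint) auto
    finally show ?thesis .
  qed
  define B where "B = {u. Kpref r s u = 0} \<union> (\<Union>m<s. {u. cfun (u\<^sup>2 * r ^ (2 * m)) = 0})"
  have B: "finite B" unfolding B_def using finite_Kpref_zeros[OF r] r by (intro finite_UnI finite_UN_I finite_cfun_zeros) auto
  define S where "S = S0 - (B - {z}) - {0}"
  have S: "open S" "z \<in> S" unfolding S_def using S0 B z by (auto intro!: open_Diff finite_imp_closed)
  show ?thesis
    unfolding Ktilde_def
  proof (rule regular_multiple_remove_sings[OF S])
    have "mholo S G (s + 1) (s + 1)" by (rule mholo_subset[OF G]) (auto simp: S_def)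
    moreover have "L holomorphic_on S" unfolding L_def P_def cfun_def using r by (intro holomorphic_intros) (auto simp: S_def)
    ultimately show "mholo S (\<lambda>u. L u \<cdot>\<^sub>m G u) (s + 1) (s + 1)" by (rule mholo_smult)
    fix u assume u: "u \<in> S - {z}"
    have "Kmat r \<kappa> s u = Kpref r s u \<cdot>\<^sub>m Khat r \<kappa> s u"
      using u by (intro Kmat_Khat[OF r]) (auto simp: S_def B_def)
    also have "Khat r \<kappa> s u = G u" using u by (intro GK) (auto simp: S_def)
    finally have "Kmat r \<kappa> s u = ((\<Prod>k<d. P k u) * L u) \<cdot>\<^sub>m G u" unfolding DL .
    moreover have "(\<Prod>k<d. P k u) \<noteq> 0" using u DL[of u] by (auto simp: S_def B_def)
    then have "inverse (\<Prod>k<d. P k u) * ((\<Prod>k<d. P k u) * L u) = L u" by (simp del: prod_zero_iff add: mult.assoc[symmetric])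
    ultimately show "inverse (\<Prod>k<d. \<Prod>l<s - 1 - k. cfun (u\<^sup>2 * r powi (2 * (1 + int k - int l)))) \<cdot>\<^sub>m Kmat r \<kappa> s u = L u \<cdot>\<^sub>m G u"
      unfolding P_def[symmetric] by (simp only: mat_smult_smult)
  qed simp_all
qed

lemma Ktilde_regular_1:
  assumes g: "generic r"
  shows "regular_multiple 1 (s + 1) (Ktilde r d \<kappa> s)
    (\<lambda>u. inverse (\<Prod>k<d. \<Prod>l<s - 1 - k. cfun (u\<^sup>2 * r powi (2 * (1 + int k - int l))))) (Kmat r \<kappa> s)"
  by (rule Ktilde_regular[OF generic_nonzero[OF g] _ Khat_regular_1[OF g]]) simp

lemma Kplus_tilde_regular:
  assumes g: "generic r" and s: "s \<ge> 1" and e: "ep \<kappa> \<noteq> 0 \<and> em \<kappa> = 0 \<or> ep \<kappa> = 0 \<and> em \<kappa> \<noteq> 0"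
  shows "regular_multiple 1 (s + 1) (Kplus_tilde r d \<kappa> s)
    (\<lambda>u. inverse (\<Prod>k<d. \<Prod>l<s - 1 - k. cfun ((inverse u * inverse (r\<^sup>2))\<^sup>2 * r powi (2 * (1 + int k - int l))))) (Kdual r \<kappa> s)"
proof -
  have r: "r \<noteq> 0" using generic_nonzero[OF g] .
  define c where "c u = inverse (\<Prod>k<d. \<Prod>l<s - 1 - k. cfun (u\<^sup>2 * r powi (2 * (1 + int k - int l))))" for u
  have "Khat_regular r (dual_params \<kappa>) s (inverse (r\<^sup>2))"
    by (rule Khat_regular_inverse_square[OF g s]) (use e in \<open>auto simp: dual_params_def\<close>)
  from Ktilde_regular[OF r _ this, of d]
  obtain S where S: "open S" "inverse (r\<^sup>2) \<in> S" and K: "mholo S (Ktilde r d (dual_params \<kappa>) s) (s + 1) (s + 1)"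
    and eq: "\<And>u. u \<in> S - {inverse (r\<^sup>2)} \<Longrightarrow> Ktilde r d (dual_params \<kappa>) s u = c u \<cdot>\<^sub>m Kmat r (dual_params \<kappa>) s u"
    using r unfolding regular_multiple_def c_def by auto
  define f where "f u = inverse u * inverse (r\<^sup>2)" for u
  define T where "T = {u \<in> - {0}. f u \<in> S}"
  have "continuous_on (- {0}) f" unfolding f_def by (intro continuous_intros) auto
  then have "open (f -` S \<inter> - {0})" using S(1) by (subst (asm) continuous_on_open_vimage) auto
  moreover have "T = f -` S \<inter> - {0}" by (auto simp: T_def)
  ultimately have T: "open T" by simp
  have T1: "1 \<in> T" using S(2) by (simp add: T_def f_def)
  have Kp: "Kplus_tilde r d \<kappa> s u = (Ktilde r d (dual_params \<kappa>) s (f u))\<^sup>T" for u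
    unfolding Kplus_tilde_def dual_params_def f_def ..
  have fh: "f holomorphic_on T" unfolding f_def by (intro holomorphic_intros) (auto simp: T_def)
  have fT: "f ` T \<subseteq> S" by (auto simp: T_def)
  have "mholo T (\<lambda>u. Kplus_tilde r d \<kappa> s u) (s + 1) (s + 1)"
    unfolding Kp by (rule mholo_transpose[OF mholo_compose[OF K fh fT]])
  moreover have "Kplus_tilde r d \<kappa> s u = c (f u) \<cdot>\<^sub>m Kdual r \<kappa> s u" if u: "u \<in> T - {1}" for u
  proof -
    have "f u \<noteq> inverse (r\<^sup>2)" using u r by (auto simp: f_def T_def field_simps)
    then have "Ktilde r d (dual_params \<kappa>) s (f u) = c (f u) \<cdot>\<^sub>m Kmat r (dual_params \<kappa>) s (f u)" using u by (intro eq) (auto simp: T_def)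
    then show ?thesis unfolding Kp Kdual_def f_def by (intro eq_matI) auto
  qed
  ultimately show ?thesis unfolding regular_multiple_def c_def f_def using T T1 by auto
qed

subsection \<open>The chain\<close>

text \<open>Adding a site: R exchanges the new site with the auxiliary space, which brings the
  auxiliary space next to the chain already treated; then the inner relation applies, and the second
  R exchanges back. A and D belong to the new site, \<open>Aa\<close> and \<open>Aa'\<close> to the
  auxiliary space before and after reflection.\<close>

lemma chain_step:
  fixes R KK A D Aa Aa' Da W :: "complex mat"
  assumes d: "\<And>M. M \<in> {R, KK, A, D, Aa, Aa', Da, W} \<Longrightarrow> dim_row M = n \<and> dim_col M = n"
    and h1: "R * (Aa + A * Da) = (A + D * Aa) * R" and h2: "R * (A + D * Aa') = (Aa' + A * Da) * R"
    and h3: "R * (D * Da) = (D * Da) * R" and h4: "R * W = W * R" and h5: "KK * A = A * KK" "KK * D = D * KK"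
    and c: "Da * D = D * Da" "Da * A = A * Da"
    and IH: "KK * (Aa + Da * W) = (Aa' + Da * W) * KK"
  shows "(R * (KK * R)) * (Aa + Da * (A + D * W)) = (Aa' + Da * (A + D * W)) * (R * (KK * R))"
proof -
  have dd: "dim_row R = n" "dim_col R = n" "dim_row KK = n" "dim_col KK = n" "dim_row A = n" "dim_col A = n"
    "dim_row D = n" "dim_col D = n" "dim_row Aa = n" "dim_col Aa = n" "dim_row Aa' = n" "dim_col Aa' = n"
    "dim_row Da = n" "dim_col Da = n" "dim_row W = n" "dim_col W = n"
    using d by auto
  define S1 where "S1 X = A + D * (X + Da * W)" for X
  define S where "S X = X + Da * (A + D * W)" for X
  have dS: "dim_row (S1 X) = n" "dim_col (S1 X) = n" "dim_row (S X) = n" "dim_col (S X) = n" for X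
    using dd by (simp_all add: S1_def S_def)
  have Se: "S X = (X + A * Da) + (D * Da) * W" if "dim_row X = n" "dim_col X = n" for X
    unfolding S_def using dd that c by (simp add: mat_distrib_left_dim mat_assoc_dim[symmetric] mat_add_assoc_dim)
  have S1e: "S1 X = (A + D * X) + (D * Da) * W" if "dim_row X = n" "dim_col X = n" for X
    unfolding S1_def using dd that by (simp add: mat_distrib_left_dim mat_assoc_dim mat_add_assoc_dim)
  have RW: "R * ((D * Da) * W) = (D * Da) * W * R"
  proof -
    have "R * ((D * Da) * W) = R * (D * Da) * W" using dd by (simp add: mat_assoc_dim)
    also have "\<dots> = (D * Da) * (R * W)" unfolding h3 using dd by (simp add: mat_assoc_dim)
    also have "\<dots> = (D * Da) * W * R" unfolding h4 using dd by (simp add: mat_assoc_dim)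
    finally show ?thesis .
  qed
  have e1: "R * S Aa = S1 Aa * R"
    unfolding Se[OF dd(9,10)] S1e[OF dd(9,10)] using dd h1 RW by (simp add: mat_distrib_left_dim mat_distrib_right_dim)
  have e3: "R * S1 Aa' = S Aa' * R"
    unfolding Se[OF dd(11,12)] S1e[OF dd(11,12)] using dd h2 RW by (simp add: mat_distrib_left_dim mat_distrib_right_dim)
  have e2: "KK * S1 Aa = S1 Aa' * KK"
  proof -
    have "KK * S1 Aa = KK * A + KK * D * (Aa + Da * W)" unfolding S1_def using dd by (simp add: mat_distrib_left_dim mat_assoc_dim)
    also have "\<dots> = A * KK + D * (KK * (Aa + Da * W))" unfolding h5 using dd by (simp add: mat_assoc_dim)
    also have "\<dots> = S1 Aa' * KK" unfolding IH S1_def using dd by (simp add: mat_distrib_right_dim mat_assoc_dim)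
    finally show ?thesis .
  qed
  have "(R * (KK * R)) * S Aa = R * (KK * (R * S Aa))" using dd dS by (simp add: mat_assoc_dim)
  also have "\<dots> = R * (KK * S1 Aa) * R" unfolding e1 using dd dS by (simp add: mat_assoc_dim)
  also have "\<dots> = (R * S1 Aa') * (KK * R)" unfolding e2 using dd dS by (simp add: mat_assoc_dim)
  also have "\<dots> = S Aa' * (R * (KK * R))" unfolding e3 using dd dS by (simp add: mat_assoc_dim)
  finally show ?thesis unfolding S_def .
qed

text \<open>Multiplying by D^(-1) on the right frees W on one side. Under the trace the two terms
  with the auxiliary generators A and A' become equal by cyclicity, and what remains is the exchange
  of W with the trace.\<close>

lemma partial_trace_exchange:
  fixes X A A' D Di P P' W :: "complex mat"
  assumes X: "X \<in> carrier_mat (d * m) (d * m)" and W: "W \<in> carrier_mat m m"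
    and c: "A \<in> carrier_mat d d" "A' \<in> carrier_mat d d" "D \<in> carrier_mat d d" "Di \<in> carrier_mat d d" "P \<in> carrier_mat d d" "P' \<in> carrier_mat d d"
    and XW: "X * (A \<otimes>\<^sub>k 1\<^sub>m m + D \<otimes>\<^sub>k W) = (A' \<otimes>\<^sub>k 1\<^sub>m m + D \<otimes>\<^sub>k W) * X"
    and Di: "D * Di = 1\<^sub>m d" "Di * D = 1\<^sub>m d"
    and P': "P' * D = l \<cdot>\<^sub>m (D * P)" and P: "A * (P * Di) = (P * Di) * A'"
  shows "partial_trace d m ((P' \<otimes>\<^sub>k 1\<^sub>m m) * X) * W = l \<cdot>\<^sub>m (W * partial_trace d m ((P \<otimes>\<^sub>k 1\<^sub>m m) * X))"
proof -
  have dd: "dim_row X = d * m" "dim_col X = d * m" "dim_row W = m" "dim_col W = m" "dim_row A = d" "dim_col A = d"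
    "dim_row A' = d" "dim_col A' = d" "dim_row D = d" "dim_col D = d" "dim_row Di = d" "dim_col Di = d"
    "dim_row P = d" "dim_col P = d" "dim_row P' = d" "dim_col P' = d" using X W c by auto
  define W1 where "W1 = 1\<^sub>m d \<otimes>\<^sub>k W"
  define e where "e M = M \<otimes>\<^sub>k 1\<^sub>m m" for M :: "complex mat"
  have de: "dim_row (e M) = dim_row M * m" "dim_col (e M) = dim_col M * m" for M by (simp_all add: e_def)
  have dW: "dim_row W1 = d * m" "dim_col W1 = d * m" by (simp_all add: W1_def dd)
  have ee: "e M * e M' = e (M * M')" if "dim_col M = dim_row M'" for M M' unfolding e_def using that by (simp add: kron_mult_kron)
  have eW: "e M * W1 = M \<otimes>\<^sub>k W" "W1 * e M = M \<otimes>\<^sub>k W" if "dim_row M = d" "dim_col M = d" for M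
    unfolding e_def W1_def using that dd by (simp_all add: kron_mult_kron)
  have e1: "e (1\<^sub>m d) = 1\<^sub>m (d * m)" by (simp add: e_def kron_one)
  have 1: "X * (e A * e Di) + X * W1 = e A' * (X * e Di) + W1 * (e D * (X * e Di))"
  proof -
    have "X * (e A + W1 * e D) = (e A' + W1 * e D) * X" using XW eW(2)[of D] dd by (simp add: e_def)
    from arg_cong[OF this, of "\<lambda>M. M * e Di"]
    have "X * (e A * e Di) + X * (W1 * (e D * e Di)) = e A' * (X * e Di) + W1 * (e D * (X * e Di))"
      using dd de dW by (simp add: mat_distrib_left_dim mat_distrib_right_dim mat_assoc_dim)
    then show ?thesis using ee[of D Di] Di dd dW by (simp add: e1 mult_one_dim)
  qed
  have DiP: "Di * P' = l \<cdot>\<^sub>m (P * Di)"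
  proof -
    have "Di * (P' * D) * Di = Di * (l \<cdot>\<^sub>m (D * P)) * Di" unfolding P' ..
    moreover have "Di * (P' * D) * Di = Di * P'" using dd Di by (simp add: mat_assoc_dim mult_one_dim)
    moreover have "Di * (l \<cdot>\<^sub>m (D * P)) * Di = l \<cdot>\<^sub>m ((Di * D) * P * Di)"
      using dd by (simp add: mat_smult_mult_left_dim mat_smult_mult_right_dim mat_assoc_dim)
    ultimately show ?thesis using dd Di by (simp add: one_mult_dim)
  qed
  \<comment> \<open>Here the intertwining property of the dual K-matrix enters; it identifies the
    two auxiliary terms.\<close>
  have AP: "(A * Di) * P' = (Di * P') * A'"
  proof -
    have "(A * Di) * P' = A * (Di * P')" using dd by (simp add: mat_assoc_dim)
    then show ?thesis unfolding DiP using dd P by (simp add: mat_smult_mult_left_dim mat_smult_mult_right_dim)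
  qed
  have cyc: "partial_trace d m (e M * Y) = partial_trace d m (Y * e M)" if "dim_row M = d" "dim_col M = d" "dim_row Y = d * m" "dim_col Y = d * m" for M Y
    unfolding e_def using that by (intro partial_trace_cyclic) auto
  have t1: "partial_trace d m (e P' * (X * (e A * e Di))) = partial_trace d m (e ((A * Di) * P') * X)"
  proof -
    have "partial_trace d m (e P' * (X * (e A * e Di))) = partial_trace d m ((e P' * X) * e (A * Di))"
      using dd de ee[of A Di] by (simp add: mat_assoc_dim)
    also have "\<dots> = partial_trace d m (e (A * Di) * (e P' * X))" using dd de by (intro cyc[symmetric]) auto
    also have "e (A * Di) * (e P' * X) = e ((A * Di) * P') * X" using dd de ee[of "A * Di" P', symmetric] by (simp add: mat_assoc_dim)
    finally show ?thesis .
  qed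
  have t2: "partial_trace d m (e P' * (e A' * (X * e Di))) = partial_trace d m (e ((Di * P') * A') * X)"
  proof -
    have "partial_trace d m (e P' * (e A' * (X * e Di))) = partial_trace d m ((e P' * (e A' * X)) * e Di)"
      using dd de by (simp add: mat_assoc_dim)
    also have "\<dots> = partial_trace d m (e Di * (e P' * (e A' * X)))" using dd de by (intro cyc[symmetric]) auto
    also have "e Di * (e P' * (e A' * X)) = e ((Di * P') * A') * X"
      using dd de ee[of "Di * P'" A', symmetric] ee[of Di P', symmetric] by (simp add: mat_assoc_dim)
    finally show ?thesis .
  qed
  have t3: "partial_trace d m (e P' * (W1 * (e D * (X * e Di)))) = l \<cdot>\<^sub>m (W * partial_trace d m (e P * X))"
  proof -
    have "e P' * (W1 * (e D * (X * e Di))) = (e P' * W1) * (e D * (X * e Di))" using dd de dW by (simp add: mat_assoc_dim)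
    also have "e P' * W1 = W1 * e P'" using eW[of P'] dd by simp
    also have "(W1 * e P') * (e D * (X * e Di)) = W1 * ((e P' * e D) * (X * e Di))" using dd de dW by (simp add: mat_assoc_dim)
    finally have 1: "e P' * (W1 * (e D * (X * e Di))) = W1 * ((e P' * e D) * (X * e Di))" .
    have "e P' * e D = l \<cdot>\<^sub>m (e D * e P)" using ee[of P' D] ee[of D P] dd unfolding P' by (simp add: e_def kron_smult_left)
    then have 2: "(e P' * e D) * (X * e Di) = l \<cdot>\<^sub>m ((e D * (e P * X)) * e Di)" using dd de by (simp add: mat_smult_mult_left_dim mat_assoc_dim)
    have "partial_trace d m (e P' * (W1 * (e D * (X * e Di)))) = W * partial_trace d m (l \<cdot>\<^sub>m ((e D * (e P * X)) * e Di))"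
      unfolding 1 2 unfolding W1_def using dd de by (intro partial_trace_mult_left) auto
    also have "partial_trace d m (l \<cdot>\<^sub>m ((e D * (e P * X)) * e Di)) = l \<cdot>\<^sub>m partial_trace d m ((e D * (e P * X)) * e Di)"
      using dd de by (intro partial_trace_smult) auto
    also have "partial_trace d m ((e D * (e P * X)) * e Di) = partial_trace d m (e Di * (e D * (e P * X)))"
      using dd de by (intro cyc[symmetric]) auto
    also have "e Di * (e D * (e P * X)) = (e Di * e D) * (e P * X)" using dd de by (simp add: mat_assoc_dim)
    also have "\<dots> = e P * X" using ee[of Di D] Di dd de by (simp add: e1 one_mult_dim)
    finally show ?thesis using dd by (simp add: mat_smult_mult_right_dim)
  qed
  have t0: "partial_trace d m (e P' * (X * W1)) = partial_trace d m (e P' * X) * W"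
  proof -
    have 1: "e P' * (X * W1) = (e P' * X) * W1" using dd de dW by (simp add: mat_assoc_dim)
    show ?thesis unfolding 1 unfolding W1_def by (rule partial_trace_mult_right) (use dd de in auto)
  qed
  have "partial_trace d m (e P' * (X * (e A * e Di))) + partial_trace d m (e P' * (X * W1)) =
    partial_trace d m (e P' * (e A' * (X * e Di))) + partial_trace d m (e P' * (W1 * (e D * (X * e Di))))"
  proof -
    have "e P' * (X * (e A * e Di)) + e P' * (X * W1) = e P' * (e A' * (X * e Di)) + e P' * (W1 * (e D * (X * e Di)))"
      using arg_cong[OF 1, of "\<lambda>M. e P' * M"] dd de dW by (simp add: mat_distrib_left_dim)
    moreover have "e P' * (X * (e A * e Di)) \<in> carrier_mat (d * m) (d * m)" "e P' * (X * W1) \<in> carrier_mat (d * m) (d * m)"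
      "e P' * (e A' * (X * e Di)) \<in> carrier_mat (d * m) (d * m)" "e P' * (W1 * (e D * (X * e Di))) \<in> carrier_mat (d * m) (d * m)"
      using dd de dW by (auto intro!: carrier_matI)
    ultimately show ?thesis by (metis partial_trace_add)
  qed
  then have E: "partial_trace d m (e ((Di * P') * A') * X) + partial_trace d m (e P' * X) * W =
    partial_trace d m (e ((Di * P') * A') * X) + l \<cdot>\<^sub>m (W * partial_trace d m (e P * X))"
    unfolding t0 t1 t2 t3 AP .
  show ?thesis unfolding e_def[symmetric]
  proof (rule eq_matI)
    fix i k assume "i < dim_row (l \<cdot>\<^sub>m (W * partial_trace d m (e P * X)))" "k < dim_col (l \<cdot>\<^sub>m (W * partial_trace d m (e P * X)))"
    then have ik: "i < m" "k < m" using dd by auto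
    from arg_cong[OF E, of "\<lambda>M. M $$ (i, k)"] show "(partial_trace d m (e P' * X) * W) $$ (i, k) = (l \<cdot>\<^sub>m (W * partial_trace d m (e P * X))) $$ (i, k)"
      using ik dd by (simp del: index_mult_mat(1))
  qed (use dd in auto)
qed

lemma embed1_replicate:
  assumes A: "A \<in> carrier_mat d d"
  shows "p \<le> N \<Longrightarrow> embed1 (replicate (Suc N) d) p A = 1\<^sub>m (d ^ p) \<otimes>\<^sub>k (A \<otimes>\<^sub>k 1\<^sub>m (d ^ (N - p)))"
proof (induction p arbitrary: N)
  case 0
  have "embed1 (replicate (Suc N) d) 0 A = A \<otimes>\<^sub>k 1\<^sub>m (d ^ N)" using embed1_Cons_0[OF A, of "replicate N d"] by (simp add: prod_list_replicate)
  then show ?case using kron_one_one(1)[of "A \<otimes>\<^sub>k 1\<^sub>m (d ^ N)"] by simp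
next
  case (Suc p)
  then obtain N' where N': "N = Suc N'" "p \<le> N'" by (cases N) auto
  have "embed1 (replicate (Suc N) d) (Suc p) A = 1\<^sub>m d \<otimes>\<^sub>k embed1 (replicate (Suc N') d) p A"
    using embed1_Cons_Suc[of p "replicate (Suc N') d" d A] N' by simp
  also have "\<dots> = (1\<^sub>m d \<otimes>\<^sub>k 1\<^sub>m (d ^ p)) \<otimes>\<^sub>k (A \<otimes>\<^sub>k 1\<^sub>m (d ^ (N' - p)))"
    unfolding Suc.IH[OF N'(2)] by (simp add: kron_assoc)
  finally show ?case using N' by (simp add: kron_one)
qed

text \<open>W_0 of the sites 1, ..., n inside the full space. Site n + 1 has position N - n, because
  position 0 is the auxiliary space and the sites follow in descending order.\<close>

fun Wchain :: "complex \<Rightarrow> bparams \<Rightarrow> nat \<Rightarrow> nat \<Rightarrow> nat \<Rightarrow> complex mat" where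
  "Wchain r \<kappa> s N 0 = ep \<kappa> \<cdot>\<^sub>m 1\<^sub>m ((s + 1) ^ Suc N)"
| "Wchain r \<kappa> s N (Suc n) = embed1 (replicate (Suc N) (s + 1)) (N - n) (Am r s (kp \<kappa>) (km \<kappa>)) +
     embed1 (replicate (Suc N) (s + 1)) (N - n) (Dm r s) * Wchain r \<kappa> s N n"

text \<open>The dressed K-matrix built from the inside: site n + 1 adds one R-matrix on either
  side.\<close>

fun Kchain :: "nat \<Rightarrow> nat \<Rightarrow> complex mat \<Rightarrow> complex mat \<Rightarrow> nat \<Rightarrow> complex mat" where
  "Kchain s N R K 0 = embed1 (replicate (Suc N) (s + 1)) 0 K"
| "Kchain s N R K (Suc n) = embed2 (replicate (Suc N) (s + 1)) (N - n) 0 R * (Kchain s N R K n * embed2 (replicate (Suc N) (s + 1)) (N - n) 0 R)"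

lemma dim_embed_replicate [simp]:
  "dim_row (embed1 (replicate n d) x A) = d ^ n" "dim_col (embed1 (replicate n d) x A) = d ^ n"
  "dim_row (embed2 (replicate n d) x y A) = d ^ n" "dim_col (embed2 (replicate n d) x y A) = d ^ n"
  by (simp_all only: dim_embed prod_list_replicate)

lemma dim_Wchain: "dim_row (Wchain r \<kappa> s N n) = (s + 1) ^ Suc N" "dim_col (Wchain r \<kappa> s N n) = (s + 1) ^ Suc N"
  by (induction n) (simp_all del: power_Suc replicate_Suc)

lemma dim_Kchain: "dim_row (Kchain s N R K n) = (s + 1) ^ Suc N" "dim_col (Kchain s N R K n) = (s + 1) ^ Suc N"
  by (induction n) (simp_all del: power_Suc replicate_Suc)

lemma W0_Suc: "W0 r \<kappa> s (Suc n) = Am r s (kp \<kappa>) (km \<kappa>) \<otimes>\<^sub>k 1\<^sub>m ((s + 1) ^ n) + Dm r s \<otimes>\<^sub>k W0 r \<kappa> s n"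
  by (simp add: Am_eq qexp_half_S3)

lemma dim_W0: "dim_row (W0 r \<kappa> s n) = (s + 1) ^ n" "dim_col (W0 r \<kappa> s n) = (s + 1) ^ n"
  by (induction n) (simp_all add: W0_Suc del: W0.simps(2))

lemma Wchain_eq: "n \<le> N \<Longrightarrow> Wchain r \<kappa> s N n = 1\<^sub>m ((s + 1) ^ (Suc N - n)) \<otimes>\<^sub>k W0 r \<kappa> s n"
proof (induction n)
  case 0
  show ?case using kron_one[of "(s + 1) ^ Suc N" 1, where ?'a = complex] by (simp add: kron_smult_right del: power_Suc)
next
  case (Suc n)
  have n: "N - (N - n) = n" "N - n \<le> N" "Suc N - n = Suc (N - n)" "Suc N - Suc n = N - n" using Suc.prems by auto
  have c: "Am r s (kp \<kappa>) (km \<kappa>) \<in> carrier_mat (s + 1) (s + 1)" "Dm r s \<in> carrier_mat (s + 1) (s + 1)" by auto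
  have "1\<^sub>m ((s + 1) ^ Suc (N - n)) = (1\<^sub>m ((s + 1) ^ (N - n)) \<otimes>\<^sub>k 1\<^sub>m (s + 1) :: complex mat)" by (simp add: kron_one mult.commute)
  then have IH: "Wchain r \<kappa> s N n = 1\<^sub>m ((s + 1) ^ (N - n)) \<otimes>\<^sub>k (1\<^sub>m (s + 1) \<otimes>\<^sub>k W0 r \<kappa> s n)"
    using Suc n by (simp add: kron_assoc del: power_Suc)
  have "embed1 (replicate (Suc N) (s + 1)) (N - n) (Dm r s) * Wchain r \<kappa> s N n = 1\<^sub>m ((s + 1) ^ (N - n)) \<otimes>\<^sub>k (Dm r s \<otimes>\<^sub>k W0 r \<kappa> s n)"
    unfolding IH embed1_replicate[OF c(2) n(2)] n(1) by (simp add: kron_mult_kron dim_W0 one_mult_dim mult_one_dim)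
  then show ?case
    unfolding Wchain.simps embed1_replicate[OF c(1) n(2)] n W0_Suc by (simp add: kron_add_right dim_W0)
qed

lemma Wchain_commute:
  assumes X: "dim_row X = (s + 1) ^ Suc N" "dim_col X = (s + 1) ^ Suc N"
    and c: "\<And>q A. N - n < q \<Longrightarrow> q \<le> N \<Longrightarrow> A \<in> carrier_mat (s + 1) (s + 1) \<Longrightarrow> X * embed1 (replicate (Suc N) (s + 1)) q A = embed1 (replicate (Suc N) (s + 1)) q A * X"
  shows "n \<le> N \<Longrightarrow> X * Wchain r \<kappa> s N n = Wchain r \<kappa> s N n * X"
  using c
proof (induction n)
  case 0
  then show ?case using X by (simp add: mat_smult_mult_left_dim mat_smult_mult_right_dim one_mult_dim mult_one_dim del: power_Suc)
next
  case (Suc n)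
  have IH: "X * Wchain r \<kappa> s N n = Wchain r \<kappa> s N n * X"
    using Suc.prems by (intro Suc.IH) auto
  define A where "A = embed1 (replicate (Suc N) (s + 1)) (N - n) (Am r s (kp \<kappa>) (km \<kappa>))"
  define D where "D = embed1 (replicate (Suc N) (s + 1)) (N - n) (Dm r s)"
  have AD: "X * A = A * X" "X * D = D * X" unfolding A_def D_def by (rule Suc.prems(2); use Suc.prems(1) in auto)+
  have dd: "dim_row A = (s + 1) ^ Suc N" "dim_col A = (s + 1) ^ Suc N" "dim_row D = (s + 1) ^ Suc N" "dim_col D = (s + 1) ^ Suc N"
    by (simp_all add: A_def D_def del: power_Suc replicate_Suc)
  note dW = dim_Wchain[of r \<kappa> s N n]
  have "X * (D * Wchain r \<kappa> s N n) = (X * D) * Wchain r \<kappa> s N n" using X dd dW by (simp add: mat_assoc_dim del: power_Suc)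
  also have "\<dots> = D * (X * Wchain r \<kappa> s N n)" unfolding AD using X dd dW by (simp add: mat_assoc_dim del: power_Suc)
  also have "\<dots> = (D * Wchain r \<kappa> s N n) * X" unfolding IH using X dd dW by (simp add: mat_assoc_dim del: power_Suc)
  finally show ?case
    unfolding Wchain.simps A_def[symmetric] D_def[symmetric] using X dd dW AD by (simp add: mat_distrib_left_dim mat_distrib_right_dim del: power_Suc)
qed

lemma Kchain_commute:
  assumes "0 < q" "q \<le> N - n" "n \<le> N" "A \<in> carrier_mat (s + 1) (s + 1)" "K \<in> carrier_mat (s + 1) (s + 1)"
  shows "Kchain s N R K n * embed1 (replicate (Suc N) (s + 1)) q A = embed1 (replicate (Suc N) (s + 1)) q A * Kchain s N R K n"
  using assms(2,3)
proof (induction n)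
  case 0
  then show ?case using assms(1,4,5) embed1_commute[of q "replicate (Suc N) (s + 1)" 0 A K] by (simp add: nth_Cons' del: replicate_Suc)
next
  case (Suc n)
  define X where "X = embed2 (replicate (Suc N) (s + 1)) (N - n) 0 R"
  define E where "E = embed1 (replicate (Suc N) (s + 1)) q A"
  define Y where "Y = Kchain s N R K n"
  define M where "M = (s + 1) ^ Suc N"
  have dd: "dim_row X = M" "dim_col X = M" "dim_row E = M" "dim_col E = M" "dim_row Y = M" "dim_col Y = M"
    by (simp_all add: X_def E_def Y_def M_def dim_Kchain del: power_Suc replicate_Suc)
  have IH: "Y * E = E * Y" unfolding Y_def E_def using Suc by auto
  have XE: "X * E = E * X"
    unfolding X_def E_def using Suc.prems assms(1) by (intro embed1_commute_embed2[symmetric]) auto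
  have "X * (Y * X) * E = X * (Y * (X * E))" using dd by (simp add: mat_assoc_dim)
  also have "\<dots> = X * ((Y * E) * X)" unfolding XE using dd by (simp add: mat_assoc_dim)
  also have "\<dots> = (X * E) * (Y * X)" unfolding IH using dd by (simp add: mat_assoc_dim)
  also have "\<dots> = E * (X * (Y * X))" unfolding XE using dd by (simp add: mat_assoc_dim)
  finally show ?case unfolding Kchain.simps X_def Y_def E_def .
qed

text \<open>Sklyanin's dressing: conjugating a K-matrix by a site produces an operator obeying the
  same relation, with the generator of the site added to W.\<close>

lemma Kchain_intertwines:
  fixes N :: nat
  assumes g: "generic r" and s: "s \<ge> 1" and u: "u \<noteq> 0" and k: "km \<kappa> \<noteq> 0" "ep \<kappa> \<noteq> 0 \<or> em \<kappa> \<noteq> 0"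
    and R: "R = x \<cdot>\<^sub>m Rmat r s s u"
  defines "ds \<equiv> replicate (Suc N) (s + 1)"
  shows "n \<le> N \<Longrightarrow> Kchain s N R (Kmat r \<kappa> s u) n * (embed1 ds 0 (Am r s (kp \<kappa> * u) (km \<kappa> * inverse u)) + embed1 ds 0 (Dm r s) * Wchain r \<kappa> s N n) =
    (embed1 ds 0 (Am r s (kp \<kappa> * inverse u) (km \<kappa> * u)) + embed1 ds 0 (Dm r s) * Wchain r \<kappa> s N n) * Kchain s N R (Kmat r \<kappa> s u) n"
proof (induction n)
  case 0
  have c: "Kmat r \<kappa> s u \<in> carrier_mat (s + 1) (s + 1)" "Wm r s a b e \<in> carrier_mat (s + 1) (s + 1)" for a b e by auto
  have E: "embed1 ds 0 M = M \<otimes>\<^sub>k 1\<^sub>m ((s + 1) ^ N)" if "M \<in> carrier_mat (s + 1) (s + 1)" for M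
    unfolding ds_def using embed1_Cons_0[OF that, of "replicate N (s + 1)"] by (simp add: prod_list_replicate)
  have W: "embed1 ds 0 (Am r s a b) + embed1 ds 0 (Dm r s) * Wchain r \<kappa> s N 0 = embed1 ds 0 (Wm r s a b (ep \<kappa>))" for a b
    unfolding Wm_def Wchain.simps by (subst (1 2 3) E) (auto simp: kron_add_left kron_smult_left mat_smult_mult_right_dim mult_one_dim)
  show ?case
    unfolding W Kchain.simps ds_def[symmetric] E[OF c(1)] E[OF c(2)]
    using Kmat_intertwines[OF s g k u] by (simp add: kron_mult_kron)
next
  case (Suc n)
  define p where "p = N - n"
  have p: "0 < p" "p \<le> N" "p < length ds" "0 < length ds" using Suc.prems by (auto simp: p_def ds_def)
  have dsn: "ds ! q = s + 1" if "q \<le> N" for q using that by (simp add: ds_def del: replicate_Suc)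
  define X where "X = embed2 ds p 0 R"
  define M where "M = (s + 1) ^ Suc N"
  have dE: "dim_row (embed1 ds q B) = M" "dim_col (embed1 ds q B) = M" "dim_row X = M" "dim_col X = M" for q B
    by (simp_all add: M_def ds_def X_def del: power_Suc replicate_Suc)
  have RG: "R_intertwining r s s" using R_intertwining[OF g s s] .
  have Rd: "dim_row R = (s + 1) * (s + 1)" "dim_col R = (s + 1) * (s + 1)" using mholoD(1,2) RG unfolding R by (auto simp: R_intertwining_def)
  have em: "X * embed2 ds p 0 B = embed2 ds p 0 B' * X" if "R * B = B' * R" "dim_row B = (s + 1) * (s + 1)" "dim_col B = (s + 1) * (s + 1)"
      "dim_row B' = (s + 1) * (s + 1)" "dim_col B' = (s + 1) * (s + 1)" for B B'
  proof -
    have "X * embed2 ds p 0 B = embed2 ds p 0 (R * B)"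
      unfolding X_def using p that Rd by (intro embed2_mult[symmetric]) (auto simp: dsn)
    also have "\<dots> = embed2 ds p 0 B' * X"
      unfolding that(1) X_def using p that Rd by (intro embed2_mult) (auto simp: dsn)
    finally show ?thesis .
  qed
  have Rm: "R * B = B' * R" if "Rmat r s s u * B = B' * Rmat r s s u" "dim_row B = (s + 1) * (s + 1)" "dim_col B' = (s + 1) * (s + 1)" for B B'
    unfolding R using that mholoD(1,2) RG by (auto simp: R_intertwining_def mat_smult_mult_left_dim mat_smult_mult_right_dim)
  have px: "p \<noteq> 0" "ds ! p = s + 1" "ds ! 0 = s + 1" using p dsn by auto
  have h1: "X * (embed1 ds 0 (Am r s (kp \<kappa> * u) (km \<kappa> * inverse u)) + embed1 ds p (Am r s (kp \<kappa>) (km \<kappa>)) * embed1 ds 0 (Dm r s)) =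
     (embed1 ds p (Am r s (kp \<kappa>) (km \<kappa>)) + embed1 ds p (Dm r s) * embed1 ds 0 (Am r s (kp \<kappa> * u) (km \<kappa> * inverse u))) * X"
  proof -
    \<comment> \<open>The site is the first leg with coefficients k_+ and k_-. Relative to the
      auxiliary coefficients u k_+ and k_-/u these are the quotient by u and the product with u,
      which is the form of the second relation.\<close>
    have "Rmat r s s u * copop r s s (kp \<kappa>) (km \<kappa>) (kp \<kappa> * u) (km \<kappa> * inverse u) = cop r s s (kp \<kappa>) (km \<kappa>) (kp \<kappa> * u) (km \<kappa> * inverse u) * Rmat r s s u"
      using RG[unfolded R_intertwining_def, THEN conjunct2, THEN conjunct2, THEN conjunct2, rule_format, OF u, of "kp \<kappa>" "km \<kappa>", THEN conjunct2]
        RG[unfolded R_intertwining_def, THEN conjunct2, THEN conjunct2, THEN conjunct2, rule_format, OF u, of "kp \<kappa> * u" "km \<kappa> * inverse u", THEN conjunct2] u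
      by (simp add: mult.assoc)
    from em[OF Rm[OF this]] show ?thesis
      unfolding embed2_cop[OF p(3) p(4) px] by simp
  qed
  have h2: "X * (embed1 ds p (Am r s (kp \<kappa>) (km \<kappa>)) + embed1 ds p (Dm r s) * embed1 ds 0 (Am r s (kp \<kappa> * inverse u) (km \<kappa> * u))) =
     (embed1 ds 0 (Am r s (kp \<kappa> * inverse u) (km \<kappa> * u)) + embed1 ds p (Am r s (kp \<kappa>) (km \<kappa>)) * embed1 ds 0 (Dm r s)) * X"
  proof -
    have "Rmat r s s u * cop r s s (kp \<kappa>) (km \<kappa>) (kp \<kappa> * inverse u) (km \<kappa> * u) = copop r s s (kp \<kappa>) (km \<kappa>) (kp \<kappa> * inverse u) (km \<kappa> * u) * Rmat r s s u"
      using RG[unfolded R_intertwining_def, THEN conjunct2, THEN conjunct2, THEN conjunct2, rule_format, OF u, of "kp \<kappa> * inverse u" "km \<kappa> * u", THEN conjunct1] u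
      by (simp add: mult.assoc mult.left_commute[of u])
    from em[OF Rm[OF this]] show ?thesis
      unfolding embed2_cop[OF p(3) p(4) px] by simp
  qed
  have h3: "X * (embed1 ds p (Dm r s) * embed1 ds 0 (Dm r s)) = (embed1 ds p (Dm r s) * embed1 ds 0 (Dm r s)) * X"
  proof -
    have "Rmat r s s u * (Dm r s \<otimes>\<^sub>k Dm r s) = (Dm r s \<otimes>\<^sub>k Dm r s) * Rmat r s s u"
      using RG u by (auto simp: R_intertwining_def)
    from em[OF Rm[OF this]] show ?thesis
      using embed2_kron[OF p(3) p(4) px(1), of "Dm r s" "Dm r s"] px by (simp add: carrier_matI)
  qed
  have h4: "X * Wchain r \<kappa> s N n = Wchain r \<kappa> s N n * X"
  proof (rule Wchain_commute)
    fix q A assume "N - n < q" "q \<le> N"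
    then show "X * embed1 (replicate (Suc N) (s + 1)) q A = embed1 (replicate (Suc N) (s + 1)) q A * X"
      unfolding X_def ds_def p_def by (intro embed1_commute_embed2[symmetric]) auto
  qed (use dE M_def Suc.prems in auto)
  have h5: "Kchain s N R (Kmat r \<kappa> s u) n * embed1 ds p A = embed1 ds p A * Kchain s N R (Kmat r \<kappa> s u) n" if "A \<in> carrier_mat (s + 1) (s + 1)" for A
    unfolding ds_def using that p Suc.prems by (intro Kchain_commute) (auto simp: p_def)
  have c: "embed1 ds 0 A * embed1 ds p B = embed1 ds p B * embed1 ds 0 A"
    if "A \<in> carrier_mat (s + 1) (s + 1)" "B \<in> carrier_mat (s + 1) (s + 1)" for A B
    using p px that by (intro embed1_commute) auto
  show ?case
    unfolding Kchain.simps Wchain.simps unfolding ds_def[symmetric] p_def[symmetric] X_def[symmetric]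
    by (rule chain_step[where n = M, OF _ h1 h2 h3 h4 h5 h5 c c Suc.IH]) (use dE Suc.prems dim_Kchain dim_Wchain in \<open>auto simp: M_def simp del: power_Suc\<close>)
qed

definition dressed :: "nat \<Rightarrow> nat \<Rightarrow> complex mat \<Rightarrow> complex mat \<Rightarrow> complex mat" where
  "dressed s N R K = mat_prod_list ((s + 1) ^ (N + 1)) (map (\<lambda>n. embed2 (replicate (N + 1) (s + 1)) (N + 1 - n) 0 R) (rev [1..<N + 1]))
     * (K \<otimes>\<^sub>k 1\<^sub>m ((s + 1) ^ N)) * mat_prod_list ((s + 1) ^ (N + 1)) (map (\<lambda>n. embed2 (replicate (N + 1) (s + 1)) (N + 1 - n) 0 R) [1..<N + 1])"

lemma dim_mat_prod_list:
  assumes "\<And>A. A \<in> set As \<Longrightarrow> dim_row A = m \<and> dim_col A = m"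
  shows "dim_row (mat_prod_list m As) = m" "dim_col (mat_prod_list m As) = m"
  using assms by (induction As) (auto simp: mat_prod_list_def)

lemma mat_prod_list_snoc:
  assumes "\<And>A. A \<in> set As \<Longrightarrow> dim_row A = m \<and> dim_col A = m" "dim_row B = m" "dim_col B = m"
  shows "mat_prod_list m (As @ [B]) = mat_prod_list m As * B"
  using assms
proof (induction As)
  case Nil
  then show ?case by (simp add: mat_prod_list_def one_mult_dim mult_one_dim)
next
  case (Cons A As)
  then have "mat_prod_list m (As @ [B]) = mat_prod_list m As * B" by auto
  moreover have "mat_prod_list m (A # Bs) = A * mat_prod_list m Bs" for Bs by (simp add: mat_prod_list_def)
  ultimately show ?case using Cons.prems dim_mat_prod_list[of As m] by (simp add: mat_assoc_dim)
qed

text \<open>The two ordered products of the transfer matrix are nested around K, which gives the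
  recursion suited to induction on sites.\<close>

lemma dressed_eq_Kchain:
  assumes K: "K \<in> carrier_mat (s + 1) (s + 1)"
  shows "dressed s N R K = Kchain s N R K N"
proof -
  define f where "f n = embed2 (replicate (N + 1) (s + 1)) (N + 1 - n) 0 R" for n
  define M where "M = (s + 1) ^ (N + 1)"
  have df: "dim_row (f n) = M" "dim_col (f n) = M" for n by (simp_all add: f_def M_def del: power_Suc replicate_Suc)
  have dm: "dim_row (mat_prod_list M (map f xs)) = M" "dim_col (mat_prod_list M (map f xs)) = M" for xs
    using dim_mat_prod_list[of "map f xs" M] df by auto
  have K1: "K \<otimes>\<^sub>k 1\<^sub>m ((s + 1) ^ N) = embed1 (replicate (Suc N) (s + 1)) 0 K"
    using embed1_Cons_0[OF K, of "replicate N (s + 1)"] by (simp add: prod_list_replicate)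
  have "mat_prod_list M (map f (rev [1..<n + 1])) * embed1 (replicate (Suc N) (s + 1)) 0 K * mat_prod_list M (map f [1..<n + 1]) = Kchain s N R K n"
    if "n \<le> N" for n
    using that
  proof (induction n)
    case 0
    have "dim_row (embed1 (replicate (Suc N) (s + 1)) 0 K) = M" "dim_col (embed1 (replicate (Suc N) (s + 1)) 0 K) = M"
      by (simp_all add: M_def del: power_Suc replicate_Suc)
    then show ?case by (simp add: mat_prod_list_def one_mult_dim mult_one_dim del: replicate_Suc)
  next
    case (Suc n)
    define E where "E = embed1 (replicate (Suc N) (s + 1)) 0 K"
    have dE: "dim_row E = M" "dim_col E = M" by (simp_all add: E_def M_def del: power_Suc replicate_Suc)
    have 1: "mat_prod_list M (map f (rev [1..<Suc n + 1])) = f (Suc n) * mat_prod_list M (map f (rev [1..<n + 1]))"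
      by (simp add: mat_prod_list_def)
    have 2: "mat_prod_list M (map f [1..<Suc n + 1]) = mat_prod_list M (map f [1..<n + 1]) * f (Suc n)"
    proof -
      have e: "[1..<Suc n + 1] = [1..<n + 1] @ [Suc n]" by simp
      show ?thesis unfolding e map_append list.map by (rule mat_prod_list_snoc) (use df in auto)
    qed
    have f: "f (Suc n) = embed2 (replicate (Suc N) (s + 1)) (N - n) 0 R" by (simp add: f_def del: replicate_Suc)
    have "mat_prod_list M (map f (rev [1..<Suc n + 1])) * E * mat_prod_list M (map f [1..<Suc n + 1]) =
       f (Suc n) * ((mat_prod_list M (map f (rev [1..<n + 1])) * E * mat_prod_list M (map f [1..<n + 1])) * f (Suc n))"
      unfolding 1 2 using df dm dE by (simp only: mat_assoc_dim index_mult_mat(2,3))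
    also have "\<dots> = Kchain s N R K (Suc n)" using Suc unfolding E_def Kchain.simps f[symmetric] by simp
    finally show ?case unfolding E_def .
  qed
  from this[of N] show ?thesis unfolding dressed_def f_def M_def K1 by simp
qed

definition dressed_trace :: "nat \<Rightarrow> nat \<Rightarrow> complex mat \<Rightarrow> complex mat \<Rightarrow> complex mat \<Rightarrow> complex mat" where
  "dressed_trace s N R P K = partial_trace (s + 1) ((s + 1) ^ N) ((P \<otimes>\<^sub>k 1\<^sub>m ((s + 1) ^ N)) * dressed s N R K)"

lemma dressed_trace_exchange:
  assumes g: "generic r" and s: "s \<ge> 1" and u: "u \<noteq> 0" and k: "kp \<kappa> \<noteq> 0" "km \<kappa> \<noteq> 0" "ep \<kappa> \<noteq> 0 \<or> em \<kappa> \<noteq> 0"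
    and b: "em \<kappa>b = 0" "ep \<kappa>b \<noteq> 0" and h: "kp \<kappa> * km \<kappa>b = r ^ 4 * (km \<kappa> * kp \<kappa>b)"
    and R: "R = x \<cdot>\<^sub>m Rmat r s s u"
  shows "dressed_trace s N R (Kdual r (scale_params l (gauge_params r \<kappa>b)) s u) (Kmat r \<kappa> s u) * W0 r \<kappa> s N =
    l ^ s \<cdot>\<^sub>m (W0 r \<kappa> s N * dressed_trace s N R (Kdual r \<kappa>b s u) (Kmat r \<kappa> s u))"
proof -
  have r: "r \<noteq> 0" using generic_nonzero[OF g] .
  define ds where "ds = replicate (Suc N) (s + 1)"
  define m where "m = (s + 1) ^ N"
  have Kc: "Kmat r \<kappa> s u \<in> carrier_mat (s + 1) (s + 1)" by auto
  have X: "dressed s N R (Kmat r \<kappa> s u) \<in> carrier_mat ((s + 1) * m) ((s + 1) * m)"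
    unfolding dressed_eq_Kchain[OF Kc] m_def using dim_Kchain[of s N R "Kmat r \<kappa> s u" N] by (intro carrier_matI) auto
  have E: "embed1 ds 0 M = M \<otimes>\<^sub>k 1\<^sub>m m" if "M \<in> carrier_mat (s + 1) (s + 1)" for M
    unfolding ds_def m_def using embed1_Cons_0[OF that, of "replicate N (s + 1)"] by (simp add: prod_list_replicate)
  have W: "Wchain r \<kappa> s N N = 1\<^sub>m (s + 1) \<otimes>\<^sub>k W0 r \<kappa> s N" using Wchain_eq[of N N r \<kappa> s] by simp
  have DW: "embed1 ds 0 (Dm r s) * Wchain r \<kappa> s N N = Dm r s \<otimes>\<^sub>k W0 r \<kappa> s N"
  proof -
    have "Dm r s \<in> carrier_mat (s + 1) (s + 1)" by auto
    note 1 = E[OF this]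
    show ?thesis unfolding W 1 m_def using dim_W0[of r \<kappa> s N] by (subst kron_mult_kron) (simp_all add: one_mult_dim mult_one_dim)
  qed
  have c: "Am r s a b \<in> carrier_mat (s + 1) (s + 1)" for a b by auto
  have XW: "dressed s N R (Kmat r \<kappa> s u) * (Am r s (kp \<kappa> * u) (km \<kappa> * inverse u) \<otimes>\<^sub>k 1\<^sub>m m + Dm r s \<otimes>\<^sub>k W0 r \<kappa> s N) =
     (Am r s (kp \<kappa> * inverse u) (km \<kappa> * u) \<otimes>\<^sub>k 1\<^sub>m m + Dm r s \<otimes>\<^sub>k W0 r \<kappa> s N) * dressed s N R (Kmat r \<kappa> s u)"
    using Kchain_intertwines[OF g s u k(2,3) R, of N N, folded ds_def] unfolding DW E[OF c] dressed_eq_Kchain[OF Kc] by simp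
  show ?thesis
    unfolding dressed_trace_def m_def[symmetric]
    by (rule partial_trace_exchange[OF X _ _ _ _ _ _ _ XW Dm_inverse_mult[OF r, of s] Kdual_gauge[OF g s u] Kdual_intertwines[OF g s u k(1,2) b h]])
       (use dim_W0 in \<open>auto simp: m_def\<close>)
qed

subsection \<open>The transfer matrix and the Hamiltonian\<close>

lemma mat_inverse_invertible:
  fixes A :: "complex mat"
  assumes A: "A \<in> carrier_mat n n" and inv: "invertible_mat A"
  shows "A * the (mat_inverse A) = 1\<^sub>m n" "the (mat_inverse A) * A = 1\<^sub>m n" "the (mat_inverse A) \<in> carrier_mat n n"
proof -
  obtain B where B: "A * B = 1\<^sub>m n" "B * A = 1\<^sub>m (dim_row B)"
    using inv A unfolding invertible_mat_def inverts_mat_def by auto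
  have "dim_col (A * B) = n" "dim_col (B * A) = dim_row B" unfolding B by simp_all
  then have Bc: "B \<in> carrier_mat n n" using A by (intro carrier_matI) auto
  then have "A \<in> Units (ring_mat TYPE(complex) n ())"
    using A B by (auto simp: Units_def ring_mat_simps)
  with mat_inverse(1)[OF A, where b = "()"] obtain X where X: "mat_inverse A = Some X" by (cases "mat_inverse A") auto
  from mat_inverse(2)[OF A X] show "A * the (mat_inverse A) = 1\<^sub>m n" "the (mat_inverse A) * A = 1\<^sub>m n" "the (mat_inverse A) \<in> carrier_mat n n"
    unfolding X by simp_all
qed

lemma deriv_mat_exchange:
  assumes S: "open S" "z \<in> S" and t: "mholo S t m m" "mholo S t' m m" and W: "dim_row W = m" "dim_col W = m"
    and eq: "\<And>u. u \<in> S \<Longrightarrow> t' u * W = C \<cdot>\<^sub>m (W * t u)"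
  shows "deriv_mat t' z * W = C \<cdot>\<^sub>m (W * deriv_mat t z)"
proof (rule eq_matI)
  note d = mholoD(1,2)[OF t(1)] mholoD(1,2)[OF t(2)]
  fix i k assume "i < dim_row (C \<cdot>\<^sub>m (W * deriv_mat t z))" "k < dim_col (C \<cdot>\<^sub>m (W * deriv_mat t z))"
  then have ik: "i < m" "k < m" using W d by (auto simp: deriv_mat_def)
  have D: "((\<lambda>u. t u $$ (l, k)) has_field_derivative deriv (\<lambda>u. t u $$ (l, k)) z) (at z)"
    "((\<lambda>u. t' u $$ (i, l)) has_field_derivative deriv (\<lambda>u. t' u $$ (i, l)) z) (at z)" if "l < m" for l
    using mholoD(3)[OF t(1) that ik(2)] mholoD(3)[OF t(2) ik(1) that] S by (auto intro: holomorphic_derivI)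
  have "((\<lambda>u. \<Sum>l<m. t' u $$ (i, l) * W $$ (l, k)) has_field_derivative (\<Sum>l<m. deriv (\<lambda>u. t' u $$ (i, l)) z * W $$ (l, k))) (at z)"
    using D by (auto intro!: DERIV_sum DERIV_cmult_right)
  moreover have "((\<lambda>u. C * (\<Sum>l<m. W $$ (i, l) * t u $$ (l, k))) has_field_derivative C * (\<Sum>l<m. W $$ (i, l) * deriv (\<lambda>u. t u $$ (l, k)) z)) (at z)"
    using D by (auto intro!: DERIV_sum DERIV_cmult)
  moreover have "(\<Sum>l<m. t' u $$ (i, l) * W $$ (l, k)) = C * (\<Sum>l<m. W $$ (i, l) * t u $$ (l, k))" if "u \<in> S" for u
  proof -
    have "(t' u * W) $$ (i, k) = (C \<cdot>\<^sub>m (W * t u)) $$ (i, k)" unfolding eq[OF that] ..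
    then show ?thesis using ik d W by (simp add: mat_mult_index del: index_mult_mat(1))
  qed
  ultimately have "(\<Sum>l<m. deriv (\<lambda>u. t' u $$ (i, l)) z * W $$ (l, k)) = C * (\<Sum>l<m. W $$ (i, l) * deriv (\<lambda>u. t u $$ (l, k)) z)"
    using has_field_derivative_transform_within_open[OF _ S(1) S(2)] by (metis (no_types, lifting) DERIV_unique)
  then show "(deriv_mat t' z * W) $$ (i, k) = (C \<cdot>\<^sub>m (W * deriv_mat t z)) $$ (i, k)"
    using ik d W by (simp add: mat_mult_index deriv_mat_def del: index_mult_mat(1))
qed (use W mholoD(1,2)[OF t(1)] mholoD(1,2)[OF t(2)] in \<open>auto simp: deriv_mat_def\<close>)

text \<open>By continuity the relation also holds at z, and since C is constant it can be
  differentiated there. In the product of inverse and derivative C cancels.\<close>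

lemma log_derivative_exchange:
  assumes S: "open S" "z \<in> S" and t: "mholo S t m m" "mholo S t' m m" and W: "dim_row W = m" "dim_col W = m"
    and eq: "\<And>u. u \<in> S - {z} \<Longrightarrow> t' u * W = C \<cdot>\<^sub>m (W * t u)"
    and inv: "invertible_mat (t z)" "invertible_mat (t' z)"
  shows "the (mat_inverse (t' z)) * deriv_mat t' z * W = W * (the (mat_inverse (t z)) * deriv_mat t z)"
proof -
  note d = mholoD(1,2)[OF t(1)] mholoD(1,2)[OF t(2)]
  have eqS: "t' u * W = C \<cdot>\<^sub>m (W * t u)" if u: "u \<in> S" for u
  proof -
    have "t' u * W - C \<cdot>\<^sub>m (W * t u) = 0\<^sub>m m m"
    proof (rule mholo_finite_exception[of S "\<lambda>u. t' u * W - C \<cdot>\<^sub>m (W * t u)" _ _ _ "{z}"])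
      show "mholo S (\<lambda>u. t' u * W - C \<cdot>\<^sub>m (W * t u)) m m"
        by (intro mholo_minus mholo_mult[where m = m] mholo_smult mholo_const t holomorphic_intros) (use W in auto)
      show "t' u * W - C \<cdot>\<^sub>m (W * t u) = 0\<^sub>m m m" if "u \<in> S" "u \<notin> {z}" for u
        using eq[of u] that d W by (intro eq_matI) auto
    qed (use S u in auto)
    then have "(t' u * W - C \<cdot>\<^sub>m (W * t u)) $$ (i, k) = 0" if "i < m" "k < m" for i k using that by simp
    then show ?thesis using d W by (intro eq_matI) auto
  qed
  define B where "B = the (mat_inverse (t z))"
  define B' where "B' = the (mat_inverse (t' z))"
  have "t z \<in> carrier_mat m m" "t' z \<in> carrier_mat m m" using d by auto
  note i = mat_inverse_invertible[OF this(1) inv(1), folded B_def] mat_inverse_invertible[OF this(2) inv(2), folded B'_def]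
  have dd: "dim_row B = m" "dim_col B = m" "dim_row B' = m" "dim_col B' = m" using i by auto
  have dt: "dim_row (deriv_mat t z) = m" "dim_col (deriv_mat t z) = m" "dim_row (deriv_mat t' z) = m" "dim_col (deriv_mat t' z) = m"
    using d by (simp_all add: deriv_mat_def)
  have "W * B = B' * (t' z * W) * B" using i(4,5) dd d W by (simp add: mat_assoc_dim[symmetric] one_mult_dim)
  also have "\<dots> = C \<cdot>\<^sub>m (B' * W * (t z * B))" unfolding eqS[OF S(2)] using dd d W
    by (simp add: mat_smult_mult_left_dim mat_smult_mult_right_dim mat_assoc_dim)
  finally have WB: "W * B = C \<cdot>\<^sub>m (B' * W)" unfolding i(1) using dd W by (simp add: mult_one_dim)
  have "B' * deriv_mat t' z * W = C \<cdot>\<^sub>m (B' * W * deriv_mat t z)"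
    using deriv_mat_exchange[OF S t W eqS] dd dt W by (simp add: mat_assoc_dim mat_smult_mult_right_dim)
  also have "\<dots> = W * B * deriv_mat t z" unfolding WB using dd dt W by (simp add: mat_smult_mult_left_dim)
  finally show ?thesis using dd dt W unfolding B_def B'_def by (simp add: mat_assoc_dim)
qed

lemma mholo_mat_prod_list:
  assumes "\<And>n. n \<in> set xs \<Longrightarrow> mholo S (f n) m m"
  shows "mholo S (\<lambda>u. mat_prod_list m (map (\<lambda>n. f n u) xs)) m m"
  using assms
proof (induction xs)
  case Nil
  then show ?case by (simp add: mat_prod_list_def mholo_const)
next
  case (Cons n xs)
  have "mat_prod_list m (map (\<lambda>n. f n u) (n # xs)) = f n u * mat_prod_list m (map (\<lambda>n. f n u) xs)" for u
    by (simp add: mat_prod_list_def)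
  then show ?case using mholo_mult[of S "f n" m m] Cons by simp
qed

lemma mholo_dressed:
  assumes R: "mholo S R ((s + 1) * (s + 1)) ((s + 1) * (s + 1))" and K: "mholo S K (s + 1) (s + 1)"
  shows "mholo S (\<lambda>u. dressed s N (R u) (K u)) ((s + 1) ^ (N + 1)) ((s + 1) ^ (N + 1))"
proof -
  have r: "mholo S (\<lambda>u. embed2 (replicate (N + 1) (s + 1)) (N + 1 - n) 0 (R u)) ((s + 1) ^ (N + 1)) ((s + 1) ^ (N + 1))" if "1 \<le> n" for n
  proof -
    have "mholo S (\<lambda>u. embed2 (replicate (N + 1) (s + 1)) (N + 1 - n) 0 (R u)) (prod_list (replicate (N + 1) (s + 1))) (prod_list (replicate (N + 1) (s + 1)))"
      by (rule mholo_embed2) (use R that in \<open>auto simp del: replicate_Suc\<close>)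
    then show ?thesis unfolding prod_list_replicate .
  qed
  have k: "mholo S (\<lambda>u. K u \<otimes>\<^sub>k 1\<^sub>m ((s + 1) ^ N)) ((s + 1) ^ (N + 1)) ((s + 1) ^ (N + 1))"
    using mholo_kron[OF K mholo_const[of "1\<^sub>m ((s + 1) ^ N)"]] by (simp add: carrier_matI)
  show ?thesis
    unfolding dressed_def by (intro mholo_mult[OF mholo_mult[OF mholo_mat_prod_list k] mholo_mat_prod_list] r) auto
qed

lemma mholo_dressed_trace:
  assumes R: "mholo S R ((s + 1) * (s + 1)) ((s + 1) * (s + 1))" and K: "mholo S K (s + 1) (s + 1)" and P: "mholo S P (s + 1) (s + 1)"
  shows "mholo S (\<lambda>u. dressed_trace s N (R u) (P u) (K u)) ((s + 1) ^ N) ((s + 1) ^ N)"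
proof -
  have p: "mholo S (\<lambda>u. P u \<otimes>\<^sub>k 1\<^sub>m ((s + 1) ^ N)) ((s + 1) ^ (N + 1)) ((s + 1) ^ (N + 1))"
    using mholo_kron[OF P mholo_const[of "1\<^sub>m ((s + 1) ^ N)"]] by (simp add: carrier_matI)
  note M = mholo_mult[OF p mholo_dressed[OF R K]]
  show ?thesis
  proof (rule mholoI)
    fix i k assume ik: "i < (s + 1) ^ N" "k < (s + 1) ^ N"
    have "(\<lambda>u. ((P u \<otimes>\<^sub>k 1\<^sub>m ((s + 1) ^ N)) * dressed s N (R u) (K u)) $$ (a * (s + 1) ^ N + i, a * (s + 1) ^ N + k)) holomorphic_on S" if "a < s + 1" for a
      using pair_index_less[OF that ik(1)] pair_index_less[OF that ik(2)] by (intro mholoD(3)[OF M]) auto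
    then have "(\<lambda>u. \<Sum>a<s + 1. ((P u \<otimes>\<^sub>k 1\<^sub>m ((s + 1) ^ N)) * dressed s N (R u) (K u)) $$ (a * (s + 1) ^ N + i, a * (s + 1) ^ N + k)) holomorphic_on S"
      by (intro holomorphic_on_sum) auto
    then show "(\<lambda>u. dressed_trace s N (R u) (P u) (K u) $$ (i, k)) holomorphic_on S"
      using ik by (simp add: dressed_trace_def partial_trace_def)
  qed (simp_all add: dressed_trace_def)
qed

lemma dim_dressed_trace: "dim_row (dressed_trace s N R P K) = (s + 1) ^ N" "dim_col (dressed_trace s N R P K) = (s + 1) ^ N"
  by (simp_all add: dressed_trace_def)

lemma dim_prod_embed2:
  "dim_row (mat_prod_list ((s + 1) ^ (N + 1)) (map (\<lambda>n. embed2 (replicate (N + 1) (s + 1)) (g n) 0 R) xs)) = (s + 1) ^ (N + 1)"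
  "dim_col (mat_prod_list ((s + 1) ^ (N + 1)) (map (\<lambda>n. embed2 (replicate (N + 1) (s + 1)) (g n) 0 R) xs)) = (s + 1) ^ (N + 1)"
proof -
  have d: "dim_row A = (s + 1) ^ (N + 1) \<and> dim_col A = (s + 1) ^ (N + 1)"
    if A: "A \<in> set (map (\<lambda>n. embed2 (replicate (N + 1) (s + 1)) (g n) 0 R) xs)" for A
  proof -
    obtain n where "A = embed2 (replicate (N + 1) (s + 1)) (g n) 0 R" using A unfolding set_map by (elim imageE)
    then show ?thesis by (simp only: dim_embed_replicate)
  qed
  show "dim_row (mat_prod_list ((s + 1) ^ (N + 1)) (map (\<lambda>n. embed2 (replicate (N + 1) (s + 1)) (g n) 0 R) xs)) = (s + 1) ^ (N + 1)"
    "dim_col (mat_prod_list ((s + 1) ^ (N + 1)) (map (\<lambda>n. embed2 (replicate (N + 1) (s + 1)) (g n) 0 R) xs)) = (s + 1) ^ (N + 1)"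
    by (rule dim_mat_prod_list, erule d)+
qed

lemma dressed_smult: "K \<in> carrier_mat (s + 1) (s + 1) \<Longrightarrow> dressed s N R (b \<cdot>\<^sub>m K) = b \<cdot>\<^sub>m dressed s N R K"
  unfolding dressed_def using dim_prod_embed2[of s N "\<lambda>n. N + 1 - n" R]
  by (simp add: kron_smult_left mat_smult_mult_left_dim mat_smult_mult_right_dim)

lemma dressed_trace_smult:
  assumes P: "P \<in> carrier_mat (s + 1) (s + 1)" and K: "K \<in> carrier_mat (s + 1) (s + 1)"
  shows "dressed_trace s N R (a \<cdot>\<^sub>m P) (b \<cdot>\<^sub>m K) = (a * b) \<cdot>\<^sub>m dressed_trace s N R P K"
proof -
  have d: "dim_row (dressed s N R K) = (s + 1) * (s + 1) ^ N" "dim_col (dressed s N R K) = (s + 1) * (s + 1) ^ N"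
    using dim_Kchain[of s N R K N] by (simp_all add: dressed_eq_Kchain[OF K])
  have "((a \<cdot>\<^sub>m P) \<otimes>\<^sub>k 1\<^sub>m ((s + 1) ^ N)) * dressed s N R (b \<cdot>\<^sub>m K) = (a * b) \<cdot>\<^sub>m ((P \<otimes>\<^sub>k 1\<^sub>m ((s + 1) ^ N)) * dressed s N R K)"
    unfolding dressed_smult[OF K] using d P by (simp add: kron_smult_left mat_smult_mult_left_dim mat_smult_mult_right_dim mat_smult_smult mult.commute)
  moreover have "(P \<otimes>\<^sub>k 1\<^sub>m ((s + 1) ^ N)) * dressed s N R K \<in> carrier_mat ((s + 1) * (s + 1) ^ N) ((s + 1) * (s + 1) ^ N)"
    using d P by (intro carrier_matI) auto
  ultimately show ?thesis unfolding dressed_trace_def by (simp only: partial_trace_smult)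
qed

lemma transfer_eq_dressed_trace: "transfer r d s N \<kappa> \<kappa>b u = dressed_trace s N (Rtilde r s s u) (Kplus_tilde r d \<kappa>b s u) (Ktilde r d \<kappa> s u)"
proof -
  have d: "dim_row (Kplus_tilde r d \<kappa>b s u) = s + 1" "dim_col (Kplus_tilde r d \<kappa>b s u) = s + 1" "dim_row (Ktilde r d \<kappa> s u) = s + 1" "dim_col (Ktilde r d \<kappa> s u) = s + 1"
    by (simp_all add: Kplus_tilde_def Ktilde_def remove_sings_mat_def)
  show ?thesis
    unfolding transfer_def dressed_trace_def dressed_def Rsite_def
    using dim_prod_embed2[of s N "\<lambda>n. N + 1 - n" "Rtilde r s s u"] d by (simp add: mat_assoc_dim)
qed

text \<open>The normalizing scalars depend on q, the spin, d and u but not on the boundary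
  parameters, so they are the same on both sides of the exchange relation.\<close>

lemma ham_intertwines:
  assumes g: "generic r" and s: "s \<ge> 1" and W: "dim_row W = (s + 1) ^ N" "dim_col W = (s + 1) ^ N"
    and e: "ep \<kappa>b \<noteq> 0 \<and> em \<kappa>b = 0 \<or> ep \<kappa>b = 0 \<and> em \<kappa>b \<noteq> 0" "ep \<kappa>b' \<noteq> 0 \<and> em \<kappa>b' = 0 \<or> ep \<kappa>b' = 0 \<and> em \<kappa>b' \<noteq> 0"
    and E: "\<And>u R x. u \<noteq> 0 \<Longrightarrow> R = x \<cdot>\<^sub>m Rmat r s s u \<Longrightarrow>
      dressed_trace s N R (Kdual r \<kappa>b' s u) (Kmat r \<kappa>' s u) * W = C \<cdot>\<^sub>m (W * dressed_trace s N R (Kdual r \<kappa>b s u) (Kmat r \<kappa> s u))"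
    and inv: "invertible_mat (transfer r d s N \<kappa> \<kappa>b 1)" "invertible_mat (transfer r d s N \<kappa>' \<kappa>b' 1)"
  shows "ham r d s N \<kappa>' \<kappa>b' * W = W * ham r d s N \<kappa> \<kappa>b"
proof -
  define n where "n = s + 1"
  define cR where "cR u = inverse (\<Prod>k<s. \<Prod>l<s. cfun (u * r powi (int s + int s - 2 * int k - 2 * int l)))" for u
  have "\<exists>S. open S \<and> 1 \<in> S \<and> mholo S (Rtilde r s s) (n * n) (n * n) \<and> (\<forall>u\<in>S - {1}. Rtilde r s s u = cR u \<cdot>\<^sub>m Rmat r s s u)"
    using Rtilde_regular[OF g s] unfolding regular_multiple_def n_def cR_def .
  then obtain S1 where R: "open S1" "1 \<in> S1" "mholo S1 (Rtilde r s s) (n * n) (n * n)" "\<And>u. u \<in> S1 - {1} \<Longrightarrow> Rtilde r s s u = cR u \<cdot>\<^sub>m Rmat r s s u"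
    by metis
  define cK where "cK u = inverse (\<Prod>k<d. \<Prod>l<s - 1 - k. cfun (u\<^sup>2 * r powi (2 * (1 + int k - int l))))" for u
  define cP where "cP u = inverse (\<Prod>k<d. \<Prod>l<s - 1 - k. cfun ((inverse u * inverse (r\<^sup>2))\<^sup>2 * r powi (2 * (1 + int k - int l))))" for u
  have K: "\<exists>S. open S \<and> 1 \<in> S \<and> mholo S (Ktilde r d \<kappa> s) n n \<and> (\<forall>u\<in>S - {1}. Ktilde r d \<kappa> s u = cK u \<cdot>\<^sub>m Kmat r \<kappa> s u)" for \<kappa>
    using Ktilde_regular_1[OF g, of s d \<kappa>] unfolding regular_multiple_def n_def cK_def .
  have P: "\<exists>S. open S \<and> 1 \<in> S \<and> mholo S (Kplus_tilde r d \<kappa> s) n n \<and> (\<forall>u\<in>S - {1}. Kplus_tilde r d \<kappa> s u = cP u \<cdot>\<^sub>m Kdual r \<kappa> s u)"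
    if "ep \<kappa> \<noteq> 0 \<and> em \<kappa> = 0 \<or> ep \<kappa> = 0 \<and> em \<kappa> \<noteq> 0" for \<kappa>
    using Kplus_tilde_regular[OF g s that, of d] unfolding regular_multiple_def n_def cP_def .
  obtain S2 where S2: "open S2" "1 \<in> S2" "mholo S2 (Ktilde r d \<kappa> s) n n" "\<And>u. u \<in> S2 - {1} \<Longrightarrow> Ktilde r d \<kappa> s u = cK u \<cdot>\<^sub>m Kmat r \<kappa> s u" using K by metis
  obtain S3 where S3: "open S3" "1 \<in> S3" "mholo S3 (Ktilde r d \<kappa>' s) n n" "\<And>u. u \<in> S3 - {1} \<Longrightarrow> Ktilde r d \<kappa>' s u = cK u \<cdot>\<^sub>m Kmat r \<kappa>' s u" using K by metis
  obtain S4 where S4: "open S4" "1 \<in> S4" "mholo S4 (Kplus_tilde r d \<kappa>b s) n n" "\<And>u. u \<in> S4 - {1} \<Longrightarrow> Kplus_tilde r d \<kappa>b s u = cP u \<cdot>\<^sub>m Kdual r \<kappa>b s u"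
    using P[OF e(1)] by metis
  obtain S5 where S5: "open S5" "1 \<in> S5" "mholo S5 (Kplus_tilde r d \<kappa>b' s) n n" "\<And>u. u \<in> S5 - {1} \<Longrightarrow> Kplus_tilde r d \<kappa>b' s u = cP u \<cdot>\<^sub>m Kdual r \<kappa>b' s u"
    using P[OF e(2)] by metis
  define S where "S = S1 \<inter> S2 \<inter> S3 \<inter> S4 \<inter> S5 - {0}"
  have S: "open S" "1 \<in> S" unfolding S_def using R S2 S3 S4 S5 by (auto intro!: open_Int open_Diff)
  have sub: "S \<subseteq> S1" "S \<subseteq> S2" "S \<subseteq> S3" "S \<subseteq> S4" "S \<subseteq> S5" by (auto simp: S_def)
  have t: "mholo S (transfer r d s N \<kappa> \<kappa>b) ((s + 1) ^ N) ((s + 1) ^ N)" "mholo S (transfer r d s N \<kappa>' \<kappa>b') ((s + 1) ^ N) ((s + 1) ^ N)"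
    unfolding transfer_eq_dressed_trace[abs_def]
    using mholo_dressed_trace[OF mholo_subset[OF R(3) sub(1), unfolded n_def] mholo_subset[OF S2(3) sub(2), unfolded n_def] mholo_subset[OF S4(3) sub(4), unfolded n_def]]
      mholo_dressed_trace[OF mholo_subset[OF R(3) sub(1), unfolded n_def] mholo_subset[OF S3(3) sub(3), unfolded n_def] mholo_subset[OF S5(3) sub(5), unfolded n_def]]
    by simp_all
  have ex: "transfer r d s N \<kappa>' \<kappa>b' u * W = C \<cdot>\<^sub>m (W * transfer r d s N \<kappa> \<kappa>b u)" if u: "u \<in> S - {1}" for u
  proof -
    have u0: "u \<noteq> 0" using u by (auto simp: S_def)
    have Ru: "Rtilde r s s u = cR u \<cdot>\<^sub>m Rmat r s s u" using R(4) u sub by auto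
    \<comment> \<open>R occurs 2N times. Its scalar stays inside \<open>R1\<close>, as E admits
      arbitrary multiples of the R-matrix, so no power of it has to be extracted.\<close>
    define R1 where "R1 = cR u \<cdot>\<^sub>m Rmat r s s u"
    have K1: "Ktilde r d \<kappa> s u = cK u \<cdot>\<^sub>m Kmat r \<kappa> s u" "Ktilde r d \<kappa>' s u = cK u \<cdot>\<^sub>m Kmat r \<kappa>' s u"
      using S2(4) S3(4) u sub by auto
    have P1: "Kplus_tilde r d \<kappa>b s u = cP u \<cdot>\<^sub>m Kdual r \<kappa>b s u" "Kplus_tilde r d \<kappa>b' s u = cP u \<cdot>\<^sub>m Kdual r \<kappa>b' s u"
      using S4(4) S5(4) u sub by auto
    have c: "Kmat r k s u \<in> carrier_mat (s + 1) (s + 1)" "Kdual r k s u \<in> carrier_mat (s + 1) (s + 1)" for k by auto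
    have T: "transfer r d s N \<kappa> \<kappa>b u = (cP u * cK u) \<cdot>\<^sub>m dressed_trace s N R1 (Kdual r \<kappa>b s u) (Kmat r \<kappa> s u)"
      "transfer r d s N \<kappa>' \<kappa>b' u = (cP u * cK u) \<cdot>\<^sub>m dressed_trace s N R1 (Kdual r \<kappa>b' s u) (Kmat r \<kappa>' s u)"
      unfolding transfer_eq_dressed_trace Ru R1_def[symmetric] K1 P1 by (rule dressed_trace_smult[OF c(2) c(1)])+
    show ?thesis
      unfolding T using E[OF u0 R1_def] W dim_dressed_trace by (simp add: mat_smult_mult_left_dim mat_smult_mult_right_dim mat_smult_smult mult.commute)
  qed
  show ?thesis unfolding ham_def using log_derivative_exchange[OF S t W ex inv] .
qed

lemma Kdual_inverse:
  assumes r: "r \<noteq> 0"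
  shows "\<exists>c. c \<noteq> 0 \<and> (\<forall>u. Kdual (inverse r) (swap_eps \<kappa>) s (inverse u) = c \<cdot>\<^sub>m Kdual r \<kappa> s u)"
proof -
  obtain c where c: "c \<noteq> 0" "\<And>u. Kmat (inverse r) (swap_eps (dual_params \<kappa>)) s (inverse u) = c \<cdot>\<^sub>m Kmat r (dual_params \<kappa>) s u"
    using Kmat_inverse[OF r] by blast
  have "Kdual (inverse r) (swap_eps \<kappa>) s (inverse u) = c \<cdot>\<^sub>m Kdual r \<kappa> s u" for u
  proof -
    have 1: "dual_params (swap_eps \<kappa>) = swap_eps (dual_params \<kappa>)" by (simp add: dual_params_def swap_eps_def)
    have 2: "inverse (inverse u) * inverse ((inverse r)\<^sup>2) = inverse (inverse u * inverse (r\<^sup>2))" by (simp add: power_inverse)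
    show ?thesis unfolding Kdual_def 1 2 c(2) by (intro eq_matI) auto
  qed
  with c(1) show ?thesis by blast
qed

lemma W1_eq_W0: "r \<noteq> 0 \<Longrightarrow> W1 r \<kappa> s N = W0 (inverse r) (swap_eps \<kappa>) s N"
proof (induction N)
  case 0
  then show ?case by (simp add: swap_eps_def)
next
  case (Suc N)
  have "Splus (inverse r) s = Splus r s" "Sminus (inverse r) s = Sminus r s" unfolding Splus_def Sminus_def Bcoef_inverse by simp_all
  moreover have S3_carrier: "S3 s \<in> carrier_mat (s + 1) (s + 1)" "2 \<cdot>\<^sub>m S3 s \<in> carrier_mat (s + 1) (s + 1)" by (auto simp: S3_def mat1_def)
  moreover have "qexp_half (inverse r) D = qexp_half r (- D)" if "D \<in> carrier_mat n n" for D n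
    using that by (intro eq_matI) (auto simp: qexp_half_def power_int_minus power_int_inverse)
  then have "qexp_half (inverse r) (S3 s) = qexp_half r (- S3 s)" "qexp_half (inverse r) (2 \<cdot>\<^sub>m S3 s) = qexp_half r (- (2 \<cdot>\<^sub>m S3 s))"
    using S3_carrier by blast+
  ultimately show ?case using Suc by (simp add: swap_eps_def)
qed

lemma dressed_trace_exchange_W0:
  assumes g: "generic r" and s: "s \<ge> 1" and k: "kp \<kappa> \<noteq> 0" "km \<kappa> \<noteq> 0" "ep \<kappa> \<noteq> 0 \<or> em \<kappa> \<noteq> 0"
    and b: "em \<kappa>b = 0" "ep \<kappa>b \<noteq> 0" and h: "kp \<kappa> * km \<kappa>b = r ^ 4 * (km \<kappa> * kp \<kappa>b)"
    and u: "u \<noteq> 0" and R: "R = x \<cdot>\<^sub>m Rmat r s s u"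
  shows "dressed_trace s N R (Kdual r (scale_params l2 (gauge_params r \<kappa>b)) s u) (Kmat r (scale_params l1 \<kappa>) s u) * W0 r \<kappa> s N =
    (l1 ^ s * l2 ^ s) \<cdot>\<^sub>m (W0 r \<kappa> s N * dressed_trace s N R (Kdual r \<kappa>b s u) (Kmat r \<kappa> s u))"
proof -
  have c: "Kmat r \<kappa> s u \<in> carrier_mat (s + 1) (s + 1)" "Kdual r (scale_params l2 (gauge_params r \<kappa>b)) s u \<in> carrier_mat (s + 1) (s + 1)" by auto
  have "dressed_trace s N R (Kdual r (scale_params l2 (gauge_params r \<kappa>b)) s u) (Kmat r (scale_params l1 \<kappa>) s u) =
     l1 ^ s \<cdot>\<^sub>m dressed_trace s N R (Kdual r (scale_params l2 (gauge_params r \<kappa>b)) s u) (Kmat r \<kappa> s u)"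
    using dressed_trace_smult[OF c(2) c(1), of N R 1 "l1 ^ s"] by (simp add: Kmat_scale[OF generic_nonzero[OF g]] one_smult_mat)
  then show ?thesis
    using dressed_trace_exchange[OF g s u k b h R, of N l2] dim_dressed_trace dim_W0 by (simp add: mat_smult_mult_left_dim mat_smult_smult)
qed

text \<open>The existential quantifier over C stands outside that over u: the constants from the
  symmetry under q to 1/q do not depend on u, as differentiation requires.\<close>

lemma dressed_trace_exchange_W1:
  assumes g: "generic r" and s: "s \<ge> 1" and k: "kp \<kappa> \<noteq> 0" "km \<kappa> \<noteq> 0" "ep \<kappa> \<noteq> 0 \<or> em \<kappa> \<noteq> 0"
    and b: "ep \<kappa>b = 0" "em \<kappa>b \<noteq> 0" and h: "kp \<kappa> * km \<kappa>b = inverse (r ^ 4) * (km \<kappa> * kp \<kappa>b)"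
  shows "\<exists>C. \<forall>u R x. u \<noteq> 0 \<longrightarrow> R = x \<cdot>\<^sub>m Rmat r s s u \<longrightarrow>
    dressed_trace s N R (Kdual r (scale_params l2 (gauge_params (inverse r) \<kappa>b)) s u) (Kmat r (scale_params l1 \<kappa>) s u) * W1 r \<kappa> s N =
    C \<cdot>\<^sub>m (W1 r \<kappa> s N * dressed_trace s N R (Kdual r \<kappa>b s u) (Kmat r \<kappa> s u))"
proof -
  have r: "r \<noteq> 0" using generic_nonzero[OF g] .
  define \<kappa>' where "\<kappa>' = scale_params l1 \<kappa>"
  define \<kappa>b' where "\<kappa>b' = scale_params l2 (gauge_params (inverse r) \<kappa>b)"
  obtain a where a: "a \<noteq> 0" "\<And>u. Kdual (inverse r) (swap_eps \<kappa>b) s (inverse u) = a \<cdot>\<^sub>m Kdual r \<kappa>b s u" using Kdual_inverse[OF r] by blast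
  obtain a' where a': "a' \<noteq> 0" "\<And>u. Kdual (inverse r) (swap_eps \<kappa>b') s (inverse u) = a' \<cdot>\<^sub>m Kdual r \<kappa>b' s u" using Kdual_inverse[OF r] by blast
  obtain f where f: "f \<noteq> 0" "\<And>u. Kmat (inverse r) (swap_eps \<kappa>) s (inverse u) = f \<cdot>\<^sub>m Kmat r \<kappa> s u" using Kmat_inverse[OF r] by blast
  obtain f' where f': "f' \<noteq> 0" "\<And>u. Kmat (inverse r) (swap_eps \<kappa>') s (inverse u) = f' \<cdot>\<^sub>m Kmat r \<kappa>' s u" using Kmat_inverse[OF r] by blast
  obtain y where y: "y \<noteq> 0" "\<And>u. Rmat (inverse r) s s (inverse u) = y \<cdot>\<^sub>m Rmat r s s u" using Rmat_inverse[OF g s s] by blast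
  have sw: "swap_eps \<kappa>' = scale_params l1 (swap_eps \<kappa>)" "swap_eps \<kappa>b' = scale_params l2 (gauge_params (inverse r) (swap_eps \<kappa>b))"
    by (simp_all add: \<kappa>'_def \<kappa>b'_def swap_eps_def scale_params_def gauge_params_def)
  have "dressed_trace s N R (Kdual r \<kappa>b' s u) (Kmat r \<kappa>' s u) * W1 r \<kappa> s N =
    (inverse (a' * f') * (l1 ^ s * l2 ^ s * (a * f))) \<cdot>\<^sub>m (W1 r \<kappa> s N * dressed_trace s N R (Kdual r \<kappa>b s u) (Kmat r \<kappa> s u))"
    if u: "u \<noteq> 0" and R: "R = x \<cdot>\<^sub>m Rmat r s s u" for u R x
  proof -
    define W where "W = W1 r \<kappa> s N"
    define t where "t = dressed_trace s N R (Kdual r \<kappa>b s u) (Kmat r \<kappa> s u)"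
    define t' where "t' = dressed_trace s N R (Kdual r \<kappa>b' s u) (Kmat r \<kappa>' s u)"
    have W: "W = W0 (inverse r) (swap_eps \<kappa>) s N" unfolding W_def by (rule W1_eq_W0[OF r])
    \<comment> \<open>The constant of the R-matrix is absorbed into the free multiple x.\<close>
    have R': "R = (x * inverse y) \<cdot>\<^sub>m Rmat (inverse r) s s (inverse u)" using y(1) by (simp add: R y(2) mat_smult_smult mult.assoc)
    have c: "Kmat r k s u \<in> carrier_mat (s + 1) (s + 1)" "Kdual r k s u \<in> carrier_mat (s + 1) (s + 1)" for k by auto
    have ex: "dressed_trace s N R (Kdual (inverse r) (swap_eps \<kappa>b') s (inverse u)) (Kmat (inverse r) (swap_eps \<kappa>') s (inverse u)) * W =
      (l1 ^ s * l2 ^ s) \<cdot>\<^sub>m (W * dressed_trace s N R (Kdual (inverse r) (swap_eps \<kappa>b) s (inverse u)) (Kmat (inverse r) (swap_eps \<kappa>) s (inverse u)))"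
      unfolding sw W
      by (rule dressed_trace_exchange_W0[OF generic_inverse[OF g] s _ _ _ _ _ _ _ R'])
        (use k b h u in \<open>auto simp: swap_eps_def power_inverse\<close>)
    have "(a' * f') \<cdot>\<^sub>m t' * W = (l1 ^ s * l2 ^ s) \<cdot>\<^sub>m (W * ((a * f) \<cdot>\<^sub>m t))"
      using ex unfolding a(2) a'(2) f(2) f'(2) dressed_trace_smult[OF c(2) c(1)] t_def t'_def .
    then have "(a' * f') \<cdot>\<^sub>m (t' * W) = (l1 ^ s * l2 ^ s * (a * f)) \<cdot>\<^sub>m (W * t)"
      using dim_dressed_trace dim_W0[of "inverse r" "swap_eps \<kappa>" s N] unfolding W t_def t'_def
      by (simp add: mat_smult_mult_left_dim mat_smult_mult_right_dim mat_smult_smult)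
    from arg_cong[OF this, of "(\<cdot>\<^sub>m) (inverse (a' * f'))"]
    moreover have "inverse (a' * f') * (a' * f') = 1" using a'(1) f'(1) by (intro left_inverse) simp
    ultimately show ?thesis unfolding W_def t_def t'_def mat_smult_smult by (simp only: one_smult_mat)
  qed
  then show ?thesis unfolding \<kappa>'_def \<kappa>b'_def by blast
qed

text \<open>The fields determine the boundary parameters up to a common factor; S is half the sum of
  the two \<epsilon>.\<close>

lemma has_fieldsE:
  assumes "has_fields \<kappa> hp hm hz"
  obtains S where "S \<noteq> 0" "\<kappa> = BParams (S * hp) (S * hm) (S * (1 + hz)) (S * (1 - hz))"
proof -
  define S where "S = (ep \<kappa> + em \<kappa>) / 2"
  have S: "S \<noteq> 0" "ep \<kappa> + em \<kappa> = 2 * S" using assms by (simp_all add: has_fields_def S_def)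
  then have h: "hp = kp \<kappa> / S" "hm = km \<kappa> / S" "hz = (ep \<kappa> - em \<kappa>) / (2 * S)" using assms by (simp_all add: has_fields_def)
  have "S * (1 + hz) = ep \<kappa>" "S * (1 - hz) = em \<kappa>"
  proof -
    have y: "S * hz = (ep \<kappa> - em \<kappa>) / 2" unfolding h(3) using S(1) by simp
    have "S * (1 + hz) = S + (ep \<kappa> - em \<kappa>) / 2" "S * (1 - hz) = S - (ep \<kappa> - em \<kappa>) / 2"
      unfolding y[symmetric] by (simp_all add: algebra_simps)
    then show "S * (1 + hz) = ep \<kappa>" "S * (1 - hz) = em \<kappa>" unfolding S_def by (simp_all add: field_simps)
  qed
  then show ?thesis using S(1) by (intro that[of S]) (cases \<kappa>; simp add: h)+
qed

theorem proposition6p6: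
  fixes q r :: complex and N s d :: nat and \<kappa> \<kappa>' \<kappa>b \<kappa>b' :: bparams
    and hp hm hz hbp hbm :: complex
  assumes q: "q \<noteq> 0" "\<And>n::nat. n > 0 \<Longrightarrow> q ^ n \<noteq> 1"
    and r: "r\<^sup>2 = q"
    and N: "N \<ge> 1"
    and s: "s \<ge> 1"
    and d: "d \<ge> 1"
    and k: "kp \<kappa> \<noteq> 0" "km \<kappa> \<noteq> 0"
    and h: "has_fields \<kappa> hp hm hz" "has_fields \<kappa>' hp hm hz"
    and inv: "invertible_mat (transfer r d s N \<kappa> \<kappa>b 1)"
             "invertible_mat (transfer r d s N \<kappa>' \<kappa>b' 1)"
  shows "(hp * hbm = q\<^sup>2 * (hm * hbp) \<and>
           has_fields \<kappa>b hbp hbm 1 \<and>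
           has_fields \<kappa>b' (hbp * q\<^sup>2) (hbm * inverse (q\<^sup>2)) 1 \<longrightarrow>
           ham r d s N \<kappa>' \<kappa>b' * W0 r \<kappa> s N = W0 r \<kappa> s N * ham r d s N \<kappa> \<kappa>b)
       \<and> (hp * hbm = inverse (q\<^sup>2) * (hm * hbp) \<and>
           has_fields \<kappa>b hbp hbm (- 1) \<and>
           has_fields \<kappa>b' (hbp * inverse (q\<^sup>2)) (hbm * q\<^sup>2) (- 1) \<longrightarrow>
           ham r d s N \<kappa>' \<kappa>b' * W1 r \<kappa> s N = W1 r \<kappa> s N * ham r d s N \<kappa> \<kappa>b)"
proof -
  have g: "generic r" using q r by (auto simp: generic_def)
  have r0: "r \<noteq> 0" using generic_nonzero[OF g] .
  have q2: "q\<^sup>2 = r ^ 4" by (simp add: r[symmetric] flip: power_mult)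
  obtain S where S: "S \<noteq> 0" "\<kappa> = BParams (S * hp) (S * hm) (S * (1 + hz)) (S * (1 - hz))" using has_fieldsE[OF h(1)] .
  obtain S' where S': "S' \<noteq> 0" "\<kappa>' = BParams (S' * hp) (S' * hm) (S' * (1 + hz)) (S' * (1 - hz))" using has_fieldsE[OF h(2)] .
  have e: "ep \<kappa> \<noteq> 0 \<or> em \<kappa> \<noteq> 0" using h(1) by (auto simp: has_fields_def)
  define l1 where "l1 = S' / S"
  \<comment> \<open>Equal fields at this end mean proportional parameters.\<close>
  have \<kappa>': "\<kappa>' = scale_params l1 \<kappa>" using S(1) unfolding S(2) S'(2) l1_def scale_params_def by simp
  show ?thesis
  proof (intro conjI impI; elim conjE)
    assume H: "hp * hbm = q\<^sup>2 * (hm * hbp)" and b: "has_fields \<kappa>b hbp hbm 1" and b': "has_fields \<kappa>b' (hbp * q\<^sup>2) (hbm * inverse (q\<^sup>2)) 1"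
    obtain T where T: "T \<noteq> 0" "\<kappa>b = BParams (T * hbp) (T * hbm) (T * (1 + 1)) (T * (1 - 1))" using has_fieldsE[OF b] .
    obtain T' where T': "T' \<noteq> 0" "\<kappa>b' = BParams (T' * (hbp * q\<^sup>2)) (T' * (hbm * inverse (q\<^sup>2))) (T' * (1 + 1)) (T' * (1 - 1))" using has_fieldsE[OF b'] .
    \<comment> \<open>The rescaling of hbar by q^2 and q^(-2) is the gauge transformation, up to a
      common factor.\<close>
    have \<kappa>b': "\<kappa>b' = scale_params (T' / T) (gauge_params r \<kappa>b)" using T(1) unfolding T(2) T'(2) q2 scale_params_def gauge_params_def by simp
    have hh: "kp \<kappa> * km \<kappa>b = r ^ 4 * (km \<kappa> * kp \<kappa>b)" using H unfolding S(2) T(2) q2 by (simp add: mult.left_commute)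
    have eb: "em \<kappa>b = 0" "ep \<kappa>b \<noteq> 0" "em \<kappa>b' = 0" "ep \<kappa>b' \<noteq> 0" using T T' by auto
    show "ham r d s N \<kappa>' \<kappa>b' * W0 r \<kappa> s N = W0 r \<kappa> s N * ham r d s N \<kappa> \<kappa>b"
    proof (rule ham_intertwines[OF g s dim_W0 _ _ _ inv])
      show "dressed_trace s N R (Kdual r \<kappa>b' s u) (Kmat r \<kappa>' s u) * W0 r \<kappa> s N = (l1 ^ s * (T' / T) ^ s) \<cdot>\<^sub>m (W0 r \<kappa> s N * dressed_trace s N R (Kdual r \<kappa>b s u) (Kmat r \<kappa> s u))"
        if "u \<noteq> 0" "R = x \<cdot>\<^sub>m Rmat r s s u" for u R x
        unfolding \<kappa>' \<kappa>b' by (rule dressed_trace_exchange_W0[OF g s k e eb(1,2) hh that])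
    qed (use eb in auto)
  next
    assume H: "hp * hbm = inverse (q\<^sup>2) * (hm * hbp)" and b: "has_fields \<kappa>b hbp hbm (- 1)" and b': "has_fields \<kappa>b' (hbp * inverse (q\<^sup>2)) (hbm * q\<^sup>2) (- 1)"
    obtain T where T: "T \<noteq> 0" "\<kappa>b = BParams (T * hbp) (T * hbm) (T * (1 + - 1)) (T * (1 - - 1))" using has_fieldsE[OF b] .
    obtain T' where T': "T' \<noteq> 0" "\<kappa>b' = BParams (T' * (hbp * inverse (q\<^sup>2))) (T' * (hbm * q\<^sup>2)) (T' * (1 + - 1)) (T' * (1 - - 1))" using has_fieldsE[OF b'] .
    \<comment> \<open>The opposite rescaling of hbar is the gauge transformation at 1/q.\<close>
    have \<kappa>b': "\<kappa>b' = scale_params (T' / T) (gauge_params (inverse r) \<kappa>b)" using T(1) unfolding T(2) T'(2) q2 scale_params_def gauge_params_def by (simp add: power_inverse)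
    have hh: "kp \<kappa> * km \<kappa>b = inverse (r ^ 4) * (km \<kappa> * kp \<kappa>b)" using H unfolding S(2) T(2) q2 by (simp add: mult.left_commute)
    have eb: "ep \<kappa>b = 0" "em \<kappa>b \<noteq> 0" "ep \<kappa>b' = 0" "em \<kappa>b' \<noteq> 0" using T T' by auto
    obtain C where C: "\<And>u R x. u \<noteq> 0 \<Longrightarrow> R = x \<cdot>\<^sub>m Rmat r s s u \<Longrightarrow>
       dressed_trace s N R (Kdual r \<kappa>b' s u) (Kmat r \<kappa>' s u) * W1 r \<kappa> s N = C \<cdot>\<^sub>m (W1 r \<kappa> s N * dressed_trace s N R (Kdual r \<kappa>b s u) (Kmat r \<kappa> s u))"
      using dressed_trace_exchange_W1[OF g s k e eb(1,2) hh, of N "T' / T" l1] unfolding \<kappa>' \<kappa>b' by blast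
    show "ham r d s N \<kappa>' \<kappa>b' * W1 r \<kappa> s N = W1 r \<kappa> s N * ham r d s N \<kappa> \<kappa>b"
      by (rule ham_intertwines[OF g s _ _ _ _ C inv]) (use eb dim_W0 in \<open>auto simp: W1_eq_W0[OF r0]\<close>)
  qed
qed

end
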